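(* Let $(X_1,Y_1),(X_2,Y_2),\ldots$ be independent and identically distributed random vectors with bivariate distribution function $H$ having continuous marginal distribution functions $F$ and $G$ and copula $C$. Let $p_0\in(0,1)$ be fixed and $\mathcal{P}=[p_0,1]$. Suppose that: (i) the first-order partial derivatives $\dot C_1(u,v)=\partial C(u,v)/\partial u$ and $\dot C_2(u,v)=\partial C(u,v)/\partial v$ exist and are continuous, respectively, on $(0,1)\times[0,1]$ and $[0,1]\times(0,1)$; (ii) as $r\to\infty$, \[ \sup_{p\in\mathcal{P}}\left|\int_{[0,p]^2}\{B_r(C)(u,v)-C(u,v)\}\,\mathrm{d}u\,\mathrm{d}v\right|=O(r^{-1}); \] (iii) $m=m(n)$ is a sequence of positive integers with $m\to\infty$ and $\sqrt n/m\to0$ as $n\to\infty$. Fix $p_j\in\mathcal{P}$ and $\alpha\in(0,1)$, and suppose that $\mathrm{Var}\{\mathbb{Z}(p_j)\}>0$, where \[ \mathbb{Z}(p)=\frac{1}{D(p)}\int_{[0,p]^2}\mathbb{G}_C(u,v)\,\mathrm{d}u\,\mathrm{d}v,\qquad p\in\mathcal{P}. \] Let $c_{j,1-\alpha,n}^{\#}$ denote the $(1-\alpha)$-quantile of the conditional distribution, given the data $(X_1,Y_1),\ldots,(X_n,Y_n)$, of $|\mathbb{Z}_n^{\#}(p_j)|$, where $\mathbb{Z}_n^{\#}(p)=\sqrt n\{\widehat{\rho}_{m,n}^{\#}(p)-\widehat{\rho}_{m,n}(p)\}$. Then, as $n\to\infty$, \[ \mathsf{P}\left\{\rho(p_j)\in\left[\widehat{\rho}_{m,n}(p_j)-\frac{c_{j,1-\alpha,n}^{\#}}{\sqrt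 n},\;\widehat{\rho}_{m,n}(p_j)+\frac{c_{j,1-\alpha,n}^{\#}}{\sqrt n}\right]\right\}\to1-\alpha. \] Moreover, if $B=B_n\to\infty$ as $n\to\infty$, then the same limit holds when $c_{j,1-\alpha,n}^{\#}$ is replaced by the empirical $(1-\alpha)$-quantile $c_{j,1-\alpha}^{\#}$ of $|T_1^{\#}(p_j)|,\ldots,|T_B^{\#}(p_j)|$, where $T_b^{\#}(p_j)=\sqrt n\{\widehat{\rho}_{m,n}^{\#,b}(p_j)-\widehat{\rho}_{m,n}(p_j)\}$ and $\widehat{\rho}_{m,n}^{\#,1},\ldots,\widehat{\rho}_{m,n}^{\#,B}$ are computed from $B$ bootstrap samples that are independent conditionally on the data.
   Context: By Sklar's theorem, $C$ is the unique copula with $H(x,y)=C\{F(x),G(y)\}$. For $p\in(0,1]$, set $D(p)=p^3/3-p^4/4$ (which is $>0$). The lower-tail Spearman's rho curve of $C$ is \[ \rho(p)=\frac{\int_{[0,p]^2}C(u,v)\,\mathrm{d}u\,\mathrm{d}v-p^4/4}{D(p)},\qquad p\in(0,1]. \] Empirical copula and estimator. Let $F_n(x)=n^{-1}\sum_{i=1}^n\mathbf{1}\{X_i\le x\}$ and $G_n(y)=n^{-1}\sum_{i=1}^n\mathbf{1}\{Y_i\le y\}$. The empirical copula is \[ C_n(u,v)=\frac1n\sum_{i=1}^n\mathbf{1}\{F_n(X_i)\le u,\;G_n(Y_i)\le v\},\qquad(u,v)\in[0,1]^2. \] For an integer $m\ge1$ and $k=0,\ldots,m$, let $P_{k,m}(u)=\binom{m}{k}u^k(1-u)^{m-k}$,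 and for a bounded function $h$ on $[0,1]^2$ let \[ B_m(h)(u,v)=\sum_{k=0}^m\sum_{\ell=0}^m h(k/m,\ell/m)P_{k,m}(u)P_{\ell,m}(v). \] The empirical Bernstein copula is $C_{m,n}=B_m(C_n)$, and the Bernstein-smoothed estimator is \[ \widehat{\rho}_{m,n}(p)=\frac{\int_{[0,p]^2}C_{m,n}(u,v)\,\mathrm{d}u\,\mathrm{d}v-p^4/4}{D(p)},\qquad p\in(0,1]. \] Bootstrap. Let $R_i^X$ and $R_i^Y$ be the ranks of $X_i$ among $X_1,\ldots,X_n$ and of $Y_i$ among $Y_1,\ldots,Y_n$ (almost surely there are no ties). Let $Q_i^\beta$ be the product law on $[0,1]^2$ with independent coordinates $U^{\#}\sim\mathrm{Beta}(R_i^X,n+1-R_i^X)$ and $V^{\#}\sim\mathrm{Beta}(R_i^Y,n+1-R_i^Y)$. The mixture $n^{-1}\sum_{i=1}^nQ_i^\beta$ has distribution function $C_{n,n}$, the empirical beta copula. A bootstrap sample is generated, conditionally on the data, by drawing $I_1^{\#},\ldots,I_n^{\#}$ independently and uniformly from $\{1,\ldots,n\}$ and then, independently, $(U_i^{\#},V_i^{\#})\sim Q_{I_i^{\#}}^\beta$, $i=1,\ldots,n$. Let $C_n^{\#}$ be the empirical copula of $(U_1^{\#},V_1^{\#}),\ldots,(U_n^{\#},V_n^{\#})$, defined as $C_n$ above but from the bootstrap sample and its own empirical margins. Put $C_{m,n}^{\#}=B_m(C_n^{\#})$ (same degree $m$) and \[ \widehat{\rho}_{m,n}^{\#}(p)=\frac{\int_{[0,p]^2}C_{m,n}^{\#}(u,v)\,\mathrm{d}u\,\mathrm{d}v-p^4/4}{D(p)}.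 \] The superscript $\#,b$ indicates the quantity computed from the $b$-th bootstrap sample. Limit process. $\mathbb{B}_C$ denotes the $C$-Brownian bridge on $[0,1]^2$: the centered Gaussian process with continuous sample paths and covariance function $K_C((u,v),(s,t))=C(\min(u,s),\min(v,t))-C(u,v)C(s,t)$. Then \[ \mathbb{G}_C(u,v)=\mathbb{B}_C(u,v)-\dot C_1(u,v)\mathbb{B}_C(u,1)-\dot C_2(u,v)\mathbb{B}_C(1,v),\qquad(u,v)\in[0,1]^2, \] where at boundary points at which the partial derivatives are not defined by hypothesis (i) they are assigned arbitrary values (the corresponding Brownian bridge terms vanish there). *)

theory Defs
  imports "HOL-Probability.Probability" "HOL-Library.Landau_Symbols"
begin

section \<open>Copulas and the lower-tail Spearman's rho curve\<close>

text \<open>A copula is represented by a function on all of \<open>\<real> \<times> \<real>\<close>; only its values on the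
  unit square are constrained, and only these are ever used.\<close>

definition copula :: "(real \<Rightarrow> real \<Rightarrow> real) \<Rightarrow> bool" where
  "copula C \<longleftrightarrow>
     (\<forall>u\<in>{0..1}. C u 0 = 0 \<and> C 0 u = 0 \<and> C u 1 = u \<and> C 1 u = u) \<and>
     (\<forall>u\<^sub>1\<in>{0..1}. \<forall>u\<^sub>2\<in>{0..1}. \<forall>v\<^sub>1\<in>{0..1}. \<forall>v\<^sub>2\<in>{0..1}. u\<^sub>1 \<le> u\<^sub>2 \<longrightarrow> v\<^sub>1 \<le> v\<^sub>2 \<longrightarrow>
        0 \<le> C u\<^sub>2 v\<^sub>2 - C u\<^sub>2 v\<^sub>1 - C u\<^sub>1 v\<^sub>2 + C u\<^sub>1 v\<^sub>1)"

text \<open>The Henstock--Kurzweil integral is used on squares because it ignores arbitrary (even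
  non-measurable) modifications of the integrand on the boundary of the unit square.\<close>

definition square_integral :: "real \<Rightarrow> (real \<Rightarrow> real \<Rightarrow> real) \<Rightarrow> real" where
  "square_integral p h = integral ({0..p} \<times> {0..p}) (\<lambda>(u, v). h u v)"

definition rho_denom :: "real \<Rightarrow> real" where
  "rho_denom p = p ^ 3 / 3 - p ^ 4 / 4"

definition spearman_curve :: "(real \<Rightarrow> real \<Rightarrow> real) \<Rightarrow> real \<Rightarrow> real" where
  "spearman_curve C p = (square_integral p C - p ^ 4 / 4) / rho_denom p"

section \<open>Empirical copula and Bernstein smoothing\<close>

text \<open>A sample of size \<open>n\<close> is a sequence of which only the entries with index \<open>i < n\<close> matter.\<close>

definition ecdf :: "nat \<Rightarrow> (nat \<Rightarrow> real) \<Rightarrow> real \<Rightarrow> real" where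
  "ecdf n x t = (\<Sum>i<n. of_bool (x i \<le> t)) / real n"

definition emp_copula :: "nat \<Rightarrow> (nat \<Rightarrow> real \<times> real) \<Rightarrow> real \<Rightarrow> real \<Rightarrow> real" where
  "emp_copula n z u v =
     (\<Sum>i<n. of_bool (ecdf n (\<lambda>j. fst (z j)) (fst (z i)) \<le> u \<and>
                      ecdf n (\<lambda>j. snd (z j)) (snd (z i)) \<le> v)) / real n"

definition bernstein_op :: "nat \<Rightarrow> (real \<Rightarrow> real \<Rightarrow> real) \<Rightarrow> real \<Rightarrow> real \<Rightarrow> real" where
  "bernstein_op m h u v =
     (\<Sum>k\<le>m. \<Sum>l\<le>m. h (real k / real m) (real l / real m) * Bernstein m k u * Bernstein m l v)"

definition rho_hat :: "nat \<Rightarrow> nat \<Rightarrow> (nat \<Rightarrow> real \<times> real) \<Rightarrow> real \<Rightarrow> real" where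
  "rho_hat m n z p = spearman_curve (bernstein_op m (emp_copula n z)) p"

section \<open>The smooth bootstrap\<close>

definition sample_rank :: "nat \<Rightarrow> (nat \<Rightarrow> real) \<Rightarrow> nat \<Rightarrow> nat" where
  "sample_rank n x i = card {j. j < n \<and> x j \<le> x i}"

definition beta_law :: "nat \<Rightarrow> nat \<Rightarrow> real measure" where
  "beta_law a b = density lborel (\<lambda>x. ennreal (if 0 < x \<and> x < 1
      then x powr (real a - 1) * (1 - x) powr (real b - 1) / Beta (real a) (real b) else 0))"

definition beta_kernel :: "nat \<Rightarrow> (nat \<Rightarrow> real \<times> real) \<Rightarrow> nat \<Rightarrow> (real \<times> real) measure" where
  "beta_kernel n z i =
     (let r = sample_rank n (\<lambda>j. fst (z j)) i; s = sample_rank n (\<lambda>j. snd (z j)) i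
      in beta_law r (n + 1 - r) \<Otimes>\<^sub>M beta_law s (n + 1 - s))"

text \<open>Law of one bootstrap sample given the data \<open>z\<close>: draw \<open>I\<^sub>i\<close>, \<open>i < n\<close>, independently
  and uniformly, then independently the \<open>i\<close>-th point from the kernel of index \<open>I\<^sub>i\<close>.  The value \<open>0\<close>
  is the default of \<open>I\<close> outside \<open>{..<n}\<close>.\<close>

definition boot_law :: "nat \<Rightarrow> (nat \<Rightarrow> real \<times> real) \<Rightarrow> (nat \<Rightarrow> real \<times> real) measure" where
  "boot_law n z =
     measure_pmf (Pi_pmf {..<n} 0 (\<lambda>_. pmf_of_set {..<n})) \<bind>
       (\<lambda>I. Pi\<^sub>M {..<n} (\<lambda>i. beta_kernel n z (I i)))"

definition boot_pivot ::
    "nat \<Rightarrow> nat \<Rightarrow> (nat \<Rightarrow> real \<times> real) \<Rightarrow> real \<Rightarrow> (nat \<Rightarrow> real \<times> real) \<Rightarrow> real" where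
  "boot_pivot m n z p s = sqrt (real n) * (rho_hat m n s p - rho_hat m n z p)"

text \<open>The quantile of order \<open>q\<close> of a distribution function.\<close>

definition quantile :: "(real \<Rightarrow> real) \<Rightarrow> real \<Rightarrow> real" where
  "quantile K q = Inf {t. q \<le> K t}"

definition boot_quantile :: "nat \<Rightarrow> nat \<Rightarrow> (nat \<Rightarrow> real \<times> real) \<Rightarrow> real \<Rightarrow> real \<Rightarrow> real" where
  "boot_quantile m n z p q =
     quantile (cdf (distr (boot_law n z) borel (\<lambda>s. \<bar>boot_pivot m n z p s\<bar>))) q"

text \<open>Empirical quantile over \<open>N\<close> bootstrap samples \<open>S 0, \<dots>, S (N - 1)\<close>.\<close>

definition emp_boot_quantile ::
    "nat \<Rightarrow> nat \<Rightarrow> (nat \<Rightarrow> real \<times> real) \<Rightarrow> real \<Rightarrow> nat \<Rightarrow> (nat \<Rightarrow> nat \<Rightarrow> real \<times> real) \<Rightarrow> real \<Rightarrow> real" where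
  "emp_boot_quantile m n z p N S q = quantile (ecdf N (\<lambda>b. \<bar>boot_pivot m n z p (S b)\<bar>)) q"

text \<open>\<open>\<kappa>\<close> is a regular conditional distribution of \<open>S\<close> given \<open>D\<close>.\<close>

definition has_conditional_law ::
    "'a measure \<Rightarrow> ('a \<Rightarrow> 'd) \<Rightarrow> 'd measure \<Rightarrow> ('a \<Rightarrow> 'e) \<Rightarrow> 'e measure \<Rightarrow> ('d \<Rightarrow> 'e measure) \<Rightarrow> bool" where
  "has_conditional_law M D A S Q \<kappa> \<longleftrightarrow>
     D \<in> M \<rightarrow>\<^sub>M A \<and> S \<in> M \<rightarrow>\<^sub>M Q \<and>
     (\<forall>E\<in>sets Q. AE \<omega> in M.
        real_cond_exp M (vimage_algebra (space M) D A) (\<lambda>\<omega>. indicator E (S \<omega>)) \<omega>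
          = measure (\<kappa> (D \<omega>)) E)"

text \<open>Given the data \<open>Z i\<close>, \<open>i < n\<close>, the bootstrap samples \<open>(S b i)\<^bsub>i < n\<^esub>\<close>, \<open>b < N\<close>, are
  independent, each with law \<open>boot_law\<close>.\<close>

definition boot_samples ::
    "'a measure \<Rightarrow> nat \<Rightarrow> nat \<Rightarrow> (nat \<Rightarrow> 'a \<Rightarrow> real \<times> real) \<Rightarrow> (nat \<Rightarrow> nat \<Rightarrow> 'a \<Rightarrow> real \<times> real) \<Rightarrow> bool" where
  "boot_samples M n N Z S \<longleftrightarrow>
     has_conditional_law M
       (\<lambda>\<omega>. \<lambda>i\<in>{..<n}. Z i \<omega>) (Pi\<^sub>M {..<n} (\<lambda>_. borel))
       (\<lambda>\<omega>. \<lambda>b\<in>{..<N}. \<lambda>i\<in>{..<n}. S b i \<omega>) (Pi\<^sub>M {..<N} (\<lambda>_. Pi\<^sub>M {..<n} (\<lambda>_. borel)))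
       (\<lambda>z. Pi\<^sub>M {..<N} (\<lambda>_. boot_law n z))"

section \<open>The limit process\<close>

text \<open>Almost surely constant variables count as (degenerate) normal.\<close>

definition normal_rv :: "'b measure \<Rightarrow> ('b \<Rightarrow> real) \<Rightarrow> bool" where
  "normal_rv N Z \<longleftrightarrow> Z \<in> borel_measurable N \<and>
     ((\<exists>\<mu> \<sigma>. 0 < \<sigma> \<and> distributed N lborel Z (normal_density \<mu> \<sigma>)) \<or>
      (\<exists>\<mu>. AE \<omega> in N. Z \<omega> = \<mu>))"

definition gaussian_process :: "'b measure \<Rightarrow> 't set \<Rightarrow> ('t \<Rightarrow> 'b \<Rightarrow> real) \<Rightarrow> bool" where
  "gaussian_process N I W \<longleftrightarrow>
     (\<forall>J a. finite J \<longrightarrow> J \<subseteq> I \<longrightarrow> normal_rv N (\<lambda>\<omega>. \<Sum>t\<in>J. a t * W t \<omega>))"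

definition copula_bridge ::
    "(real \<Rightarrow> real \<Rightarrow> real) \<Rightarrow> 'b measure \<Rightarrow> (real \<times> real \<Rightarrow> 'b \<Rightarrow> real) \<Rightarrow> bool" where
  "copula_bridge C N W \<longleftrightarrow>
     gaussian_process N ({0..1} \<times> {0..1}) W \<and>
     (\<forall>t\<in>{0..1} \<times> {0..1}. prob_space.expectation N (W t) = 0) \<and>
     (\<forall>u\<in>{0..1}. \<forall>v\<in>{0..1}. \<forall>s\<in>{0..1}. \<forall>t\<in>{0..1}.
        prob_space.expectation N (\<lambda>\<omega>. W (u, v) \<omega> * W (s, t) \<omega>)
          = C (min u s) (min v t) - C u v * C s t) \<and>
     (\<forall>\<omega>\<in>space N. continuous_on ({0..1} \<times> {0..1}) (\<lambda>t. W t \<omega>))"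

text \<open>\<open>C\<^sub>1\<close> and \<open>C\<^sub>2\<close> are the partial derivatives of the copula, with arbitrary values where these
  do not exist.\<close>

definition copula_limit ::
    "(real \<Rightarrow> real \<Rightarrow> real) \<Rightarrow> (real \<Rightarrow> real \<Rightarrow> real) \<Rightarrow> (real \<times> real \<Rightarrow> 'b \<Rightarrow> real)
      \<Rightarrow> 'b \<Rightarrow> real \<Rightarrow> real \<Rightarrow> real" where
  "copula_limit C\<^sub>1 C\<^sub>2 W \<omega> u v = W (u, v) \<omega> - C\<^sub>1 u v * W (u, 1) \<omega> - C\<^sub>2 u v * W (1, v) \<omega>"

definition rho_limit ::
    "(real \<Rightarrow> real \<Rightarrow> real) \<Rightarrow> (real \<Rightarrow> real \<Rightarrow> real) \<Rightarrow> (real \<times> real \<Rightarrow> 'b \<Rightarrow> real)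
      \<Rightarrow> real \<Rightarrow> 'b \<Rightarrow> real" where
  "rho_limit C\<^sub>1 C\<^sub>2 W p \<omega> = square_integral p (copula_limit C\<^sub>1 C\<^sub>2 W \<omega>) / rho_denom p"

end

theory Submission
  imports Defs "HOL-Real_Asymp.Real_Asymp"
begin

text \<open>Integrating a Bernstein copula over \<open>[0,p]\<^sup>2\<close> turns the estimator into the rank statistic
  \<open>n\<^sup>-\<^sup>1 \<Sum> bphi (R\<^sub>i / n) * bphi (S\<^sub>i / n)\<close>, where \<open>bphi\<close> is a step function approximating
  \<open>hinge p s = max 0 (p - s)\<close>.  A first-order expansion in the rank errors and the projection of the
  resulting \<open>U\<close>-statistics give an \<open>L\<^sup>1\<close> linearisation with a bounded influence function \<open>infl\<close>
  and error bounds that are explicit and the same for all laws with uniform margins.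

  Without ties, a bootstrap observation, given the data, follows a law with exactly uniform margins.
  So the linearisation and a central limit theorem that is uniform over the sampled law apply both to
  the estimator and, conditionally, to its bootstrap version.  The conditional variances converge because
  \<open>infl\<close> can be approximated by finitely many Lipschitz test functions.

  The variance of \<open>infl\<close> is that of the Gaussian limit: both are second moments of one linear
  functional, applied to \<open>[c\<^sub>1 \<le> u, c\<^sub>2 \<le> v] - C u v\<close> and to the bridge, which have the same covariance.
  Hence pivot and bootstrap pivot have the same continuous, strictly increasing limit distribution, which
  gives the coverage; for finitely many bootstrap samples, Chebyshev's inequality, conditionally on the data,
  replaces the bootstrap distribution by its empirical version.\<close>

section \<open>Integrated Bernstein weights\<close>

text \<open>Two obstacles shape the proof: the resampling law moves with the data, and the slope of
  \<open>hinge\<close> jumps at \<open>p\<close>. Hence every error bound keeps a fixed tolerance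
  \<epsilon>, lets \<open>n\<close> and \<open>m\<close> grow, and only then lets \<epsilon> shrink.
  The tolerance is the half width of a window around \<open>p\<close>: outside it the smoothed
  weights are accurate, inside it uniform margins leave a mass of order \<epsilon>. The condition
  that \<open>sqrt n / m\<close> vanishes absorbs the discretisation errors of order
  \<open>1 / m\<close> and the smoothing bias. The influence function depends on the sampled law, so
  its variance is compared both in the integrand and in the measure. Moreover the linearisation of
  the bootstrap statistic is centred at its mean under the resampling law, the pivot at the data
  statistic. This gap is of smaller order than \<open>1 / sqrt n\<close>, because a beta law
  deviates from its normalised rank by \<open>1 / sqrt n\<close> but its mean only by
  \<open>1 / n\<close>. The partial derivatives of \<open>C\<close> enter through the variance,
  where the projections become integrals against them.\<close>

lemma DERIV_Bernstein_Suc: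
  "(Bernstein (Suc n) (Suc k) has_real_derivative
      real (Suc n) * (Bernstein n k x - Bernstein n (Suc k) x)) (at x)"
proof (cases "Suc k \<le> n")
  case True
  have c1: "real (Suc n choose Suc k) * real (Suc k) = real (Suc n) * real (n choose k)"
    by (metis Suc_times_binomial_eq mult.commute of_nat_mult)
  have "Suc n * (n choose Suc k) = (Suc n - Suc k) * (Suc n choose Suc k)"
    using binomial_absorb_comp[of "Suc n" "Suc k"] by simp
  then have c2: "real (Suc n choose Suc k) * real (n - k) = real (Suc n) * real (n choose Suc k)"
    by (metis diff_Suc_Suc mult.commute of_nat_mult)
  define A where "A = real (Suc n choose Suc k)"
  have d: "((\<lambda>x. A * x ^ Suc k * (1 - x) ^ (n - k)) has_real_derivative
      (A * real (Suc k)) * x ^ k * (1 - x) ^ (n - k) - (A * real (n - k)) * x ^ Suc k * (1 - x) ^ (n - Suc k)) (at x)"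
    by (rule derivative_eq_intros refl)+ (use True in \<open>simp add: algebra_simps\<close>)
  show ?thesis
    using d unfolding A_def c1 c2 Bernstein_def by (simp add: algebra_simps)
next
  case False
  show ?thesis
  \<comment> \<open>For \<open>k = n\<close> a single monomial remains; for larger \<open>k\<close>
    all binomial coefficients vanish.\<close>
  proof (cases "k = n")
    case True
    then show ?thesis
      using DERIV_pow[of "Suc n" x UNIV] unfolding Bernstein_def by (simp add: binomial_eq_0)
  next
    case F2: False
    with False have "Suc n < Suc k" "n < k" "n < Suc k" by auto
    then show ?thesis
      unfolding Bernstein_def by (simp add: binomial_eq_0)
  qed
qed

text \<open>Weight of the grid point \<open>k / m\<close> once a Bernstein polynomial is integrated
  over an interval. Over a square the weights multiply, which is why a one-dimensional integral
  suffices.\<close>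

definition bw :: "real \<Rightarrow> nat \<Rightarrow> nat \<Rightarrow> real" where
  "bw p m k = integral {0..p} (Bernstein m k)"

lemma continuous_Bernstein: "continuous_on S (Bernstein m k)"
  unfolding Bernstein_def by (intro continuous_intros)

text \<open>The incomplete beta integral is a binomial tail: the derivative of each polynomial is a
  difference of neighbours, so the sum over \<open>{k..m}\<close> telescopes to
  \<open>(m + 1) * Bernstein m k\<close>. For \<open>p\<close> in the unit interval,
  \<open>(m + 1) * bw p m k\<close> is thus the probability of more than \<open>k\<close> successes
  in \<open>m + 1\<close> trials.\<close>

lemma bw_eq_tail:
  assumes "k \<le> m" "0 \<le> p"
  shows "real (Suc m) * bw p m k = (\<Sum>j\<in>{k..m}. Bernstein (Suc m) (Suc j) p)"
proof -
  have "((\<lambda>x. \<Sum>j\<in>{k..m}. Bernstein (Suc m) (Suc j) x) has_real_derivative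
      real (Suc m) * Bernstein m k x) (at x)" for x
  proof -
    have "((\<lambda>x. \<Sum>j\<in>{k..m}. Bernstein (Suc m) (Suc j) x) has_real_derivative
      (\<Sum>j\<in>{k..m}. real (Suc m) * (Bernstein m j x - Bernstein m (Suc j) x))) (at x)"
      by (intro DERIV_sum DERIV_Bernstein_Suc)
    also have "(\<Sum>j\<in>{k..m}. real (Suc m) * (Bernstein m j x - Bernstein m (Suc j) x))
      = real (Suc m) * (Bernstein m k x - Bernstein m (Suc m) x)"
      using sum_Suc_diff[of k m "\<lambda>j. - Bernstein m j x"] assms
      by (simp add: sum_distrib_left[symmetric])
    also have "Bernstein m (Suc m) x = 0" by (simp add: Bernstein_def binomial_eq_0)
    finally show ?thesis by simp
  qed
  then have "((\<lambda>x. real (Suc m) * Bernstein m k x) has_integral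
      ((\<Sum>j\<in>{k..m}. Bernstein (Suc m) (Suc j) p) - (\<Sum>j\<in>{k..m}. Bernstein (Suc m) (Suc j) 0))) {0..p}"
    using assms by (intro fundamental_theorem_of_calculus)
      (auto simp: has_real_derivative_iff_has_vector_derivative[symmetric] intro: has_field_derivative_at_within)
  moreover have "(\<Sum>j\<in>{k..m}. Bernstein (Suc m) (Suc j) 0) = 0" by (simp add: Bernstein_def)
  ultimately have "integral {0..p} (\<lambda>x. real (Suc m) * Bernstein m k x) = (\<Sum>j\<in>{k..m}. Bernstein (Suc m) (Suc j) p)"
    by (metis diff_zero integral_unique)
  then show ?thesis unfolding bw_def integral_mult_right .
qed

lemma sum_Bernstein_Suc: "(\<Sum>j\<le>m. Bernstein (Suc m) (Suc j) p) + Bernstein (Suc m) 0 p = 1"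
  using sum_Bernstein[of "Suc m" p] unfolding sum.atMost_Suc_shift by simp

lemma bw_bounds:
  assumes "k \<le> m" "0 \<le> p" "p \<le> 1"
  shows "0 \<le> bw p m k" "real (Suc m) * bw p m k \<le> 1" "bw p m k \<le> 1 / real (Suc m)"
proof -
  have "0 \<le> (\<Sum>j\<in>{k..m}. Bernstein (Suc m) (Suc j) p)"
    using assms by (intro sum_nonneg Bernstein_nonneg)
  then have "0 \<le> real (Suc m) * bw p m k" using bw_eq_tail assms by simp
  then show "0 \<le> bw p m k" by (simp add: zero_le_mult_iff)
  have "(\<Sum>j\<in>{k..m}. Bernstein (Suc m) (Suc j) p) \<le> (\<Sum>j\<le>m. Bernstein (Suc m) (Suc j) p)"
    using assms by (intro sum_mono2) (auto intro: Bernstein_nonneg)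
  also have "\<dots> \<le> 1" using sum_Bernstein_Suc[of m p] Bernstein_nonneg[of p "Suc m" 0] assms by linarith
  finally show "real (Suc m) * bw p m k \<le> 1" using bw_eq_tail assms by simp
  then show "bw p m k \<le> 1 / real (Suc m)" by (simp add: field_simps)
qed

lemma Bernstein_variance:
  "(\<Sum>k\<le>n. (real k - real n * p)\<^sup>2 * Bernstein n k p) = real n * p * (1 - p)"
proof -
  have *: "(real k - real n * p)\<^sup>2 = real k * (real k - 1) + (1 - 2 * real n * p) * real k + (real n * p)\<^sup>2" for k
    by (simp add: algebra_simps power2_eq_square)
  have "(\<Sum>k\<le>n. (real k - real n * p)\<^sup>2 * Bernstein n k p)
    = (\<Sum>k\<le>n. real k * (real k - 1) * Bernstein n k p) + (1 - 2 * real n * p) * (\<Sum>k\<le>n. real k * Bernstein n k p)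
      + (real n * p)\<^sup>2 * (\<Sum>k\<le>n. Bernstein n k p)"
    unfolding * by (simp only: distrib_right sum.distrib mult.assoc sum_distrib_left[symmetric])
  then show ?thesis by (simp only: sum_kk_Bernstein sum_k_Bernstein sum_Bernstein)
      (simp add: algebra_simps power2_eq_square)
qed

text \<open>Chebyshev's inequality for the binomial law; the factor 4 comes from
  \<open>p * (1 - p) \<le> 1/4\<close>.\<close>

lemma Bernstein_concentration:
  assumes "0 \<le> p" "p \<le> 1" "0 < n" "0 < e" "S \<subseteq> {k. k \<le> n \<and> \<bar>real k / real n - p\<bar> \<ge> e}"
  shows "(\<Sum>k\<in>S. Bernstein n k p) \<le> 1 / (4 * real n * e\<^sup>2)"
proof -
  have "(real n * e)\<^sup>2 * (\<Sum>k\<in>S. Bernstein n k p) \<le> (\<Sum>k\<in>S. (real k - real n * p)\<^sup>2 * Bernstein n k p)"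
    unfolding sum_distrib_left
  proof (intro sum_mono mult_right_mono Bernstein_nonneg assms)
    fix k assume "k \<in> S"
    then have "e \<le> \<bar>real k / real n - p\<bar>" using assms by auto
    then have "real n * e \<le> \<bar>real k - real n * p\<bar>"
      using assms(3) by (simp add: field_simps abs_if split: if_splits)
    then show "(real n * e)\<^sup>2 \<le> (real k - real n * p)\<^sup>2"
      using assms by (simp add: abs_le_square_iff[symmetric])
  qed
  also have "\<dots> \<le> (\<Sum>k\<le>n. (real k - real n * p)\<^sup>2 * Bernstein n k p)"
    using assms by (intro sum_mono2) (auto intro!: mult_nonneg_nonneg Bernstein_nonneg)
  also have "\<dots> \<le> real n * (1/4)"
    unfolding Bernstein_variance mult.assoc
  proof (intro mult_left_mono)
    have "0 \<le> (p - 1/2)\<^sup>2" by simp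
    then show "p * (1 - p) \<le> 1/4" by (simp add: power2_eq_square algebra_simps)
  qed simp
  finally have "(real n * e)\<^sup>2 * (\<Sum>k\<in>S. Bernstein n k p) \<le> real n * (1/4)" .
  then have "real n * (4 * real n * e\<^sup>2 * (\<Sum>k\<in>S. Bernstein n k p)) \<le> real n * 1"
    by (simp add: power2_eq_square algebra_simps)
  then have "4 * real n * e\<^sup>2 * (\<Sum>k\<in>S. Bernstein n k p) \<le> 1"
    using assms(3) by (subst (asm) mult_le_cancel_left_pos) auto
  then show ?thesis using assms by (simp add: field_simps)
qed

text \<open>One number \<epsilon> is both the half width of the excluded window around
  \<open>p\<close> and the error outside it. Inside the window the rescaled weight passes from 1 to
  0 and nothing is claimed.\<close>

definition bw_accurate :: "real \<Rightarrow> real \<Rightarrow> nat \<Rightarrow> bool" where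
  "bw_accurate \<epsilon> p m \<longleftrightarrow> (\<forall>k\<le>m. \<bar>real k / real m - p\<bar> > \<epsilon> \<longrightarrow>
     \<bar>real (Suc m) * bw p m k - of_bool (real k / real m < p)\<bar> \<le> \<epsilon>)"

text \<open>The rescaled weight is a binomial tail probability. When \<open>k / m\<close> is farther
  than \<epsilon> from \<open>p\<close>, either this tail or its complement lies in a deviation
  event.\<close>

lemma bw_accurateI:
  assumes p: "0 \<le> p" "p \<le> 1" and e: "0 < \<epsilon>" and m: "1 \<le> m" "1 / (4 * real (Suc m) * \<epsilon>\<^sup>2) \<le> \<epsilon>"
  shows "bw_accurate \<epsilon> p m"
  unfolding bw_accurate_def
proof (intro allI impI)
  fix k assume k: "k \<le> m" and far: "\<bar>real k / real m - p\<bar> > \<epsilon>"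
  have sh: "(\<Sum>j\<in>{a..m}. Bernstein (Suc m) (Suc j) p) = (\<Sum>j\<in>{Suc a..Suc m}. Bernstein (Suc m) j p)" for a
    by (rule sum.reindex_bij_witness[of _ "\<lambda>j. j - 1" Suc]) auto
  have tail: "real (Suc m) * bw p m k = (\<Sum>j\<in>{Suc k..Suc m}. Bernstein (Suc m) j p)"
    using bw_eq_tail[OF k p(1)] sh[of k] by simp
  have nn: "0 \<le> (\<Sum>j\<in>{Suc k..Suc m}. Bernstein (Suc m) j p)" "0 \<le> (\<Sum>j\<in>{..k}. Bernstein (Suc m) j p)"
    using p by (auto intro!: sum_nonneg Bernstein_nonneg simp del: sum.cl_ivl_Suc)
  show "\<bar>real (Suc m) * bw p m k - of_bool (real k / real m < p)\<bar> \<le> \<epsilon>"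
  proof (cases "real k / real m < p")
    case False
    with far have a: "real k / real m > p + \<epsilon>" by linarith
    have "(\<Sum>j\<in>{Suc k..Suc m}. Bernstein (Suc m) j p) \<le> 1 / (4 * real (Suc m) * \<epsilon>\<^sup>2)"
    proof (rule Bernstein_concentration)
      show "{Suc k..Suc m} \<subseteq> {j. j \<le> Suc m \<and> \<epsilon> \<le> \<bar>real j / real (Suc m) - p\<bar>}"
      proof
        fix j assume j: "j \<in> {Suc k..Suc m}"
        \<comment> \<open>Shifting both index and degree helps: \<open>k \<le> m\<close> makes
          \<open>(k + 1) / (m + 1)\<close> at least \<open>k / m\<close>, so the event keeps its
          distance from \<open>p\<close>.\<close>
        have "real k / real m \<le> real (Suc k) / real (Suc m)"
          using k m by (simp add: field_simps)
        also have "\<dots> \<le> real j / real (Suc m)" using j by (intro divide_right_mono) auto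
        finally show "j \<in> {j. j \<le> Suc m \<and> \<epsilon> \<le> \<bar>real j / real (Suc m) - p\<bar>}" using a j by auto
      qed
    qed (use p e in auto)
    then show ?thesis
      using False m(2) nn unfolding tail by (simp del: sum.cl_ivl_Suc)
  next
    case True
    with far have a: "real k / real m < p - \<epsilon>" by linarith
    have "(\<Sum>j\<in>{..k}. Bernstein (Suc m) j p) \<le> 1 / (4 * real (Suc m) * \<epsilon>\<^sup>2)"
    proof (rule Bernstein_concentration)
      show "{..k} \<subseteq> {j. j \<le> Suc m \<and> \<epsilon> \<le> \<bar>real j / real (Suc m) - p\<bar>}"
      proof
        fix j assume j: "j \<in> {..k}"
        have "real j / real (Suc m) \<le> real k / real (Suc m)" using j by (intro divide_right_mono) auto
        also have "\<dots> \<le> real k / real m" using k m by (simp add: field_simps)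
        finally show "j \<in> {j. j \<le> Suc m \<and> \<epsilon> \<le> \<bar>real j / real (Suc m) - p\<bar>}" using a j k by auto
      qed
    qed (use p e in auto)
    moreover have "(\<Sum>j\<in>{..k}. Bernstein (Suc m) j p) + (\<Sum>j\<in>{Suc k..Suc m}. Bernstein (Suc m) j p) = 1"
    proof -
      have "{..Suc m} = {..k} \<union> {Suc k..Suc m}" using k by auto
      then have "(\<Sum>j\<le>Suc m. Bernstein (Suc m) j p) = (\<Sum>j\<in>{..k}. Bernstein (Suc m) j p) + (\<Sum>j\<in>{Suc k..Suc m}. Bernstein (Suc m) j p)"
        by (simp only:) (rule sum.union_disjoint, auto)
      then show ?thesis using sum_Bernstein[of "Suc m" p] by simp
    qed
    ultimately show ?thesis
      using True m(2) nn unfolding tail by (simp del: sum.cl_ivl_Suc)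
  qed
qed

lemma eventually_bw_accurate:
  assumes p: "0 \<le> p" "p \<le> 1" and e: "0 < \<epsilon>"
  shows "eventually (bw_accurate \<epsilon> p) sequentially"
proof -
  have "((\<lambda>m. 1 / (4 * real (Suc m) * \<epsilon>\<^sup>2)) \<longlongrightarrow> 0) sequentially"
    using e by real_asymp
  then have "eventually (\<lambda>m. 1 / (4 * real (Suc m) * \<epsilon>\<^sup>2) < \<epsilon>) sequentially"
    using e by (intro order_tendstoD) auto
  then show ?thesis
    using eventually_ge_at_top[of 1]
    by eventually_elim (rule bw_accurateI[OF p e], auto)
qed

text \<open>The Bernstein approximation of the indicator of \<open>[s, 1]\<close>, integrated over
  \<open>[0, p]\<close>. Without smoothing this integral is \<open>hinge p s\<close> for
  \<open>s \<ge> 0\<close>.\<close>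

definition bphi :: "real \<Rightarrow> nat \<Rightarrow> real \<Rightarrow> real" where
  "bphi p m s = (\<Sum>k\<le>m. bw p m k * of_bool (s \<le> real k / real m))"

definition hinge :: "real \<Rightarrow> real \<Rightarrow> real" where
  "hinge p s = max 0 (p - s)"

section \<open>Step function against hinge: increments and first-order expansion\<close>

lemma card_nat_half_open:
  assumes "0 \<le> a" "a \<le> b"
  shows "finite {k::nat. a \<le> real k \<and> real k < b}" "\<bar>real (card {k::nat. a \<le> real k \<and> real k < b}) - (b - a)\<bar> \<le> 1"
proof -
  have "a \<le> real k \<longleftrightarrow> nat \<lceil>a\<rceil> \<le> k" "real k < b \<longleftrightarrow> k < nat \<lceil>b\<rceil>" for k
    using nat_ceiling_le_eq[of a k] nat_ceiling_le_eq[of b k] not_le[of b "real k"] not_le[of "nat \<lceil>b\<rceil>" k] by argo+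
  then have eq: "{k::nat. a \<le> real k \<and> real k < b} = {nat \<lceil>a\<rceil>..<nat \<lceil>b\<rceil>}"
    by (intro set_eqI) (simp only: mem_Collect_eq atLeastLessThan_iff)
  show "finite {k::nat. a \<le> real k \<and> real k < b}" unfolding eq by simp
  have le: "nat \<lceil>a\<rceil> \<le> nat \<lceil>b\<rceil>" using assms by (intro nat_mono ceiling_mono)
  have "real (nat \<lceil>a\<rceil>) = real_of_int \<lceil>a\<rceil>" "real (nat \<lceil>b\<rceil>) = real_of_int \<lceil>b\<rceil>"
    using assms by simp_all
  then have "real (nat \<lceil>b\<rceil> - nat \<lceil>a\<rceil>) = real_of_int \<lceil>b\<rceil> - real_of_int \<lceil>a\<rceil>"
    using le by (simp only: of_nat_diff)
  moreover have "\<bar>(real_of_int \<lceil>b\<rceil> - real_of_int \<lceil>a\<rceil>) - (b - a)\<bar> \<le> 1"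
    using ceiling_correct[of a] ceiling_correct[of b] by linarith
  ultimately show "\<bar>real (card {k::nat. a \<le> real k \<and> real k < b}) - (b - a)\<bar> \<le> 1"
    unfolding eq card_atLeastLessThan by (simp only:)
qed

lemma card_nat_closed:
  assumes "a \<le> b"
  shows "finite {k::nat. a \<le> real k \<and> real k \<le> b}" "real (card {k::nat. a \<le> real k \<and> real k \<le> b}) \<le> b - a + 1"
proof -
  have "finite {k::nat. real k \<le> b}"
    by (rule finite_subset[of _ "{..nat \<lfloor>b\<rfloor>}"]) (auto simp: le_nat_floor)
  then show "finite {k::nat. a \<le> real k \<and> real k \<le> b}"
    by (rule rev_finite_subset) auto
  show "real (card {k::nat. a \<le> real k \<and> real k \<le> b}) \<le> b - a + 1"
  proof (cases "0 \<le> b")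
    case True
    have "{k::nat. a \<le> real k \<and> real k \<le> b} \<subseteq> {nat \<lceil>a\<rceil>..nat \<lfloor>b\<rfloor>}"
      using True by (auto simp: le_nat_floor nat_ceiling_le_eq)
    then have "card {k::nat. a \<le> real k \<and> real k \<le> b} \<le> card {nat \<lceil>a\<rceil>..nat \<lfloor>b\<rfloor>}"
      by (intro card_mono) auto
    then have "real (card {k::nat. a \<le> real k \<and> real k \<le> b}) \<le> real (Suc (nat \<lfloor>b\<rfloor>) - nat \<lceil>a\<rceil>)"
      by simp
    also have "\<dots> \<le> b - a + 1"
    proof (cases "nat \<lceil>a\<rceil> \<le> Suc (nat \<lfloor>b\<rfloor>)")
      case le: True
      have "real (nat \<lfloor>b\<rfloor>) \<le> b" "a \<le> real (nat \<lceil>a\<rceil>)" using True by (auto simp: real_nat_ceiling_ge)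
      then show ?thesis using le by (simp add: of_nat_diff)
    next
      case False
      then have "Suc (nat \<lfloor>b\<rfloor>) - nat \<lceil>a\<rceil> = 0" by linarith
      then have "real (Suc (nat \<lfloor>b\<rfloor>) - nat \<lceil>a\<rceil>) = 0" by (simp only: of_nat_0)
      then show ?thesis using assms by linarith
    qed
    finally show ?thesis .
  next
    case False
    then have "{k::nat. a \<le> real k \<and> real k \<le> b} = {}" by auto
    then have "real (card {k::nat. a \<le> real k \<and> real k \<le> b}) = 0" by (simp only: card.empty of_nat_0)
    then show ?thesis using assms by linarith
  qed
qed

lemma bphi_diff:
  assumes "x \<le> y"
  shows "bphi p m x - bphi p m y = (\<Sum>k\<in>{k. k \<le> m \<and> x \<le> real k / real m \<and> real k / real m < y}. bw p m k)"
proof -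
  have "bphi p m x - bphi p m y = (\<Sum>k\<le>m. bw p m k * of_bool (x \<le> real k / real m \<and> real k / real m < y))"
    unfolding bphi_def sum_subtractf[symmetric]
    using assms by (intro sum.cong refl) (auto simp: of_bool_def)
  also have "\<dots> = (\<Sum>k\<in>{k. k \<le> m \<and> x \<le> real k / real m \<and> real k / real m < y}. bw p m k)"
    by (rule sum.mono_neutral_cong_right) auto
  finally show ?thesis .
qed

text \<open>The increment collects about \<open>m * (y - x)\<close> weights, each at most
  \<open>1 / (m + 1)\<close>. On an interval that avoids the window around \<open>p\<close>, each
  weight is within \<open>\<epsilon> / (m + 1)\<close> of \<open>of_bool q / (m + 1)\<close>, where
  \<open>q\<close> tells whether the interval lies to the left of \<open>p\<close>.\<close>

lemma bphi_diff_approx: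
  assumes p: "0 \<le> p" "p \<le> 1" and acc: "bw_accurate \<epsilon> p m" and m: "1 \<le> m" and e: "0 < \<epsilon>" "\<epsilon> \<le> 1"
    and xy: "0 \<le> x" "x \<le> y" "y \<le> 1"
  shows "bphi p m x - bphi p m y \<ge> 0"
    "bphi p m x - bphi p m y \<le> (y - x) + 2 / real m"
    "(\<And>t. x \<le> t \<Longrightarrow> t < y \<Longrightarrow> \<bar>t - p\<bar> > \<epsilon> \<and> (t < p \<longleftrightarrow> q)) \<Longrightarrow>
       \<bar>(bphi p m x - bphi p m y) - of_bool q * (y - x)\<bar> \<le> \<epsilon> * (y - x) + 4 / real m"
proof -
  define S where "S = {k. k \<le> m \<and> x \<le> real k / real m \<and> real k / real m < y}"
  have S_eq: "S = {k. real m * x \<le> real k \<and> real k < real m * y}"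
  proof -
    have "real k < real m * y \<Longrightarrow> k \<le> m" for k
    proof -
      assume "real k < real m * y"
      also have "\<dots> \<le> real m" using xy by (simp add: mult_left_le)
      finally show "k \<le> m" by simp
    qed
    then show ?thesis unfolding S_def using m by (auto simp: field_simps)
  qed
  have A: "bphi p m x - bphi p m y = (\<Sum>k\<in>S. bw p m k)" unfolding S_def by (rule bphi_diff[OF xy(2)])
  define N where "N = real (card S)"
  have "\<bar>N - (real m * y - real m * x)\<bar> \<le> 1"
    unfolding N_def S_eq using xy m by (intro card_nat_half_open) (auto intro: mult_left_mono)
  then have N1: "\<bar>N - real m * (y - x)\<bar> \<le> 1" by (simp add: algebra_simps)
  \<comment> \<open>One unit is the counting error; the other comes from \<open>m + 1\<close> in
    place of \<open>m\<close>, as \<open>y - x \<le> 1\<close>.\<close>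
  have N2: "\<bar>N / real (Suc m) - (y - x)\<bar> \<le> 2 / real m"
  proof -
    have "N - real (Suc m) * (y - x) = (N - real m * (y - x)) - (y - x)" by (simp add: algebra_simps)
    then have "\<bar>N - real (Suc m) * (y - x)\<bar> \<le> 2" using N1 xy by linarith
    then have "\<bar>N - real (Suc m) * (y - x)\<bar> / real (Suc m) \<le> 2 / real (Suc m)" by (rule divide_right_mono) simp
    moreover have "\<bar>N - real (Suc m) * (y - x)\<bar> / real (Suc m) = \<bar>N / real (Suc m) - (y - x)\<bar>"
      by (subst abs_div_pos) (auto simp: field_simps)
    moreover have "2 / real (Suc m) \<le> 2 / real m" using m by (simp add: field_simps)
    ultimately show ?thesis by linarith
  qed
  have b: "0 \<le> bw p m k" "bw p m k \<le> 1 / real (Suc m)" if "k \<in> S" for k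
    using that bw_bounds[of k m p] p unfolding S_def by auto
  show "bphi p m x - bphi p m y \<ge> 0" unfolding A using b by (intro sum_nonneg)
  have "(\<Sum>k\<in>S. bw p m k) \<le> (\<Sum>k\<in>S. 1 / real (Suc m))" using b by (intro sum_mono)
  also have "\<dots> = N / real (Suc m)" by (simp add: N_def)
  finally show "bphi p m x - bphi p m y \<le> (y - x) + 2 / real m" unfolding A using N2 by linarith
  have aux: "\<bar>S - Y\<bar> \<le> F + 2 * R" if "\<bar>S - X\<bar> \<le> E" "\<bar>X - Y\<bar> \<le> R" "E \<le> F + R" for S X Y E F R :: real
    using that by linarith
  assume q: "\<And>t. x \<le> t \<Longrightarrow> t < y \<Longrightarrow> \<bar>t - p\<bar> > \<epsilon> \<and> (t < p \<longleftrightarrow> q)"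
  have "\<bar>bw p m k - of_bool q / real (Suc m)\<bar> \<le> \<epsilon> / real (Suc m)" if "k \<in> S" for k
  proof -
    have "k \<le> m" "x \<le> real k / real m" "real k / real m < y" using that unfolding S_def by auto
    then have "\<bar>real (Suc m) * bw p m k - of_bool q\<bar> \<le> \<epsilon>"
      using acc q[of "real k / real m"] unfolding bw_accurate_def by auto
    then have "\<bar>real (Suc m) * bw p m k - of_bool q\<bar> / real (Suc m) \<le> \<epsilon> / real (Suc m)" by (rule divide_right_mono) simp
    then show ?thesis by (subst (asm) abs_div_pos) (auto simp: diff_divide_distrib)
  qed
  then have "\<bar>\<Sum>k\<in>S. bw p m k - of_bool q / real (Suc m)\<bar> \<le> (\<Sum>k\<in>S. \<epsilon> / real (Suc m))"
    by (intro order_trans[OF sum_abs] sum_mono)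
  then have 1: "\<bar>(\<Sum>k\<in>S. bw p m k) - of_bool q * (N / real (Suc m))\<bar> \<le> \<epsilon> * (N / real (Suc m))"
    by (simp add: sum_subtractf N_def algebra_simps)
  have 2: "\<bar>of_bool q * (N / real (Suc m)) - of_bool q * (y - x)\<bar> \<le> 2 / real m"
    using N2 by (cases q) auto
  have "\<epsilon> * (N / real (Suc m)) \<le> \<epsilon> * ((y - x) + 2 / real m)"
    using N2 e by (intro mult_left_mono) linarith+
  also have "\<dots> \<le> \<epsilon> * (y - x) + 1 * (2 / real m)"
    unfolding distrib_left using e by (intro add_left_mono mult_right_mono) auto
  finally show "\<bar>(bphi p m x - bphi p m y) - of_bool q * (y - x)\<bar> \<le> \<epsilon> * (y - x) + 4 / real m"
    unfolding A using aux[OF 1 2, of "\<epsilon> * (y - x)"] by simp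
qed

text \<open>The derivative \<open>- of_bool (x < p)\<close> is reliable when \<open>x\<close> is far
  from \<open>p\<close> and the step is short; otherwise the Lipschitz bound costs a full
  \<open>\<bar>y - x\<bar>\<close>. The two indicators record these exceptional cases, so that their
  means can be bounded later.\<close>

lemma bphi_taylor:
  assumes p: "0 \<le> p" "p \<le> 1" and acc: "bw_accurate \<epsilon> p m" and m: "1 \<le> m" and e: "0 < \<epsilon>" "\<epsilon> \<le> 1"
    and x: "x \<in> {0..1}" and y: "y \<in> {0..1}"
  shows "\<bar>bphi p m y - bphi p m x + of_bool (x < p) * (y - x)\<bar>
    \<le> \<bar>y - x\<bar> * (\<epsilon> + of_bool (\<bar>x - p\<bar> \<le> 2 * \<epsilon>) + of_bool (\<bar>y - x\<bar> > \<epsilon>)) + 4 / real m"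
proof -
  define a b where "a = min x y" and "b = max x y"
  have ab: "0 \<le> a" "a \<le> b" "b \<le> 1" "b - a = \<bar>y - x\<bar>" using x y by (auto simp: a_def b_def)
  have eq: "\<bar>bphi p m y - bphi p m x + of_bool (x < p) * (y - x)\<bar> = \<bar>(bphi p m a - bphi p m b) - of_bool (x < p) * (b - a)\<bar>"
    by (cases "x \<le> y") (auto simp: a_def b_def min_def max_def algebra_simps)
  note D = bphi_diff_approx[OF p acc m e ab(1-3)]
  have q4: "2 / real m \<le> 4 / real m" "0 \<le> 2 / real m" using m by (auto simp: field_simps)
  have aux: "\<bar>A - B\<bar> \<le> d + r" if "0 \<le> A" "A \<le> d + r" "0 \<le> B" "B \<le> d" "0 \<le> r" for A B d r :: real
    using that by linarith
  show ?thesis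
  proof (cases "\<bar>x - p\<bar> \<le> 2 * \<epsilon> \<or> \<bar>y - x\<bar> > \<epsilon>")
    case True
    have "of_bool (x < p) * (b - a) \<ge> 0" "of_bool (x < p) * (b - a) \<le> b - a" using ab by auto
    then have "\<bar>(bphi p m a - bphi p m b) - of_bool (x < p) * (b - a)\<bar> \<le> (b - a) * 1 + 2 / real m"
      using D(1,2) q4(2) by (intro aux) simp_all
    also have "\<dots> \<le> (b - a) * (\<epsilon> + of_bool (\<bar>x - p\<bar> \<le> 2 * \<epsilon>) + of_bool (\<bar>y - x\<bar> > \<epsilon>)) + 4 / real m"
      using True e ab q4(1) by (intro add_mono mult_left_mono q4(1)) auto
    finally show ?thesis unfolding eq ab(4) .
  next
    case False
    have "\<bar>(bphi p m a - bphi p m b) - of_bool (x < p) * (b - a)\<bar> \<le> \<epsilon> * (b - a) + 4 / real m"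
    proof (rule D(3))
      \<comment> \<open>\<open>x\<close> is more than \<open>2 * \<epsilon>\<close> from
        \<open>p\<close> and \<open>t\<close> stays within \<open>\<epsilon>\<close> of
        \<open>x\<close>, hence on the same side of \<open>p\<close> and outside its window.\<close>
      fix t assume "a \<le> t" "t < b"
      then have "\<bar>t - x\<bar> \<le> \<epsilon>" using False unfolding a_def b_def by (auto simp: min_def max_def split: if_splits)
      then show "\<epsilon> < \<bar>t - p\<bar> \<and> (t < p) = (x < p)" using False e by auto
    qed
    then show ?thesis unfolding eq ab(4) using False by (simp add: mult.commute)
  qed
qed

lemma bphi_bounds:
  assumes p: "0 \<le> p" "p \<le> 1"
  shows "0 \<le> bphi p m s" "bphi p m s \<le> 1"
proof -
  show "0 \<le> bphi p m s" unfolding bphi_def using p by (intro sum_nonneg mult_nonneg_nonneg bw_bounds) auto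
  have "bphi p m s \<le> (\<Sum>k\<le>m. 1 / real (Suc m))" unfolding bphi_def
  proof (rule sum_mono)
    fix k assume "k \<in> {..m}"
    then show "bw p m k * of_bool (s \<le> real k / real m) \<le> 1 / real (Suc m)"
      using bw_bounds[of k m p] p by (cases "s \<le> real k / real m") auto
  qed
  then show "bphi p m s \<le> 1" by simp
qed

lemma hinge_bounds: "0 \<le> p \<Longrightarrow> p \<le> 1 \<Longrightarrow> 0 \<le> s \<Longrightarrow> 0 \<le> hinge p s \<and> hinge p s \<le> 1"
  unfolding hinge_def by auto

lemma hinge_lipschitz: "\<bar>hinge p s - hinge p t\<bar> \<le> \<bar>s - t\<bar>"
  unfolding hinge_def by (auto simp: max_def)

text \<open>Following the slopes from the right end: \<open>bphi\<close> is at most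
  \<open>1 / m\<close> at 1, stays nearly flat down to the window around \<open>p\<close>, gains at
  most the width of the window there, and then climbs with slope close to one. The constants collect
  the window and the counting errors.\<close>

lemma bphi_hinge:
  assumes p: "0 \<le> p" "p \<le> 1" and acc: "bw_accurate \<epsilon> p m" and m: "1 \<le> m" and e: "0 < \<epsilon>" "\<epsilon> \<le> 1"
    and s: "s \<in> {0..1}"
  shows "\<bar>bphi p m s - hinge p s\<bar> \<le> 6 * \<epsilon> + 11 / real m"
proof -
  define q where "q = 1 / real m"
  have q: "0 \<le> q" "c / real m = c * q" for c by (auto simp: q_def)
  note L = bphi_diff_approx[OF p acc m e, unfolded q(2)]
  have nn: "0 \<le> bphi p m t" for t by (rule bphi_bounds[OF p])
  \<comment> \<open>At argument 1 only the last grid point contributes, which anchors the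
    comparison.\<close>
  have "bphi p m 1 = (\<Sum>k\<in>{m}. bw p m k)"
    unfolding bphi_def using m by (intro sum.mono_neutral_cong_right) (auto simp: field_simps of_bool_def)
  moreover have "1 / real (Suc m) \<le> q" unfolding q_def using m by (simp add: field_simps)
  ultimately have last: "bphi p m 1 \<le> q"
    using bw_bounds(3)[of m m p] p by simp
  have up: "bphi p m t \<le> \<epsilon> + 5 * q" if t: "t \<in> {0..1}" "t > p + \<epsilon>" for t
  proof -
    have "\<bar>(bphi p m t - bphi p m 1) - of_bool False * (1 - t)\<bar> \<le> \<epsilon> * (1 - t) + 4 * q"
      using t e by (intro L(3)) auto
    then have "bphi p m t - bphi p m 1 \<le> \<epsilon> * (1 - t) + 4 * q" by simp
    moreover have "\<epsilon> * (1 - t) \<le> \<epsilon>" using t e by (simp add: mult_left_le)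
    ultimately show ?thesis using last by linarith
  qed
  have mid: "bphi p m t \<le> (p + 2 * \<epsilon> - t) + \<epsilon> + 7 * q" if t: "t \<in> {0..1}" "t \<le> p + 2*\<epsilon>" for t
  proof (cases "p + 2*\<epsilon> \<le> 1")
    case True
    have "bphi p m t - bphi p m (p + 2 * \<epsilon>) \<le> (p + 2 * \<epsilon> - t) + 2 * q"
      using t True by (intro L(2)) auto
    moreover have "bphi p m (p + 2 * \<epsilon>) \<le> \<epsilon> + 5 * q" using True p e by (intro up) auto
    ultimately show ?thesis by linarith
  next
    case False
    have "bphi p m t - bphi p m 1 \<le> (1 - t) + 2 * q" using t by (intro L(2)) auto
    then show ?thesis using last False e q(1) by linarith
  qed
  consider "s < p - 2 * \<epsilon>" | "p - 2 * \<epsilon> \<le> s" "s \<le> p + 2 * \<epsilon>" | "p + 2 * \<epsilon> < s" by linarith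
  then have "\<bar>bphi p m s - hinge p s\<bar> \<le> 6 * \<epsilon> + 11 * q"
  proof cases
    case 1
    define b where "b = p - 2 * \<epsilon>"
    have b: "b \<in> {0..1}" "b \<le> p + 2*\<epsilon>" "s \<le> b" using 1 s p e by (auto simp: b_def)
    have "\<bar>(bphi p m s - bphi p m b) - of_bool True * (b - s)\<bar> \<le> \<epsilon> * (b - s) + 4 * q"
      using 1 s p e unfolding b_def by (intro L(3)) auto
    then have "\<bar>(bphi p m s - bphi p m b) - (b - s)\<bar> \<le> \<epsilon> * (b - s) + 4 * q" by simp
    moreover have "\<epsilon> * (b - s) \<le> \<epsilon>" using b s e by (simp add: mult_left_le)
    moreover have "hinge p s = p - s" unfolding hinge_def using 1 e by simp
    ultimately show ?thesis
      using mid[OF b(1,2)] nn[of b] e(1) q(1) unfolding b_def by linarith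
  next
    case 2
    have "0 \<le> hinge p s" "hinge p s \<le> 2 * \<epsilon>" unfolding hinge_def using 2 e by auto
    then show ?thesis using mid[of s] nn[of s] 2 e(1) q(1) s by fastforce
  next
    case 3
    have "hinge p s = 0" unfolding hinge_def using 3 e by simp
    then show ?thesis using up[of s] nn[of s] 3 e(1) q(1) s by simp
  qed
  then show ?thesis unfolding q(2) .
qed

section \<open>Samples from a law with uniform margins\<close>

lemma measurable_of_bool_cmp:
  fixes f g :: "'b \<Rightarrow> real"
  assumes [measurable]: "f \<in> borel_measurable N" "g \<in> borel_measurable N"
  shows "(\<lambda>x. of_bool (f x \<le> g x) :: real) \<in> borel_measurable N"
    and "(\<lambda>x. of_bool (f x < g x) :: real) \<in> borel_measurable N"
    and "(\<lambda>x. of_bool (f x = g x) :: real) \<in> borel_measurable N"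
  by measurable

section \<open>Moments of sums under a product law\<close>

context prob_space
begin

abbreviation sample_law :: "nat \<Rightarrow> (nat \<Rightarrow> 'a) measure" where
  "sample_law n \<equiv> Pi\<^sub>M {..<n} (\<lambda>_. M)"

lemma prob_space_sample_law: "prob_space (sample_law n)"
  by (intro prob_space_PiM prob_space_axioms)

lemma sample_component_measurable: "i < n \<Longrightarrow> (\<lambda>\<omega>. \<omega> i) \<in> measurable (sample_law n) M"
  by (rule measurable_component_singleton) auto

lemma integrable_sample_bounded:
  fixes f :: "(nat \<Rightarrow> 'a) \<Rightarrow> real"
  assumes "f \<in> borel_measurable (sample_law n)" "\<And>\<omega>. \<bar>f \<omega>\<bar> \<le> B"
  shows "integrable (sample_law n) f"
proof -
  interpret P: prob_space "sample_law n" by (rule prob_space_sample_law)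
  show ?thesis using assms by (intro P.integrable_const_bound[of _ B]) auto
qed

lemma integral_sample_component:
  fixes f :: "'a \<Rightarrow> real"
  assumes "i < n" "f \<in> borel_measurable M"
  shows "(\<integral>\<omega>. f (\<omega> i) \<partial>sample_law n) = (\<integral>x. f x \<partial>M)"
proof -
  have "distr (sample_law n) M (\<lambda>\<omega>. \<omega> i) = M"
    using assms(1) by (intro distr_PiM_component prob_space_axioms) auto
  then have "(\<integral>x. f x \<partial>M) = (\<integral>x. f x \<partial>distr (sample_law n) M (\<lambda>\<omega>. \<omega> i))" by simp
  also have "\<dots> = (\<integral>\<omega>. f (\<omega> i) \<partial>sample_law n)"
    using assms by (intro integral_distr) auto
  finally show ?thesis by simp
qed

text \<open>Coordinate \<open>i\<close> is integrated out first. The vanishing of cross terms, the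
  degeneracy of the rank errors and the absence of ties are all obtained through this one
  step.\<close>

lemma integral_sample_zero:
  fixes f :: "(nat \<Rightarrow> 'a) \<Rightarrow> real"
  assumes "i < n" "f \<in> borel_measurable (sample_law n)" "\<And>\<omega>. \<bar>f \<omega>\<bar> \<le> B"
    and zero: "\<And>\<omega>. (\<integral>x. f (fun_upd \<omega> i x) \<partial>M) = 0"
  shows "(\<integral>\<omega>. f \<omega> \<partial>sample_law n) = 0"
proof -
  interpret product_sigma_finite "\<lambda>_::nat. M"
    by (intro product_sigma_finite.intro sigma_finite_measure_axioms)
  have ins: "{..<n} = insert i ({..<n} - {i})" using assms(1) by auto
  have "integrable (sample_law n) f" using assms by (intro integrable_sample_bounded)
  then have "integrable (Pi\<^sub>M (insert i ({..<n} - {i})) (\<lambda>_. M)) f"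
    using ins by metis
  then have "(\<integral>\<omega>. f \<omega> \<partial>Pi\<^sub>M (insert i ({..<n} - {i})) (\<lambda>_. M)) =
      (\<integral>\<omega>. (\<integral>x. f (fun_upd \<omega> i x) \<partial>M) \<partial>Pi\<^sub>M ({..<n} - {i}) (\<lambda>_. M))"
    by (intro product_integral_insert) auto
  then show ?thesis using zero ins by simp
qed

lemma integral_sample_sum_square:
  fixes f :: "'a \<Rightarrow> real"
  assumes f[measurable]: "f \<in> borel_measurable M" and B: "\<And>x. \<bar>f x\<bar> \<le> B" and mean: "(\<integral>x. f x \<partial>M) = 0"
  shows "(\<integral>\<omega>. (\<Sum>i<n. f (\<omega> i))\<^sup>2 \<partial>sample_law n) = real n * (\<integral>x. (f x)\<^sup>2 \<partial>M)"
proof -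
  have B0: "0 \<le> B" using B[of undefined] by linarith
  have int: "integrable (sample_law n) (\<lambda>\<omega>. f (\<omega> i) * f (\<omega> j))" if "i < n" "j < n" for i j
    using that B B0 by (intro integrable_sample_bounded[where B="B * B"]) (auto simp: abs_mult intro!: mult_mono)
  have trm: "(\<integral>\<omega>. f (\<omega> i) * f (\<omega> j) \<partial>sample_law n) = (if i = j then (\<integral>x. (f x)\<^sup>2 \<partial>M) else 0)" if "i < n" "j < n" for i j
  proof (cases "i = j")
    case True
    then show ?thesis using integral_sample_component[of j n "\<lambda>x. f x * f x"] that by (simp add: power2_eq_square)
  next
    case False
    have "(\<integral>\<omega>. f (\<omega> i) * f (\<omega> j) \<partial>sample_law n) = 0"
      using that False B B0 mean
      by (intro integral_sample_zero[where B="B * B" and i=i]) (auto simp: abs_mult intro!: mult_mono)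
    then show ?thesis using False by simp
  qed
  have "(\<integral>\<omega>. (\<Sum>i<n. f (\<omega> i))\<^sup>2 \<partial>sample_law n) = (\<integral>\<omega>. (\<Sum>i<n. \<Sum>j<n. f (\<omega> i) * f (\<omega> j)) \<partial>sample_law n)"
    by (simp add: power2_eq_square sum_product)
  also have "\<dots> = (\<Sum>i<n. \<Sum>j<n. (\<integral>\<omega>. f (\<omega> i) * f (\<omega> j) \<partial>sample_law n))"
    using int by (subst Bochner_Integration.integral_sum) (auto intro!: Bochner_Integration.integrable_sum sum.cong Bochner_Integration.integral_sum)
  also have "\<dots> = (\<Sum>i<n. \<Sum>j<n. (if i = j then (\<integral>x. (f x)\<^sup>2 \<partial>M) else 0))"
    using trm by (intro sum.cong refl) auto
  also have "\<dots> = real n * (\<integral>x. (f x)\<^sup>2 \<partial>M)" by (simp add: sum.delta)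
  finally show ?thesis .
qed

text \<open>A pointwise inequality between arithmetic and geometric mean takes the place of
  Cauchy-Schwarz; \<open>s\<close> bounds the root mean square.\<close>

lemma expectation_abs_le_of_square:
  fixes R :: "'a \<Rightarrow> real"
  assumes "integrable M R" "integrable M (\<lambda>x. (R x)\<^sup>2)" "0 < s" "(\<integral>x. (R x)\<^sup>2 \<partial>M) \<le> s\<^sup>2"
  shows "(\<integral>x. \<bar>R x\<bar> \<partial>M) \<le> s"
proof -
  have *: "\<bar>R x\<bar> \<le> ((R x)\<^sup>2 / s + s) / 2" for x
  proof -
    have "0 \<le> (\<bar>R x\<bar> - s)\<^sup>2" by simp
    then have "2 * s * \<bar>R x\<bar> \<le> (R x)\<^sup>2 + s\<^sup>2" by (simp add: power2_eq_square algebra_simps)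
    then show ?thesis using assms(3) by (simp add: field_simps power2_eq_square)
  qed
  have "(\<integral>x. \<bar>R x\<bar> \<partial>M) \<le> (\<integral>x. ((R x)\<^sup>2 / s + s) / 2 \<partial>M)"
    using assms(1,2) * by (intro integral_mono) auto
  also have "\<dots> = ((\<integral>x. (R x)\<^sup>2 \<partial>M) / s + s) / 2"
    using assms(2) by (simp add: prob_space)
  also have "\<dots> \<le> (s\<^sup>2 / s + s) / 2"
    using assms by (intro divide_right_mono add_right_mono) auto
  also have "\<dots> = s" using assms(3) by (simp add: power2_eq_square)
  finally show ?thesis .
qed

end

section \<open>Ranks of a coordinate with uniform law\<close>

definition own_ecdf :: "nat \<Rightarrow> ('a \<Rightarrow> real) \<Rightarrow> (nat \<Rightarrow> 'a) \<Rightarrow> nat \<Rightarrow> real" where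
  "own_ecdf n c \<omega> i = ecdf n (\<lambda>j. c (\<omega> j)) (c (\<omega> i))"

text \<open>A coordinate function on a probability space rather than a law on the unit interval: two
  coordinates of one law can be treated side by side, and standardised data and clamped bootstrap
  observations are both instances. The range condition holds at every point, so that bounds are
  pointwise.\<close>

locale uniform_coord = prob_space M for M :: "'a measure" +
  fixes c :: "'a \<Rightarrow> real"
  assumes c_measurable[measurable]: "c \<in> borel_measurable M"
    and c_range: "\<And>x. 0 \<le> c x \<and> c x \<le> 1"
    and c_uniform: "\<And>u. 0 \<le> u \<Longrightarrow> u \<le> 1 \<Longrightarrow> prob {x \<in> space M. c x \<le> u} = u"
begin

lemma c_compose_measurable[measurable (raw)]:
  "f \<in> measurable N M \<Longrightarrow> (\<lambda>z. c (f z)) \<in> borel_measurable N"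
  by (rule measurable_compose[OF _ c_measurable])

lemma prob_c_le: "prob {x \<in> space M. c x \<le> u} = max 0 (min 1 u)"
proof -
  consider "u < 0" | "0 \<le> u" "u \<le> 1" | "1 < u" by linarith
  then show ?thesis
  proof cases
    case 1
    then have "{x \<in> space M. c x \<le> u} = {}" using c_range by (auto simp: not_le intro: less_le_trans)
    then have "prob {x \<in> space M. c x \<le> u} = 0" by (simp only: measure_empty)
    then show ?thesis using 1 by simp
  next
    case 3
    then have "c x \<le> u" for x using c_range[of x] by linarith
    then have "{x \<in> space M. c x \<le> u} = space M" by auto
    then show ?thesis using 3 by (simp add: prob_space)
  qed (use c_uniform in auto)
qed

lemma prob_c_near: "0 \<le> d \<Longrightarrow> prob {x \<in> space M. \<bar>c x - a\<bar> \<le> d} \<le> 2 * d"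
proof (rule field_le_epsilon)
  \<comment> \<open>The left endpoint belongs to the event; the extra \<open>e\<close> keeps it out
    of the subtracted half-line.\<close>
  fix e :: real assume d: "0 \<le> d" and e: "0 < e"
  have "{x \<in> space M. \<bar>c x - a\<bar> \<le> d} \<subseteq> {x \<in> space M. c x \<le> a + d} - {x \<in> space M. c x \<le> a - d - e}"
    using e by auto
  then have "prob {x \<in> space M. \<bar>c x - a\<bar> \<le> d} \<le> prob ({x \<in> space M. c x \<le> a + d} - {x \<in> space M. c x \<le> a - d - e})"
    by (intro finite_measure_mono) measurable
  also have "\<dots> = prob {x \<in> space M. c x \<le> a + d} - prob {x \<in> space M. c x \<le> a - d - e}"
    using d e by (intro finite_measure_Diff) (auto, measurable)
  also have "\<dots> \<le> 2 * d + e" unfolding prob_c_le using d e by (simp add: max_def min_def)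
  finally show "prob {x \<in> space M. \<bar>c x - a\<bar> \<le> d} \<le> 2 * d + e" .
qed

lemma integral_c_near: "0 \<le> d \<Longrightarrow> (\<integral>x. of_bool (\<bar>c x - a\<bar> \<le> d) \<partial>M) \<le> 2 * d"
proof -
  assume d: "0 \<le> d"
  have "(\<integral>x. of_bool (\<bar>c x - a\<bar> \<le> d) \<partial>M) = (\<integral>x. indicator {x \<in> space M. \<bar>c x - a\<bar> \<le> d} x \<partial>M :: real)"
    by (intro Bochner_Integration.integral_cong) (auto simp: indicator_def)
  also have "\<dots> = prob {x \<in> space M. \<bar>c x - a\<bar> \<le> d}" by simp
  finally show ?thesis using prob_c_near[OF d, of a] by simp
qed

text \<open>A window of radius zero has probability zero, so with the other point held fixed a tie
  has probability zero.\<close>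

lemma AE_no_ties:
  "AE \<omega> in sample_law n. \<forall>i<n. \<forall>j<n. c (\<omega> i) = c (\<omega> j) \<longrightarrow> i = j"
proof -
  interpret P: prob_space "sample_law n" by (rule prob_space_sample_law)
  have pair: "AE \<omega> in sample_law n. \<not> c (\<omega> i) = c (\<omega> j)" if ij: "i < n" "j < n" "i \<noteq> j" for i j
  proof -
    note [measurable] = c_compose_measurable[OF sample_component_measurable[OF ij(1)]] c_compose_measurable[OF sample_component_measurable[OF ij(2)]]
    have "(\<integral>\<omega>. of_bool (c (\<omega> i) = c (\<omega> j)) \<partial>sample_law n) = (0::real)"
    proof (rule integral_sample_zero[of i _ _ 1])
      fix \<omega> :: "nat \<Rightarrow> 'a"
      have "0 \<le> (\<integral>x. of_bool (c x = c (\<omega> j)) \<partial>M :: real)" by (intro integral_nonneg_AE) auto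
      moreover have "(\<integral>x. of_bool (c x = c (\<omega> j)) \<partial>M :: real) \<le> 0"
        using integral_c_near[of 0 "c (\<omega> j)"] by simp
      ultimately have "(\<integral>x. of_bool (c x = c (\<omega> j)) \<partial>M :: real) = 0" by linarith
      then show "(\<integral>x. of_bool (c ((fun_upd \<omega> i x) i) = c ((fun_upd \<omega> i x) j)) \<partial>M) = (0::real)"
        using ij by simp
    qed (use ij in \<open>auto intro!: measurable_of_bool_cmp c_compose_measurable sample_component_measurable\<close>)
    moreover have "(\<integral>\<omega>. of_bool (c (\<omega> i) = c (\<omega> j)) \<partial>sample_law n) = P.prob {\<omega> \<in> space (sample_law n). c (\<omega> i) = c (\<omega> j)}"
    proof -
      have "(\<integral>\<omega>. of_bool (c (\<omega> i) = c (\<omega> j)) \<partial>sample_law n) =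
        (\<integral>\<omega>. indicator {\<omega> \<in> space (sample_law n). c (\<omega> i) = c (\<omega> j)} \<omega> \<partial>sample_law n :: real)"
        by (intro Bochner_Integration.integral_cong) (auto simp: indicator_def)
      then show ?thesis by simp
    qed
    ultimately have "P.prob {\<omega> \<in> space (sample_law n). c (\<omega> i) = c (\<omega> j)} = 0" by simp
    moreover have "{\<omega> \<in> space (sample_law n). c (\<omega> i) = c (\<omega> j)} \<in> P.events"
      using ij by (intro borel_measurable_eq c_compose_measurable sample_component_measurable)
    ultimately show ?thesis using P.prob_Collect_eq_0[of "\<lambda>\<omega>. c (\<omega> i) = c (\<omega> j)"] by simp
  qed
  have "AE \<omega> in sample_law n. \<forall>i\<in>{..<n}. \<forall>j\<in>{..<n}. c (\<omega> i) = c (\<omega> j) \<longrightarrow> i = j"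
  proof (intro AE_finite_allI)
    fix i j assume "i \<in> {..<n}" "j \<in> {..<n}"
    then show "AE \<omega> in sample_law n. c (\<omega> i) = c (\<omega> j) \<longrightarrow> i = j"
      using pair[of i j] by (cases "i = j") auto
  qed auto
  then show ?thesis by eventually_elim auto
qed

text \<open>The rank error at \<open>x\<close> averages this kernel over the sample points
  \<open>y\<close>. It is centred in \<open>y\<close> but in general not in \<open>x\<close>, which
  is why a projection on \<open>y\<close> remains.\<close>

definition dev :: "'a \<Rightarrow> 'a \<Rightarrow> real" where "dev x y = of_bool (c y \<le> c x) - c x"

lemma dev_bound: "\<bar>dev x y\<bar> \<le> 1" unfolding dev_def using c_range[of x] by (auto simp: of_bool_def)

lemma dev_measurable[measurable (raw)]:
  assumes [measurable]: "f \<in> measurable N M" "g \<in> measurable N M"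
  shows "(\<lambda>z. dev (f z) (g z)) \<in> borel_measurable N"
  unfolding dev_def by measurable

lemma integral_dev: "(\<integral>y. dev x y \<partial>M) = 0"
proof -
  have "(\<integral>y. dev x y \<partial>M) = (\<integral>y. indicator {y \<in> space M. c y \<le> c x} y - c x \<partial>M)"
    unfolding dev_def by (intro Bochner_Integration.integral_cong) (auto simp: indicator_def)
  also have "\<dots> = prob {y \<in> space M. c y \<le> c x} - c x"
    by (subst Bochner_Integration.integral_diff) (auto simp: prob_space intro!: integrable_real_indicator emeasure_finite[unfolded less_top])
  finally show ?thesis using c_uniform c_range by auto
qed

lemma own_ecdf_dev: "0 < n \<Longrightarrow> own_ecdf n c \<omega> i - c (\<omega> i) = (\<Sum>j<n. dev (\<omega> i) (\<omega> j)) / real n"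
  unfolding own_ecdf_def ecdf_def dev_def by (simp add: sum_subtractf diff_divide_distrib)

lemma own_ecdf_measurable[measurable]:
  assumes "i < n"
  shows "(\<lambda>\<omega>. own_ecdf n c \<omega> i) \<in> borel_measurable (sample_law n)"
proof -
  have "(\<lambda>\<omega>. of_bool (c (\<omega> j) \<le> c (\<omega> i)) :: real) \<in> borel_measurable (sample_law n)" if j: "j < n" for j
  proof -
    show ?thesis
      using j assms by (intro measurable_of_bool_cmp c_compose_measurable sample_component_measurable)
  qed
  then show ?thesis
    unfolding own_ecdf_def ecdf_def by (intro borel_measurable_divide borel_measurable_sum) auto
qed

lemma own_ecdf_bounds: "0 \<le> own_ecdf n c \<omega> i" "own_ecdf n c \<omega> i \<le> 1"
proof -
  have "(\<Sum>j<n. of_bool (c (\<omega> j) \<le> c (\<omega> i))) \<le> (\<Sum>j<n. 1::real)" by (intro sum_mono) auto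
  then show "own_ecdf n c \<omega> i \<le> 1" unfolding own_ecdf_def ecdf_def by (auto simp: divide_le_eq_1)
qed (auto simp: own_ecdf_def ecdf_def intro!: divide_nonneg_nonneg sum_nonneg)

lemma own_ecdf_error:
  assumes i: "i < n"
  shows "(\<integral>\<omega>. (own_ecdf n c \<omega> i - c (\<omega> i))\<^sup>2 \<partial>sample_law n) \<le> 1 / real n"
proof -
  interpret P: prob_space "sample_law n" by (rule prob_space_sample_law)
  have meas[measurable]: "(\<lambda>\<omega>. dev (\<omega> i) (\<omega> j) * dev (\<omega> i) (\<omega> k)) \<in> borel_measurable (sample_law n)" if jk: "j < n" "k < n" for j k
    using jk[THEN sample_component_measurable] sample_component_measurable[OF i] by (intro borel_measurable_times dev_measurable)
  have bd: "\<bar>dev x y * dev x z\<bar> \<le> 1" for x y z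
    using dev_bound[of x y] dev_bound[of x z] by (simp add: abs_mult mult_le_one)
  have trm: "(\<integral>\<omega>. dev (\<omega> i) (\<omega> j) * dev (\<omega> i) (\<omega> k) \<partial>sample_law n) \<le> of_bool (j = k)" if jk: "j < n" "k < n" for j k
  proof -
    \<comment> \<open>For \<open>j \<noteq> k\<close> at least one of them differs from
      \<open>i\<close>; that coordinate occurs in a single factor, which has mean zero.\<close>
    consider "j = k" | "j \<noteq> k" "j \<noteq> i" | "j \<noteq> k" "k \<noteq> i" by blast
    then show ?thesis
    proof cases
      case 1
      have "(\<integral>\<omega>. dev (\<omega> i) (\<omega> j) * dev (\<omega> i) (\<omega> k) \<partial>sample_law n) \<le> (\<integral>\<omega>. 1 \<partial>sample_law n)"
        using bd meas[OF jk] by (intro integral_mono integrable_sample_bounded[of _ _ 1]) (auto intro: abs_le_D1)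
      then show ?thesis using 1 by (simp add: P.prob_space)
    next
      case 2
      then have "(\<integral>\<omega>. dev (\<omega> i) (\<omega> j) * dev (\<omega> i) (\<omega> k) \<partial>sample_law n) = 0"
        using jk i bd integral_dev by (intro integral_sample_zero[of j _ _ 1] meas) auto
      then show ?thesis by simp
    next
      case 3
      then have "(\<integral>\<omega>. dev (\<omega> i) (\<omega> j) * dev (\<omega> i) (\<omega> k) \<partial>sample_law n) = 0"
        using jk i bd integral_dev by (intro integral_sample_zero[of k _ _ 1] meas) auto
      then show ?thesis by simp
    qed
  qed
  have n: "0 < n" using i by auto
  have "(\<integral>\<omega>. (own_ecdf n c \<omega> i - c (\<omega> i))\<^sup>2 \<partial>sample_law n) =
      (\<integral>\<omega>. (\<Sum>j<n. \<Sum>k<n. dev (\<omega> i) (\<omega> j) * dev (\<omega> i) (\<omega> k)) / (real n)\<^sup>2 \<partial>sample_law n)"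
    unfolding own_ecdf_dev[OF n] by (simp add: power2_eq_square sum_product)
  also have "\<dots> = (\<Sum>j<n. \<Sum>k<n. (\<integral>\<omega>. dev (\<omega> i) (\<omega> j) * dev (\<omega> i) (\<omega> k) \<partial>sample_law n)) / (real n)\<^sup>2"
    using bd by (simp, subst Bochner_Integration.integral_sum)
      (auto intro!: Bochner_Integration.integrable_sum sum.cong Bochner_Integration.integral_sum integrable_sample_bounded[of _ _ 1] meas)
  also have "\<dots> \<le> (\<Sum>j<n. \<Sum>k<n. of_bool (j = k)) / (real n)\<^sup>2"
    using trm by (intro divide_right_mono sum_mono) auto
  also have "(\<Sum>j<n. \<Sum>k<n. of_bool (j = k)) = real n"
    by (simp add: of_bool_def sum.delta)
  finally show ?thesis using n by (simp add: power2_eq_square)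
qed

text \<open>The weighted rank error \<open>\<Sum> a(\<omega>\<^sub>i) (own_ecdf - c)\<close> is a degenerate \<open>U\<close>-statistic up to the
  sum of these projections.\<close>

definition proj :: "('a \<Rightarrow> real) \<Rightarrow> real \<Rightarrow> real" where
  "proj a s = (\<integral>x. a x * (of_bool (s \<le> c x) - c x) \<partial>M)"

lemma proj_measurable:
  assumes [measurable]: "a \<in> borel_measurable M"
  shows "proj a \<in> borel_measurable borel"
  unfolding proj_def by measurable

lemma proj_bound:
  assumes [measurable]: "a \<in> borel_measurable M" and a: "\<And>x. \<bar>a x\<bar> \<le> 1"
  shows "\<bar>proj a s\<bar> \<le> 1"
proof -
  have b: "\<bar>of_bool (s \<le> c x) - c x\<bar> \<le> 1" for x using c_range[of x] by (auto simp: of_bool_def)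
  have b: "\<bar>a x * (of_bool (s \<le> c x) - c x)\<bar> \<le> 1" for x
    using a[of x] b[of x] by (simp add: abs_mult mult_le_one)
  have "\<bar>proj a s\<bar> \<le> (\<integral>x. \<bar>a x * (of_bool (s \<le> c x) - c x)\<bar> \<partial>M)" unfolding proj_def by (rule integral_abs_bound)
  also have "\<dots> \<le> (\<integral>x. 1 \<partial>M)"
    using b by (intro integral_mono integrable_const_bound[of _ 1]) auto
  finally show ?thesis by (simp add: prob_space)
qed

text \<open>Subtracting the projection leaves a kernel \<open>h\<close> with mean zero in each
  argument. The second moment of its double sum involves four indices and vanishes unless they pair
  up; three pairings, with products bounded by 4, give 12 whatever the law.\<close>

lemma projection_error:
  assumes a_meas[measurable]: "a \<in> borel_measurable M" and a: "\<And>x. \<bar>a x\<bar> \<le> 1" and n: "0 < n"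
  shows "(\<integral>\<omega>. ((\<Sum>i<n. a (\<omega> i) * (own_ecdf n c \<omega> i - c (\<omega> i))) - (\<Sum>j<n. proj a (c (\<omega> j))))\<^sup>2 \<partial>sample_law n) \<le> 12"
    and "integral\<^sup>L M (\<lambda>x. proj a (c x)) = 0"
proof -
  interpret P: prob_space "sample_law n" by (rule prob_space_sample_law)
  interpret MM: pair_sigma_finite M M by standard
  interpret MM: pair_prob_space M M by standard
  note [measurable] = proj_measurable[OF a_meas]
  define h where "h x y = a x * dev x y - proj a (c y)" for x y
  have h_meas[measurable (raw)]: "(\<lambda>z. h (f z) (g z)) \<in> borel_measurable N"
    if [measurable]: "f \<in> measurable N M" "g \<in> measurable N M" for f g and N :: "'c measure"
    unfolding h_def by measurable
  have ad: "\<bar>a x * dev x y\<bar> \<le> 1" for x y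
    using a[of x] dev_bound[of x y] by (simp add: abs_mult mult_le_one)
  have hb: "\<bar>h x y\<bar> \<le> 2" for x y
    unfolding h_def using ad[of x y] proj_bound[of a "c y", OF a_meas a] by linarith
  have i1: "(\<integral>x. h x y \<partial>M) = 0" for y
  proof -
    have "(\<integral>x. h x y \<partial>M) = (\<integral>x. a x * dev x y \<partial>M) - (\<integral>x. proj a (c y) \<partial>M)"
      unfolding h_def using ad proj_bound[of a, OF a_meas a] by (intro Bochner_Integration.integral_diff integrable_const_bound[of _ 1]) (auto simp: dev_def)
    then show ?thesis by (simp add: prob_space proj_def dev_def)
  qed
  \<comment> \<open>Exchanging the integrals puts the mean on the second argument of
    \<open>dev\<close>, where it is zero.\<close>
  have "(\<integral>y. (\<integral>x. a x * dev x y \<partial>M) \<partial>M) = (\<integral>x. (\<integral>y. a x * dev x y \<partial>M) \<partial>M)"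
    using ad by (intro MM.Fubini_integral MM.P.integrable_const_bound[of _ 1]) (auto simp: dev_def split: prod.split)
  then show p0: "(\<integral>y. proj a (c y) \<partial>M) = 0"
    using integral_dev by (simp add: proj_def dev_def)
  have i2: "(\<integral>y. h x y \<partial>M) = 0" for x
  proof -
    have "(\<integral>y. h x y \<partial>M) = (\<integral>y. a x * dev x y \<partial>M) - (\<integral>y. proj a (c y) \<partial>M)"
      unfolding h_def using ad proj_bound[of a, OF a_meas a]
      by (intro Bochner_Integration.integral_diff integrable_const_bound[of _ 1]) (auto simp: dev_def)
    then show ?thesis using p0 integral_dev by simp
  qed
  have meas[measurable]: "(\<lambda>\<omega>. h (\<omega> i) (\<omega> j) * h (\<omega> k) (\<omega> l)) \<in> borel_measurable (sample_law n)"
    if "i < n" "j < n" "k < n" "l < n" for i j k l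
    using that[THEN sample_component_measurable] by (intro borel_measurable_times h_meas)
  have bd: "\<bar>h x y * h z w\<bar> \<le> 4" for x y z w
    using mult_mono[OF hb[of x y] hb[of z w]] by (simp add: abs_mult)
  have trm: "(\<integral>\<omega>. h (\<omega> i) (\<omega> j) * h (\<omega> k) (\<omega> l) \<partial>sample_law n)
      \<le> 4 * (of_bool (i = j) * of_bool (k = l) + of_bool (i = k) * of_bool (j = l) + of_bool (i = l) * of_bool (j = k))"
    (is "?I \<le> _") if ijkl: "i < n" "j < n" "k < n" "l < n" for i j k l
  proof -
    \<comment> \<open>An index that occurs only once can be integrated out and gives zero; otherwise
      the four indices form two pairs.\<close>
    consider "i \<notin> {j, k, l}" | "j \<notin> {i, k, l}" | "k \<notin> {i, j, l}" | "l \<notin> {i, j, k}" |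
      "(i = j \<and> k = l) \<or> (i = k \<and> j = l) \<or> (i = l \<and> j = k)" by blast
    then show ?thesis
    proof cases
      case 1
      then have "?I = 0" using ijkl bd i1 i2 by (intro integral_sample_zero[of i _ _ 4] meas) auto
      then show ?thesis by simp
    next
      case 2
      then have "?I = 0" using ijkl bd i1 i2 by (intro integral_sample_zero[of j _ _ 4] meas) auto
      then show ?thesis by simp
    next
      case 3
      then have "?I = 0" using ijkl bd i1 i2 by (intro integral_sample_zero[of k _ _ 4] meas) auto
      then show ?thesis by simp
    next
      case 4
      then have "?I = 0" using ijkl bd i1 i2 by (intro integral_sample_zero[of l _ _ 4] meas) auto
      then show ?thesis by simp
    next
      case 5
      have "?I \<le> (\<integral>\<omega>. 4 \<partial>sample_law n)"
        using bd meas[OF ijkl] by (intro integral_mono integrable_sample_bounded[of _ _ 4]) (auto intro: abs_le_D1)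
      then have "?I \<le> 4" by (simp add: P.prob_space)
      then show ?thesis using 5 by (auto simp: of_bool_def)
    qed
  qed
  have eq: "(\<Sum>i<n. a (\<omega> i) * (own_ecdf n c \<omega> i - c (\<omega> i))) - (\<Sum>j<n. proj a (c (\<omega> j)))
      = (\<Sum>i<n. \<Sum>j<n. h (\<omega> i) (\<omega> j)) / real n" for \<omega>
  proof -
    have "(\<Sum>i<n. \<Sum>j<n. proj a (c (\<omega> j))) / real n = (\<Sum>j<n. proj a (c (\<omega> j)))" using n by simp
    then show ?thesis unfolding h_def own_ecdf_dev[OF n]
      by (simp only: sum_subtractf diff_divide_distrib) (simp add: sum_distrib_left sum_divide_distrib)
  qed
  have "(\<integral>\<omega>. ((\<Sum>i<n. a (\<omega> i) * (own_ecdf n c \<omega> i - c (\<omega> i))) - (\<Sum>j<n. proj a (c (\<omega> j))))\<^sup>2 \<partial>sample_law n)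
    = (\<integral>\<omega>. (\<Sum>i<n. \<Sum>k<n. \<Sum>j<n. \<Sum>l<n. h (\<omega> i) (\<omega> j) * h (\<omega> k) (\<omega> l)) / (real n)\<^sup>2 \<partial>sample_law n)"
    unfolding eq by (simp add: power2_eq_square sum_product)
  also have "\<dots> = (\<Sum>i<n. \<Sum>k<n. \<Sum>j<n. \<Sum>l<n. (\<integral>\<omega>. h (\<omega> i) (\<omega> j) * h (\<omega> k) (\<omega> l) \<partial>sample_law n)) / (real n)\<^sup>2"
  proof -
    have int: "integrable (sample_law n) (\<lambda>\<omega>. h (\<omega> i) (\<omega> j) * h (\<omega> k) (\<omega> l))"
      if "i < n" "j < n" "k < n" "l < n" for i j k l
      using bd by (intro integrable_sample_bounded[of _ _ 4] meas that) auto
    have "(\<integral>\<omega>. (\<Sum>i<n. \<Sum>k<n. \<Sum>j<n. \<Sum>l<n. h (\<omega> i) (\<omega> j) * h (\<omega> k) (\<omega> l)) \<partial>sample_law n)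
      = (\<Sum>i<n. \<Sum>k<n. \<Sum>j<n. \<Sum>l<n. (\<integral>\<omega>. h (\<omega> i) (\<omega> j) * h (\<omega> k) (\<omega> l) \<partial>sample_law n))"
      by ((subst Bochner_Integration.integral_sum, force intro!: Bochner_Integration.integrable_sum int, rule sum.cong[OF refl])+, rule refl)
    then show ?thesis by simp
  qed
  also have "\<dots> \<le> (\<Sum>i<n. \<Sum>k<n. \<Sum>j<n. \<Sum>l<n.
      4 * (of_bool (i = j) * of_bool (k = l) + of_bool (i = k) * of_bool (j = l) + of_bool (i = l) * of_bool (j = k))) / (real n)\<^sup>2"
    using trm by (intro divide_right_mono sum_mono) auto
  also have "(\<Sum>i<n. \<Sum>k<n. \<Sum>j<n. \<Sum>l<n.
      4 * (of_bool (i = j) * of_bool (k = l) + of_bool (i = k) * of_bool (j = l) + of_bool (i = l) * of_bool (j = k))) = 12 * (real n)\<^sup>2"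
  proof -
    have d: "(\<Sum>k<n. of_bool (i = k) * f k) = f i" "(\<Sum>k<n. f k * of_bool (i = k)) = f i" if "i < n" for i and f :: "nat \<Rightarrow> real"
      using that by (auto simp: of_bool_def if_distrib if_distribR sum.delta cong: if_cong)
    have d1: "(\<Sum>k<n. of_bool (i = k)) = (1::real)" if "i < n" for i using d(1)[of i "\<lambda>_. 1"] that by simp
    show ?thesis
      by (simp add: sum.distrib sum_distrib_left[symmetric] d d1 sum_distrib_right[symmetric] power2_eq_square)
  qed
  finally show "(\<integral>\<omega>. ((\<Sum>i<n. a (\<omega> i) * (own_ecdf n c \<omega> i - c (\<omega> i))) - (\<Sum>j<n. proj a (c (\<omega> j))))\<^sup>2 \<partial>sample_law n) \<le> 12"
    using n by (simp add: power2_eq_square)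
qed

end

section \<open>Asymptotic linearity of the smoothed rank statistic\<close>

definition rank_stat :: "real \<Rightarrow> nat \<Rightarrow> nat \<Rightarrow> ('a \<Rightarrow> real) \<Rightarrow> ('a \<Rightarrow> real) \<Rightarrow> (nat \<Rightarrow> 'a) \<Rightarrow> real" where
  "rank_stat p m n c\<^sub>1 c\<^sub>2 \<omega> =
     (\<Sum>i<n. bphi p m (own_ecdf n c\<^sub>1 \<omega> i) * bphi p m (own_ecdf n c\<^sub>2 \<omega> i)) / real n"

lemma bphi_measurable[measurable]: "bphi p m \<in> borel_measurable borel"
  unfolding bphi_def by measurable

lemma hinge_measurable[measurable]: "hinge p \<in> borel_measurable borel"
  unfolding hinge_def by measurable

lemma rank_stat_bounds:
  assumes "0 \<le> p" "p \<le> 1"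
  shows "0 \<le> rank_stat p m n c\<^sub>1 c\<^sub>2 \<omega>" "rank_stat p m n c\<^sub>1 c\<^sub>2 \<omega> \<le> 1"
proof -
  have "(\<Sum>i<n. bphi p m (own_ecdf n c\<^sub>1 \<omega> i) * bphi p m (own_ecdf n c\<^sub>2 \<omega> i)) \<le> (\<Sum>i<n. 1)"
    using bphi_bounds[OF assms] by (intro sum_mono mult_le_one) auto
  then show "rank_stat p m n c\<^sub>1 c\<^sub>2 \<omega> \<le> 1"
    unfolding rank_stat_def by (auto simp: divide_le_eq_1)
  show "0 \<le> rank_stat p m n c\<^sub>1 c\<^sub>2 \<omega>"
    unfolding rank_stat_def using bphi_bounds[OF assms]
    by (intro divide_nonneg_nonneg sum_nonneg mult_nonneg_nonneg) auto
qed

locale uniform_pair = prob_space M + c1: uniform_coord M c\<^sub>1 + c2: uniform_coord M c\<^sub>2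
  for M :: "'a measure" and c\<^sub>1 c\<^sub>2 :: "'a \<Rightarrow> real" +
  fixes p :: real
  assumes p: "0 \<le> p" "p \<le> 1"
begin

text \<open>Minus the partial derivative of \<open>hinge p a * hinge p b\<close> in
  \<open>a\<close>, taken at the two coordinates; \<open>wt\<^sub>2\<close> is its mirror
  image.\<close>

definition wt\<^sub>1 :: "'a \<Rightarrow> real" where "wt\<^sub>1 x = of_bool (c\<^sub>1 x < p) * hinge p (c\<^sub>2 x)"
definition wt\<^sub>2 :: "'a \<Rightarrow> real" where "wt\<^sub>2 x = of_bool (c\<^sub>2 x < p) * hinge p (c\<^sub>1 x)"
definition kernel_mean :: real where "kernel_mean = (\<integral>x. hinge p (c\<^sub>1 x) * hinge p (c\<^sub>2 x) \<partial>M)"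
text \<open>The natural centring of the smoothed statistic. Its distance to
  \<open>kernel_mean\<close> is the Bernstein bias, which is kept apart from the stochastic error
  because hypothesis (ii) controls it.\<close>

definition smooth_mean :: "nat \<Rightarrow> real" where "smooth_mean m = (\<integral>x. bphi p m (c\<^sub>1 x) * bphi p m (c\<^sub>2 x) \<partial>M)"

text \<open>The first-order effect of one observation: its own centred value, and the effect of
  estimating each margin by ranks, with the weights \<open>wt\<^sub>1\<close> and
  \<open>wt\<^sub>2\<close> as negative derivatives.\<close>

definition infl :: "'a \<Rightarrow> real" where
  "infl x = hinge p (c\<^sub>1 x) * hinge p (c\<^sub>2 x) - kernel_mean - c1.proj wt\<^sub>1 (c\<^sub>1 x) - c2.proj wt\<^sub>2 (c\<^sub>2 x)"

lemma hinge_c: "0 \<le> hinge p (c\<^sub>1 x)" "hinge p (c\<^sub>1 x) \<le> 1" "0 \<le> hinge p (c\<^sub>2 x)" "hinge p (c\<^sub>2 x) \<le> 1"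
  using hinge_bounds[OF p, of "c\<^sub>1 x"] hinge_bounds[OF p, of "c\<^sub>2 x"] c1.c_range[of x] c2.c_range[of x] by auto

lemma wt_measurable[measurable]: "wt\<^sub>1 \<in> borel_measurable M" "wt\<^sub>2 \<in> borel_measurable M"
  unfolding wt\<^sub>1_def wt\<^sub>2_def by measurable

lemma wt_bounds: "\<bar>wt\<^sub>1 x\<bar> \<le> 1" "\<bar>wt\<^sub>2 x\<bar> \<le> 1"
  unfolding wt\<^sub>1_def wt\<^sub>2_def using hinge_c[of x] by (auto simp: of_bool_def)

lemma proj_meas[measurable]: "c1.proj wt\<^sub>1 \<in> borel_measurable borel" "c2.proj wt\<^sub>2 \<in> borel_measurable borel"
  by (intro c1.proj_measurable c2.proj_measurable wt_measurable)+

lemma infl_measurable[measurable]: "infl \<in> borel_measurable M"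
  unfolding infl_def by measurable

lemma hinge_prod_bounds: "0 \<le> hinge p (c\<^sub>1 x) * hinge p (c\<^sub>2 x)" "hinge p (c\<^sub>1 x) * hinge p (c\<^sub>2 x) \<le> 1"
  using hinge_c[of x] by (auto intro: mult_le_one)

lemma kernel_mean_bounds: "0 \<le> kernel_mean" "kernel_mean \<le> 1"
proof -
  show "0 \<le> kernel_mean" unfolding kernel_mean_def using hinge_prod_bounds by (intro integral_nonneg_AE) auto
  have "kernel_mean \<le> (\<integral>x. 1 \<partial>M)" unfolding kernel_mean_def
    using hinge_prod_bounds by (intro integral_mono integrable_const_bound[of _ 1]) auto
  then show "kernel_mean \<le> 1" by (simp add: prob_space)
qed

lemma infl_bound: "\<bar>infl x\<bar> \<le> 3"
  unfolding infl_def using hinge_prod_bounds[of x] kernel_mean_bounds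
    c1.proj_bound[of wt\<^sub>1 "c\<^sub>1 x", OF wt_measurable(1) wt_bounds(1)]
    c2.proj_bound[of wt\<^sub>2 "c\<^sub>2 x", OF wt_measurable(2) wt_bounds(2)] by linarith

lemma infl_mean: "(\<integral>x. infl x \<partial>M) = 0"
proof -
  have i: "integrable M (\<lambda>x. hinge p (c\<^sub>1 x) * hinge p (c\<^sub>2 x))"
      "integrable M (\<lambda>x. c1.proj wt\<^sub>1 (c\<^sub>1 x))" "integrable M (\<lambda>x. c2.proj wt\<^sub>2 (c\<^sub>2 x))"
    using hinge_prod_bounds c1.proj_bound[of wt\<^sub>1, OF wt_measurable(1) wt_bounds(1)]
      c2.proj_bound[of wt\<^sub>2, OF wt_measurable(2) wt_bounds(2)]
    by (auto intro!: integrable_const_bound[of _ 1])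
  show ?thesis
    unfolding infl_def using i
    by (simp add: c1.projection_error(2)[of wt\<^sub>1 1, OF wt_measurable(1) wt_bounds(1)] c2.projection_error(2)[of wt\<^sub>2 1, OF wt_measurable(2) wt_bounds(2)]
      kernel_mean_def prob_space)
qed

end

text \<open>A linear term is traded for a quadratic one and a constant. With \<open>l\<close> of
  order \<open>sqrt n\<close> the two balance, because squared rank errors have mean at most
  \<open>1 / n\<close>.\<close>

lemma abs_times_split:
  fixes x w :: real
  assumes "0 < l"
  shows "\<bar>x\<bar> \<le> (l * x\<^sup>2 + 1 / l) / 2"
proof -
  have "0 \<le> (l * \<bar>x\<bar> - 1)\<^sup>2" by simp
  then have "2 * l * \<bar>x\<bar> \<le> l * (l * x\<^sup>2) + 1" by (simp add: power2_eq_square algebra_simps)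
  then have "2 * \<bar>x\<bar> \<le> l * x\<^sup>2 + 1 / l" using assms by (simp add: field_simps)
  then show ?thesis by simp
qed

text \<open>\<open>r\<close> stands for \<open>sqrt n\<close>: each product of the rank error with a
  small factor is split so that both parts have mean of order \<open>1 / r\<close> times a small
  constant. The last term keeps the window indicator; its mean is of order \<epsilon>, so that
  division by \<open>sqrt \<epsilon>\<close> still leaves \<open>sqrt \<epsilon>\<close>.\<close>

lemma bphi_linear_error:
  assumes p: "0 \<le> p" "p \<le> 1" and acc: "bw_accurate \<epsilon> p m" and m: "1 \<le> m" and e: "0 < \<epsilon>" "\<epsilon> \<le> 1"
    and u: "u \<in> {0..1}" and x: "x \<in> {0..1}" and v: "v \<in> {0..1}" and r: "1 \<le> r"
  shows "\<bar>(bphi p m x - bphi p m u) * bphi p m v + of_bool (u < p) * hinge p v * (x - u)\<bar>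
    \<le> (7 * sqrt \<epsilon> * r + 6 * r / real m + 1 / \<epsilon>) * (x - u)\<^sup>2 + 4 * sqrt \<epsilon> / r + 10 / real m
      + of_bool (\<bar>u - p\<bar> \<le> 2 * \<epsilon>) / (sqrt \<epsilon> * r)"
proof -
  define d where "d = \<bar>x - u\<bar>"
  define q where "q = 1 / real m"
  define s where "s = sqrt \<epsilon>"
  define A where "A = (of_bool (\<bar>u - p\<bar> \<le> 2 * \<epsilon>) :: real)"
  define B where "B = (of_bool (d > \<epsilon>) :: real)"
  have q: "0 \<le> q" "q \<le> 1" "c / real m = c * q" for c using m by (auto simp: q_def)
  have s: "0 < s" "s \<le> 1" "\<epsilon> \<le> s" "s * s = \<epsilon>"
    using e real_le_rsqrt[of \<epsilon> \<epsilon>] by (auto simp: s_def power2_eq_square mult_le_one mult_left_le)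
  have d0: "0 \<le> d" "d\<^sup>2 = (x - u)\<^sup>2" by (auto simp: d_def)
  define D where "D = bphi p m x - bphi p m u + of_bool (u < p) * (x - u)"
  have D: "\<bar>D\<bar> \<le> d * (\<epsilon> + A + B) + 4 * q"
    unfolding D_def d_def A_def B_def q(3)[symmetric] using bphi_taylor[OF p acc m e u x] .
  have V: "0 \<le> bphi p m v" "bphi p m v \<le> 1" by (rule bphi_bounds[OF p])+
  have VH: "\<bar>bphi p m v - hinge p v\<bar> \<le> 6 * \<epsilon> + 11 * q"
    using bphi_hinge[OF p acc m e v] unfolding q(3) .
  have "(bphi p m x - bphi p m u) * bphi p m v + of_bool (u < p) * hinge p v * (x - u)
      = D * bphi p m v - of_bool (u < p) * (x - u) * (bphi p m v - hinge p v)"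
    unfolding D_def by (simp add: algebra_simps)
  also have "\<bar>\<dots>\<bar> \<le> \<bar>D\<bar> * 1 + d * (6 * \<epsilon> + 11 * q)"
  proof (rule order_trans[OF abs_triangle_ineq4] add_mono)+
    show "\<bar>D * bphi p m v\<bar> \<le> \<bar>D\<bar> * 1" unfolding abs_mult using V by (intro mult_left_mono) auto
    show "\<bar>of_bool (u < p) * (x - u) * (bphi p m v - hinge p v)\<bar> \<le> d * (6 * \<epsilon> + 11 * q)"
      unfolding abs_mult d_def[symmetric] using VH d0 by (intro mult_mono) (auto simp: of_bool_def)
  qed
  also have "\<dots> \<le> d * (7 * \<epsilon> + 11 * q) + d * A + d * B + 4 * q" using D by (simp add: algebra_simps)
  also have "\<dots> \<le> (7 * s * r + 6 * r * q + 1 / \<epsilon>) * d\<^sup>2 + 4 * s / r + 10 * q + A / (s * r)"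
  proof -
    have 1: "d * (7 * \<epsilon>) \<le> (7/2 * s * r) * d\<^sup>2 + 7/2 * s / r"
    proof -
      have "d \<le> (r * d\<^sup>2 + 1 / r) / 2" using abs_times_split[of r d] r d0 by simp
      then have "d * (7 * \<epsilon>) \<le> (r * d\<^sup>2 + 1 / r) / 2 * (7 * s)" using d0 s e r by (intro mult_mono) auto
      also have "\<dots> = (7/2 * s * r) * d\<^sup>2 + 7/2 * s / r" by (simp add: algebra_simps)
      finally show ?thesis .
    qed
    have 2: "d * (11 * q) \<le> (6 * r * q) * d\<^sup>2 + 6 * q"
    proof -
      have "d \<le> (r * d\<^sup>2 + 1 / r) / 2" using abs_times_split[of r d] r d0 by simp
      then have "d * (11 * q) \<le> (r * d\<^sup>2 + 1 / r) / 2 * (11 * q)" using q by (intro mult_right_mono) auto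
      also have "\<dots> \<le> (r * d\<^sup>2 + 1) / 2 * (12 * q)"
        using r q by (intro mult_mono divide_right_mono add_left_mono) auto
      finally show ?thesis by (simp add: algebra_simps)
    qed
    \<comment> \<open>Weight \<open>s * r\<close> instead of \<open>r\<close>: the indicator is
      rare, so its constant part may be larger in exchange for a smaller quadratic part.\<close>
    have 3: "d * A \<le> (1/2 * s * r) * d\<^sup>2 + A / (s * r)"
    proof -
      have "d \<le> ((s * r) * d\<^sup>2 + 1 / (s * r)) / 2" using abs_times_split[of "s * r" d] r s d0 by simp
      also have "\<dots> = (s * r) * d\<^sup>2 / 2 + 1 / (s * r) / 2" by (rule add_divide_distrib)
      also have "\<dots> \<le> (s * r) * d\<^sup>2 / 2 + 1 / (s * r)"
        using divide_left_mono[of 1 2 "1 / (s * r)"] r s by (intro add_left_mono) simp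
      finally have "d \<le> (s * r * d\<^sup>2) / 2 + 1 / (s * r)" .
      then have "d \<le> (1/2 * s * r) * d\<^sup>2 + 1 / (s * r)" by simp
      moreover have "0 \<le> (1/2 * s * r) * d\<^sup>2" using r s by simp
      ultimately show ?thesis unfolding A_def by (simp add: of_bool_def)
    qed
    \<comment> \<open>A long step satisfies \<open>d \<le> d\<^sup>2 / \<epsilon>\<close> and goes
      into the quadratic part.\<close>
    have 4: "d * B \<le> 1 / \<epsilon> * d\<^sup>2"
    proof (cases "d > \<epsilon>")
      case True
      then have "\<epsilon> * d \<le> d * d" using d0 by (intro mult_right_mono) auto
      then show ?thesis using True e by (simp add: B_def power2_eq_square field_simps)
    qed (use e in \<open>simp add: B_def\<close>)
    have 5: "3 * s * r * d\<^sup>2 \<ge> 0" "1/2 * s / r \<ge> 0" using s r by auto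
    show ?thesis using 1 2 3 4 5 by (simp add: algebra_simps)
  qed
  finally show ?thesis unfolding q(3) s_def A_def d0(2) .
qed

context uniform_pair
begin

lemma sample_meas:
  assumes "i < n"
  shows "(\<lambda>\<omega>. c\<^sub>1 (\<omega> i)) \<in> borel_measurable (sample_law n)" "(\<lambda>\<omega>. c\<^sub>2 (\<omega> i)) \<in> borel_measurable (sample_law n)"
    "(\<lambda>\<omega>. own_ecdf n c\<^sub>1 \<omega> i) \<in> borel_measurable (sample_law n)"
    "(\<lambda>\<omega>. own_ecdf n c\<^sub>2 \<omega> i) \<in> borel_measurable (sample_law n)"
    "(\<lambda>\<omega>. infl (\<omega> i)) \<in> borel_measurable (sample_law n)"
    "(\<lambda>\<omega>. c1.proj wt\<^sub>1 (c\<^sub>1 (\<omega> i))) \<in> borel_measurable (sample_law n)"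
    "(\<lambda>\<omega>. c2.proj wt\<^sub>2 (c\<^sub>2 (\<omega> i))) \<in> borel_measurable (sample_law n)"
    "(\<lambda>\<omega>. wt\<^sub>1 (\<omega> i)) \<in> borel_measurable (sample_law n)"
    "(\<lambda>\<omega>. wt\<^sub>2 (\<omega> i)) \<in> borel_measurable (sample_law n)"
proof -
  note [measurable] = sample_component_measurable[OF assms]
  show "(\<lambda>\<omega>. c\<^sub>1 (\<omega> i)) \<in> borel_measurable (sample_law n)" "(\<lambda>\<omega>. c\<^sub>2 (\<omega> i)) \<in> borel_measurable (sample_law n)"
    "(\<lambda>\<omega>. own_ecdf n c\<^sub>1 \<omega> i) \<in> borel_measurable (sample_law n)"
    "(\<lambda>\<omega>. own_ecdf n c\<^sub>2 \<omega> i) \<in> borel_measurable (sample_law n)"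
    by (intro c1.c_compose_measurable c2.c_compose_measurable c1.own_ecdf_measurable c2.own_ecdf_measurable
      sample_component_measurable assms)+
  then show "(\<lambda>\<omega>. c1.proj wt\<^sub>1 (c\<^sub>1 (\<omega> i))) \<in> borel_measurable (sample_law n)"
    "(\<lambda>\<omega>. c2.proj wt\<^sub>2 (c\<^sub>2 (\<omega> i))) \<in> borel_measurable (sample_law n)"
    by (auto intro: measurable_compose[OF _ proj_meas(1)] measurable_compose[OF _ proj_meas(2)])
  show "(\<lambda>\<omega>. infl (\<omega> i)) \<in> borel_measurable (sample_law n)"
    "(\<lambda>\<omega>. wt\<^sub>1 (\<omega> i)) \<in> borel_measurable (sample_law n)"
    "(\<lambda>\<omega>. wt\<^sub>2 (\<omega> i)) \<in> borel_measurable (sample_law n)"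
    by (auto intro: measurable_compose[OF sample_component_measurable[OF assms]])
qed

lemma rank_stat_measurable: "rank_stat p m n c\<^sub>1 c\<^sub>2 \<in> borel_measurable (sample_law n)"
  unfolding rank_stat_def
  by (intro borel_measurable_divide borel_measurable_sum borel_measurable_times
      measurable_compose[OF _ bphi_measurable] sample_meas) auto

text \<open>The remainder has four parts: the Taylor error, two degenerate double sums from the rank
  errors, and the replacement of \<open>bphi\<close> by \<open>hinge\<close> in the centred leading
  sum. For fixed \<epsilon> only \<open>50 * sqrt \<epsilon>\<close> survives when \<open>n\<close>
  grows and \<open>sqrt n / m\<close> vanishes.\<close>

lemma asymptotic_linearity:
  assumes acc: "bw_accurate \<epsilon> p m" and m: "1 \<le> m" and e: "0 < \<epsilon>" "\<epsilon> \<le> 1" and n: "1 \<le> n"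
  shows "(\<integral>\<omega>. \<bar>sqrt (real n) * (rank_stat p m n c\<^sub>1 c\<^sub>2 \<omega> - smooth_mean m) - (\<Sum>i<n. infl (\<omega> i)) / sqrt (real n)\<bar> \<partial>sample_law n)
    \<le> 50 * sqrt \<epsilon> + 12 / (\<epsilon> * sqrt (real n)) + 64 * sqrt (real n) / real m"
proof -
  interpret P: prob_space "sample_law n" by (rule prob_space_sample_law)
  define r where "r = sqrt (real n)"
  define q where "q = 1 / real m"
  define s where "s = sqrt \<epsilon>"
  have r: "1 \<le> r" "r * r = real n" "0 < r" using n by (auto simp: r_def)
  have q: "0 \<le> q" "q \<le> 1" "c / real m = c * q" for c using m by (auto simp: q_def)
  have s: "0 < s" "s \<le> 1" "\<epsilon> \<le> s" "s * s = \<epsilon>"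
    using e real_le_rsqrt[of \<epsilon> \<epsilon>] by (auto simp: s_def power2_eq_square mult_le_one mult_left_le)
  define x where "x i \<omega> = own_ecdf n c\<^sub>1 \<omega> i - c\<^sub>1 (\<omega> i)" for i \<omega>
  define y where "y i \<omega> = own_ecdf n c\<^sub>2 \<omega> i - c\<^sub>2 (\<omega> i)" for i \<omega>
  define A where "A i \<omega> = (of_bool (\<bar>c\<^sub>1 (\<omega> i) - p\<bar> \<le> 2 * \<epsilon>) :: real)" for i and \<omega> :: "nat \<Rightarrow> 'a"
  define B where "B i \<omega> = (of_bool (\<bar>c\<^sub>2 (\<omega> i) - p\<bar> \<le> 2 * \<epsilon>) :: real)" for i and \<omega> :: "nat \<Rightarrow> 'a"
  define K where "K = 7 * s * r + 6 * r * q + 1 / \<epsilon>"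
  \<comment> \<open>Integrable majorant of the Taylor error of one summand; its mean needs only the
    second moments of the rank errors and the window probabilities.\<close>
  define b where "b i \<omega> = (K + 1) * ((x i \<omega>)\<^sup>2 + (y i \<omega>)\<^sup>2) + (A i \<omega> + B i \<omega>) / (s * r) + (8 * s / r + 28 * q)" for i \<omega>
  define R where "R i \<omega> = bphi p m (own_ecdf n c\<^sub>1 \<omega> i) * bphi p m (own_ecdf n c\<^sub>2 \<omega> i)
     - bphi p m (c\<^sub>1 (\<omega> i)) * bphi p m (c\<^sub>2 (\<omega> i)) + wt\<^sub>1 (\<omega> i) * x i \<omega> + wt\<^sub>2 (\<omega> i) * y i \<omega>" for i \<omega>
  have rangeE: "own_ecdf n c\<^sub>1 \<omega> i \<in> {0..1}" "own_ecdf n c\<^sub>2 \<omega> i \<in> {0..1}" "c\<^sub>1 z \<in> {0..1}" "c\<^sub>2 z \<in> {0..1}" for i \<omega> z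
    using c1.own_ecdf_bounds c2.own_ecdf_bounds c1.c_range c2.c_range by auto
  have lip: "\<bar>bphi p m v - bphi p m u\<bar> \<le> \<bar>v - u\<bar> + 2 * q" if "u \<in> {0..1}" "v \<in> {0..1}" for u v
  proof (cases "u \<le> v")
    case True
    then show ?thesis using bphi_diff_approx(1,2)[OF p acc m e, of u v] that unfolding q(3) by auto
  next
    case False
    then show ?thesis using bphi_diff_approx(1,2)[OF p acc m e, of v u] that unfolding q(3) by auto
  qed
  have Rb: "\<bar>R i \<omega>\<bar> \<le> b i \<omega>" for i \<omega>
  proof -
    define E F U V where "E = bphi p m (own_ecdf n c\<^sub>1 \<omega> i)" and "F = bphi p m (own_ecdf n c\<^sub>2 \<omega> i)"
      and "U = bphi p m (c\<^sub>1 (\<omega> i))" and "V = bphi p m (c\<^sub>2 (\<omega> i))"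
    have 1: "\<bar>(E - U) * V + wt\<^sub>1 (\<omega> i) * x i \<omega>\<bar> \<le> K * (x i \<omega>)\<^sup>2 + 4 * s / r + 10 * q + A i \<omega> / (s * r)"
      using bphi_linear_error[OF p acc m e rangeE(3)[of "\<omega> i"] rangeE(1)[of \<omega> i] rangeE(4)[of "\<omega> i"] r(1)]
      unfolding E_def U_def V_def wt\<^sub>1_def x_def A_def K_def s_def q(3) by simp
    have 2: "\<bar>(F - V) * U + wt\<^sub>2 (\<omega> i) * y i \<omega>\<bar> \<le> K * (y i \<omega>)\<^sup>2 + 4 * s / r + 10 * q + B i \<omega> / (s * r)"
      using bphi_linear_error[OF p acc m e rangeE(4)[of "\<omega> i"] rangeE(2)[of \<omega> i] rangeE(3)[of "\<omega> i"] r(1)]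
      unfolding F_def U_def V_def wt\<^sub>2_def y_def B_def K_def s_def q(3) by simp
    \<comment> \<open>The mixed term is a product of two increments, hence already quadratic in the
      rank errors up to \<open>1 / m\<close>.\<close>
    have 3: "\<bar>(E - U) * (F - V)\<bar> \<le> (x i \<omega>)\<^sup>2 + (y i \<omega>)\<^sup>2 + 8 * q"
    proof -
      have "\<bar>(E - U) * (F - V)\<bar> \<le> (\<bar>x i \<omega>\<bar> + 2 * q) * (\<bar>y i \<omega>\<bar> + 2 * q)"
        unfolding abs_mult E_def F_def U_def V_def x_def y_def using rangeE q by (intro mult_mono lip) auto
      also have "\<dots> \<le> (x i \<omega>)\<^sup>2 + (y i \<omega>)\<^sup>2 + 8 * (q * q)"
      proof -
        have "0 \<le> (\<bar>x i \<omega>\<bar> - \<bar>y i \<omega>\<bar>)\<^sup>2" "0 \<le> (\<bar>x i \<omega>\<bar> - 2 * q)\<^sup>2" "0 \<le> (\<bar>y i \<omega>\<bar> - 2 * q)\<^sup>2" by auto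
        then show ?thesis by (simp add: power2_eq_square algebra_simps)
      qed
      also have "\<dots> \<le> (x i \<omega>)\<^sup>2 + (y i \<omega>)\<^sup>2 + 8 * q" using q by (simp add: mult_left_le)
      finally show ?thesis .
    qed
    have "R i \<omega> = ((E - U) * V + wt\<^sub>1 (\<omega> i) * x i \<omega>) + ((F - V) * U + wt\<^sub>2 (\<omega> i) * y i \<omega>) + (E - U) * (F - V)"
      unfolding R_def E_def F_def U_def V_def by (simp add: algebra_simps)
    then have "\<bar>R i \<omega>\<bar> \<le> (K * (x i \<omega>)\<^sup>2 + 4 * s / r + 10 * q + A i \<omega> / (s * r))
        + (K * (y i \<omega>)\<^sup>2 + 4 * s / r + 10 * q + B i \<omega> / (s * r)) + ((x i \<omega>)\<^sup>2 + (y i \<omega>)\<^sup>2 + 8 * q)"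
      using 1 2 3 by linarith
    then show ?thesis unfolding b_def by (simp add: algebra_simps add_divide_distrib)
  qed
  have xm: "x i \<in> borel_measurable (sample_law n)" "y i \<in> borel_measurable (sample_law n)"
      "A i \<in> borel_measurable (sample_law n)" "B i \<in> borel_measurable (sample_law n)"
      "R i \<in> borel_measurable (sample_law n)" if i: "i < n" for i
  proof -
    note [measurable] = sample_meas[OF i]
    show *: "x i \<in> borel_measurable (sample_law n)" "y i \<in> borel_measurable (sample_law n)"
      unfolding x_def y_def by measurable
    show "A i \<in> borel_measurable (sample_law n)" "B i \<in> borel_measurable (sample_law n)"
      unfolding A_def B_def
      by (intro measurable_of_bool_cmp borel_measurable_abs borel_measurable_diff sample_meas i borel_measurable_const)+
    note [measurable] = *
    show "R i \<in> borel_measurable (sample_law n)" unfolding R_def by measurable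
  qed
  have xb: "\<bar>x i \<omega>\<bar> \<le> 1" "\<bar>y i \<omega>\<bar> \<le> 1" "\<bar>A i \<omega>\<bar> \<le> 1" "\<bar>B i \<omega>\<bar> \<le> 1" for i \<omega>
    unfolding x_def y_def A_def B_def using rangeE(1,2)[of \<omega> i] rangeE(3,4)[of "\<omega> i"] by auto
  have xi: "integrable (sample_law n) (\<lambda>\<omega>. (x i \<omega>)\<^sup>2)" "integrable (sample_law n) (\<lambda>\<omega>. (y i \<omega>)\<^sup>2)"
      "integrable (sample_law n) (A i)" "integrable (sample_law n) (B i)" if i: "i < n" for i
    using xm[OF i] xb by (auto intro!: integrable_sample_bounded[of _ _ 1] simp: abs_square_le_1)
  have Eb: "integrable (sample_law n) (b i)" "(\<integral>\<omega>. b i \<omega> \<partial>sample_law n) \<le> (K + 1) * (2 / real n) + 16 * \<epsilon> / (s * r) + 8 * s / r + 28 * q" if i: "i < n" for i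
  proof -
    show "integrable (sample_law n) (b i)" unfolding b_def using xi[OF i] by simp
    have K0: "0 \<le> K + 1" unfolding K_def using s r q e by (auto intro!: add_nonneg_nonneg)
    have sq: "(\<integral>\<omega>. (x i \<omega>)\<^sup>2 \<partial>sample_law n) \<le> 1 / real n" "(\<integral>\<omega>. (y i \<omega>)\<^sup>2 \<partial>sample_law n) \<le> 1 / real n"
      unfolding x_def y_def by (intro c1.own_ecdf_error c2.own_ecdf_error i)+
    have A: "(\<integral>\<omega>. A i \<omega> \<partial>sample_law n) \<le> 2 * (2 * \<epsilon>)"
    proof -
      have "(\<integral>\<omega>. A i \<omega> \<partial>sample_law n) = (\<integral>z. of_bool (\<bar>c\<^sub>1 z - p\<bar> \<le> 2 * \<epsilon>) \<partial>M)"
        unfolding A_def by (intro integral_sample_component i) measurable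
      then show ?thesis using c1.integral_c_near[of "2 * \<epsilon>" p] e by simp
    qed
    have B: "(\<integral>\<omega>. B i \<omega> \<partial>sample_law n) \<le> 2 * (2 * \<epsilon>)"
    proof -
      have "(\<integral>\<omega>. B i \<omega> \<partial>sample_law n) = (\<integral>z. of_bool (\<bar>c\<^sub>2 z - p\<bar> \<le> 2 * \<epsilon>) \<partial>M)"
        unfolding B_def by (intro integral_sample_component i) measurable
      then show ?thesis using c2.integral_c_near[of "2 * \<epsilon>" p] e by simp
    qed
    have "(\<integral>\<omega>. b i \<omega> \<partial>sample_law n) = (K + 1) * ((\<integral>\<omega>. (x i \<omega>)\<^sup>2 \<partial>sample_law n) + (\<integral>\<omega>. (y i \<omega>)\<^sup>2 \<partial>sample_law n))
        + ((\<integral>\<omega>. A i \<omega> \<partial>sample_law n) + (\<integral>\<omega>. B i \<omega> \<partial>sample_law n)) / (s * r) + (8 * s / r + 28 * q)"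
      unfolding b_def using xi[OF i] by (simp add: P.prob_space)
    also have "\<dots> \<le> (K + 1) * (1 / real n + 1 / real n) + (2 * (2 * \<epsilon>) + 2 * (2 * \<epsilon>)) / (s * r) + (8 * s / r + 28 * q)"
      using sq A B K0 s r by (intro add_mono mult_left_mono divide_right_mono) auto
    also have "\<dots> \<le> (K + 1) * (2 / real n) + 16 * \<epsilon> / (s * r) + 8 * s / r + 28 * q"
    proof -
      have "(2 * (2 * \<epsilon>) + 2 * (2 * \<epsilon>)) / (s * r) \<le> 16 * \<epsilon> / (s * r)" using s r e by (intro divide_right_mono) auto
      then show ?thesis by simp
    qed
    finally show "(\<integral>\<omega>. b i \<omega> \<partial>sample_law n) \<le> (K + 1) * (2 / real n) + 16 * \<epsilon> / (s * r) + 8 * s / r + 28 * q" .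
  qed
  define R1 where "R1 \<omega> = (\<Sum>i<n. R i \<omega>) / r" for \<omega>
  define R2 where "R2 \<omega> = ((\<Sum>i<n. wt\<^sub>1 (\<omega> i) * x i \<omega>) - (\<Sum>j<n. c1.proj wt\<^sub>1 (c\<^sub>1 (\<omega> j)))) / r" for \<omega>
  define R3 where "R3 \<omega> = ((\<Sum>i<n. wt\<^sub>2 (\<omega> i) * y i \<omega>) - (\<Sum>j<n. c2.proj wt\<^sub>2 (c\<^sub>2 (\<omega> j)))) / r" for \<omega>
  define f where "f z = (bphi p m (c\<^sub>1 z) * bphi p m (c\<^sub>2 z) - smooth_mean m) - (hinge p (c\<^sub>1 z) * hinge p (c\<^sub>2 z) - kernel_mean)" for z
  define R4 where "R4 \<omega> = (\<Sum>i<n. f (\<omega> i)) / r" for \<omega>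
  have decomp: "sqrt (real n) * (rank_stat p m n c\<^sub>1 c\<^sub>2 \<omega> - smooth_mean m) - (\<Sum>i<n. infl (\<omega> i)) / sqrt (real n)
      = R1 \<omega> - R2 \<omega> - R3 \<omega> + R4 \<omega>" for \<omega>
  proof -
    have "r * (rank_stat p m n c\<^sub>1 c\<^sub>2 \<omega> - smooth_mean m)
      = (\<Sum>i<n. bphi p m (own_ecdf n c\<^sub>1 \<omega> i) * bphi p m (own_ecdf n c\<^sub>2 \<omega> i) - smooth_mean m) / r"
    proof -
      have "r * (S / (r * r) - \<mu>) = (S - (r * r) * \<mu>) / r" for S \<mu> using r(3) by (simp add: field_simps)
      then show ?thesis unfolding rank_stat_def sum_subtractf by (simp add: r(2))
    qed
    then have "r * (rank_stat p m n c\<^sub>1 c\<^sub>2 \<omega> - smooth_mean m) - (\<Sum>i<n. infl (\<omega> i)) / r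
      = ((\<Sum>i<n. bphi p m (own_ecdf n c\<^sub>1 \<omega> i) * bphi p m (own_ecdf n c\<^sub>2 \<omega> i) - smooth_mean m) - (\<Sum>i<n. infl (\<omega> i))) / r"
      by (simp add: diff_divide_distrib)
    also have "\<dots> = R1 \<omega> - R2 \<omega> - R3 \<omega> + R4 \<omega>"
      unfolding R1_def R2_def R3_def R4_def diff_divide_distrib[symmetric] add_divide_distrib[symmetric] sum_subtractf[symmetric] sum.distrib[symmetric]
      by (rule arg_cong[where f="\<lambda>t. t / r"], rule sum.cong[OF refl]) (simp add: R_def f_def infl_def)
    finally show ?thesis unfolding r_def .
  qed
  have fm[measurable]: "f \<in> borel_measurable M" unfolding f_def by measurable
  have sm: "0 \<le> smooth_mean m" "smooth_mean m \<le> 1"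
  proof -
    show "0 \<le> smooth_mean m" unfolding smooth_mean_def using bphi_bounds[OF p] by (intro integral_nonneg_AE) auto
    have "smooth_mean m \<le> (\<integral>x. 1 \<partial>M)" unfolding smooth_mean_def
      using bphi_bounds[OF p] by (intro integral_mono integrable_const_bound[of _ 1]) (auto intro!: mult_le_one)
    then show "smooth_mean m \<le> 1" by (simp add: prob_space)
  qed
  have fb: "\<bar>f z\<bar> \<le> 2" for z
  proof -
    have "0 \<le> bphi p m (c\<^sub>1 z) * bphi p m (c\<^sub>2 z)" "bphi p m (c\<^sub>1 z) * bphi p m (c\<^sub>2 z) \<le> 1"
      using bphi_bounds[OF p] by (auto intro: mult_le_one)
    then show ?thesis unfolding f_def using sm kernel_mean_bounds hinge_prod_bounds[of z] by linarith
  qed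
  define g where "g z = bphi p m (c\<^sub>1 z) * bphi p m (c\<^sub>2 z) - hinge p (c\<^sub>1 z) * hinge p (c\<^sub>2 z)" for z
  have gm[measurable]: "g \<in> borel_measurable M" unfolding g_def by measurable
  have gb: "\<bar>g z\<bar> \<le> 12 * \<epsilon> + 22 * q" for z
  proof -
    have "g z = (bphi p m (c\<^sub>1 z) - hinge p (c\<^sub>1 z)) * bphi p m (c\<^sub>2 z) + hinge p (c\<^sub>1 z) * (bphi p m (c\<^sub>2 z) - hinge p (c\<^sub>2 z))"
      unfolding g_def by (simp add: algebra_simps)
    also have "\<bar>\<dots>\<bar> \<le> (6 * \<epsilon> + 11 * q) * 1 + 1 * (6 * \<epsilon> + 11 * q)"
    proof (intro order_trans[OF abs_triangle_ineq] add_mono)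
      show "\<bar>(bphi p m (c\<^sub>1 z) - hinge p (c\<^sub>1 z)) * bphi p m (c\<^sub>2 z)\<bar> \<le> (6 * \<epsilon> + 11 * q) * 1"
        unfolding abs_mult using bphi_hinge[OF p acc m e rangeE(3)[of z]] bphi_bounds[OF p] e q
        by (intro mult_mono) (auto simp: q(3))
      show "\<bar>hinge p (c\<^sub>1 z) * (bphi p m (c\<^sub>2 z) - hinge p (c\<^sub>2 z))\<bar> \<le> 1 * (6 * \<epsilon> + 11 * q)"
        unfolding abs_mult using bphi_hinge[OF p acc m e rangeE(4)[of z]] hinge_c[of z] e q
        by (intro mult_mono) (auto simp: q(3))
    qed
    finally show ?thesis by simp
  qed
  have gi: "integrable M g" "integrable M (\<lambda>z. (g z)\<^sup>2)"
  proof -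
    show "integrable M g" using gb by (intro integrable_const_bound[of _ "12 * \<epsilon> + 22 * q"]) auto
    have "\<bar>(g z)\<^sup>2\<bar> \<le> (12 * \<epsilon> + 22 * q)\<^sup>2" for z
      using power_mono[OF gb[of z] abs_ge_zero, of 2] by simp
    then show "integrable M (\<lambda>z. (g z)\<^sup>2)"
      by (intro integrable_const_bound[of _ "(12 * \<epsilon> + 22 * q)\<^sup>2"]) auto
  qed
  have bi: "integrable M (\<lambda>z. bphi p m (c\<^sub>1 z) * bphi p m (c\<^sub>2 z))" "integrable M (\<lambda>z. hinge p (c\<^sub>1 z) * hinge p (c\<^sub>2 z))"
  proof -
    have "\<bar>bphi p m (c\<^sub>1 z) * bphi p m (c\<^sub>2 z)\<bar> \<le> 1" "\<bar>hinge p (c\<^sub>1 z) * hinge p (c\<^sub>2 z)\<bar> \<le> 1" for z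
      using bphi_bounds[OF p] hinge_prod_bounds[of z] by (auto simp: abs_mult intro!: mult_le_one simp del: abs_mult_self_eq)
    then show "integrable M (\<lambda>z. bphi p m (c\<^sub>1 z) * bphi p m (c\<^sub>2 z))" "integrable M (\<lambda>z. hinge p (c\<^sub>1 z) * hinge p (c\<^sub>2 z))"
      by (auto intro!: integrable_const_bound[of _ 1] AE_I2)
  qed
  have f_eq: "f z = g z - (\<integral>z. g z \<partial>M)" for z
    unfolding f_def g_def smooth_mean_def kernel_mean_def using bi by simp
  have f0: "(\<integral>z. f z \<partial>M) = 0" unfolding f_eq using gi by (simp add: prob_space)
  have f2: "(\<integral>z. (f z)\<^sup>2 \<partial>M) \<le> (12 * \<epsilon> + 22 * q)\<^sup>2"
  proof -
    have "(\<integral>z. (f z)\<^sup>2 \<partial>M) = (\<integral>z. (g z)\<^sup>2 \<partial>M) - (\<integral>z. g z \<partial>M)\<^sup>2"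
      unfolding f_eq using variance_eq[OF gi] by simp
    also have "\<dots> \<le> (\<integral>z. (g z)\<^sup>2 \<partial>M)" by simp
    also have "\<dots> \<le> (\<integral>z. (12 * \<epsilon> + 22 * q)\<^sup>2 \<partial>M)"
    proof (intro integral_mono gi(2) integrable_const)
      show "(g z)\<^sup>2 \<le> (12 * \<epsilon> + 22 * q)\<^sup>2" for z
        using power_mono[OF gb[of z] abs_ge_zero, of 2] by simp
    qed
    finally show ?thesis by (simp add: prob_space)
  qed
  have R_meas: "R1 \<in> borel_measurable (sample_law n)" "R2 \<in> borel_measurable (sample_law n)"
      "R3 \<in> borel_measurable (sample_law n)" "R4 \<in> borel_measurable (sample_law n)"
    unfolding R1_def R2_def R3_def R4_def
    by (intro borel_measurable_divide borel_measurable_sum borel_measurable_diff borel_measurable_times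
        borel_measurable_const sample_meas xm measurable_compose[OF sample_component_measurable fm]; simp)+
  have sum_bd: "\<bar>(\<Sum>i<n. h i) / r\<bar> \<le> real n * C / r" if "\<And>i. \<bar>h i\<bar> \<le> C" for h C
    unfolding abs_divide using that r sum_bounded_above[of "{..<n}" "\<lambda>i. \<bar>h i\<bar>" C]
    by (auto intro!: divide_right_mono order_trans[OF sum_abs])
  have wx: "\<bar>wt\<^sub>1 (\<omega> i) * x i \<omega>\<bar> \<le> 1" "\<bar>wt\<^sub>2 (\<omega> i) * y i \<omega>\<bar> \<le> 1" for i \<omega>
    using wt_bounds[of "\<omega> i"] xb[of i \<omega>] by (auto simp: abs_mult intro!: mult_le_one)
  have bnd: "\<exists>C. \<forall>\<omega>. \<bar>R1 \<omega>\<bar> \<le> C" "\<exists>C. \<forall>\<omega>. \<bar>R2 \<omega>\<bar> \<le> C" "\<exists>C. \<forall>\<omega>. \<bar>R3 \<omega>\<bar> \<le> C" "\<exists>C. \<forall>\<omega>. \<bar>R4 \<omega>\<bar> \<le> C"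
  proof -
    have prod1: "\<bar>u * v\<bar> \<le> 1" if "0 \<le> u" "u \<le> 1" "0 \<le> v" "v \<le> 1" for u v :: real
      using that by (auto simp: abs_mult intro!: mult_le_one)
    have R4b: "\<bar>R i \<omega>\<bar> \<le> 4" for i \<omega>
      unfolding R_def using wx[of \<omega> i] prod1[OF bphi_bounds[OF p] bphi_bounds[OF p], of m "own_ecdf n c\<^sub>1 \<omega> i" m "own_ecdf n c\<^sub>2 \<omega> i"]
        prod1[OF bphi_bounds[OF p] bphi_bounds[OF p], of m "c\<^sub>1 (\<omega> i)" m "c\<^sub>2 (\<omega> i)"] by linarith
    show "\<exists>C. \<forall>\<omega>. \<bar>R1 \<omega>\<bar> \<le> C"
      unfolding R1_def by (rule exI[of _ "real n * 4 / r"]) (intro allI sum_bd R4b)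
    have R2b: "\<bar>wt\<^sub>1 (\<omega> i) * x i \<omega> - c1.proj wt\<^sub>1 (c\<^sub>1 (\<omega> i))\<bar> \<le> 2" "\<bar>wt\<^sub>2 (\<omega> i) * y i \<omega> - c2.proj wt\<^sub>2 (c\<^sub>2 (\<omega> i))\<bar> \<le> 2" for i \<omega>
      using wx[of \<omega> i] c1.proj_bound[of wt\<^sub>1 "c\<^sub>1 (\<omega> i)", OF wt_measurable(1) wt_bounds(1)]
        c2.proj_bound[of wt\<^sub>2 "c\<^sub>2 (\<omega> i)", OF wt_measurable(2) wt_bounds(2)] by linarith+
    show "\<exists>C. \<forall>\<omega>. \<bar>R2 \<omega>\<bar> \<le> C" "\<exists>C. \<forall>\<omega>. \<bar>R3 \<omega>\<bar> \<le> C"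
      unfolding R2_def R3_def sum_subtractf[symmetric] by (rule exI[of _ "real n * 2 / r"], intro allI sum_bd R2b)+
    show "\<exists>C. \<forall>\<omega>. \<bar>R4 \<omega>\<bar> \<le> C" unfolding R4_def by (rule exI[of _ "real n * 2 / r"]) (intro allI sum_bd fb)
  qed
  have int_bd: "integrable (sample_law n) h \<and> integrable (sample_law n) (\<lambda>\<omega>. (h \<omega>)\<^sup>2)"
    if hm: "h \<in> borel_measurable (sample_law n)" and hb: "\<exists>C. \<forall>\<omega>. \<bar>h \<omega>\<bar> \<le> C" for h :: "(nat \<Rightarrow> 'a) \<Rightarrow> real"
  proof -
    obtain C where C: "\<And>\<omega>. \<bar>h \<omega>\<bar> \<le> C" using hb by auto
    have "\<bar>(h \<omega>)\<^sup>2\<bar> \<le> C\<^sup>2" for \<omega> using C[of \<omega>] by (simp add: abs_le_square_iff[symmetric])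
    then have "integrable (sample_law n) (\<lambda>\<omega>. (h \<omega>)\<^sup>2)"
      using hm by (intro integrable_sample_bounded[of _ _ "C\<^sup>2"]) auto
    moreover have "integrable (sample_law n) h" using hm C by (intro integrable_sample_bounded[of _ _ C])
    ultimately show ?thesis by blast
  qed
  have R1_int: "integrable (sample_law n) R1" "integrable (sample_law n) (\<lambda>\<omega>. (R1 \<omega>)\<^sup>2)"
    and R2_int: "integrable (sample_law n) R2" "integrable (sample_law n) (\<lambda>\<omega>. (R2 \<omega>)\<^sup>2)"
    and R3_int: "integrable (sample_law n) R3" "integrable (sample_law n) (\<lambda>\<omega>. (R3 \<omega>)\<^sup>2)"
    and R4_int: "integrable (sample_law n) R4" "integrable (sample_law n) (\<lambda>\<omega>. (R4 \<omega>)\<^sup>2)"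
    using int_bd R_meas bnd by blast+
  \<comment> \<open>Centring first matters: the normalised sum is bounded by the root mean square of
    \<open>f\<close>, without a factor \<open>sqrt n\<close>.\<close>
  have R4: "(\<integral>\<omega>. \<bar>R4 \<omega>\<bar> \<partial>sample_law n) \<le> 12 * \<epsilon> + 22 * q"
  proof -
    have "(\<integral>\<omega>. (R4 \<omega>)\<^sup>2 \<partial>sample_law n) = (\<integral>z. (f z)\<^sup>2 \<partial>M)"
      unfolding R4_def power_divide using r n integral_sample_sum_square[OF fm fb f0, of n] by (simp add: power2_eq_square)
    then show ?thesis
      using f2 e q R4_int by (intro P.expectation_abs_le_of_square) (auto intro: add_pos_nonneg)
  qed
  have R2: "(\<integral>\<omega>. \<bar>R2 \<omega>\<bar> \<partial>sample_law n) \<le> 4 / r"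
  proof (rule P.expectation_abs_le_of_square)
    have "(\<integral>\<omega>. (R2 \<omega>)\<^sup>2 \<partial>sample_law n) \<le> 12 / r\<^sup>2"
      unfolding R2_def power_divide x_def
      using c1.projection_error(1)[of wt\<^sub>1 n, OF wt_measurable(1) wt_bounds(1)] n by (simp add: divide_right_mono)
    also have "\<dots> \<le> (4 / r)\<^sup>2" unfolding power_divide by (intro divide_right_mono) auto
    finally show "(\<integral>\<omega>. (R2 \<omega>)\<^sup>2 \<partial>sample_law n) \<le> (4 / r)\<^sup>2" .
  qed (use r R2_int in auto)
  have R3: "(\<integral>\<omega>. \<bar>R3 \<omega>\<bar> \<partial>sample_law n) \<le> 4 / r"
  proof (rule P.expectation_abs_le_of_square)
    have "(\<integral>\<omega>. (R3 \<omega>)\<^sup>2 \<partial>sample_law n) \<le> 12 / r\<^sup>2"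
      unfolding R3_def power_divide y_def
      using c2.projection_error(1)[of wt\<^sub>2 n, OF wt_measurable(2) wt_bounds(2)] n by (simp add: divide_right_mono)
    also have "\<dots> \<le> (4 / r)\<^sup>2" unfolding power_divide by (intro divide_right_mono) auto
    finally show "(\<integral>\<omega>. (R3 \<omega>)\<^sup>2 \<partial>sample_law n) \<le> (4 / r)\<^sup>2" .
  qed (use r R3_int in auto)
  have R1: "(\<integral>\<omega>. \<bar>R1 \<omega>\<bar> \<partial>sample_law n) \<le> 38 * s + 40 * q * r + 4 / (\<epsilon> * r)"
  proof -
    have "(\<integral>\<omega>. \<bar>R1 \<omega>\<bar> \<partial>sample_law n) \<le> (\<integral>\<omega>. (\<Sum>i<n. b i \<omega>) / r \<partial>sample_law n)"
    proof (rule integral_mono)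
      show "integrable (sample_law n) (\<lambda>\<omega>. \<bar>R1 \<omega>\<bar>)" using R1_int by simp
      show "integrable (sample_law n) (\<lambda>\<omega>. (\<Sum>i<n. b i \<omega>) / r)"
        using Eb(1) by (intro integrable_divide_zero Bochner_Integration.integrable_sum) auto
      show "\<bar>R1 \<omega>\<bar> \<le> (\<Sum>i<n. b i \<omega>) / r" for \<omega>
        unfolding R1_def abs_divide using r Rb by (auto intro!: divide_right_mono order_trans[OF sum_abs] sum_mono)
    qed
    also have "\<dots> = (\<Sum>i<n. (\<integral>\<omega>. b i \<omega> \<partial>sample_law n)) / r"
      using Eb(1) by (simp add: Bochner_Integration.integral_sum)
    also have "\<dots> \<le> (\<Sum>i<n. (K + 1) * (2 / real n) + 16 * \<epsilon> / (s * r) + 8 * s / r + 28 * q) / r"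
      using r Eb(2) by (intro divide_right_mono sum_mono) auto
    \<comment> \<open>\<open>n\<close> equal terms divided by \<open>sqrt n\<close> give a factor
      \<open>r\<close>, which turns \<open>1 / r\<close> into a constant and \<open>1 / m\<close>
      into \<open>sqrt n / m\<close>.\<close>
    also have "\<dots> = r * ((K + 1) * (2 / (r * r)) + 16 * \<epsilon> / (s * r) + 8 * s / r + 28 * q)"
      using r by (simp add: r(2)[symmetric])
    also have "\<dots> = 2 * (K + 1) / r + 16 * (\<epsilon> / s) + 8 * s + 28 * q * r"
      using r(3) s(1) by (simp add: field_simps)
    also have "\<epsilon> / s = s" using s by (simp add: field_simps)
    also have "2 * (K + 1) / r = 14 * s + 12 * q + (2 / (\<epsilon> * r) + 2 / r)"
      unfolding K_def using r e by (simp add: field_simps)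
    also have "2 / r \<le> 2 / (\<epsilon> * r)" using r e by (intro divide_left_mono) (auto simp: mult_le_cancel_right1)
    also have "12 * q \<le> 12 * (q * r)" using q r by (simp add: mult_le_cancel_left1)
    finally show ?thesis by (simp add: algebra_simps)
  qed
  have "(\<integral>\<omega>. \<bar>R1 \<omega> - R2 \<omega> - R3 \<omega> + R4 \<omega>\<bar> \<partial>sample_law n)
    \<le> (\<integral>\<omega>. \<bar>R1 \<omega>\<bar> + \<bar>R2 \<omega>\<bar> + \<bar>R3 \<omega>\<bar> + \<bar>R4 \<omega>\<bar> \<partial>sample_law n)"
    using R1_int R2_int R3_int R4_int by (intro integral_mono) auto
  also have "\<dots> = (\<integral>\<omega>. \<bar>R1 \<omega>\<bar> \<partial>sample_law n) + (\<integral>\<omega>. \<bar>R2 \<omega>\<bar> \<partial>sample_law n) + (\<integral>\<omega>. \<bar>R3 \<omega>\<bar> \<partial>sample_law n) + (\<integral>\<omega>. \<bar>R4 \<omega>\<bar> \<partial>sample_law n)"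
    using R1_int R2_int R3_int R4_int by simp
  also have "\<dots> \<le> (38 * s + 40 * q * r + 4 / (\<epsilon> * r)) + 4 / r + 4 / r + (12 * \<epsilon> + 22 * q)"
    using R1 R2 R3 R4 by linarith
  also have "\<dots> \<le> 50 * s + 12 / (\<epsilon> * r) + 64 * (r * q)"
  proof -
    have "4 / r \<le> 4 / (\<epsilon> * r)" using r e by (intro divide_left_mono) (auto simp: mult_le_cancel_right1)
    moreover have "4 / (\<epsilon> * r) + 4 / (\<epsilon> * r) + 4 / (\<epsilon> * r) = 12 / (\<epsilon> * r)" by (simp add: add_divide_distrib[symmetric])
    moreover have "22 * q \<le> 22 * (r * q)" using q r by (simp add: mult_le_cancel_right1)
    moreover have "0 \<le> r * q" using r q by simp
    moreover have "40 * q * r = 40 * (r * q)" by simp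
    ultimately show ?thesis using s by linarith
  qed
  finally show ?thesis unfolding decomp r_def s_def q_def by simp
qed

end

section \<open>A uniform central limit theorem\<close>

lemma cmod_iexp_diff: "cmod (iexp a - iexp b) \<le> \<bar>a - b\<bar>"
proof -
  have "iexp a - iexp b = iexp b * (iexp (a - b) - 1)"
    by (simp add: algebra_simps exp_add[symmetric])
  also have "cmod \<dots> = cmod (iexp (a - b) - 1)" by (simp add: norm_mult)
  also have "\<dots> \<le> \<bar>a - b\<bar>" using iexp_approx1[of "a - b" 0] by simp
  finally show ?thesis .
qed

lemma (in prob_space) char_sample_mean:
  fixes f :: "'a \<Rightarrow> real"
  assumes [measurable]: "f \<in> borel_measurable M"
  shows "char (distr (sample_law n) borel (\<lambda>\<omega>. (\<Sum>i<n. f (\<omega> i)) / a)) s = char (distr M borel f) (s / a) ^ n"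
proof -
  interpret product_sigma_finite "\<lambda>_::nat. M"
    by (intro product_sigma_finite.intro sigma_finite_measure_axioms)
  have S[measurable]: "(\<lambda>\<omega>. (\<Sum>i<n. f (\<omega> i)) / a) \<in> borel_measurable (sample_law n)"
    by (intro borel_measurable_divide borel_measurable_sum measurable_compose[OF sample_component_measurable assms]) auto
  have "char (distr (sample_law n) borel (\<lambda>\<omega>. (\<Sum>i<n. f (\<omega> i)) / a)) s
      = (\<integral>\<omega>. iexp (s * ((\<Sum>i<n. f (\<omega> i)) / a)) \<partial>sample_law n)"
    unfolding char_def by (subst integral_distr) auto
  also have "\<dots> = (\<integral>\<omega>. (\<Prod>i\<in>{..<n}. iexp (s / a * f (\<omega> i))) \<partial>sample_law n)"
  proof (rule Bochner_Integration.integral_cong[OF refl])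
    fix \<omega> :: "nat \<Rightarrow> 'a"
    have "\<i> * complex_of_real (s * ((\<Sum>i<n. f (\<omega> i)) / a)) = (\<Sum>i<n. \<i> * complex_of_real (s / a * f (\<omega> i)))"
      by (simp add: sum_distrib_left sum_divide_distrib algebra_simps)
    then show "iexp (s * ((\<Sum>i<n. f (\<omega> i)) / a)) = (\<Prod>i\<in>{..<n}. iexp (s / a * f (\<omega> i)))"
      by (simp only: exp_sum finite_lessThan)
  qed
  also have "\<dots> = (\<Prod>i\<in>{..<n}. (\<integral>x. iexp (s / a * f x) \<partial>M))"
  proof (rule product_integral_prod)
    have m: "(\<lambda>x. iexp (s / a * f x)) \<in> borel_measurable M" by measurable
    then show "integrable M (\<lambda>x. iexp (s / a * f x))"
      by (intro integrable_const_bound[of _ 1]) auto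
  qed simp
  also have "\<dots> = char (distr M borel f) (s / a) ^ n"
    unfolding char_def by (subst integral_distr) auto
  finally show ?thesis .
qed

text \<open>For \<open>\<sigma> > 0\<close>, the distribution function of the modulus of a centred
  normal variable with standard deviation \<open>\<sigma>\<close>; for negative \<open>t\<close> the
  interval is empty and the value zero.\<close>

definition normal_abs_cdf :: "real \<Rightarrow> real \<Rightarrow> real" where
  "normal_abs_cdf \<sigma> t = measure std_normal_distribution {- (t / \<sigma>)..t / \<sigma>}"

lemma std_normal_finite: "finite A \<Longrightarrow> emeasure std_normal_distribution A = 0"
proof -
  assume "finite A"
  then have "A \<in> null_sets lborel" by (rule finite_imp_null_set_lborel)
  then have "A \<in> null_sets std_normal_distribution"
    using AE_not_in[of A lborel] by (subst null_sets_density_iff) (auto simp: null_sets_def)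
  then show ?thesis by auto
qed

text \<open>The sampled law changes from row to row. Bounded summands give a third-moment estimate
  for the characteristic function of the row sums, a remainder moves it by at most
  \<open>\<bar>s / \<sigma>\<bar>\<close> times its mean modulus, and Levy's continuity theorem
  concludes.\<close>

lemma triangular_clt:
  fixes Q :: "nat \<Rightarrow> 'a measure" and f :: "nat \<Rightarrow> 'a \<Rightarrow> real" and Z :: "nat \<Rightarrow> (nat \<Rightarrow> 'a) \<Rightarrow> real"
  assumes N: "filterlim N at_top sequentially" and N1: "\<And>k. 1 \<le> N k"
    and Q: "\<And>k. prob_space (Q k)" and f: "\<And>k. f k \<in> borel_measurable (Q k)"
    and B: "\<And>k x. \<bar>f k x\<bar> \<le> B" and mean: "\<And>k. (\<integral>x. f k x \<partial>Q k) = 0"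
    and var: "(\<lambda>k. (\<integral>x. (f k x)\<^sup>2 \<partial>Q k)) \<longlonglongrightarrow> \<sigma>\<^sup>2" and \<sigma>: "0 < \<sigma>"
    and Z: "\<And>k. Z k \<in> borel_measurable (Pi\<^sub>M {..<N k} (\<lambda>_. Q k))"
    and ZI: "\<And>k. integrable (Pi\<^sub>M {..<N k} (\<lambda>_. Q k)) (\<lambda>\<omega>. \<bar>Z k \<omega> - (\<Sum>i<N k. f k (\<omega> i)) / sqrt (real (N k))\<bar>)"
    and ZL: "(\<lambda>k. (\<integral>\<omega>. \<bar>Z k \<omega> - (\<Sum>i<N k. f k (\<omega> i)) / sqrt (real (N k))\<bar> \<partial>Pi\<^sub>M {..<N k} (\<lambda>_. Q k))) \<longlonglongrightarrow> 0"
  shows "(\<lambda>k. measure (Pi\<^sub>M {..<N k} (\<lambda>_. Q k)) {\<omega> \<in> space (Pi\<^sub>M {..<N k} (\<lambda>_. Q k)). \<bar>Z k \<omega>\<bar> \<le> t})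
    \<longlonglongrightarrow> normal_abs_cdf \<sigma> t"
proof -
  define P where "P k = Pi\<^sub>M {..<N k} (\<lambda>_. Q k)" for k
  define S where "S k \<omega> = (\<Sum>i<N k. f k (\<omega> i)) / sqrt (real (N k))" for k and \<omega> :: "nat \<Rightarrow> 'a"
  define D where "D k = distr (P k) borel (\<lambda>\<omega>. Z k \<omega> / \<sigma>)" for k
  note Z = Z[folded P_def] and ZI = ZI[folded P_def S_def] and ZL = ZL[folded P_def S_def]
  have PP: "prob_space (P k)" for k unfolding P_def by (intro prob_space_PiM Q)
  have Sm: "S k \<in> borel_measurable (P k)" for k
    unfolding S_def P_def
    by (intro borel_measurable_divide borel_measurable_sum measurable_compose[OF prob_space.sample_component_measurable[OF Q] f]) auto
  have rd: "real_distribution (D k)" for k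
  proof -
    interpret prob_space "P k" by (rule PP)
    note [measurable] = Z[of k]
    show ?thesis unfolding D_def by (intro real_distribution_distr) measurable
  qed
  have conv: "(\<lambda>k. char (D k) s) \<longlonglongrightarrow> char std_normal_distribution s" for s
  proof -
    define x where "x = - s\<^sup>2 / 2"
    define v where "v k = (\<integral>x. (f k x)\<^sup>2 \<partial>Q k)" for k
    define r where "r k = sqrt (real (N k))" for k
    have r: "0 < r k" "r k * r k = real (N k)" for k using N1[of k] by (auto simp: r_def)
    have B0: "0 \<le> B" using B[of 0 undefined] by linarith
    have rlim: "filterlim r at_top sequentially"
      unfolding r_def by (intro filterlim_compose[OF sqrt_at_top] filterlim_compose[OF filterlim_real_sequentially] N)
    define u where "u k = s / (\<sigma> * r k)" for k
    have cz: "cmod (char (D k) s - char (distr (P k) borel (\<lambda>\<omega>. S k \<omega> / \<sigma>)) s)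
        \<le> \<bar>s / \<sigma>\<bar> * (\<integral>\<omega>. \<bar>Z k \<omega> - S k \<omega>\<bar> \<partial>P k)" for k
    proof -
      interpret prob_space "P k" by (rule PP)
      note [measurable] = Z[of k] Sm[of k]
      have m: "(\<lambda>\<omega>. iexp (s * (Z k \<omega> / \<sigma>))) \<in> borel_measurable (P k)" "(\<lambda>\<omega>. iexp (s * (S k \<omega> / \<sigma>))) \<in> borel_measurable (P k)"
        by measurable
      have i: "integrable (P k) (\<lambda>\<omega>. iexp (s * (Z k \<omega> / \<sigma>)))" "integrable (P k) (\<lambda>\<omega>. iexp (s * (S k \<omega> / \<sigma>)))"
        using m by (auto intro!: integrable_const_bound[of _ 1])
      have "char (D k) s - char (distr (P k) borel (\<lambda>\<omega>. S k \<omega> / \<sigma>)) s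
        = (\<integral>\<omega>. iexp (s * (Z k \<omega> / \<sigma>)) - iexp (s * (S k \<omega> / \<sigma>)) \<partial>P k)"
        unfolding char_def D_def using i by (simp add: integral_distr)
      also have "cmod \<dots> \<le> (\<integral>\<omega>. cmod (iexp (s * (Z k \<omega> / \<sigma>)) - iexp (s * (S k \<omega> / \<sigma>))) \<partial>P k)"
        by (rule integral_norm_bound)
      also have "\<dots> \<le> (\<integral>\<omega>. \<bar>s / \<sigma>\<bar> * \<bar>Z k \<omega> - S k \<omega>\<bar> \<partial>P k)"
      proof (intro integral_mono integrable_norm Bochner_Integration.integrable_diff i integrable_mult_right ZI)
        fix \<omega>
        have "\<bar>s * (Z k \<omega> / \<sigma>) - s * (S k \<omega> / \<sigma>)\<bar> = \<bar>s / \<sigma>\<bar> * \<bar>Z k \<omega> - S k \<omega>\<bar>"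
        proof -
          have "s * (Z k \<omega> / \<sigma>) - s * (S k \<omega> / \<sigma>) = s / \<sigma> * (Z k \<omega> - S k \<omega>)"
            by (simp add: right_diff_distrib)
          then show ?thesis unfolding abs_mult[symmetric] by (rule arg_cong)
        qed
        then show "cmod (iexp (s * (Z k \<omega> / \<sigma>)) - iexp (s * (S k \<omega> / \<sigma>))) \<le> \<bar>s / \<sigma>\<bar> * \<bar>Z k \<omega> - S k \<omega>\<bar>"
          using cmod_iexp_diff[of "s * (Z k \<omega> / \<sigma>)" "s * (S k \<omega> / \<sigma>)"] by simp
      qed
      finally show ?thesis by simp
    qed
    have cs: "cmod (char (distr (P k) borel (\<lambda>\<omega>. S k \<omega> / \<sigma>)) s - (1 + complex_of_real x / of_nat (N k)) ^ N k)
       \<le> \<bar>s\<bar> ^ 3 * B ^ 3 / (6 * \<sigma> ^ 3 * r k) + s\<^sup>2 / (2 * \<sigma>\<^sup>2) * \<bar>v k - \<sigma>\<^sup>2\<bar>" if big: "s\<^sup>2 \<le> real (N k)" for k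
    proof -
      interpret prob_space "Q k" by (rule Q)
      note [measurable] = f[of k]
      interpret rd: real_distribution "distr (Q k) borel (f k)" by (intro real_distribution_distr) measurable
      have fi: "integrable (Q k) (f k)" "integrable (Q k) (\<lambda>x. (f k x)\<^sup>2)"
      proof -
        show "integrable (Q k) (f k)" using B by (intro integrable_const_bound[of _ B]) auto
        have "\<bar>(f k x)\<^sup>2\<bar> \<le> B\<^sup>2" for x using power_mono[OF B[of k x] abs_ge_zero, of 2] by simp
        then show "integrable (Q k) (\<lambda>x. (f k x)\<^sup>2)" by (intro integrable_const_bound[of _ "B\<^sup>2"]) auto
      qed
      have "cmod (char (distr (Q k) borel (f k)) (u k) - (1 - (u k)\<^sup>2 * v k / 2)) \<le>
        ((u k)\<^sup>2 / 6) * expectation (\<lambda>x. min (6 * (f k x)\<^sup>2) (\<bar>u k\<bar> * \<bar>f k x\<bar>^3))"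
        using fi mean by (intro char_approx3') (auto simp: v_def)
      also have "\<dots> \<le> ((u k)\<^sup>2 / 6) * expectation (\<lambda>x. \<bar>u k\<bar> * B ^ 3)"
      proof (intro mult_left_mono integral_mono integrable_const)
        show mm: "min (6 * (f k x)\<^sup>2) (\<bar>u k\<bar> * \<bar>f k x\<bar>^3) \<le> \<bar>u k\<bar> * B ^ 3" for x
          using B[of k x] by (intro min.coboundedI2 mult_left_mono power_mono) auto
        show "integrable (Q k) (\<lambda>x. min (6 * (f k x)\<^sup>2) (\<bar>u k\<bar> * \<bar>f k x\<bar>^3))"
          using mm B0 by (intro integrable_const_bound[of _ "\<bar>u k\<bar> * B ^ 3"]) auto
      qed auto
      also have "\<dots> = \<bar>u k\<bar> ^ 3 * B ^ 3 / 6"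
      proof -
        have "(u k)\<^sup>2 * \<bar>u k\<bar> = \<bar>u k\<bar> ^ 3" by (simp add: power2_eq_square power3_eq_cube)
        then have "(u k)\<^sup>2 / 6 * (\<bar>u k\<bar> * B ^ 3) = \<bar>u k\<bar> ^ 3 * B ^ 3 / 6" by (metis mult.assoc times_divide_eq_left)
        then show ?thesis by (simp only: lebesgue_integral_const prob_space scaleR_one)
      qed
      finally have 1: "cmod (char (distr (Q k) borel (f k)) (u k) - (1 - (u k)\<^sup>2 * v k / 2)) \<le> \<bar>u k\<bar> ^ 3 * B ^ 3 / 6" .
      have "(1 - (u k)\<^sup>2 * v k / 2) - (1 + x / real (N k)) = - (s\<^sup>2 / (2 * \<sigma>\<^sup>2) * (v k - \<sigma>\<^sup>2)) / real (N k)"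
        unfolding u_def x_def power_divide power_mult_distrib using r[of k] \<sigma> by (simp add: power2_eq_square r(2)[symmetric] field_simps)
      then have 2: "\<bar>(1 - (u k)\<^sup>2 * v k / 2) - (1 + x / real (N k))\<bar> = s\<^sup>2 / (2 * \<sigma>\<^sup>2) * \<bar>v k - \<sigma>\<^sup>2\<bar> / real (N k)"
        by (simp add: abs_mult abs_divide)
      have 3: "cmod (char (distr (Q k) borel (f k)) (u k) - (1 + complex_of_real x / of_nat (N k)))
        \<le> \<bar>u k\<bar> ^ 3 * B ^ 3 / 6 + s\<^sup>2 / (2 * \<sigma>\<^sup>2) * \<bar>v k - \<sigma>\<^sup>2\<bar> / real (N k)"
      proof -
        have "char (distr (Q k) borel (f k)) (u k) - (1 + complex_of_real x / of_nat (N k))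
          = (char (distr (Q k) borel (f k)) (u k) - (1 - (u k)\<^sup>2 * v k / 2)) + complex_of_real ((1 - (u k)\<^sup>2 * v k / 2) - (1 + x / real (N k)))"
          by simp
        also have "cmod \<dots> \<le> \<bar>u k\<bar> ^ 3 * B ^ 3 / 6 + s\<^sup>2 / (2 * \<sigma>\<^sup>2) * \<bar>v k - \<sigma>\<^sup>2\<bar> / real (N k)"
          using 1 2 by (intro order_trans[OF norm_triangle_ineq] add_mono) (auto simp only: norm_of_real)
        finally show ?thesis .
      qed
      \<comment> \<open>Comparing \<open>N\<close>-th powers costs only a factor \<open>N\<close>
        when both bases lie in the unit disc; for this base \<open>s\<^sup>2 \<le> N\<close> is
        enough.\<close>
      have n1: "cmod (1 + complex_of_real x / of_nat (N k)) \<le> 1"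
      proof -
        have "\<bar>1 + x / real (N k)\<bar> \<le> 1" unfolding x_def using big N1[of k] by (auto simp: abs_le_iff field_simps)
        moreover have "1 + complex_of_real x / of_nat (N k) = complex_of_real (1 + x / real (N k))" by simp
        ultimately show ?thesis by (metis norm_of_real)
      qed
      have "char (distr (P k) borel (\<lambda>\<omega>. S k \<omega> / \<sigma>)) s = char (distr (Q k) borel (f k)) (u k) ^ N k"
        unfolding P_def S_def u_def r_def using char_sample_mean[of "f k" "N k" "sqrt (real (N k)) * \<sigma>" s]
        by (simp add: mult.commute)
      then have "cmod (char (distr (P k) borel (\<lambda>\<omega>. S k \<omega> / \<sigma>)) s - (1 + complex_of_real x / of_nat (N k)) ^ N k)
        \<le> real (N k) * cmod (char (distr (Q k) borel (f k)) (u k) - (1 + complex_of_real x / of_nat (N k)))"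
        using n1 rd.cmod_char_le_1 by (simp add: norm_power_diff)
      also have "\<dots> \<le> real (N k) * (\<bar>u k\<bar> ^ 3 * B ^ 3 / 6 + s\<^sup>2 / (2 * \<sigma>\<^sup>2) * \<bar>v k - \<sigma>\<^sup>2\<bar> / real (N k))"
        by (intro mult_left_mono 3) auto
      also have "\<dots> = \<bar>s\<bar> ^ 3 * B ^ 3 / (6 * \<sigma> ^ 3 * r k) + s\<^sup>2 / (2 * \<sigma>\<^sup>2) * \<bar>v k - \<sigma>\<^sup>2\<bar>"
        unfolding distrib_left
      proof (rule arg_cong2[where f="(+)"])
        show "real (N k) * (\<bar>u k\<bar> ^ 3 * B ^ 3 / 6) = \<bar>s\<bar> ^ 3 * B ^ 3 / (6 * \<sigma> ^ 3 * r k)"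
          unfolding u_def abs_divide abs_mult power_divide power_mult_distrib using r[of k] \<sigma>
          by (simp add: r(2)[symmetric] power3_eq_cube field_simps)
      qed (use N1[of k] in simp)
      finally show ?thesis .
    qed
    have l1: "(\<lambda>k. \<bar>s / \<sigma>\<bar> * (\<integral>\<omega>. \<bar>Z k \<omega> - S k \<omega>\<bar> \<partial>P k) + (\<bar>s\<bar> ^ 3 * B ^ 3 / (6 * \<sigma> ^ 3 * r k) + s\<^sup>2 / (2 * \<sigma>\<^sup>2) * \<bar>v k - \<sigma>\<^sup>2\<bar>)) \<longlonglongrightarrow> 0"
    proof -
      have "(\<lambda>k. v k - \<sigma>\<^sup>2) \<longlonglongrightarrow> 0" using var unfolding v_def by (simp add: LIM_zero)
      then have a: "(\<lambda>k. s\<^sup>2 / (2 * \<sigma>\<^sup>2) * \<bar>v k - \<sigma>\<^sup>2\<bar>) \<longlonglongrightarrow> 0"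
        by (intro tendsto_mult_right_zero tendsto_rabs_zero)
      have "filterlim (\<lambda>k. 6 * \<sigma> ^ 3 * r k) at_top sequentially"
        using \<sigma> by (intro filterlim_tendsto_pos_mult_at_top[OF tendsto_const _ rlim]) auto
      then have b: "(\<lambda>k. \<bar>s\<bar> ^ 3 * B ^ 3 / (6 * \<sigma> ^ 3 * r k)) \<longlonglongrightarrow> 0"
        by (intro tendsto_divide_0[OF tendsto_const] filterlim_at_top_imp_at_infinity)
      have c: "(\<lambda>k. \<bar>s / \<sigma>\<bar> * (\<integral>\<omega>. \<bar>Z k \<omega> - S k \<omega>\<bar> \<partial>P k)) \<longlonglongrightarrow> 0"
        by (intro tendsto_mult_right_zero ZL)
      show ?thesis using tendsto_add[OF c tendsto_add[OF b a]] by simp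
    qed
    have ev: "eventually (\<lambda>k. s\<^sup>2 \<le> real (N k)) sequentially"
      using filterlim_compose[OF filterlim_real_sequentially N] unfolding filterlim_at_top by blast
    have "(\<lambda>k. char (D k) s - (1 + complex_of_real x / of_nat (N k)) ^ N k) \<longlonglongrightarrow> 0"
    proof (rule Lim_null_comparison[OF _ l1])
      show "eventually (\<lambda>k. cmod (char (D k) s - (1 + complex_of_real x / of_nat (N k)) ^ N k) \<le>
        \<bar>s / \<sigma>\<bar> * (\<integral>\<omega>. \<bar>Z k \<omega> - S k \<omega>\<bar> \<partial>P k) + (\<bar>s\<bar> ^ 3 * B ^ 3 / (6 * \<sigma> ^ 3 * r k) + s\<^sup>2 / (2 * \<sigma>\<^sup>2) * \<bar>v k - \<sigma>\<^sup>2\<bar>)) sequentially"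
        using ev
      proof eventually_elim
        case (elim k)
        have "char (D k) s - (1 + complex_of_real x / of_nat (N k)) ^ N k
          = (char (D k) s - char (distr (P k) borel (\<lambda>\<omega>. S k \<omega> / \<sigma>)) s)
           + (char (distr (P k) borel (\<lambda>\<omega>. S k \<omega> / \<sigma>)) s - (1 + complex_of_real x / of_nat (N k)) ^ N k)" by simp
        then show ?case by (simp only:) (rule norm_triangle_le[OF add_mono[OF cz[of k] cs[OF elim]]])
      qed
    qed
    moreover have "(\<lambda>k. (1 + complex_of_real x / of_nat (N k)) ^ N k) \<longlonglongrightarrow> exp (complex_of_real x)"
    proof -
      have "(\<lambda>k. (1 + x / real (N k)) ^ N k) \<longlonglongrightarrow> exp x"
        by (rule filterlim_compose[OF tendsto_exp_limit_sequentially N])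
      then have "(\<lambda>k. complex_of_real ((1 + x / real (N k)) ^ N k)) \<longlonglongrightarrow> complex_of_real (exp x)"
        by (rule tendsto_of_real)
      then show ?thesis by (simp add: exp_of_real)
    qed
    ultimately have "(\<lambda>k. char (D k) s) \<longlonglongrightarrow> exp (complex_of_real x)"
      using tendsto_add by fastforce
    then show ?thesis unfolding char_std_normal_distribution x_def exp_of_real .
  qed
  have w: "weak_conv_m D std_normal_distribution"
    by (rule levy_continuity[OF rd real_dist_normal_dist conv])
  have "(\<lambda>k. measure (D k) {- (t / \<sigma>)..t / \<sigma>}) \<longlonglongrightarrow> measure std_normal_distribution {- (t / \<sigma>)..t / \<sigma>}"
  proof (rule weak_conv_imp_continuity_set_conv[OF rd real_dist_normal_dist w])
    show "emeasure std_normal_distribution (frontier {- (t / \<sigma>)..t / \<sigma>}) = 0"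
    proof (rule std_normal_finite, rule finite_subset)
      show "frontier {- (t / \<sigma>)..t / \<sigma>} \<subseteq> {- (t / \<sigma>), t / \<sigma>}"
        unfolding frontier_def by (auto simp: interior_atLeastAtMost_real)
    qed simp
  qed simp
  moreover have "measure (D k) {- (t / \<sigma>)..t / \<sigma>} = measure (P k) {\<omega> \<in> space (P k). \<bar>Z k \<omega>\<bar> \<le> t}" for k
  proof -
    note [measurable] = Z[of k]
    have "measure (D k) {- (t / \<sigma>)..t / \<sigma>} = measure (P k) ((\<lambda>\<omega>. Z k \<omega> / \<sigma>) -` {- (t / \<sigma>)..t / \<sigma>} \<inter> space (P k))"
      unfolding D_def by (intro measure_distr) auto
    also have "(\<lambda>\<omega>. Z k \<omega> / \<sigma>) -` {- (t / \<sigma>)..t / \<sigma>} \<inter> space (P k) = {\<omega> \<in> space (P k). \<bar>Z k \<omega>\<bar> \<le> t}"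
    proof -
      have "- (t / \<sigma>) \<le> z / \<sigma> \<longleftrightarrow> - t \<le> z" "z / \<sigma> \<le> t / \<sigma> \<longleftrightarrow> z \<le> t" for z
        using \<sigma> by (simp_all add: field_simps)
      then show ?thesis by (auto simp: abs_le_iff)
    qed
    finally show ?thesis .
  qed
  ultimately show ?thesis unfolding normal_abs_cdf_def P_def by simp
qed

text \<open>Uniformity over the sampled law allows the theorem to be applied conditionally on the data.\<close>

lemma uniform_clt:
  assumes \<sigma>: "0 < \<sigma>" and \<epsilon>: "0 < \<epsilon>"
  shows "\<exists>\<delta>>0. \<exists>n0. \<forall>n\<ge>n0. \<forall>(Q :: 'a measure) f Z. prob_space Q \<longrightarrow> f \<in> borel_measurable Q \<longrightarrow> (\<forall>x. \<bar>f x\<bar> \<le> B) \<longrightarrow>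
      (\<integral>x. f x \<partial>Q) = 0 \<longrightarrow> \<bar>(\<integral>x. (f x)\<^sup>2 \<partial>Q) - \<sigma>\<^sup>2\<bar> \<le> \<delta> \<longrightarrow>
      Z \<in> borel_measurable (Pi\<^sub>M {..<n} (\<lambda>_. Q)) \<longrightarrow>
      integrable (Pi\<^sub>M {..<n} (\<lambda>_. Q)) (\<lambda>\<omega>. \<bar>Z \<omega> - (\<Sum>i<n. f (\<omega> i)) / sqrt (real n)\<bar>) \<longrightarrow>
      (\<integral>\<omega>. \<bar>Z \<omega> - (\<Sum>i<n. f (\<omega> i)) / sqrt (real n)\<bar> \<partial>Pi\<^sub>M {..<n} (\<lambda>_. Q)) \<le> \<delta> \<longrightarrow>
      \<bar>measure (Pi\<^sub>M {..<n} (\<lambda>_. Q)) {\<omega> \<in> space (Pi\<^sub>M {..<n} (\<lambda>_. Q)). \<bar>Z \<omega>\<bar> \<le> t} - normal_abs_cdf \<sigma> t\<bar> \<le> \<epsilon>"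
    (is "\<exists>\<delta>>0. \<exists>n0. \<forall>n\<ge>n0. \<forall>Q f Z. ?R \<delta> n Q f Z")
proof (rule ccontr)
  assume neg: "\<not> ?thesis"
  define R :: "real \<Rightarrow> nat \<Rightarrow> 'a measure \<Rightarrow> ('a \<Rightarrow> real) \<Rightarrow> ((nat \<Rightarrow> 'a) \<Rightarrow> real) \<Rightarrow> bool"
    where "R = (\<lambda>\<delta> n Q f Z. ?R \<delta> n Q f Z)"
  have "\<not> (\<exists>\<delta>>0. \<exists>n0. \<forall>n\<ge>n0. \<forall>Q f Z. R \<delta> n Q f Z)" unfolding R_def by (rule neg)
  then have "\<And>\<delta> n0. 0 < \<delta> \<Longrightarrow> \<exists>n\<ge>n0. \<exists>Q f Z. \<not> R \<delta> n Q f Z" by blast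
  \<comment> \<open>Failure along \<open>\<delta> = 1 / (k + 1)\<close> and ever larger sample sizes
    yields a triangular array; size, law, influence function and statistic are packed into one tuple
    for the choice.\<close>
  then have "\<exists>n\<ge>Suc k. \<exists>Q f Z. \<not> R (1 / real (Suc k)) n Q f Z" for k by simp
  then have "\<forall>k. \<exists>w. Suc k \<le> fst w \<and> \<not> R (1 / real (Suc k)) (fst w) (fst (snd w)) (fst (snd (snd w))) (snd (snd (snd w)))"
    by fastforce
  from choice[OF this] obtain w where w: "\<And>k. Suc k \<le> fst (w k) \<and>
      \<not> R (1 / real (Suc k)) (fst (w k)) (fst (snd (w k))) (fst (snd (snd (w k)))) (snd (snd (snd (w k))))"
    by blast
  define N Q f Z where "N k = fst (w k)" and "Q k = fst (snd (w k))" and "f k = fst (snd (snd (w k)))"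
    and "Z k = snd (snd (snd (w k)))" for k
  have NQ0: "Suc k \<le> N k \<and> \<not> ?R (1 / real (Suc k)) (N k) (Q k) (f k) (Z k)" for k
    using w[of k] unfolding R_def N_def Q_def f_def Z_def .
  have NQ: "Suc k \<le> N k" "prob_space (Q k)" "f k \<in> borel_measurable (Q k)" "\<bar>f k x\<bar> \<le> B" "(\<integral>x. f k x \<partial>Q k) = 0"
      "\<bar>(\<integral>x. (f k x)\<^sup>2 \<partial>Q k) - \<sigma>\<^sup>2\<bar> \<le> 1 / real (Suc k)"
      "Z k \<in> borel_measurable (Pi\<^sub>M {..<N k} (\<lambda>_. Q k))"
      "integrable (Pi\<^sub>M {..<N k} (\<lambda>_. Q k)) (\<lambda>\<omega>. \<bar>Z k \<omega> - (\<Sum>i<N k. f k (\<omega> i)) / sqrt (real (N k))\<bar>)"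
      "(\<integral>\<omega>. \<bar>Z k \<omega> - (\<Sum>i<N k. f k (\<omega> i)) / sqrt (real (N k))\<bar> \<partial>Pi\<^sub>M {..<N k} (\<lambda>_. Q k)) \<le> 1 / real (Suc k)"
      "\<not> \<bar>measure (Pi\<^sub>M {..<N k} (\<lambda>_. Q k)) {\<omega> \<in> space (Pi\<^sub>M {..<N k} (\<lambda>_. Q k)). \<bar>Z k \<omega>\<bar> \<le> t} - normal_abs_cdf \<sigma> t\<bar> \<le> \<epsilon>" for k x
    using NQ0[of k] by blast+
  have N: "filterlim N at_top sequentially"
    by (rule filterlim_at_top_mono[OF filterlim_ident]) (auto intro!: always_eventually Suc_leD[OF NQ(1)])
  have inv: "(\<lambda>k. 1 / real (Suc k)) \<longlonglongrightarrow> 0" using LIMSEQ_inverse_real_of_nat by (simp add: inverse_eq_divide)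
  have "(\<lambda>k. measure (Pi\<^sub>M {..<N k} (\<lambda>_. Q k)) {\<omega> \<in> space (Pi\<^sub>M {..<N k} (\<lambda>_. Q k)). \<bar>Z k \<omega>\<bar> \<le> t})
    \<longlonglongrightarrow> normal_abs_cdf \<sigma> t"
  proof (rule triangular_clt[where f=f, OF N])
    show "(\<lambda>k. (\<integral>x. (f k x)\<^sup>2 \<partial>Q k)) \<longlonglongrightarrow> \<sigma>\<^sup>2"
    proof (rule LIM_zero_cancel, rule Lim_null_comparison[OF _ inv])
      show "eventually (\<lambda>k. norm ((\<integral>x. (f k x)\<^sup>2 \<partial>Q k) - \<sigma>\<^sup>2) \<le> 1 / real (Suc k)) sequentially"
        using NQ(6) by (intro always_eventually) (simp only: real_norm_def, blast)
    qed
    show "(\<lambda>k. (\<integral>\<omega>. \<bar>Z k \<omega> - (\<Sum>i<N k. f k (\<omega> i)) / sqrt (real (N k))\<bar> \<partial>Pi\<^sub>M {..<N k} (\<lambda>_. Q k))) \<longlonglongrightarrow> 0"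
    proof (rule Lim_null_comparison[OF _ inv])
      show "eventually (\<lambda>k. norm (\<integral>\<omega>. \<bar>Z k \<omega> - (\<Sum>i<N k. f k (\<omega> i)) / sqrt (real (N k))\<bar> \<partial>Pi\<^sub>M {..<N k} (\<lambda>_. Q k)) \<le> 1 / real (Suc k)) sequentially"
      proof (intro always_eventually allI)
        fix k
        have "(\<integral>\<omega>. \<bar>Z k \<omega> - (\<Sum>i<N k. f k (\<omega> i)) / sqrt (real (N k))\<bar> \<partial>Pi\<^sub>M {..<N k} (\<lambda>_. Q k)) \<le> 1 / real (Suc k)" by (rule NQ(9))
        moreover have "0 \<le> (\<integral>\<omega>. \<bar>Z k \<omega> - (\<Sum>i<N k. f k (\<omega> i)) / sqrt (real (N k))\<bar> \<partial>Pi\<^sub>M {..<N k} (\<lambda>_. Q k))"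
          by (intro integral_nonneg_AE) auto
        ultimately show "norm (\<integral>\<omega>. \<bar>Z k \<omega> - (\<Sum>i<N k. f k (\<omega> i)) / sqrt (real (N k))\<bar> \<partial>Pi\<^sub>M {..<N k} (\<lambda>_. Q k)) \<le> 1 / real (Suc k)"
          by simp
      qed
    qed
    show "1 \<le> N k" for k using NQ(1)[of k] by linarith
  qed (rule NQ \<sigma>)+
  then have "eventually (\<lambda>k. dist (measure (Pi\<^sub>M {..<N k} (\<lambda>_. Q k)) {\<omega> \<in> space (Pi\<^sub>M {..<N k} (\<lambda>_. Q k)). \<bar>Z k \<omega>\<bar> \<le> t}) (normal_abs_cdf \<sigma> t) < \<epsilon>) sequentially"
    by (rule tendstoD[OF _ \<epsilon>])
  then obtain k where "dist (measure (Pi\<^sub>M {..<N k} (\<lambda>_. Q k)) {\<omega> \<in> space (Pi\<^sub>M {..<N k} (\<lambda>_. Q k)). \<bar>Z k \<omega>\<bar> \<le> t}) (normal_abs_cdf \<sigma> t) < \<epsilon>"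
    using eventually_happens'[OF sequentially_bot] by blast
  then show False using NQ(10)[of k] unfolding dist_real_def by (meson less_imp_le)
qed

text \<open>Continuity of the normal distribution function and the intermediate value theorem. The
  lemma supplies thresholds whose limiting probability lies slightly below or above the nominal
  level.\<close>

lemma normal_abs_cdf_quantile:
  assumes \<sigma>: "0 < \<sigma>" and q: "0 < q" "q < 1"
  shows "\<exists>c>0. normal_abs_cdf \<sigma> c = q"
proof -
  interpret real_distribution std_normal_distribution by (rule real_dist_normal_dist)
  have atom: "measure std_normal_distribution {x} = 0" for x
    using std_normal_finite[of "{x}"] by (simp add: measure_def)
  have eq: "normal_abs_cdf \<sigma> t = cdf std_normal_distribution (t / \<sigma>) - cdf std_normal_distribution (- (t / \<sigma>))" if "0 \<le> t" for t
  proof -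
    have "- (t / \<sigma>) \<le> 0" "0 \<le> t / \<sigma>" using that \<sigma> by simp_all
    then have "{- (t / \<sigma>)..t / \<sigma>} = {- (t / \<sigma>)} \<union> {- (t / \<sigma>)<..t / \<sigma>}" by force
    then have "normal_abs_cdf \<sigma> t = measure std_normal_distribution {- (t / \<sigma>)} + measure std_normal_distribution {- (t / \<sigma>)<..t / \<sigma>}"
      unfolding normal_abs_cdf_def by (simp only:) (subst finite_measure_Union, auto)
    moreover have "- (t / \<sigma>) < t / \<sigma>" if "t \<noteq> 0"
    proof -
      have "0 < t / \<sigma>" using that \<open>0 \<le> t\<close> \<sigma> by simp
      then show ?thesis by linarith
    qed
    ultimately show ?thesis using cdf_diff_eq[of "- (t / \<sigma>)" "t / \<sigma>"] atom by (cases "t = 0") auto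
  qed
  define h where "h t = cdf std_normal_distribution (t / \<sigma>) - cdf std_normal_distribution (- (t / \<sigma>))" for t
  have cont: "isCont (cdf std_normal_distribution) x" for x using isCont_cdf atom by simp
  have hc: "continuous_on UNIV h"
  proof -
    have "continuous_on UNIV (cdf std_normal_distribution)" using cont by (simp add: continuous_at_imp_continuous_on)
    then show ?thesis
      unfolding h_def using \<sigma>
      by (intro continuous_on_diff continuous_on_compose2[of UNIV "cdf std_normal_distribution" _ "\<lambda>t. t / \<sigma>"]
          continuous_on_compose2[of UNIV "cdf std_normal_distribution" _ "\<lambda>t. - (t / \<sigma>)"])
        (auto intro!: continuous_intros)
  qed
  have "((\<lambda>t. h t) \<longlongrightarrow> 1 - 0) at_top"
    unfolding h_def
  proof (intro tendsto_diff)
    have t: "filterlim (\<lambda>t. t / \<sigma>) at_top at_top"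
      using filterlim_tendsto_pos_mult_at_top[OF tendsto_const[of "1 / \<sigma>"] _ filterlim_ident[of at_top]] \<sigma> by simp
    show "((\<lambda>t. cdf std_normal_distribution (t / \<sigma>)) \<longlongrightarrow> 1) at_top"
      by (rule filterlim_compose[OF cdf_lim_at_top_prob t])
    show "((\<lambda>t. cdf std_normal_distribution (- (t / \<sigma>))) \<longlongrightarrow> 0) at_top"
      by (rule filterlim_compose[OF cdf_lim_at_bot]) (use t in \<open>simp add: filterlim_uminus_at_bot\<close>)
  qed
  then have "eventually (\<lambda>t. q < h t) at_top" using q by (intro order_tendstoD) auto
  then have "eventually (\<lambda>t. q < h t \<and> 0 < t) at_top" using eventually_gt_at_top[of 0] by eventually_elim auto
  then obtain T where T: "q < h T" "0 < T" using eventually_happens'[OF trivial_limit_at_top_linorder] by blast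
  have "\<exists>c\<ge>0. c \<le> T \<and> h c = q"
    using T q by (intro IVT') (auto simp: h_def[of 0] intro: continuous_on_subset[OF hc])
  then obtain c where c: "0 \<le> c" "h c = q" by auto
  then have "c \<noteq> 0" using q by (auto simp: h_def)
  then have "0 < c" using c by simp
  moreover have "normal_abs_cdf \<sigma> c = q" using eq[OF c(1)] c(2) by (simp only: h_def)
  ultimately show ?thesis by blast
qed

section \<open>The law of a bootstrap observation\<close>

lemma Bernstein_1: "k \<le> m \<Longrightarrow> bw 1 m k = 1 / real (Suc m)"
proof -
  assume k: "k \<le> m"
  have "real (Suc m) * bw 1 m k = (\<Sum>j\<in>{k..m}. Bernstein (Suc m) (Suc j) 1)" using bw_eq_tail[OF k, of 1] by simp
  also have "\<dots> = (\<Sum>j\<in>{m}. Bernstein (Suc m) (Suc j) 1)"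
    using k by (intro sum.mono_neutral_right) (auto simp: Bernstein_def)
  finally have "real (Suc m) * bw 1 m k = 1" by (simp add: Bernstein_def)
  then show ?thesis by (simp add: field_simps)
qed

text \<open>Multiplication by \<open>x\<close> raises degree and index, so beta moments are again
  integrals of Bernstein polynomials.\<close>

lemma times_Bernstein: "x * Bernstein m k x = real (Suc k) / real (Suc m) * Bernstein (Suc m) (Suc k) x"
proof -
  have "real (Suc k) * real (Suc m choose Suc k) = real (Suc m) * real (m choose k)"
    by (metis Suc_times_binomial_eq mult.commute of_nat_mult)
  then have "real (m choose k) = real (Suc k) / real (Suc m) * real (Suc m choose Suc k)"
    by (simp add: field_simps del: of_nat_Suc)
  then show ?thesis unfolding Bernstein_def by (simp del: of_nat_Suc binomial_Suc_Suc)
qed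

lemma Bernstein_measurable[measurable]: "Bernstein m k \<in> borel_measurable borel"
  unfolding Bernstein_def by measurable

lemma set_lebesgue_Bernstein:
  "set_integrable lborel {0..u} (Bernstein m k)" "(LINT x:{0..u}|lborel. Bernstein m k x) = bw u m k"
proof -
  show "set_integrable lborel {0..u} (Bernstein m k)"
    by (rule borel_integrable_atLeastAtMost') (rule continuous_Bernstein)
  then show "(LINT x:{0..u}|lborel. Bernstein m k x) = bw u m k"
    unfolding bw_def by (rule set_borel_integral_eq_integral(2))
qed

text \<open>With integer parameters that sum to \<open>n + 1\<close>, the beta density is
  \<open>n\<close> times a Bernstein polynomial of degree \<open>n - 1\<close>. Its distribution
  function is therefore given by the weights \<open>bw\<close>.\<close>

lemma beta_law_eq:
  assumes "1 \<le> r" "r \<le> n"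
  shows "beta_law r (n + 1 - r) = density lborel (\<lambda>x. ennreal (indicator {0..1} x * (real n * Bernstein (n - 1) (r - 1) x)))"
  unfolding beta_law_def
proof (rule density_cong)
  define B where "B = Beta (real r) (real (n + 1 - r))"
  obtain r' where r': "r = Suc r'" using assms by (cases r) auto
  obtain n' where n': "n = Suc n'" using assms by (cases n) auto
  have le: "r' \<le> n'" using assms r' n' by simp
  have "Gamma (real r) = fact r'" "Gamma (real (n + 1 - r)) = fact (n' - r')" "Gamma (real r + real (n + 1 - r)) = fact n"
    using assms Gamma_fact[of r', where 'a=real] Gamma_fact[of "n' - r'", where 'a=real] Gamma_fact[of n, where 'a=real]
    by (simp_all add: r' n' of_nat_diff Suc_diff_le algebra_simps)
  then have B: "1 / B = real n * real (n' choose r')"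
    unfolding B_def Beta_def binomial_fact[OF le] using n' by (simp add: field_simps)
  \<comment> \<open>The endpoints are dropped: there the density is set to zero while the polynomial
    may be positive.\<close>
  have "AE x in lborel. x \<noteq> 0 \<and> x \<noteq> (1::real)" using AE_lborel_singleton[of 0] AE_lborel_singleton[of 1] by eventually_elim auto
  then show "AE x in lborel. ennreal (if 0 < x \<and> x < 1 then x powr (real r - 1) * (1 - x) powr (real (n + 1 - r) - 1) / Beta (real r) (real (n + 1 - r)) else 0)
      = ennreal (indicator {0..1} x * (real n * Bernstein (n - 1) (r - 1) x))"
  proof eventually_elim
    case (elim x)
    show ?case
    proof (cases "0 < x \<and> x < 1")
      case True
      have "real r - 1 = real r'" "real (n + 1 - r) - 1 = real (n' - r')" using assms r' n' by (auto simp: of_nat_diff)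
      then have "x powr (real r - 1) = x ^ r'" "(1 - x) powr (real (n + 1 - r) - 1) = (1 - x) ^ (n' - r')"
        using True by (simp_all only: powr_realpow diff_gt_0_iff_gt)
      then have "x powr (real r - 1) * (1 - x) powr (real (n + 1 - r) - 1) / Beta (real r) (real (n + 1 - r))
        = x ^ r' * (1 - x) ^ (n' - r') * (1 / B)" by (simp add: B_def)
      also have "\<dots> = real n * Bernstein (n - 1) (r - 1) x" unfolding B Bernstein_def r' n' by simp
      finally show ?thesis using True by simp
    next
      case False
      then have "indicator {0..1} x = (0::real)" using elim by (auto simp: indicator_def)
      then show ?thesis using False by (simp only: if_False mult_zero_left)
    qed
  qed
qed measurable

lemma sets_beta_law[measurable_cong, simp]: "sets (beta_law a b) = sets borel"
  unfolding beta_law_def by simp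

lemma space_beta_law[simp]: "space (beta_law a b) = UNIV"
  unfolding beta_law_def by simp

lemma integral_beta_law:
  assumes r: "1 \<le> r" "r \<le> n" and [measurable]: "f \<in> borel_measurable borel"
  shows "(\<integral>x. f x \<partial>beta_law r (n + 1 - r)) = (LINT x:{0..1}|lborel. real n * Bernstein (n - 1) (r - 1) x * f x)"
proof -
  have "(\<integral>x. f x \<partial>beta_law r (n + 1 - r)) = (\<integral>x. (indicator {0..1} x * (real n * Bernstein (n - 1) (r - 1) x)) *\<^sub>R f x \<partial>lborel)"
    unfolding beta_law_eq[OF r]
    by (rule integral_density) (auto intro!: mult_nonneg_nonneg Bernstein_nonneg simp: indicator_def)
  then show ?thesis unfolding set_lebesgue_integral_def by (simp add: mult.assoc)
qed

lemma emeasure_beta_law: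
  assumes r: "1 \<le> r" "r \<le> n" and u: "0 \<le> u" "u \<le> 1"
  shows "emeasure (beta_law r (n + 1 - r)) {..u} = ennreal (real n * bw u (n - 1) (r - 1))"
proof -
  have "emeasure (beta_law r (n + 1 - r)) {..u} = (\<integral>\<^sup>+x. ennreal (indicator {0..1} x * (real n * Bernstein (n - 1) (r - 1) x)) * indicator {..u} x \<partial>lborel)"
    unfolding beta_law_eq[OF r] by (rule emeasure_density) auto
  also have "\<dots> = (\<integral>\<^sup>+x. ennreal (indicator {0..u} x * (real n * Bernstein (n - 1) (r - 1) x)) \<partial>lborel)"
    using u by (intro nn_integral_cong) (auto simp: indicator_def)
  also have "\<dots> = ennreal (\<integral>x. indicator {0..u} x * (real n * Bernstein (n - 1) (r - 1) x) \<partial>lborel)"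
  proof (rule nn_integral_eq_integral)
    show "integrable lborel (\<lambda>x. indicator {0..u} x * (real n * Bernstein (n - 1) (r - 1) x))"
      using integrable_mult_right[OF set_lebesgue_Bernstein(1)[of u "n - 1" "r - 1", unfolded set_integrable_def], of "real n"]
      by (simp add: mult.left_commute)
    show "AE x in lborel. 0 \<le> indicator {0..u} x * (real n * Bernstein (n - 1) (r - 1) x)"
      using u by (intro AE_I2) (auto intro!: mult_nonneg_nonneg Bernstein_nonneg simp: indicator_def)
  qed
  also have "(\<integral>x. indicator {0..u} x * (real n * Bernstein (n - 1) (r - 1) x) \<partial>lborel) = real n * bw u (n - 1) (r - 1)"
    using set_lebesgue_Bernstein(2)[of u "n - 1" "r - 1", unfolded set_lebesgue_integral_def]
    by (simp add: mult.left_commute)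
  finally show ?thesis .
qed

lemma prob_space_beta_law:
  assumes r: "1 \<le> r" "r \<le> n"
  shows "prob_space (beta_law r (n + 1 - r))"
proof
  have "emeasure (beta_law r (n + 1 - r)) UNIV = (\<integral>\<^sup>+x. ennreal (indicator {0..1} x * (real n * Bernstein (n - 1) (r - 1) x)) * indicator UNIV x \<partial>lborel)"
    unfolding beta_law_eq[OF r] by (rule emeasure_density) auto
  also have "\<dots> = (\<integral>\<^sup>+x. ennreal (indicator {0..1} x * (real n * Bernstein (n - 1) (r - 1) x)) * indicator {..1} x \<partial>lborel)"
    by (intro nn_integral_cong) (auto simp: indicator_def)
  also have "\<dots> = emeasure (beta_law r (n + 1 - r)) {..1}"
    unfolding beta_law_eq[OF r] by (rule emeasure_density[symmetric]) auto
  also have "\<dots> = 1"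
    using emeasure_beta_law[OF r, of 1] Bernstein_1[of "r - 1" "n - 1"] r by simp
  finally show "emeasure (beta_law r (n + 1 - r)) (space (beta_law r (n + 1 - r))) = 1" by simp
qed

text \<open>A beta law lives on the unit interval only almost surely. Clamping secures the range at
  every point, and being monotone it can also serve as a standardising transformation.\<close>

definition clamp01 :: "real \<Rightarrow> real" where "clamp01 x = max 0 (min 1 x)"

lemma clamp01_range: "0 \<le> clamp01 x" "clamp01 x \<le> 1" "clamp01 x \<in> {0..1}"
  by (auto simp: clamp01_def)

lemma clamp01_id: "x \<in> {0..1} \<Longrightarrow> clamp01 x = x"
  by (auto simp: clamp01_def)

lemma clamp01_measurable[measurable]: "clamp01 \<in> borel_measurable borel"
  unfolding clamp01_def by measurable

text \<open>The law fluctuates around \<open>r / n\<close> at scale \<open>1 / sqrt n\<close>, but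
  its mean \<open>r / (n + 1)\<close> misses by at most \<open>1 / n\<close>. This difference of
  orders makes the bootstrap centring error negligible.\<close>

lemma beta_law_moments:
  defines "N \<equiv> \<lambda>r n. beta_law r (n + 1 - r)"
  assumes r: "1 \<le> r" "r \<le> n"
  shows "(\<integral>x. clamp01 x \<partial>N r n) = real r / (real n + 1)"
    and "(\<integral>x. (clamp01 x - real r / real n)\<^sup>2 \<partial>N r n) \<le> 3 / real n"
    and "\<bar>(\<integral>x. clamp01 x \<partial>N r n) - real r / real n\<bar> \<le> 1 / real n"
proof -
  interpret prob_space "N r n" unfolding N_def by (rule prob_space_beta_law[OF r])
  have [measurable_cong, simp]: "sets (N r n) = sets borel" by (simp add: N_def)
  have NN: "N r n = beta_law r (n + 1 - r)" by (simp only: N_def)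
  have n: "0 < n" using r by simp
  obtain r' where r': "r = Suc r'" using r by (cases r) auto
  obtain n' where n': "n = Suc n'" using r by (cases n) auto
  have "(\<integral>x. clamp01 x \<partial>N r n) = (LINT x:{0..1}|lborel. real n * Bernstein n' r' x * clamp01 x)"
    unfolding N_def integral_beta_law[OF r clamp01_measurable] using r' n' by simp
  also have "\<dots> = (LINT x:{0..1}|lborel. real r * Bernstein n r x)"
  proof (rule set_lebesgue_integral_cong)
    show "\<forall>x. x \<in> {0..1} \<longrightarrow> real n * Bernstein n' r' x * clamp01 x = real r * Bernstein n r x"
      using times_Bernstein[of _ n' r'] n unfolding r' n' by (auto simp: clamp01_id mult.commute field_simps)
  qed simp
  also have "\<dots> = real r / (real n + 1)"
    using set_lebesgue_Bernstein(2)[of 1 n r] Bernstein_1[of r n] r by simp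
  finally show m1: "(\<integral>x. clamp01 x \<partial>N r n) = real r / (real n + 1)" .
  have "(\<integral>x. (clamp01 x)\<^sup>2 \<partial>N r n) = (LINT x:{0..1}|lborel. real n * Bernstein n' r' x * (clamp01 x)\<^sup>2)"
    unfolding N_def by (subst integral_beta_law[OF r]) (use r' n' in auto)
  also have "\<dots> = (LINT x:{0..1}|lborel. (real r * (real r + 1) / (real n + 1)) * Bernstein (Suc n) (Suc r) x)"
  proof (rule set_lebesgue_integral_cong)
    show "\<forall>x. x \<in> {0..1} \<longrightarrow> real n * Bernstein n' r' x * (clamp01 x)\<^sup>2 = (real r * (real r + 1) / (real n + 1)) * Bernstein (Suc n) (Suc r) x"
    proof (intro allI impI)
      fix x :: real assume "x \<in> {0..1}"
      then have "real n * Bernstein n' r' x * (clamp01 x)\<^sup>2 = real n * (x * (x * Bernstein n' r' x))"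
        by (simp add: clamp01_id power2_eq_square)
      also have "\<dots> = real r * (x * Bernstein n r x)"
        unfolding times_Bernstein[of x n' r'] using n unfolding r'[symmetric] n'[symmetric] by (simp add: field_simps)
      also have "\<dots> = (real r * (real r + 1) / (real n + 1)) * Bernstein (Suc n) (Suc r) x"
        unfolding times_Bernstein[of x n r] by (simp add: field_simps)
      finally show "real n * Bernstein n' r' x * (clamp01 x)\<^sup>2 = (real r * (real r + 1) / (real n + 1)) * Bernstein (Suc n) (Suc r) x" .
    qed
  qed simp
  also have "\<dots> = real r * (real r + 1) / ((real n + 1) * (real n + 2))"
    using set_lebesgue_Bernstein(2)[of 1 "Suc n" "Suc r"] Bernstein_1[of "Suc r" "Suc n"] r by simp
  finally have m2: "(\<integral>x. (clamp01 x)\<^sup>2 \<partial>N r n) = real r * (real r + 1) / ((real n + 1) * (real n + 2))" .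
  define q where "q = real r / real n"
  have q: "0 \<le> q" "q \<le> 1" using r n by (auto simp: q_def)
  have lo: "q - q / real n \<le> real r / (real n + 1)" "real r / (real n + 1) \<le> q"
  proof -
    have "(q - q / real n) * (real n + 1) = q * real n - q / real n" using n by (simp add: field_simps)
    also have "\<dots> \<le> real r" using q n by (simp add: q_def)
    finally show "q - q / real n \<le> real r / (real n + 1)" by (simp add: pos_le_divide_eq)
    show "real r / (real n + 1) \<le> q" unfolding q_def using n by (intro divide_left_mono) auto
  qed
  have qn: "q / real n \<le> 1 / real n" using q by (intro divide_right_mono) auto
  show "\<bar>(\<integral>x. clamp01 x \<partial>N r n) - real r / real n\<bar> \<le> 1 / real n"
    unfolding m1 q_def[symmetric] using lo qn by linarith
  have i: "integrable (N r n) clamp01" "integrable (N r n) (\<lambda>x. (clamp01 x)\<^sup>2)"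
    using clamp01_range by (auto intro!: integrable_const_bound[of _ 1] simp: power_le_one)
  have "(\<integral>x. (clamp01 x - q)\<^sup>2 \<partial>N r n) = (\<integral>x. (clamp01 x)\<^sup>2 - 2 * q * clamp01 x + q\<^sup>2 \<partial>N r n)"
    by (intro Bochner_Integration.integral_cong) (auto simp: power2_eq_square algebra_simps)
  also have "\<dots> = real r * (real r + 1) / ((real n + 1) * (real n + 2)) - 2 * q * (real r / (real n + 1)) + q\<^sup>2"
    using i prob_space by (simp add: m1 m2)
  also have "\<dots> \<le> q * (q + 1 / real n) - 2 * q * (q - q / real n) + q\<^sup>2"
  proof -
    have "real r * (real r + 1) / ((real n + 1) * (real n + 2)) = (real r / (real n + 1)) * ((real r + 1) / (real n + 2))" by simp
    also have "\<dots> \<le> q * (q + 1 / real n)"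
    proof (rule mult_mono[OF lo(2)])
      have "(real r + 1) / (real n + 2) \<le> (real r + 1) / real n" using n by (intro divide_left_mono) auto
      then show "(real r + 1) / (real n + 2) \<le> q + 1 / real n" by (simp add: q_def add_divide_distrib)
    qed (use q in auto)
    finally show ?thesis using mult_left_mono[OF lo(1), of "2 * q"] q by simp
  qed
  also have "\<dots> = q / real n + 2 * (q * (q / real n))" by (simp add: power2_eq_square algebra_simps)
  also have "\<dots> \<le> 1 / real n + 2 * (1 * (1 / real n))" using q qn by (intro add_mono mult_left_mono mult_mono) auto
  finally show "(\<integral>x. (clamp01 x - real r / real n)\<^sup>2 \<partial>N r n) \<le> 3 / real n"
    unfolding q_def by simp
qed

lemma beta_law_abs_dev:
  defines "N \<equiv> \<lambda>r n. beta_law r (n + 1 - r)"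
  assumes r: "1 \<le> r" "r \<le> n"
  shows "(\<integral>x. \<bar>clamp01 x - real r / real n\<bar> \<partial>N r n) \<le> 2 / sqrt (real n)"
proof -
  interpret prob_space "N r n" unfolding N_def by (rule prob_space_beta_law[OF r])
  have [measurable_cong, simp]: "sets (N r n) = sets borel" by (simp add: N_def)
  have NN: "N r n = beta_law r (n + 1 - r)" by (simp only: N_def)
  have n: "0 < n" using r by simp
  have q: "0 \<le> real r / real n" "real r / real n \<le> 1" using r by auto
  have b: "\<bar>clamp01 x - real r / real n\<bar> \<le> 1" for x using clamp01_range(1,2)[of x] q by linarith
  show ?thesis
  proof (rule expectation_abs_le_of_square)
    show "integrable (N r n) (\<lambda>x. clamp01 x - real r / real n)"
      using b by (intro integrable_const_bound[of _ 1]) auto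
    show "integrable (N r n) (\<lambda>x. (clamp01 x - real r / real n)\<^sup>2)"
      using b by (intro integrable_const_bound[of _ 1]) (auto simp: abs_square_le_1)
    have "3 / real n \<le> (2 / sqrt (real n))\<^sup>2" using n by (simp add: power_divide divide_right_mono)
    then show "(\<integral>x. (clamp01 x - real r / real n)\<^sup>2 \<partial>N r n) \<le> (2 / sqrt (real n))\<^sup>2"
      using beta_law_moments(2)[OF r, folded NN] by linarith
  qed (use n in simp)
qed

text \<open>The linear term has mean at most \<open>1 / n\<close>. What remains of the deviation
  \<open>1 / sqrt n\<close> is multiplied by \<epsilon> or by the window indicator, a gain that a
  bare Lipschitz estimate would lose.\<close>

lemma beta_law_bphi:
  defines "N \<equiv> \<lambda>r n. beta_law r (n + 1 - r)"
  assumes p: "0 \<le> p" "p \<le> 1" and acc: "bw_accurate \<epsilon> p m" and m: "1 \<le> m" and e: "0 < \<epsilon>" "\<epsilon> \<le> 1"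
    and r: "1 \<le> r" "r \<le> n"
  shows "\<bar>(\<integral>x. bphi p m (clamp01 x) \<partial>N r n) - bphi p m (real r / real n)\<bar>
    \<le> 2 / sqrt (real n) * (\<epsilon> + of_bool (\<bar>real r / real n - p\<bar> \<le> 2 * \<epsilon>)) + 4 / (\<epsilon> * real n) + 4 / real m"
proof -
  interpret prob_space "N r n" unfolding N_def by (rule prob_space_beta_law[OF r])
  have [measurable_cong, simp]: "sets (N r n) = sets borel" by (simp add: N_def)
  have NN: "N r n = beta_law r (n + 1 - r)" by (simp only: N_def)
  have n: "0 < n" using r by simp
  define q where "q = real r / real n"
  define A where "A = (of_bool (\<bar>q - p\<bar> \<le> 2 * \<epsilon>) :: real)"
  have q: "q \<in> {0..1}" using r n by (auto simp: q_def)
  have b: "\<bar>clamp01 x - q\<bar> \<le> 1" for x using clamp01_range[of x] q by (auto simp: abs_le_iff)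
  have b': "\<bar>bphi p m (clamp01 x)\<bar> \<le> 1" for x using bphi_bounds[OF p, of m "clamp01 x"] by simp
  have i: "integrable (N r n) (\<lambda>x. clamp01 x - q)" "integrable (N r n) (\<lambda>x. (clamp01 x - q)\<^sup>2)"
     "integrable (N r n) (\<lambda>x. bphi p m (clamp01 x))" "integrable (N r n) clamp01"
    using b b' clamp01_range by (auto intro!: integrable_const_bound[of _ 1] simp: abs_square_le_1)
  define h where "h x = bphi p m (clamp01 x) - bphi p m q + of_bool (q < p) * (clamp01 x - q)" for x
  have hi: "integrable (N r n) h" unfolding h_def using i by auto
  have hb: "\<bar>h x\<bar> \<le> \<bar>clamp01 x - q\<bar> * (\<epsilon> + A) + (clamp01 x - q)\<^sup>2 / \<epsilon> + 4 / real m" for x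
  proof -
    have "\<bar>h x\<bar> \<le> \<bar>clamp01 x - q\<bar> * (\<epsilon> + A + of_bool (\<bar>clamp01 x - q\<bar> > \<epsilon>)) + 4 / real m"
      unfolding h_def A_def by (rule bphi_taylor[OF p acc m e q clamp01_range(3)])
    \<comment> \<open>Long deviations are paid for by the second moment, at the price
      \<open>1 / \<epsilon>\<close>.\<close>
    moreover have "\<bar>clamp01 x - q\<bar> * of_bool (\<bar>clamp01 x - q\<bar> > \<epsilon>) \<le> (clamp01 x - q)\<^sup>2 / \<epsilon>"
    proof (cases "\<bar>clamp01 x - q\<bar> > \<epsilon>")
      case True
      then have "\<epsilon> * \<bar>clamp01 x - q\<bar> \<le> \<bar>clamp01 x - q\<bar> * \<bar>clamp01 x - q\<bar>" by (intro mult_right_mono) auto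
      then show ?thesis using True e by (simp add: pos_le_divide_eq power2_eq_square mult.commute)
    qed (use e in simp)
    ultimately show ?thesis by (simp add: distrib_left)
  qed
  have "\<bar>\<integral>x. h x \<partial>N r n\<bar> \<le> (\<integral>x. \<bar>clamp01 x - q\<bar> * (\<epsilon> + A) + (clamp01 x - q)\<^sup>2 / \<epsilon> + 4 / real m \<partial>N r n)"
    using hi hb i by (intro order_trans[OF integral_abs_bound] integral_mono) auto
  also have "\<dots> = (\<integral>x. \<bar>clamp01 x - q\<bar> \<partial>N r n) * (\<epsilon> + A) + (\<integral>x. (clamp01 x - q)\<^sup>2 \<partial>N r n) / \<epsilon> + 4 / real m"
    using i prob_space by simp
  also have "\<dots> \<le> 2 / sqrt (real n) * (\<epsilon> + A) + 3 / real n / \<epsilon> + 4 / real m"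
    unfolding q_def using beta_law_abs_dev[OF r, folded NN] beta_law_moments(2)[OF r, folded NN] e
    by (intro add_mono mult_right_mono divide_right_mono) (auto simp: A_def)
  finally have 1: "\<bar>\<integral>x. h x \<partial>N r n\<bar> \<le> 2 / sqrt (real n) * (\<epsilon> + A) + 3 / real n / \<epsilon> + 4 / real m" .
  have "(\<integral>x. h x \<partial>N r n) = (\<integral>x. bphi p m (clamp01 x) \<partial>N r n) - bphi p m q
     + of_bool (q < p) * ((\<integral>x. clamp01 x \<partial>N r n) - q)"
    unfolding h_def using i prob_space by simp
  moreover have "\<bar>of_bool (q < p) * ((\<integral>x. clamp01 x \<partial>N r n) - q)\<bar> \<le> 1 / real n"
    using beta_law_moments(3)[OF r, folded NN] n unfolding q_def by (auto simp: of_bool_def)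
  moreover have "1 / real n \<le> 1 / (\<epsilon> * real n)" using e n by (intro divide_left_mono) (auto simp: mult_left_le_one_le)
  moreover have "1 / (\<epsilon> * real n) + 3 / real n / \<epsilon> = 4 / (\<epsilon> * real n)" using e n by (simp add: field_simps)
  ultimately show ?thesis using 1 unfolding A_def q_def by linarith
qed


section \<open>Mixture kernels and the product form of the bootstrap law\<close>

lemma subprob_beta_law:
  assumes "a \<le> n"
  shows "subprob_space (beta_law a (n + 1 - a))"
proof (cases "a = 0")
  case True
  \<comment> \<open>An index outside the sample may have rank zero. There \<open>Gamma\<close> takes
    its default 0 at the pole, and division by the vanishing \<open>Beta\<close> makes the density
    zero, so the kernel is still a subprobability.\<close>
  have B0: "Beta (real 0) (real (n + 1)) = 0" unfolding Beta_def by simp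
  have "beta_law 0 (n + 1) = density lborel (\<lambda>_. 0)"
    unfolding beta_law_def B0 by (rule density_cong) auto
  then have "emeasure (beta_law 0 (n + 1)) (space (beta_law 0 (n + 1))) = 0" by (simp add: emeasure_density)
  then show ?thesis unfolding True by (intro subprob_spaceI) auto
next
  case False
  then show ?thesis using assms by (intro prob_space_imp_subprob_space prob_space_beta_law) auto
qed

lemma sample_rank_bounds: "sample_rank n x i \<le> n" "i < n \<Longrightarrow> 1 \<le> sample_rank n x i"
proof -
  have "{j. j < n \<and> x j \<le> x i} \<subseteq> {..<n}" by auto
  from card_mono[OF _ this] show "sample_rank n x i \<le> n" unfolding sample_rank_def by simp
  assume "i < n"
  then have "{i} \<subseteq> {j. j < n \<and> x j \<le> x i}" by auto
  from card_mono[OF _ this] show "1 \<le> sample_rank n x i" unfolding sample_rank_def by simp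
qed

lemma own_ecdf_rank: "own_ecdf n c \<omega> i = real (sample_rank n (\<lambda>j. c (\<omega> j)) i) / real n"
proof -
  have "(\<Sum>j<n. of_bool (c (\<omega> j) \<le> c (\<omega> i))) = real (card {j. j < n \<and> c (\<omega> j) \<le> c (\<omega> i)})"
    by (simp add: of_bool_def sum.If_cases Int_def)
  then show ?thesis unfolding own_ecdf_def ecdf_def sample_rank_def by simp
qed

text \<open>Without ties larger values have strictly larger ranks, so the ranks are a permutation. A
  sum over the observations of a function of the rank thus becomes a sum over \<open>1..n\<close>
  that no longer depends on the data.\<close>

lemma sample_rank_bij:
  assumes "\<And>i j. i < n \<Longrightarrow> j < n \<Longrightarrow> x i = x j \<Longrightarrow> i = j"
  shows "bij_betw (sample_rank n x) {..<n} {1..n}"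
proof -
  have less: "sample_rank n x i < sample_rank n x j" if "i < n" "j < n" "x i < x j" for i j
  proof -
    have "{k. k < n \<and> x k \<le> x i} \<subseteq> {k. k < n \<and> x k \<le> x j}" using that by auto
    moreover have "j \<notin> {k. k < n \<and> x k \<le> x i}" "j \<in> {k. k < n \<and> x k \<le> x j}" using that by auto
    ultimately have "{k. k < n \<and> x k \<le> x i} \<subset> {k. k < n \<and> x k \<le> x j}" by blast
    then show ?thesis unfolding sample_rank_def by (intro psubset_card_mono) auto
  qed
  have "inj_on (sample_rank n x) {..<n}"
  proof (rule inj_onI)
    fix i j assume ij: "i \<in> {..<n}" "j \<in> {..<n}" "sample_rank n x i = sample_rank n x j"
    then have "x i = x j" using less[of i j] less[of j i] by (cases "x i" "x j" rule: linorder_cases) auto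
    then show "i = j" using assms ij by auto
  qed
  moreover have "sample_rank n x ` {..<n} = {1..n}"
  proof (rule card_subset_eq)
    show "sample_rank n x ` {..<n} \<subseteq> {1..n}" 
      by (auto intro: sample_rank_bounds sample_rank_bounds(2)[unfolded One_nat_def])
    show "card (sample_rank n x ` {..<n}) = card {1..n}" using card_image[OF calculation] by simp
  qed simp
  ultimately show ?thesis by (simp add: bij_betw_def)
qed

text \<open>Law of one bootstrap observation given the data; without ties its distribution function
  is the empirical beta copula.\<close>

definition boot_base :: "nat \<Rightarrow> (nat \<Rightarrow> real \<times> real) \<Rightarrow> (real \<times> real) measure" where
  "boot_base n z = measure_pmf (pmf_of_set {..<n}) \<bind> beta_kernel n z"

lemma sets_beta_kernel[simp, measurable_cong]: "sets (beta_kernel n z i) = sets (borel :: (real \<times> real) measure)"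
  unfolding beta_kernel_def Let_def by (simp add: borel_prod[symmetric] cong: sets_pair_measure_cong)

lemma space_beta_kernel[simp]: "space (beta_kernel n z i) = UNIV"
  using sets_eq_imp_space_eq[OF sets_beta_kernel] by simp

lemma subprob_beta_kernel: "subprob_space (beta_kernel n z i)"
proof -
  let ?r = "sample_rank n (\<lambda>j. fst (z j)) i" and ?s = "sample_rank n (\<lambda>j. snd (z j)) i"
  interpret A: subprob_space "beta_law ?r (n + 1 - ?r)" by (rule subprob_beta_law) (rule sample_rank_bounds)
  interpret B: subprob_space "beta_law ?s (n + 1 - ?s)" by (rule subprob_beta_law) (rule sample_rank_bounds)
  interpret P: pair_sigma_finite "beta_law ?r (n + 1 - ?r)" "beta_law ?s (n + 1 - ?s)" by standard
  show ?thesis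
  proof (rule subprob_spaceI)
    have "emeasure (beta_law ?r (n + 1 - ?r) \<Otimes>\<^sub>M beta_law ?s (n + 1 - ?s)) (UNIV \<times> UNIV)
      = emeasure (beta_law ?r (n + 1 - ?r)) UNIV * emeasure (beta_law ?s (n + 1 - ?s)) UNIV"
      by (rule B.emeasure_pair_measure_Times) auto
    also have "\<dots> \<le> 1 * 1"
      using A.emeasure_space_le_1 B.emeasure_space_le_1 unfolding space_beta_law by (rule mult_mono) auto
    finally have "emeasure (beta_law ?r (n + 1 - ?r) \<Otimes>\<^sub>M beta_law ?s (n + 1 - ?s)) (UNIV \<times> UNIV) \<le> 1 * 1" .
    then show "emeasure (beta_kernel n z i) (space (beta_kernel n z i)) \<le> 1"
      unfolding space_beta_kernel unfolding beta_kernel_def Let_def by simp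
  qed simp
qed

lemma prob_beta_kernel: "i < n \<Longrightarrow> prob_space (beta_kernel n z i)"
proof -
  let ?r = "sample_rank n (\<lambda>j. fst (z j)) i" and ?s = "sample_rank n (\<lambda>j. snd (z j)) i"
  assume i: "i < n"
  interpret A: prob_space "beta_law ?r (n + 1 - ?r)" by (intro prob_space_beta_law sample_rank_bounds i)
  interpret B: prob_space "beta_law ?s (n + 1 - ?s)" by (intro prob_space_beta_law sample_rank_bounds i)
  interpret P: pair_prob_space "beta_law ?r (n + 1 - ?r)" "beta_law ?s (n + 1 - ?s)" by standard
  show ?thesis unfolding beta_kernel_def Let_def by (rule P.prob_space_axioms)
qed

lemma beta_kernel_measurable:
  "beta_kernel n z \<in> measurable (measure_pmf P) (subprob_algebra borel)"
  by (auto simp: space_subprob_algebra subprob_beta_kernel)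

lemma sets_boot_base[simp, measurable_cong]: "sets (boot_base n z) = sets borel"
  unfolding boot_base_def by (rule sets_bind) auto

lemma space_boot_base[simp]: "space (boot_base n z) = UNIV"
  using sets_eq_imp_space_eq[OF sets_boot_base] by simp

lemma emeasure_boot_base:
  "A \<in> sets borel \<Longrightarrow> emeasure (boot_base n z) A = (\<integral>\<^sup>+i. emeasure (beta_kernel n z i) A \<partial>measure_pmf (pmf_of_set {..<n}))"
  unfolding boot_base_def by (rule emeasure_bind[OF _ beta_kernel_measurable]) auto

lemma prob_boot_base: "0 < n \<Longrightarrow> prob_space (boot_base n z)"
proof
  assume n: "0 < n"
  have "emeasure (boot_base n z) UNIV = (\<integral>\<^sup>+i. emeasure (beta_kernel n z i) UNIV \<partial>measure_pmf (pmf_of_set {..<n}))"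
    by (rule emeasure_boot_base) simp
  also have "\<dots> = (\<integral>\<^sup>+i. 1 \<partial>measure_pmf (pmf_of_set {..<n}))"
  proof (rule nn_integral_cong_AE, rule AE_pmfI)
    fix i assume "i \<in> set_pmf (pmf_of_set {..<n})"
    then have "i < n" using n by (subst (asm) set_pmf_of_set) auto
    then interpret prob_space "beta_kernel n z i" by (rule prob_beta_kernel)
    show "emeasure (beta_kernel n z i) UNIV = 1" using emeasure_space_1 by simp
  qed
  finally show "emeasure (boot_base n z) (space (boot_base n z)) = 1"
    by (simp add: measure_pmf.emeasure_space_1[simplified])
qed

text \<open>Drawing all indices first and then the points yields independent, identically
  distributed observations: on a rectangle the integral over independent indices factorises.
  Conditionally on the data the bootstrap is therefore ordinary sampling from
  \<open>boot_base\<close>.\<close>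

lemma boot_law_eq:
  assumes n: "0 < n"
  shows "boot_law n z = Pi\<^sub>M {..<n} (\<lambda>_. boot_base n z)"
proof -
  interpret B: prob_space "boot_base n z" by (rule prob_boot_base[OF n])
  interpret product_sigma_finite "\<lambda>_::nat. boot_base n z"
    by (intro product_sigma_finite.intro B.sigma_finite_measure_axioms)
  let ?P = "measure_pmf (Pi_pmf {..<n} 0 (\<lambda>_. pmf_of_set {..<n}))"
  have setsK: "sets (Pi\<^sub>M {..<n} (\<lambda>i. beta_kernel n z (I i))) = sets (Pi\<^sub>M {..<n} (\<lambda>_. borel :: (real \<times> real) measure))" for I
    by (rule sets_PiM_cong) auto
  have psf: "product_sigma_finite (\<lambda>i. beta_kernel n z (I i))" for I :: "nat \<Rightarrow> nat"
    by (intro product_sigma_finite.intro finite_measure.sigma_finite_measure subprob_space.axioms(1) subprob_beta_kernel)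
  have sub: "subprob_space (Pi\<^sub>M {..<n} (\<lambda>i. beta_kernel n z (I i)))" for I :: "nat \<Rightarrow> nat"
  proof (rule subprob_spaceI)
    have "emeasure (Pi\<^sub>M {..<n} (\<lambda>i. beta_kernel n z (I i))) (\<Pi>\<^sub>E i\<in>{..<n}. UNIV) = (\<Prod>i<n. emeasure (beta_kernel n z (I i)) UNIV)"
      by (rule product_sigma_finite.emeasure_PiM[OF psf]) auto
    also have "\<dots> \<le> 1"
      using subprob_space.emeasure_space_le_1[OF subprob_beta_kernel] by (intro prod_le_1) auto
    finally show "emeasure (Pi\<^sub>M {..<n} (\<lambda>i. beta_kernel n z (I i))) (space (Pi\<^sub>M {..<n} (\<lambda>i. beta_kernel n z (I i)))) \<le> 1"
      by (simp add: space_PiM)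
  qed (simp add: space_PiM PiE_eq_empty_iff)
  have meas: "(\<lambda>I. Pi\<^sub>M {..<n} (\<lambda>i. beta_kernel n z (I i))) \<in> measurable ?P (subprob_algebra (Pi\<^sub>M {..<n} (\<lambda>_. borel)))"
    using sub setsK by (auto simp: space_subprob_algebra)
  show ?thesis
  proof (rule PiM_eqI)
    show "sets (boot_law n z) = sets (Pi\<^sub>M {..<n} (\<lambda>_. boot_base n z))"
    proof -
      have "sets (boot_law n z) = sets (Pi\<^sub>M {..<n} (\<lambda>_. borel :: (real \<times> real) measure))"
        unfolding boot_law_def by (rule sets_bind[OF setsK]) simp
      also have "\<dots> = sets (Pi\<^sub>M {..<n} (\<lambda>_. boot_base n z))" by (rule sets_PiM_cong) auto
      finally show ?thesis .
    qed
  next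
    fix A :: "nat \<Rightarrow> (real \<times> real) set" assume "\<And>i. i \<in> {..<n} \<Longrightarrow> A i \<in> sets (boot_base n z)"
    then have A: "\<And>i. i < n \<Longrightarrow> A i \<in> sets borel" by auto
    have "emeasure (boot_law n z) (Pi\<^sub>E {..<n} A) = (\<integral>\<^sup>+I. emeasure (Pi\<^sub>M {..<n} (\<lambda>i. beta_kernel n z (I i))) (Pi\<^sub>E {..<n} A) \<partial>?P)"
      unfolding boot_law_def by (rule emeasure_bind[OF _ meas]) (use A in \<open>auto intro!: sets_PiM_I_finite\<close>)
    also have "\<dots> = (\<integral>\<^sup>+I. (\<Prod>i\<in>{..<n}. emeasure (beta_kernel n z (I i)) (A i)) \<partial>?P)"
      by (intro nn_integral_cong product_sigma_finite.emeasure_PiM[OF psf]) (use A in auto)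
    also have "\<dots> = (\<Prod>i\<in>{..<n}. \<integral>\<^sup>+k. emeasure (beta_kernel n z k) (A i) \<partial>measure_pmf (pmf_of_set {..<n}))"
      by (rule nn_integral_prod_Pi_pmf) simp
    also have "\<dots> = (\<Prod>i\<in>{..<n}. emeasure (boot_base n z) (A i))"
      using A by (intro prod.cong refl emeasure_boot_base[symmetric]) auto
    finally show "emeasure (boot_law n z) (Pi\<^sub>E {..<n} A) = (\<Prod>i\<in>{..<n}. emeasure (boot_base n z) (A i))" .
  qed simp
qed

lemma integral_boot_base:
  assumes n: "0 < n" and f[measurable]: "f \<in> borel_measurable borel" and B: "\<And>x. \<bar>f x\<bar> \<le> B"
  shows "(\<integral>x. f x \<partial>boot_base n z) = (\<Sum>i<n. \<integral>x. f x \<partial>beta_kernel n z i) / real n"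
proof -
  have "(\<integral>x. f x \<partial>boot_base n z) = (\<integral>i. (\<integral>x. f x \<partial>beta_kernel n z i) \<partial>measure_pmf (pmf_of_set {..<n}))"
    unfolding boot_base_def
    by (rule integral_bind[OF f _ beta_kernel_measurable, where B=B and B'=1])
      (use B subprob_space.emeasure_space_le_1[OF subprob_beta_kernel] measure_pmf.finite_measure_axioms in auto)
  also have "\<dots> = (\<Sum>i<n. \<integral>x. f x \<partial>beta_kernel n z i) / real n"
    using n by (subst integral_pmf_of_set) auto
  finally show ?thesis .
qed


lemma integral_beta_kernel:
  fixes n z i f
  assumes i: "i < n" and f[measurable]: "f \<in> borel_measurable borel" and B: "\<And>x. \<bar>f x\<bar> \<le> (B::real)"
  defines "r \<equiv> sample_rank n (\<lambda>j. fst (z j)) i" and "s \<equiv> sample_rank n (\<lambda>j. snd (z j)) i"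
  shows "(\<integral>x. f x \<partial>beta_kernel n z i) = (\<integral>x. (\<integral>y. f (x, y) \<partial>beta_law s (n + 1 - s)) \<partial>beta_law r (n + 1 - r))"
proof -
  interpret A: prob_space "beta_law r (n + 1 - r)" unfolding r_def by (intro prob_space_beta_law sample_rank_bounds i)
  interpret B: prob_space "beta_law s (n + 1 - s)" unfolding s_def by (intro prob_space_beta_law sample_rank_bounds i)
  interpret P: pair_prob_space "beta_law r (n + 1 - r)" "beta_law s (n + 1 - s)" by standard
  have [measurable]: "f \<in> borel_measurable (beta_law r (n + 1 - r) \<Otimes>\<^sub>M beta_law s (n + 1 - s))"
    using f by (simp add: borel_prod[symmetric] cong: measurable_cong_sets sets_pair_measure_cong)
  have "integrable (beta_law r (n + 1 - r) \<Otimes>\<^sub>M beta_law s (n + 1 - s)) f"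
    using B by (intro P.integrable_const_bound[of _ B]) auto
  from P.integral_fst'[OF this] show ?thesis unfolding beta_kernel_def Let_def r_def s_def by simp
qed

abbreviation "cl\<^sub>1 \<equiv> (\<lambda>x :: real \<times> real. clamp01 (fst x))"
abbreviation "cl\<^sub>2 \<equiv> (\<lambda>x :: real \<times> real. clamp01 (snd x))"

lemma emeasure_beta_kernel_Times:
  fixes n z
  assumes "A \<in> sets borel" "B \<in> sets borel"
  defines "r i \<equiv> sample_rank n (\<lambda>j. fst (z j)) i" and "s i \<equiv> sample_rank n (\<lambda>j. snd (z j)) i"
  shows "emeasure (beta_kernel n z i) (A \<times> B) = emeasure (beta_law (r i) (n + 1 - r i)) A * emeasure (beta_law (s i) (n + 1 - s i)) B"
proof -
  interpret B: subprob_space "beta_law (s i) (n + 1 - s i)" unfolding s_def by (rule subprob_beta_law) (rule sample_rank_bounds)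
  show ?thesis unfolding beta_kernel_def Let_def r_def[symmetric] s_def[symmetric]
    using assms by (intro B.emeasure_pair_measure_Times) auto
qed

text \<open>The beta laws of all ranks average to the uniform law, because the Bernstein polynomials
  of one degree sum to 1.\<close>

lemma average_beta_law:
  assumes n: "0 < n" and inj: "\<And>i j. i < n \<Longrightarrow> j < n \<Longrightarrow> x i = x j \<Longrightarrow> i = j" and u: "0 \<le> u" "u \<le> 1"
  shows "(\<integral>\<^sup>+i. emeasure (beta_law (sample_rank n x i) (n + 1 - sample_rank n x i)) {..u} \<partial>measure_pmf (pmf_of_set {..<n})) = ennreal u"
proof -
  have ne: "{..<n} \<noteq> {}" using n by auto
  have "(\<integral>\<^sup>+i. emeasure (beta_law (sample_rank n x i) (n + 1 - sample_rank n x i)) {..u} \<partial>measure_pmf (pmf_of_set {..<n}))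
    = (\<Sum>i<n. emeasure (beta_law (sample_rank n x i) (n + 1 - sample_rank n x i)) {..u}) / of_nat n"
    using ne by (subst nn_integral_pmf_of_set) auto
  also have "(\<Sum>i<n. emeasure (beta_law (sample_rank n x i) (n + 1 - sample_rank n x i)) {..u}) = (\<Sum>r\<in>{1..n}. emeasure (beta_law r (n + 1 - r)) {..u})"
    by (rule sum.reindex_bij_betw[OF sample_rank_bij[OF inj]])
  also have "\<dots> = (\<Sum>r\<in>{1..n}. ennreal (real n * bw u (n - 1) (r - 1)))"
    using u by (intro sum.cong refl emeasure_beta_law) auto
  also have "\<dots> = ennreal (\<Sum>r\<in>{1..n}. real n * bw u (n - 1) (r - 1))"
    using u by (intro sum_ennreal) (auto intro!: mult_nonneg_nonneg bw_bounds)
  also have "(\<Sum>r\<in>{1..n}. real n * bw u (n - 1) (r - 1)) = (\<Sum>k\<le>n - 1. real n * bw u (n - 1) k)"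
    using n by (intro sum.reindex_bij_witness[of _ Suc "\<lambda>r. r - 1"]) auto
  also have "\<dots> = real n * integral {0..u} (\<lambda>x. \<Sum>k\<le>n - 1. Bernstein (n - 1) k x)"
    unfolding bw_def sum_distrib_left[symmetric]
    by (subst integral_sum) (auto intro: integrable_continuous_interval continuous_Bernstein)
  also have "\<dots> = real n * u" using u by simp
  also have "ennreal (real n * u) / of_nat n = ennreal u"
    using n u by (simp add: ennreal_of_nat_eq_real_of_nat divide_ennreal)
  finally show ?thesis .
qed

text \<open>Exact, not asymptotic, uniformity: the other coordinate integrates out and the ranks run
  through \<open>1..n\<close>. The analysis of laws with uniform margins thereby applies to the
  resampling law.\<close>

lemma uniform_coord_boot_base:
  assumes n: "0 < n"
  shows "(\<And>i j. i < n \<Longrightarrow> j < n \<Longrightarrow> fst (z i) = fst (z j) \<Longrightarrow> i = j) \<Longrightarrow> uniform_coord (boot_base n z) cl\<^sub>1"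
    and "(\<And>i j. i < n \<Longrightarrow> j < n \<Longrightarrow> snd (z i) = snd (z j) \<Longrightarrow> i = j) \<Longrightarrow> uniform_coord (boot_base n z) cl\<^sub>2"
proof -
  interpret B: prob_space "boot_base n z" by (rule prob_boot_base[OF n])
  \<comment> \<open>Clamping changes the event at level 1 only, where it becomes the whole
    space.\<close>
  have cl: "clamp01 x \<le> u \<longleftrightarrow> x \<le> u \<or> u = 1" if "0 \<le> u" "u \<le> 1" for u x
    using that unfolding clamp01_def by auto
  have cl_meas: "cl\<^sub>1 \<in> borel_measurable (boot_base n z)" "cl\<^sub>2 \<in> borel_measurable (boot_base n z)"
  proof -
    have "(fst :: real \<times> real \<Rightarrow> real) \<in> borel_measurable borel" "(snd :: real \<times> real \<Rightarrow> real) \<in> borel_measurable borel"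
      by (auto intro!: borel_measurable_continuous_onI continuous_intros)
    then have "cl\<^sub>1 \<in> borel_measurable borel" "cl\<^sub>2 \<in> borel_measurable borel"
      by (auto intro: measurable_compose[OF _ clamp01_measurable])
    then show "cl\<^sub>1 \<in> borel_measurable (boot_base n z)" "cl\<^sub>2 \<in> borel_measurable (boot_base n z)"
      by (simp_all cong: measurable_cong_sets)
  qed
  have bsets: "{..u} \<in> sets borel" "UNIV \<in> sets borel" for u :: real by auto
  have full: "emeasure (beta_law (sample_rank n x i) (n + 1 - sample_rank n x i)) UNIV = 1" if "i < n" for i x
  proof -
    interpret prob_space "beta_law (sample_rank n x i) (n + 1 - sample_rank n x i)"
      by (intro prob_space_beta_law sample_rank_bounds that)
    show ?thesis using emeasure_space_1 by (simp only: space_beta_law)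
  qed
  have set: "set_pmf (pmf_of_set {..<n}) = {..<n}" using n by (intro set_pmf_of_set) auto
  {
    assume inj: "\<And>i j. i < n \<Longrightarrow> j < n \<Longrightarrow> fst (z i) = fst (z j) \<Longrightarrow> i = j"
    have "B.prob {x \<in> space (boot_base n z). cl\<^sub>1 x \<le> u} = u" if u: "0 \<le> u" "u \<le> 1" for u
    proof (cases "u = 1")
      case True
      then show ?thesis using clamp01_range B.prob_space by simp
    next
      case False
      have "emeasure (boot_base n z) ({..u} \<times> UNIV) = (\<integral>\<^sup>+i. emeasure (beta_kernel n z i) ({..u} \<times> UNIV) \<partial>measure_pmf (pmf_of_set {..<n}))"
        by (rule emeasure_boot_base) (simp add: borel_prod[symmetric])
      also have "\<dots> = (\<integral>\<^sup>+i. emeasure (beta_law (sample_rank n (\<lambda>j. fst (z j)) i) (n + 1 - sample_rank n (\<lambda>j. fst (z j)) i)) {..u} \<partial>measure_pmf (pmf_of_set {..<n}))"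
      proof (intro nn_integral_cong_AE AE_pmfI)
        fix i assume "i \<in> set_pmf (pmf_of_set {..<n})"
        then have "i < n" by (simp add: set)
        then show "emeasure (beta_kernel n z i) ({..u} \<times> UNIV) = emeasure (beta_law (sample_rank n (\<lambda>j. fst (z j)) i) (n + 1 - sample_rank n (\<lambda>j. fst (z j)) i)) {..u}"
          by (simp only: emeasure_beta_kernel_Times[OF bsets(1,2)] full mult_1_right)
      qed
      also have "\<dots> = ennreal u" by (rule average_beta_law[OF n _ u]) (rule inj)
      finally have "B.prob ({..u} \<times> UNIV) = u" using u by (simp add: measure_def)
      moreover have "{x \<in> space (boot_base n z). cl\<^sub>1 x \<le> u} = {..u} \<times> UNIV"
        by (rule set_eqI) (simp add: cl[OF u] False mem_Times_iff)
      ultimately show ?thesis by simp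
    qed
    then show "uniform_coord (boot_base n z) cl\<^sub>1"
      by (intro uniform_coord.intro uniform_coord_axioms.intro B.prob_space_axioms conjI clamp01_range cl_meas)
  }
  {
    assume inj: "\<And>i j. i < n \<Longrightarrow> j < n \<Longrightarrow> snd (z i) = snd (z j) \<Longrightarrow> i = j"
    have "B.prob {x \<in> space (boot_base n z). cl\<^sub>2 x \<le> u} = u" if u: "0 \<le> u" "u \<le> 1" for u
    proof (cases "u = 1")
      case True
      then show ?thesis using clamp01_range B.prob_space by simp
    next
      case False
      have "emeasure (boot_base n z) (UNIV \<times> {..u}) = (\<integral>\<^sup>+i. emeasure (beta_kernel n z i) (UNIV \<times> {..u}) \<partial>measure_pmf (pmf_of_set {..<n}))"
        by (rule emeasure_boot_base) (simp add: borel_prod[symmetric])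
      also have "\<dots> = (\<integral>\<^sup>+i. emeasure (beta_law (sample_rank n (\<lambda>j. snd (z j)) i) (n + 1 - sample_rank n (\<lambda>j. snd (z j)) i)) {..u} \<partial>measure_pmf (pmf_of_set {..<n}))"
      proof (intro nn_integral_cong_AE AE_pmfI)
        fix i assume "i \<in> set_pmf (pmf_of_set {..<n})"
        then have "i < n" by (simp add: set)
        then show "emeasure (beta_kernel n z i) (UNIV \<times> {..u}) = emeasure (beta_law (sample_rank n (\<lambda>j. snd (z j)) i) (n + 1 - sample_rank n (\<lambda>j. snd (z j)) i)) {..u}"
          by (simp only: emeasure_beta_kernel_Times[OF bsets(2,1)] full mult_1)
      qed
      also have "\<dots> = ennreal u" by (rule average_beta_law[OF n _ u]) (rule inj)
      finally have "B.prob (UNIV \<times> {..u}) = u" using u by (simp add: measure_def)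
      moreover have "{x \<in> space (boot_base n z). cl\<^sub>2 x \<le> u} = UNIV \<times> {..u}"
        by (rule set_eqI) (simp add: cl[OF u] False mem_Times_iff)
      ultimately show ?thesis by simp
    qed
    then show "uniform_coord (boot_base n z) cl\<^sub>2"
      by (intro uniform_coord.intro uniform_coord_axioms.intro B.prob_space_axioms conjI clamp01_range cl_meas)
  }
qed

section \<open>Bootstrap expectations against averages over ranks\<close>

definition lipschitz_square :: "real \<Rightarrow> (real \<Rightarrow> real \<Rightarrow> real) \<Rightarrow> bool" where
  "lipschitz_square L f \<longleftrightarrow> 0 < L \<and> case_prod f \<in> borel_measurable borel \<and>
    (\<forall>x\<in>{0..1}. \<forall>y\<in>{0..1}. \<forall>x'\<in>{0..1}. \<forall>y'\<in>{0..1}. \<bar>f x y - f x' y'\<bar> \<le> L * (\<bar>x - x'\<bar> + \<bar>y - y'\<bar>)) \<and>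
    (\<forall>x\<in>{0..1}. \<forall>y\<in>{0..1}. \<bar>f x y\<bar> \<le> L)"

text \<open>Each beta coordinate stays within \<open>2 / sqrt n\<close> of its normalised rank in
  the mean, and there are two coordinates.\<close>

lemma boot_base_lipschitz:
  assumes n: "0 < n" and f: "lipschitz_square L f"
  shows "\<bar>(\<integral>x. f (cl\<^sub>1 x) (cl\<^sub>2 x) \<partial>boot_base n z) - (\<Sum>i<n. f (own_ecdf n fst z i) (own_ecdf n snd z i)) / real n\<bar> \<le> 4 * L / sqrt (real n)"
proof -
  have fm[measurable]: "case_prod f \<in> borel_measurable borel" and L: "0 \<le> L" using f by (auto simp: lipschitz_square_def)
  have fcl: "(\<lambda>x. f (cl\<^sub>1 x) (cl\<^sub>2 x)) \<in> borel_measurable borel"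
    using measurable_compose[OF _ fm, of "\<lambda>x. (cl\<^sub>1 x, cl\<^sub>2 x)" borel] by (simp add: borel_prod[symmetric])
  have fb: "\<bar>f (cl\<^sub>1 x) (cl\<^sub>2 x)\<bar> \<le> L" for x
    using f clamp01_range(3) unfolding lipschitz_square_def by blast
  have one: "\<bar>(\<integral>x. f (cl\<^sub>1 x) (cl\<^sub>2 x) \<partial>beta_kernel n z i) - f (own_ecdf n fst z i) (own_ecdf n snd z i)\<bar> \<le> 4 * L / sqrt (real n)" if i: "i < n" for i
  proof -
    define r where "r = sample_rank n (\<lambda>j. fst (z j)) i"
    define s where "s = sample_rank n (\<lambda>j. snd (z j)) i"
    have r: "1 \<le> r" "r \<le> n" and s: "1 \<le> s" "s \<le> n" unfolding r_def s_def by (intro sample_rank_bounds i)+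
    define A where "A = beta_law r (n + 1 - r)"
    define B where "B = beta_law s (n + 1 - s)"
    have [measurable_cong, simp]: "sets A = sets borel" "sets B = sets borel" by (simp_all add: A_def B_def)
    interpret A: prob_space A unfolding A_def by (rule prob_space_beta_law[OF r])
    interpret B: prob_space B unfolding B_def by (rule prob_space_beta_law[OF s])
    interpret P: pair_prob_space A B by standard
    have K: "beta_kernel n z i = A \<Otimes>\<^sub>M B" unfolding beta_kernel_def Let_def A_def B_def r_def s_def ..
    define x0 where "x0 = real r / real n"
    define y0 where "y0 = real s / real n"
    have xy: "x0 \<in> {0..1}" "y0 \<in> {0..1}" using r s n by (auto simp: x0_def y0_def)
    have fcl'[measurable]: "(\<lambda>x. f (cl\<^sub>1 x) (cl\<^sub>2 x)) \<in> borel_measurable (A \<Otimes>\<^sub>M B)"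
      using fcl by (simp add: borel_prod[symmetric] cong: measurable_cong_sets sets_pair_measure_cong)
    have b1: "\<bar>clamp01 u - x0\<bar> \<le> 1" "\<bar>clamp01 u - y0\<bar> \<le> 1" for u using clamp01_range(1,2)[of u] xy by (auto simp: abs_le_iff)
    have i1: "integrable (A \<Otimes>\<^sub>M B) (\<lambda>x. f (cl\<^sub>1 x) (cl\<^sub>2 x))" using fb by (intro P.integrable_const_bound[of _ L]) auto
    have i2: "integrable (A \<Otimes>\<^sub>M B) (\<lambda>x. \<bar>cl\<^sub>1 x - x0\<bar>)" "integrable (A \<Otimes>\<^sub>M B) (\<lambda>x. \<bar>cl\<^sub>2 x - y0\<bar>)"
      using b1 by (auto intro!: P.integrable_const_bound[of _ 1])
    have "\<bar>(\<integral>x. f (cl\<^sub>1 x) (cl\<^sub>2 x) \<partial>(A \<Otimes>\<^sub>M B)) - f x0 y0\<bar> = \<bar>\<integral>x. f (cl\<^sub>1 x) (cl\<^sub>2 x) - f x0 y0 \<partial>(A \<Otimes>\<^sub>M B)\<bar>"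
      using i1 by (simp add: P.prob_space)
    also have "\<dots> \<le> (\<integral>x. L * (\<bar>cl\<^sub>1 x - x0\<bar> + \<bar>cl\<^sub>2 x - y0\<bar>) \<partial>(A \<Otimes>\<^sub>M B))"
    proof (rule order_trans[OF integral_abs_bound], rule integral_mono)
      show "\<bar>f (cl\<^sub>1 x) (cl\<^sub>2 x) - f x0 y0\<bar> \<le> L * (\<bar>cl\<^sub>1 x - x0\<bar> + \<bar>cl\<^sub>2 x - y0\<bar>)" for x
        using f clamp01_range(3) xy unfolding lipschitz_square_def by blast
    qed (use i1 i2 in auto)
    also have "\<dots> = L * ((\<integral>x. \<bar>cl\<^sub>1 x - x0\<bar> \<partial>(A \<Otimes>\<^sub>M B)) + (\<integral>x. \<bar>cl\<^sub>2 x - y0\<bar> \<partial>(A \<Otimes>\<^sub>M B)))"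
      using i2 by simp
    also have "(\<integral>x. \<bar>cl\<^sub>1 x - x0\<bar> \<partial>(A \<Otimes>\<^sub>M B)) = (\<integral>u. \<bar>clamp01 u - x0\<bar> \<partial>A)"
      using P.integral_fst'[OF i2(1)] by (simp add: B.prob_space)
    also have "(\<integral>x. \<bar>cl\<^sub>2 x - y0\<bar> \<partial>(A \<Otimes>\<^sub>M B)) = (\<integral>u. \<bar>clamp01 u - y0\<bar> \<partial>B)"
      using P.integral_fst'[OF i2(2)] by (simp add: A.prob_space)
    also have "L * ((\<integral>u. \<bar>clamp01 u - x0\<bar> \<partial>A) + (\<integral>u. \<bar>clamp01 u - y0\<bar> \<partial>B)) \<le> L * (2 / sqrt (real n) + 2 / sqrt (real n))"
      unfolding A_def B_def x0_def y0_def using L by (intro mult_left_mono add_mono beta_law_abs_dev r s)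
    finally show ?thesis unfolding K own_ecdf_rank r_def[symmetric] s_def[symmetric] x0_def y0_def by (simp add: algebra_simps)
  qed
  have "(\<integral>x. f (cl\<^sub>1 x) (cl\<^sub>2 x) \<partial>boot_base n z) - (\<Sum>i<n. f (own_ecdf n fst z i) (own_ecdf n snd z i)) / real n
    = (\<Sum>i<n. (\<integral>x. f (cl\<^sub>1 x) (cl\<^sub>2 x) \<partial>beta_kernel n z i) - f (own_ecdf n fst z i) (own_ecdf n snd z i)) / real n"
    unfolding integral_boot_base[OF n fcl fb] by (simp add: sum_subtractf diff_divide_distrib)
  also have "\<bar>\<dots>\<bar> = \<bar>\<Sum>i<n. (\<integral>x. f (cl\<^sub>1 x) (cl\<^sub>2 x) \<partial>beta_kernel n z i) - f (own_ecdf n fst z i) (own_ecdf n snd z i)\<bar> / real n"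
    by (simp add: abs_divide)
  also have "\<dots> \<le> (\<Sum>i<n. 4 * L / sqrt (real n)) / real n"
    by (intro divide_right_mono order_trans[OF sum_abs] sum_mono one) auto
  also have "\<dots> = 4 * L / sqrt (real n)" using n by simp
  finally show ?thesis .
qed


text \<open>The pivot subtracts the data statistic, the linearisation the mean under the resampling
  law. Their gap is averaged over ranks, of which only about \<open>4 * \<epsilon> * n\<close> lie
  in the window, so that even after scaling by \<open>sqrt n\<close> the surviving gap is of order
  \<epsilon>.\<close>

lemma boot_base_centering:
  assumes p: "0 \<le> p" "p \<le> 1" and acc: "bw_accurate \<epsilon> p m" and m: "1 \<le> m" and e: "0 < \<epsilon>" "\<epsilon> \<le> 1" and n: "0 < n"
    and inj1: "\<And>i j. i < n \<Longrightarrow> j < n \<Longrightarrow> fst (z i) = fst (z j) \<Longrightarrow> i = j"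
    and inj2: "\<And>i j. i < n \<Longrightarrow> j < n \<Longrightarrow> snd (z i) = snd (z j) \<Longrightarrow> i = j"
  shows "sqrt (real n) * \<bar>(\<integral>x. bphi p m (cl\<^sub>1 x) * bphi p m (cl\<^sub>2 x) \<partial>boot_base n z) - rank_stat p m n fst snd z\<bar>
    \<le> 20 * \<epsilon> + 12 / (\<epsilon> * sqrt (real n)) + 8 * sqrt (real n) / real m"
proof -
  define d where "d r = 2 / sqrt (real n) * (\<epsilon> + of_bool (\<bar>real r / real n - p\<bar> \<le> 2 * \<epsilon>)) + 4 / (\<epsilon> * real n) + 4 / real m" for r :: nat
  define r where "r = sample_rank n (\<lambda>j. fst (z j))"
  define s where "s = sample_rank n (\<lambda>j. snd (z j))"
  have fm: "(\<lambda>x. bphi p m (cl\<^sub>1 x) * bphi p m (cl\<^sub>2 x)) \<in> borel_measurable borel"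
  proof -
    have "(fst :: real \<times> real \<Rightarrow> real) \<in> borel_measurable borel" "(snd :: real \<times> real \<Rightarrow> real) \<in> borel_measurable borel"
      by (auto intro!: borel_measurable_continuous_onI continuous_intros)
    then show ?thesis
      by (intro borel_measurable_times measurable_compose[OF _ bphi_measurable] measurable_compose[OF _ clamp01_measurable])
  qed
  have fb: "\<bar>bphi p m (cl\<^sub>1 x) * bphi p m (cl\<^sub>2 x)\<bar> \<le> 1" for x
    using bphi_bounds[OF p, of m "cl\<^sub>1 x"] bphi_bounds[OF p, of m "cl\<^sub>2 x"] by (simp add: abs_mult mult_le_one)
  have one: "\<bar>(\<integral>x. bphi p m (cl\<^sub>1 x) * bphi p m (cl\<^sub>2 x) \<partial>beta_kernel n z i) - bphi p m (own_ecdf n fst z i) * bphi p m (own_ecdf n snd z i)\<bar>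
     \<le> d (r i) + d (s i)" if i: "i < n" for i
  proof -
    have ri: "1 \<le> r i" "r i \<le> n" and si: "1 \<le> s i" "s i \<le> n" unfolding r_def s_def by (intro sample_rank_bounds i)+
    define U where "U = (\<integral>x. bphi p m (clamp01 x) \<partial>beta_law (r i) (n + 1 - r i))"
    define V where "V = (\<integral>x. bphi p m (clamp01 x) \<partial>beta_law (s i) (n + 1 - s i))"
    define u where "u = bphi p m (real (r i) / real n)"
    define v where "v = bphi p m (real (s i) / real n)"
    have eq: "(\<integral>x. bphi p m (cl\<^sub>1 x) * bphi p m (cl\<^sub>2 x) \<partial>beta_kernel n z i) = U * V"
      unfolding integral_beta_kernel[OF i fm fb] U_def V_def r_def s_def by simp
    have Ub: "\<bar>U - u\<bar> \<le> d (r i)" unfolding U_def u_def d_def by (rule beta_law_bphi[OF p acc m e ri])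
    have Vb: "\<bar>V - v\<bar> \<le> d (s i)" unfolding V_def v_def d_def by (rule beta_law_bphi[OF p acc m e si])
    have u01: "0 \<le> u" "u \<le> 1" unfolding u_def by (rule bphi_bounds[OF p])+
    have V01: "0 \<le> V" "V \<le> 1"
    proof -
      interpret prob_space "beta_law (s i) (n + 1 - s i)" by (rule prob_space_beta_law[OF si])
      show "0 \<le> V" unfolding V_def using bphi_bounds[OF p] by (intro integral_nonneg_AE) auto
      have "V \<le> (\<integral>x. 1 \<partial>beta_law (s i) (n + 1 - s i))" unfolding V_def
      proof (rule integral_mono)
        show "integrable (beta_law (s i) (n + 1 - s i)) (\<lambda>x. bphi p m (clamp01 x))"
          using bphi_bounds[OF p] by (intro integrable_const_bound[of _ 1]) auto
        show "integrable (beta_law (s i) (n + 1 - s i)) (\<lambda>x. 1 :: real)" by (rule integrable_const)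
      qed (rule bphi_bounds[OF p])
      also have "\<dots> = 1" using prob_space by (simp only: lebesgue_integral_const scaleR_one)
      finally show "V \<le> 1" .
    qed
    have "U * V - u * v = (U - u) * V + u * (V - v)" by (simp add: algebra_simps)
    also have "\<bar>\<dots>\<bar> \<le> \<bar>U - u\<bar> * 1 + 1 * \<bar>V - v\<bar>"
      using u01 V01 by (intro order_trans[OF abs_triangle_ineq] add_mono) (auto simp: abs_mult intro!: mult_left_le mult_left_le_one_le)
    also have "\<dots> \<le> d (r i) + d (s i)" using Ub Vb by simp
    finally show ?thesis unfolding eq own_ecdf_rank u_def v_def r_def s_def .
  qed
  \<comment> \<open>Both rank vectors are permutations of \<open>1..n\<close>, so the two sums
    coincide and no longer depend on the data.\<close>
  have sumd: "(\<Sum>i<n. d (r i)) + (\<Sum>i<n. d (s i)) = 2 * (\<Sum>k\<in>{1..n}. d k)"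
  proof -
    have "(\<Sum>i<n. d (r i)) = (\<Sum>k\<in>{1..n}. d k)"
      unfolding r_def by (rule sum.reindex_bij_betw[OF sample_rank_bij]) (rule inj1)
    moreover have "(\<Sum>i<n. d (s i)) = (\<Sum>k\<in>{1..n}. d k)"
      unfolding s_def by (rule sum.reindex_bij_betw[OF sample_rank_bij]) (rule inj2)
    ultimately show ?thesis by linarith
  qed
  have cnt: "(\<Sum>k\<in>{1..n}. of_bool (\<bar>real k / real n - p\<bar> \<le> 2 * \<epsilon>)) \<le> 4 * \<epsilon> * real n + (1::real)"
  proof -
    define S where "S = {k::nat. real n * (p - 2 * \<epsilon>) \<le> real k \<and> real k \<le> real n * (p + 2 * \<epsilon>)}"
    have le: "real n * (p - 2 * \<epsilon>) \<le> real n * (p + 2 * \<epsilon>)" using e by (intro mult_left_mono) auto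
    have fin: "finite S" unfolding S_def by (rule card_nat_closed[OF le])
    have "(\<Sum>k\<in>{1..n}. of_bool (\<bar>real k / real n - p\<bar> \<le> 2 * \<epsilon>)) = real (card ({1..n} \<inter> {k. \<bar>real k / real n - p\<bar> \<le> 2 * \<epsilon>}))"
      by (simp add: of_bool_def sum.If_cases)
    also have "card ({1..n} \<inter> {k. \<bar>real k / real n - p\<bar> \<le> 2 * \<epsilon>}) \<le> card S"
    proof (rule card_mono[OF fin], rule subsetI)
      fix k assume "k \<in> {1..n} \<inter> {k. \<bar>real k / real n - p\<bar> \<le> 2 * \<epsilon>}"
      then have k: "\<bar>real k / real n - p\<bar> \<le> 2 * \<epsilon>" by blast
      have n0: "0 < real n" using n by simp
      have "p - 2 * \<epsilon> \<le> real k / real n" "real k / real n \<le> p + 2 * \<epsilon>" using k by linarith+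
      then have "(p - 2 * \<epsilon>) * real n \<le> real k" "real k \<le> (p + 2 * \<epsilon>) * real n"
        unfolding pos_le_divide_eq[OF n0] pos_divide_le_eq[OF n0] .
      then show "k \<in> S" unfolding S_def mem_Collect_eq mult.commute[of "real n"] by blast
    qed
    also have "real (card S) \<le> real n * (p + 2 * \<epsilon>) - real n * (p - 2 * \<epsilon>) + 1"
      unfolding S_def by (rule card_nat_closed(2)[OF le])
    also have "\<dots> = 4 * \<epsilon> * real n + 1" by (simp add: algebra_simps)
    finally show ?thesis by simp
  qed
  define R where "R = sqrt (real n)"
  have R: "1 \<le> R" "R * R = real n" using n by (auto simp: R_def)
  have "(\<Sum>k\<in>{1..n}. d k) = 2 / R * (real n * \<epsilon> + (\<Sum>k\<in>{1..n}. of_bool (\<bar>real k / real n - p\<bar> \<le> 2 * \<epsilon>))) + real n * (4 / (\<epsilon> * real n)) + real n * (4 / real m)"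
  proof -
    have "(\<Sum>k\<in>{1..n}. c * (\<epsilon> + h k) + a + b) = c * (real n * \<epsilon> + (\<Sum>k\<in>{1..n}. h k)) + real n * a + real n * b"
      for c a b and h :: "nat \<Rightarrow> real"
      by (simp only: sum.distrib sum_distrib_left[symmetric] sum_constant card_atLeastAtMost) simp
    then show ?thesis unfolding d_def R_def .
  qed
  also have "\<dots> \<le> 2 / R * (real n * \<epsilon> + (4 * \<epsilon> * real n + 1)) + real n * (4 / (\<epsilon> * real n)) + real n * (4 / real m)"
    using cnt R by (intro add_mono mult_left_mono) auto
  finally have D: "(\<Sum>k\<in>{1..n}. d k) \<le> 2 / R * (real n * \<epsilon> + (4 * \<epsilon> * real n + 1)) + real n * (4 / (\<epsilon> * real n)) + real n * (4 / real m)" .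
  have "(\<integral>x. bphi p m (cl\<^sub>1 x) * bphi p m (cl\<^sub>2 x) \<partial>boot_base n z) - rank_stat p m n fst snd z
    = (\<Sum>i<n. (\<integral>x. bphi p m (cl\<^sub>1 x) * bphi p m (cl\<^sub>2 x) \<partial>beta_kernel n z i) - bphi p m (own_ecdf n fst z i) * bphi p m (own_ecdf n snd z i)) / real n"
    unfolding integral_boot_base[OF n fm fb] rank_stat_def by (simp add: sum_subtractf diff_divide_distrib)
  then have "\<bar>(\<integral>x. bphi p m (cl\<^sub>1 x) * bphi p m (cl\<^sub>2 x) \<partial>boot_base n z) - rank_stat p m n fst snd z\<bar>
    = \<bar>\<Sum>i<n. (\<integral>x. bphi p m (cl\<^sub>1 x) * bphi p m (cl\<^sub>2 x) \<partial>beta_kernel n z i) - bphi p m (own_ecdf n fst z i) * bphi p m (own_ecdf n snd z i)\<bar> / real n"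
    by (simp add: abs_divide)
  also have "\<dots> \<le> (\<Sum>i<n. d (r i) + d (s i)) / real n"
    by (intro divide_right_mono order_trans[OF sum_abs] sum_mono one) auto
  also have "\<dots> = 2 * (\<Sum>k\<in>{1..n}. d k) / real n" unfolding sum.distrib sumd ..
  also have "\<dots> \<le> 2 * (2 / R * (real n * \<epsilon> + (4 * \<epsilon> * real n + 1)) + real n * (4 / (\<epsilon> * real n)) + real n * (4 / real m)) / real n"
    using D by (intro divide_right_mono mult_left_mono) auto
  finally have "R * \<bar>(\<integral>x. bphi p m (cl\<^sub>1 x) * bphi p m (cl\<^sub>2 x) \<partial>boot_base n z) - rank_stat p m n fst snd z\<bar>
    \<le> R * (2 * (2 / R * (real n * \<epsilon> + (4 * \<epsilon> * real n + 1)) + real n * (4 / (\<epsilon> * real n)) + real n * (4 / real m)) / real n)"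
    using R by (intro mult_left_mono) auto
  \<comment> \<open>Five multiples of \<open>\<epsilon> * n\<close> are present, one from the smooth
    part and four from the window; each coordinate carries a factor 2.\<close>
  also have "\<dots> = 20 * \<epsilon> + 4 / (R * R) + 8 / (\<epsilon> * R) + 8 * R / real m"
    unfolding R(2)[symmetric] using R(1) e m by (simp add: field_simps)
  also have "4 / (R * R) \<le> 4 / (\<epsilon> * R)"
    using R(1) e by (intro divide_left_mono mult_right_mono) auto
  also have "20 * \<epsilon> + 4 / (\<epsilon> * R) + 8 / (\<epsilon> * R) + 8 * R / real m = 20 * \<epsilon> + 12 / (\<epsilon> * R) + 8 * R / real m"
    by (simp add: add_divide_distrib[symmetric])
  finally show ?thesis unfolding R_def by simp
qed

section \<open>Continuity of the asymptotic variance\<close>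

lemma lipschitz_squareD:
  assumes "lipschitz_square L f"
  shows "0 < L" "case_prod f \<in> borel_measurable borel"
    "\<And>x y x' y'. x \<in> {0..1} \<Longrightarrow> y \<in> {0..1} \<Longrightarrow> x' \<in> {0..1} \<Longrightarrow> y' \<in> {0..1} \<Longrightarrow> \<bar>f x y - f x' y'\<bar> \<le> L * (\<bar>x - x'\<bar> + \<bar>y - y'\<bar>)"
    "\<And>x y. x \<in> {0..1} \<Longrightarrow> y \<in> {0..1} \<Longrightarrow> \<bar>f x y\<bar> \<le> L"
  using assms unfolding lipschitz_square_def by blast+

lemma lipschitz_square_swap:
  assumes "lipschitz_square L f"
  shows "lipschitz_square L (\<lambda>x y. f y x)"
proof -
  note D = lipschitz_squareD[OF assms]
  have "(\<lambda>z. case_prod f (snd z, fst z)) \<in> borel_measurable borel"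
    using D(2) by (intro measurable_compose[OF _ D(2)]) (auto intro!: borel_measurable_continuous_onI continuous_intros)
  then have "case_prod (\<lambda>x y. f y x) \<in> borel_measurable borel" by (simp add: case_prod_unfold)
  moreover have "\<bar>f y x - f y' x'\<bar> \<le> L * (\<bar>x - x'\<bar> + \<bar>y - y'\<bar>)"
    if "x \<in> {0..1}" "y \<in> {0..1}" "x' \<in> {0..1}" "y' \<in> {0..1}" for x y x' y'
    using D(3)[of y x y' x'] that by (simp only: add.commute)
  ultimately show ?thesis unfolding lipschitz_square_def using D(1,4) by blast
qed

lemma lipschitz_square_compose:
  assumes f: "lipschitz_square L f" and g: "g \<in> borel_measurable N" and h: "h \<in> borel_measurable N"
  shows "(\<lambda>x. f (g x) (h x)) \<in> borel_measurable N"
proof -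
  have "(\<lambda>x. case_prod f (g x, h x)) \<in> borel_measurable N"
    using g h by (intro measurable_compose[OF _ lipschitz_squareD(2)[OF f]]) auto
  then show ?thesis by simp
qed

lemma clamp01_lipschitz: "\<bar>clamp01 x - clamp01 y\<bar> \<le> \<bar>x - y\<bar>"
  unfolding clamp01_def by (auto simp: max_def min_def)

text \<open>A Lipschitz approximation of \<open>of_bool (u < p) * hinge p v * (of_bool (s \<le> u) - u)\<close>.\<close>

definition smooth_kernel :: "real \<Rightarrow> real \<Rightarrow> real \<Rightarrow> real \<Rightarrow> real \<Rightarrow> real" where
  "smooth_kernel p d s u v = clamp01 ((p - u) / d) * hinge p v * (clamp01 ((u - s) / d + 1) - u)"

lemma abs_sum3:
  fixes x y z :: real
  shows "\<bar>x\<bar> \<le> a \<Longrightarrow> \<bar>y\<bar> \<le> b \<Longrightarrow> \<bar>z\<bar> \<le> c \<Longrightarrow> \<bar>x + y + z\<bar> \<le> a + b + c"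
  by linarith

lemma product_lipschitz:
  fixes a b c :: real
  assumes "\<bar>a\<bar> \<le> 1" "\<bar>b'\<bar> \<le> 1" "\<bar>b\<bar> \<le> 1" "\<bar>c\<bar> \<le> 1" "\<bar>c'\<bar> \<le> 1" "\<bar>a'\<bar> \<le> 1"
  shows "\<bar>a * b * c - a' * b' * c'\<bar> \<le> \<bar>a - a'\<bar> + \<bar>b - b'\<bar> + \<bar>c - c'\<bar>"
proof -
  have 1: "\<bar>(a - a') * (b * c)\<bar> \<le> \<bar>a - a'\<bar> * 1"
    unfolding abs_mult using assms by (intro mult_left_mono mult_le_one) auto
  have 2: "\<bar>(b - b') * (a' * c)\<bar> \<le> \<bar>b - b'\<bar> * 1"
    unfolding abs_mult using assms by (intro mult_left_mono mult_le_one) auto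
  have 3: "\<bar>(c - c') * (a' * b')\<bar> \<le> \<bar>c - c'\<bar> * 1"
    unfolding abs_mult using assms by (intro mult_left_mono mult_le_one) auto
  have "a * b * c - a' * b' * c' = (a - a') * (b * c) + (b - b') * (a' * c) + (c - c') * (a' * b')"
    by (simp add: algebra_simps)
  then show ?thesis using abs_sum3[OF 1 2 3] by simp
qed

text \<open>Two ramps of slope \<open>1 / d\<close> and the linear term give
  \<open>2 / d + 1\<close> in \<open>u\<close>; all factors are bounded by 1.\<close>

lemma smooth_kernel_lipschitz:
  assumes p: "0 \<le> p" "p \<le> 1" and d: "0 < d"
  shows "lipschitz_square (2 / d + 1) (smooth_kernel p d s)"
proof -
  have H: "\<bar>hinge p y\<bar> \<le> 1" if "y \<in> {0..1}" for y using hinge_bounds[OF p, of y] that by auto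
  have C: "\<bar>clamp01 y\<bar> \<le> 1" for y using clamp01_range(1,2)[of y] by simp
  have K: "\<bar>clamp01 y - x\<bar> \<le> 1" if "x \<in> {0..1}" for x y using clamp01_range(1,2)[of y] that by (auto simp: abs_le_iff)
  have lip: "\<bar>smooth_kernel p d s x y - smooth_kernel p d s x' y'\<bar> \<le> (2 / d + 1) * (\<bar>x - x'\<bar> + \<bar>y - y'\<bar>)"
    if "x \<in> {0..1}" "y \<in> {0..1}" "x' \<in> {0..1}" "y' \<in> {0..1}" for x y x' y'
  proof -
    have "\<bar>clamp01 ((p - x) / d) - clamp01 ((p - x') / d)\<bar> \<le> \<bar>x - x'\<bar> / d"
    proof -
      have "(p - x) / d - (p - x') / d = - (x - x') / d" by (simp add: diff_divide_distrib)
      then show ?thesis using clamp01_lipschitz[of "(p - x) / d" "(p - x') / d"] d by (simp add: abs_minus_commute)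
    qed
    moreover have "\<bar>(clamp01 ((x - s) / d + 1) - x) - (clamp01 ((x' - s) / d + 1) - x')\<bar> \<le> \<bar>x - x'\<bar> / d + \<bar>x - x'\<bar>"
    proof -
      have "((x - s) / d + 1) - ((x' - s) / d + 1) = (x - x') / d" by (simp add: diff_divide_distrib)
      then have "\<bar>clamp01 ((x - s) / d + 1) - clamp01 ((x' - s) / d + 1)\<bar> \<le> \<bar>x - x'\<bar> / d"
        using clamp01_lipschitz[of "(x - s) / d + 1" "(x' - s) / d + 1"] d by simp
      then show ?thesis by linarith
    qed
    moreover have "\<bar>hinge p y - hinge p y'\<bar> \<le> \<bar>y - y'\<bar>" by (rule hinge_lipschitz)
    moreover have "\<bar>smooth_kernel p d s x y - smooth_kernel p d s x' y'\<bar> \<le> \<bar>clamp01 ((p - x) / d) - clamp01 ((p - x') / d)\<bar>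
       + \<bar>hinge p y - hinge p y'\<bar> + \<bar>(clamp01 ((x - s) / d + 1) - x) - (clamp01 ((x' - s) / d + 1) - x')\<bar>"
      unfolding smooth_kernel_def using that by (intro product_lipschitz C H K)
    ultimately have "\<bar>smooth_kernel p d s x y - smooth_kernel p d s x' y'\<bar> \<le> \<bar>x - x'\<bar> / d + \<bar>y - y'\<bar> + (\<bar>x - x'\<bar> / d + \<bar>x - x'\<bar>)"
      by linarith
    also have "\<dots> \<le> (2 / d + 1) * (\<bar>x - x'\<bar> + \<bar>y - y'\<bar>)"
    proof -
      have "0 \<le> 2 / d * \<bar>y - y'\<bar>" using d by simp
      then show ?thesis by (simp add: algebra_simps)
    qed
    finally show ?thesis .
  qed
  have bd: "\<bar>smooth_kernel p d s x y\<bar> \<le> 2 / d + 1" if "x \<in> {0..1}" "y \<in> {0..1}" for x y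
  proof -
    have "\<bar>smooth_kernel p d s x y\<bar> \<le> 1"
      unfolding smooth_kernel_def abs_mult using that C H K by (intro mult_le_one) auto
    moreover have "0 \<le> 2 / d" using d by simp
    ultimately show ?thesis by linarith
  qed
  have m: "case_prod (smooth_kernel p d s) \<in> borel_measurable borel"
    unfolding smooth_kernel_def case_prod_unfold
    by (intro borel_measurable_times borel_measurable_diff measurable_compose[OF _ clamp01_measurable] measurable_compose[OF _ hinge_measurable])
      (use d in \<open>auto intro!: borel_measurable_continuous_onI continuous_intros\<close>)
  have "0 < 2 / d + 1" using d by (simp add: add_pos_pos)
  then show ?thesis unfolding lipschitz_square_def using m lip bd by blast
qed

text \<open>Beyond distance \<open>d\<close> from its jump each ramp coincides with the indicator
  that it replaces.\<close>

lemma smooth_kernel_error: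
  assumes p: "0 \<le> p" "p \<le> 1" and d: "0 < d" and uv: "u \<in> {0..1}" "v \<in> {0..1}"
  shows "\<bar>of_bool (u < p) * hinge p v * (of_bool (s \<le> u) - u) - smooth_kernel p d s u v\<bar>
    \<le> of_bool (\<bar>u - p\<bar> \<le> d) + of_bool (\<bar>u - s\<bar> \<le> d)"
proof -
  have H: "\<bar>hinge p v\<bar> \<le> 1" using hinge_bounds[OF p, of v] uv by auto
  have C: "\<bar>clamp01 y\<bar> \<le> 1" for y using clamp01_range(1,2)[of y] by simp
  have K: "\<bar>clamp01 y - u\<bar> \<le> 1" "\<bar>of_bool (s \<le> u) - u\<bar> \<le> 1" for y using clamp01_range(1,2)[of y] uv by (auto simp: abs_le_iff)
  have 1: "\<bar>of_bool (u < p) - clamp01 ((p - u) / d)\<bar> \<le> of_bool (\<bar>u - p\<bar> \<le> d)"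
  proof (cases "\<bar>u - p\<bar> \<le> d")
    case True
    then show ?thesis using clamp01_range(1,2)[of "(p - u) / d"] by auto
  next
    case False
    then have "p - u > d \<or> p - u < - d" by linarith
    then have "clamp01 ((p - u) / d) = of_bool (u < p)"
    proof
      assume a: "p - u > d"
      then have "1 \<le> (p - u) / d" using d by (simp add: pos_le_divide_eq)
      moreover have "u < p" using a d by linarith
      ultimately show ?thesis by (simp add: clamp01_def)
    next
      assume a: "p - u < - d"
      then have "(p - u) / d \<le> 0" using d by (simp add: divide_nonpos_pos)
      moreover have "\<not> u < p" using a d by linarith
      ultimately show ?thesis by (simp add: clamp01_def)
    qed
    then show ?thesis by simp
  qed
  have 2: "\<bar>(of_bool (s \<le> u) - u) - (clamp01 ((u - s) / d + 1) - u)\<bar> \<le> of_bool (\<bar>u - s\<bar> \<le> d)"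
  proof (cases "\<bar>u - s\<bar> \<le> d")
    case True
    then show ?thesis using clamp01_range(1,2)[of "(u - s) / d + 1"] by auto
  next
    case False
    then have "u - s > d \<or> u - s < - d" by linarith
    then have "clamp01 ((u - s) / d + 1) = of_bool (s \<le> u)"
    proof
      assume a: "u - s > d"
      then have "0 \<le> (u - s) / d" using d by simp
      moreover have "s \<le> u" using a d by linarith
      ultimately show ?thesis by (simp add: clamp01_def)
    next
      assume a: "u - s < - d"
      then have "(u - s) / d \<le> -1" using d by (simp add: pos_divide_le_eq)
      moreover have "\<not> s \<le> u" using a d by linarith
      ultimately show ?thesis by (simp add: clamp01_def)
    qed
    then show ?thesis by simp
  qed
  have "\<bar>of_bool (u < p) * hinge p v * (of_bool (s \<le> u) - u) - smooth_kernel p d s u v\<bar>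
    \<le> \<bar>of_bool (u < p) - clamp01 ((p - u) / d)\<bar> + \<bar>hinge p v - hinge p v\<bar> + \<bar>(of_bool (s \<le> u) - u) - (clamp01 ((u - s) / d + 1) - u)\<bar>"
    unfolding smooth_kernel_def by (intro product_lipschitz C H K) auto
  then show ?thesis using 1 2 by simp
qed

section \<open>Projections and influence functions under a change of law\<close>

context uniform_coord
begin

text \<open>The two indicators differ only if the coordinate lies between \<open>s\<close> and
  \<open>t\<close>, an event of probability at most \<open>\<bar>s - t\<bar>\<close>. Hence
  projections are Lipschitz although their integrand jumps.\<close>

lemma proj_lipschitz:
  assumes [measurable]: "a \<in> borel_measurable M" and a: "\<And>x. \<bar>a x\<bar> \<le> 1"
  shows "\<bar>proj a s - proj a t\<bar> \<le> \<bar>s - t\<bar>"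
proof -
  have K: "\<bar>a x * (of_bool (s \<le> c x) - c x)\<bar> \<le> 1" for x s
  proof -
    have "\<bar>of_bool (s \<le> c x) - c x\<bar> \<le> 1" using c_range[of x] by auto
    then show ?thesis using a[of x] by (simp add: abs_mult mult_le_one)
  qed
  have i: "integrable M (\<lambda>x. a x * (of_bool (s \<le> c x) - c x))" for s
    using K by (intro integrable_const_bound[of _ 1]) auto
  have ii: "integrable M (\<lambda>x. of_bool (\<bar>c x - (s + t) / 2\<bar> \<le> \<bar>s - t\<bar> / 2) :: real)"
    by (intro integrable_const_bound[of _ 1]) auto
  have "proj a s - proj a t = (\<integral>x. a x * (of_bool (s \<le> c x) - c x) - a x * (of_bool (t \<le> c x) - c x) \<partial>M)"
    unfolding proj_def using i by simp
  also have "\<bar>\<dots>\<bar> \<le> (\<integral>x. of_bool (\<bar>c x - (s + t) / 2\<bar> \<le> \<bar>s - t\<bar> / 2) \<partial>M)"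
  proof (rule order_trans[OF integral_abs_bound], rule integral_mono)
    fix x
    have "a x * (of_bool (s \<le> c x) - c x) - a x * (of_bool (t \<le> c x) - c x) = a x * (of_bool (s \<le> c x) - of_bool (t \<le> c x))"
      by (simp add: algebra_simps)
    also have "\<bar>\<dots>\<bar> \<le> 1 * \<bar>of_bool (s \<le> c x) - of_bool (t \<le> c x)\<bar>"
      unfolding abs_mult using a by (intro mult_right_mono) auto
    also have "\<dots> \<le> of_bool (\<bar>c x - (s + t) / 2\<bar> \<le> \<bar>s - t\<bar> / 2)"
      by (auto simp: of_bool_def abs_le_iff abs_if field_simps)
    finally show "\<bar>a x * (of_bool (s \<le> c x) - c x) - a x * (of_bool (t \<le> c x) - c x)\<bar> \<le> of_bool (\<bar>c x - (s + t) / 2\<bar> \<le> \<bar>s - t\<bar> / 2)" .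
  qed (use i ii in auto)
  also have "\<dots> \<le> 2 * (\<bar>s - t\<bar> / 2)" by (rule integral_c_near) simp
  finally show ?thesis by simp
qed

text \<open>Two windows of radius \<open>d\<close>, around \<open>p\<close> and around
  \<open>s\<close>, each of probability at most \<open>2 * d\<close>.\<close>

lemma proj_smooth_kernel:
  assumes p: "0 \<le> p" "p \<le> 1" and d: "0 < d" and e[measurable]: "e \<in> borel_measurable M" and er: "\<And>x. e x \<in> {0..1}"
  shows "\<bar>proj (\<lambda>x. of_bool (c x < p) * hinge p (e x)) s - (\<integral>x. smooth_kernel p d s (c x) (e x) \<partial>M)\<bar> \<le> 4 * d"
proof -
  have cr: "c x \<in> {0..1}" for x using c_range[of x] by auto
  have m: "(\<lambda>x. smooth_kernel p d s (c x) (e x)) \<in> borel_measurable M"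
    by (rule lipschitz_square_compose[OF smooth_kernel_lipschitz[OF p d]]) measurable
  have i1: "integrable M (\<lambda>x. smooth_kernel p d s (c x) (e x))"
    using lipschitz_squareD(4)[OF smooth_kernel_lipschitz[OF p d]] cr er m
    by (intro integrable_const_bound[of _ "2 / d + 1"]) auto
  have m2: "(\<lambda>x. of_bool (c x < p) * hinge p (e x) * (of_bool (s \<le> c x) - c x)) \<in> borel_measurable M" by measurable
  have K: "\<bar>of_bool (c x < p) * hinge p (e x) * (of_bool (s \<le> c x) - c x)\<bar> \<le> 1" for x
  proof -
    have "\<bar>of_bool (s \<le> c x) - c x\<bar> \<le> 1" "\<bar>hinge p (e x)\<bar> \<le> 1" "\<bar>of_bool (c x < p) :: real\<bar> \<le> 1"
      using cr[of x] er[of x] hinge_bounds[OF p, of "e x"] by auto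
    then show ?thesis unfolding abs_mult by (intro mult_le_one) auto
  qed
  have i2: "integrable M (\<lambda>x. of_bool (c x < p) * hinge p (e x) * (of_bool (s \<le> c x) - c x))"
    using K m2 by (intro integrable_const_bound[of _ 1]) auto
  have i3: "integrable M (\<lambda>x. of_bool (\<bar>c x - q\<bar> \<le> d) :: real)" for q
    by (intro integrable_const_bound[of _ 1]) auto
  have "proj (\<lambda>x. of_bool (c x < p) * hinge p (e x)) s - (\<integral>x. smooth_kernel p d s (c x) (e x) \<partial>M)
    = (\<integral>x. of_bool (c x < p) * hinge p (e x) * (of_bool (s \<le> c x) - c x) - smooth_kernel p d s (c x) (e x) \<partial>M)" (is "?L = integral\<^sup>L M ?h")
    unfolding proj_def using i1 i2 by simp
  moreover have "\<bar>integral\<^sup>L M ?h\<bar> \<le> (\<integral>x. of_bool (\<bar>c x - p\<bar> \<le> d) + of_bool (\<bar>c x - s\<bar> \<le> d) \<partial>M)"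
    using i1 i2 i3 smooth_kernel_error[OF p d cr er]
    by (intro order_trans[OF integral_abs_bound] integral_mono) auto
  moreover have "(\<integral>x. of_bool (\<bar>c x - p\<bar> \<le> d) + of_bool (\<bar>c x - s\<bar> \<le> d) \<partial>M) \<le> 2 * d + 2 * d"
    using integral_c_near[of d p] integral_c_near[of d s] d i3 by simp
  ultimately show ?thesis by linarith
qed

end

context uniform_pair
begin

text \<open>The influence function read on the unit square, so that it can be evaluated at points
  drawn from another law.\<close>

definition psi :: "real \<Rightarrow> real \<Rightarrow> real" where
  "psi s t = hinge p s * hinge p t - kernel_mean - c1.proj wt\<^sub>1 s - c2.proj wt\<^sub>2 t"

lemma infl_psi: "infl x = psi (c\<^sub>1 x) (c\<^sub>2 x)"
  unfolding infl_def psi_def ..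

lemma psi_bound: "s \<in> {0..1} \<Longrightarrow> t \<in> {0..1} \<Longrightarrow> \<bar>psi s t\<bar> \<le> 3"
proof -
  assume st: "s \<in> {0..1}" "t \<in> {0..1}"
  have "0 \<le> hinge p s * hinge p t" "hinge p s * hinge p t \<le> 1"
    using hinge_bounds[OF p, of s] hinge_bounds[OF p, of t] st by (auto intro: mult_le_one)
  then show ?thesis unfolding psi_def using kernel_mean_bounds
    c1.proj_bound[of wt\<^sub>1 s, OF wt_measurable(1) wt_bounds(1)]
    c2.proj_bound[of wt\<^sub>2 t, OF wt_measurable(2) wt_bounds(2)] by linarith
qed

lemma hinge_prod_lipschitz: "lipschitz_square 1 (\<lambda>s t. hinge p s * hinge p t)"
proof -
  have H: "\<bar>hinge p y\<bar> \<le> 1" if "y \<in> {0..1}" for y using hinge_bounds[OF p, of y] that by auto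
  have m: "(\<lambda>(s, t). hinge p s * hinge p t) \<in> borel_measurable borel"
    unfolding case_prod_unfold
    by (intro borel_measurable_times measurable_compose[OF _ hinge_measurable])
      (auto intro!: borel_measurable_continuous_onI continuous_intros)
  have lip: "\<bar>hinge p s * hinge p t - hinge p s' * hinge p t'\<bar> \<le> \<bar>s - s'\<bar> + \<bar>t - t'\<bar>"
    if "s \<in> {0..1}" "t \<in> {0..1}" "s' \<in> {0..1}" "t' \<in> {0..1}" for s t s' t'
    using product_lipschitz[of "hinge p s" "hinge p t'" "hinge p t" 1 1 "hinge p s'"] that H
      hinge_lipschitz[of p s s'] hinge_lipschitz[of p t t'] by fastforce
  have bd: "\<bar>hinge p s * hinge p t\<bar> \<le> 1" if "s \<in> {0..1}" "t \<in> {0..1}" for s t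
    unfolding abs_mult using that H by (intro mult_le_one) auto
  show ?thesis unfolding lipschitz_square_def using m lip bd by auto
qed

lemma psi_lipschitz:
  assumes "s \<in> {0..1}" "t \<in> {0..1}" "s' \<in> {0..1}" "t' \<in> {0..1}"
  shows "\<bar>psi s t - psi s' t'\<bar> \<le> 2 * (\<bar>s - s'\<bar> + \<bar>t - t'\<bar>)"
proof -
  have "psi s t - psi s' t' = (hinge p s * hinge p t - hinge p s' * hinge p t')
      + (c1.proj wt\<^sub>1 s' - c1.proj wt\<^sub>1 s) + (c2.proj wt\<^sub>2 t' - c2.proj wt\<^sub>2 t)"
    unfolding psi_def by simp
  also have "\<bar>\<dots>\<bar> \<le> 1 * (\<bar>s - s'\<bar> + \<bar>t - t'\<bar>) + \<bar>s' - s\<bar> + \<bar>t' - t\<bar>"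
    by (intro abs_sum3 lipschitz_squareD(3)[OF hinge_prod_lipschitz assms] c1.proj_lipschitz c2.proj_lipschitz wt_measurable wt_bounds)
  finally show ?thesis by (simp add: abs_minus_commute)
qed

lemma psi_square_lipschitz: "lipschitz_square 12 (\<lambda>s t. (psi s t)\<^sup>2)"
proof -
  have m: "(\<lambda>(s, t). (psi s t)\<^sup>2) \<in> borel_measurable borel"
    unfolding psi_def case_prod_unfold
    by (intro borel_measurable_power borel_measurable_diff borel_measurable_times borel_measurable_const
        measurable_compose[OF _ hinge_measurable] measurable_compose[OF _ proj_meas(1)] measurable_compose[OF _ proj_meas(2)])
      (auto intro!: borel_measurable_continuous_onI continuous_intros)
  have lip: "\<bar>(psi s t)\<^sup>2 - (psi s' t')\<^sup>2\<bar> \<le> 12 * (\<bar>s - s'\<bar> + \<bar>t - t'\<bar>)"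
    if st: "s \<in> {0..1}" "t \<in> {0..1}" "s' \<in> {0..1}" "t' \<in> {0..1}" for s t s' t'
  proof -
    have "(psi s t)\<^sup>2 - (psi s' t')\<^sup>2 = (psi s t - psi s' t') * (psi s t + psi s' t')" by (simp add: power2_eq_square algebra_simps)
    also have "\<bar>\<dots>\<bar> \<le> (2 * (\<bar>s - s'\<bar> + \<bar>t - t'\<bar>)) * 6"
      unfolding abs_mult using psi_lipschitz[OF st] psi_bound[OF st(1,2)] psi_bound[OF st(3,4)] by (intro mult_mono) auto
    finally show ?thesis by simp
  qed
  have bd: "\<bar>(psi s t)\<^sup>2\<bar> \<le> 12" if "s \<in> {0..1}" "t \<in> {0..1}" for s t
    using power_mono[OF psi_bound[OF that] abs_ge_zero, of 2] by simp
  show ?thesis unfolding lipschitz_square_def using m lip bd by auto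
qed

definition asymp_var :: real where "asymp_var = (\<integral>x. (infl x)\<^sup>2 \<partial>M)"

definition mean_of :: "(real \<Rightarrow> real \<Rightarrow> real) \<Rightarrow> real" where "mean_of f = (\<integral>x. f (c\<^sub>1 x) (c\<^sub>2 x) \<partial>M)"

lemma coords_range: "c\<^sub>1 x \<in> {0..1}" "c\<^sub>2 x \<in> {0..1}" using c1.c_range[of x] c2.c_range[of x] by auto

lemma mean_of_integrable: "lipschitz_square L f \<Longrightarrow> integrable M (\<lambda>x. f (c\<^sub>1 x) (c\<^sub>2 x))"
proof -
  assume f: "lipschitz_square L f"
  have "\<bar>f (c\<^sub>1 x) (c\<^sub>2 x)\<bar> \<le> L" for x using lipschitz_squareD(4)[OF f] coords_range by blast
  moreover have "(\<lambda>x. f (c\<^sub>1 x) (c\<^sub>2 x)) \<in> borel_measurable M"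
    by (rule lipschitz_square_compose[OF f]) measurable
  ultimately show ?thesis by (intro integrable_const_bound[of _ L]) auto
qed

text \<open>The product of hinges fixes \<open>kernel_mean\<close>, the smooth kernels at grid
  points fix both projections up to rounding, and the square of \<open>psi\<close> compares the
  variance integrals for one and the same integrand. The family is finite, so only finitely many
  averages have to converge.\<close>

definition test_functions :: "real \<Rightarrow> nat \<Rightarrow> (real \<Rightarrow> real \<Rightarrow> real) set" where
  "test_functions d k = {\<lambda>s t. hinge p s * hinge p t, \<lambda>s t. (psi s t)\<^sup>2}
     \<union> (\<lambda>j. smooth_kernel p d (real j / real k)) ` {..k} \<union> (\<lambda>j s t. smooth_kernel p d (real j / real k) t s) ` {..k}"

lemma test_functions_lipschitz:
  assumes "0 < d" "f \<in> test_functions d k"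
  shows "lipschitz_square (2 / d + 12) f"
proof -
  have mono: "lipschitz_square L' g" if "lipschitz_square L g" "L \<le> L'" for L L' g
  proof -
    have "\<bar>g x y - g x' y'\<bar> \<le> L' * (\<bar>x - x'\<bar> + \<bar>y - y'\<bar>)" if xy: "x \<in> {0..1}" "y \<in> {0..1}" "x' \<in> {0..1}" "y' \<in> {0..1}" for x y x' y'
      by (rule order_trans[OF lipschitz_squareD(3)[OF \<open>lipschitz_square L g\<close> xy]]) (intro mult_right_mono that(2) \<open>L \<le> L'\<close>, simp)
    moreover have "\<bar>g x y\<bar> \<le> L'" if xy: "x \<in> {0..1}" "y \<in> {0..1}" for x y
      using lipschitz_squareD(4)[OF \<open>lipschitz_square L g\<close> xy] \<open>L \<le> L'\<close> by linarith
    ultimately show ?thesis unfolding lipschitz_square_def using lipschitz_squareD(1,2)[OF that(1)] that(2) by auto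
  qed
  have "0 \<le> 2 / d" using assms by simp
  then have d: "1 \<le> 2 / d + 12" "12 \<le> 2 / d + 12" "2 / d + 1 \<le> 2 / d + 12" by linarith+
  show ?thesis
    using assms(2) mono[OF hinge_prod_lipschitz d(1)] mono[OF psi_square_lipschitz d(2)]
      mono[OF smooth_kernel_lipschitz[OF p assms(1)] d(3)]
      mono[OF lipschitz_square_swap[OF smooth_kernel_lipschitz[OF p assms(1)]] d(3)]
    unfolding test_functions_def by blast
qed

lemma finite_test_functions: "finite (test_functions d k)" unfolding test_functions_def by auto

end

text \<open>Rounding \<open>s\<close> down to the grid costs \<open>1 / k\<close> for each law by
  the Lipschitz property, smoothing costs \<open>4 * d\<close> for each, and on the grid the
  smoothed integrals are close by assumption.\<close>

lemma proj_uniform_close: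
  assumes A: "uniform_pair M c e p" and B: "uniform_pair M' c' e' p" and d: "0 < d" and k: "0 < k"
    and close: "\<And>j. j \<le> k \<Longrightarrow> \<bar>(\<integral>x. smooth_kernel p d (real j / real k) (c' x) (e' x) \<partial>M') - (\<integral>x. smooth_kernel p d (real j / real k) (c x) (e x) \<partial>M)\<bar> \<le> \<eta>"
    and s: "s \<in> {0..1}"
  shows "\<bar>uniform_coord.proj M' c' (\<lambda>x. of_bool (c' x < p) * hinge p (e' x)) s - uniform_coord.proj M c (\<lambda>x. of_bool (c x < p) * hinge p (e x)) s\<bar>
    \<le> \<eta> + 8 * d + 2 / real k"
proof -
  interpret A: uniform_pair M c e p by (rule A)
  interpret B: uniform_pair M' c' e' p by (rule B)
  define j where "j = nat \<lfloor>real k * s\<rfloor>"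
  define t where "t = real j / real k"
  have ks: "0 \<le> real k * s" "real k * s \<le> real k" using s by (auto simp: mult_left_le)
  have "real j = real_of_int \<lfloor>real k * s\<rfloor>" unfolding j_def using ks(1) by simp
  then have j1: "real j \<le> real k * s" "real k * s < real j + 1" by linarith+
  then have jk: "j \<le> k" using ks by linarith
  have st: "\<bar>s - t\<bar> \<le> 1 / real k"
  proof -
    have "real k * (s - t) = real k * s - real j" using k by (simp add: t_def right_diff_distrib)
    then have "\<bar>real k * (s - t)\<bar> \<le> 1" using j1 by linarith
    then have "real k * \<bar>s - t\<bar> \<le> 1" by (simp add: abs_mult)
    then show ?thesis using k by (simp add: field_simps)
  qed
  define a where "a x = of_bool (c x < p) * hinge p (e x)" for x
  define a' where "a' x = of_bool (c' x < p) * hinge p (e' x)" for x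
  have "a = A.wt\<^sub>1" "a' = B.wt\<^sub>1" unfolding a_def a'_def A.wt\<^sub>1_def B.wt\<^sub>1_def by auto
  then have am: "a \<in> borel_measurable M" "a' \<in> borel_measurable M'" "\<bar>a x\<bar> \<le> 1" "\<bar>a' y\<bar> \<le> 1" for x y
    using A.wt_measurable A.wt_bounds B.wt_measurable B.wt_bounds by auto
  have 1: "\<bar>A.c1.proj a s - A.c1.proj a t\<bar> \<le> 1 / real k" using A.c1.proj_lipschitz[OF am(1,3), of s t] st by linarith
  have 2: "\<bar>B.c1.proj a' s - B.c1.proj a' t\<bar> \<le> 1 / real k" using B.c1.proj_lipschitz[OF am(2,4), of s t] st by linarith
  have 3: "\<bar>A.c1.proj a t - (\<integral>x. smooth_kernel p d t (c x) (e x) \<partial>M)\<bar> \<le> 4 * d"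
    unfolding a_def by (rule A.c1.proj_smooth_kernel[OF A.p d]) (auto simp: A.c2.c_range)
  have 4: "\<bar>B.c1.proj a' t - (\<integral>x. smooth_kernel p d t (c' x) (e' x) \<partial>M')\<bar> \<le> 4 * d"
    unfolding a'_def by (rule B.c1.proj_smooth_kernel[OF A.p d]) (auto simp: B.c2.c_range)
  have 5: "2 / real k = 1 / real k + 1 / real k" by simp
  show ?thesis
    using 1 2 3 4 close[OF jk] unfolding t_def[symmetric] 5 a_def[symmetric] a'_def[symmetric] by linarith
qed

text \<open>Changing the law changes the integrand as well as the measure. The two influence
  functions are compared uniformly on the square, then the square of one fixed function is
  integrated against both laws.\<close>

lemma asymp_var_close:
  assumes A: "uniform_pair M c\<^sub>1 c\<^sub>2 p" and B: "uniform_pair M' c\<^sub>1' c\<^sub>2' p" and d: "0 < d" and k: "0 < k"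
    and close: "\<And>f. f \<in> uniform_pair.test_functions M c\<^sub>1 c\<^sub>2 p d k \<Longrightarrow>
      \<bar>uniform_pair.mean_of M' c\<^sub>1' c\<^sub>2' f - uniform_pair.mean_of M c\<^sub>1 c\<^sub>2 f\<bar> \<le> \<eta>"
  shows "\<bar>uniform_pair.asymp_var M' c\<^sub>1' c\<^sub>2' p - uniform_pair.asymp_var M c\<^sub>1 c\<^sub>2 p\<bar> \<le> 19 * \<eta> + 96 * d + 24 / real k"
proof -
  interpret A: uniform_pair M c\<^sub>1 c\<^sub>2 p by (rule A)
  interpret B: uniform_pair M' c\<^sub>1' c\<^sub>2' p by (rule B)
  \<comment> \<open>Exchanging the coordinates turns the second projection into a first one.\<close>
  have swapA: "uniform_pair M c\<^sub>2 c\<^sub>1 p" and swapB: "uniform_pair M' c\<^sub>2' c\<^sub>1' p"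
    by (intro uniform_pair.intro uniform_pair_axioms.intro A.prob_space_axioms B.prob_space_axioms A.c1.uniform_coord_axioms
      A.c2.uniform_coord_axioms B.c1.uniform_coord_axioms B.c2.uniform_coord_axioms A.p)+
  have km: "\<bar>B.kernel_mean - A.kernel_mean\<bar> \<le> \<eta>"
    using close[of "\<lambda>s t. hinge p s * hinge p t"]
    unfolding A.mean_of_def B.mean_of_def A.kernel_mean_def B.kernel_mean_def A.test_functions_def by simp
  have p1: "\<bar>B.c1.proj B.wt\<^sub>1 s - A.c1.proj A.wt\<^sub>1 s\<bar> \<le> \<eta> + 8 * d + 2 / real k" if "s \<in> {0..1}" for s
    unfolding A.wt\<^sub>1_def[abs_def] B.wt\<^sub>1_def[abs_def]
  proof (rule proj_uniform_close[OF A B d k _ that])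
    fix j assume "j \<le> k"
    then have "smooth_kernel p d (real j / real k) \<in> A.test_functions d k" unfolding A.test_functions_def by auto
    from close[OF this] show "\<bar>(\<integral>x. smooth_kernel p d (real j / real k) (c\<^sub>1' x) (c\<^sub>2' x) \<partial>M') - (\<integral>x. smooth_kernel p d (real j / real k) (c\<^sub>1 x) (c\<^sub>2 x) \<partial>M)\<bar> \<le> \<eta>"
      unfolding A.mean_of_def B.mean_of_def .
  qed
  have p2: "\<bar>B.c2.proj B.wt\<^sub>2 s - A.c2.proj A.wt\<^sub>2 s\<bar> \<le> \<eta> + 8 * d + 2 / real k" if "s \<in> {0..1}" for s
    unfolding A.wt\<^sub>2_def[abs_def] B.wt\<^sub>2_def[abs_def]
  proof (rule proj_uniform_close[OF swapA swapB d k _ that])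
    fix j assume "j \<le> k"
    then have "(\<lambda>s t. smooth_kernel p d (real j / real k) t s) \<in> A.test_functions d k" unfolding A.test_functions_def by auto
    from close[OF this] show "\<bar>(\<integral>x. smooth_kernel p d (real j / real k) (c\<^sub>2' x) (c\<^sub>1' x) \<partial>M') - (\<integral>x. smooth_kernel p d (real j / real k) (c\<^sub>2 x) (c\<^sub>1 x) \<partial>M)\<bar> \<le> \<eta>"
      unfolding A.mean_of_def B.mean_of_def .
  qed
  \<comment> \<open>\<open>h\<close> bounds the difference of the influence functions. Both are
    bounded by 3, so their squares differ by at most \<open>6 * h\<close>, and the final bound is
    \<open>6 * h + \<eta>\<close>.\<close>
  define h where "h = \<eta> + 2 * (\<eta> + 8 * d + 2 / real k)"
  have psi: "\<bar>B.psi s t - A.psi s t\<bar> \<le> h" if "s \<in> {0..1}" "t \<in> {0..1}" for s t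
  proof -
    have "B.psi s t - A.psi s t = (A.kernel_mean - B.kernel_mean) + (A.c1.proj A.wt\<^sub>1 s - B.c1.proj B.wt\<^sub>1 s) + (A.c2.proj A.wt\<^sub>2 t - B.c2.proj B.wt\<^sub>2 t)"
      unfolding A.psi_def B.psi_def by simp
    also have "\<bar>\<dots>\<bar> \<le> \<eta> + (\<eta> + 8 * d + 2 / real k) + (\<eta> + 8 * d + 2 / real k)"
      using km p1[OF that(1)] p2[OF that(2)] by (intro abs_sum3) (simp_all only: abs_minus_commute)
    finally show ?thesis by (simp add: h_def)
  qed
  have psi2: "\<bar>(B.psi s t)\<^sup>2 - (A.psi s t)\<^sup>2\<bar> \<le> h * 6" if st: "s \<in> {0..1}" "t \<in> {0..1}" for s t
  proof -
    have "(B.psi s t)\<^sup>2 - (A.psi s t)\<^sup>2 = (B.psi s t - A.psi s t) * (B.psi s t + A.psi s t)" by (simp add: power2_eq_square algebra_simps)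
    also have "\<bar>\<dots>\<bar> \<le> h * 6"
      unfolding abs_mult using psi[OF st] A.psi_bound[OF st] B.psi_bound[OF st] by (intro mult_mono) auto
    finally show ?thesis .
  qed
  have iA: "integrable M' (\<lambda>x. (A.psi (c\<^sub>1' x) (c\<^sub>2' x))\<^sup>2)" by (rule B.mean_of_integrable[OF A.psi_square_lipschitz])
  have iB: "integrable M' (\<lambda>x. (B.psi (c\<^sub>1' x) (c\<^sub>2' x))\<^sup>2)" by (rule B.mean_of_integrable[OF B.psi_square_lipschitz])
  have 1: "\<bar>B.asymp_var - B.mean_of (\<lambda>s t. (A.psi s t)\<^sup>2)\<bar> \<le> h * 6"
  proof -
    have "B.asymp_var - B.mean_of (\<lambda>s t. (A.psi s t)\<^sup>2) = (\<integral>x. (B.psi (c\<^sub>1' x) (c\<^sub>2' x))\<^sup>2 - (A.psi (c\<^sub>1' x) (c\<^sub>2' x))\<^sup>2 \<partial>M')"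
      unfolding B.asymp_var_def B.mean_of_def B.infl_psi using iA iB by simp
    also have "\<bar>\<dots>\<bar> \<le> (\<integral>x. h * 6 \<partial>M')"
      using iA iB psi2[OF B.coords_range] by (intro order_trans[OF integral_abs_bound] integral_mono) auto
    finally show ?thesis by (simp add: B.prob_space)
  qed
  have 2: "\<bar>B.mean_of (\<lambda>s t. (A.psi s t)\<^sup>2) - A.asymp_var\<bar> \<le> \<eta>"
    using close[of "\<lambda>s t. (A.psi s t)\<^sup>2"] unfolding A.asymp_var_def A.infl_psi A.mean_of_def A.test_functions_def by simp
  show ?thesis using 1 2 unfolding h_def by (simp add: algebra_simps)
qed


section \<open>The data\<close>

text \<open>Ranks only depend on the ordering, so that \<open>F\<close> and \<open>G\<close> standardise the margins for free.\<close>

locale data_law = uniform_pair Q "\<lambda>x. F (fst x)" "\<lambda>x. G (snd x)" p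
  for Q :: "(real \<times> real) measure" and F G :: "real \<Rightarrow> real" and p :: real +
  assumes sets_Q[simp, measurable_cong]: "sets Q = sets borel"
    and mono_F: "mono F" and mono_G: "mono G"
begin

abbreviation "d\<^sub>1 \<equiv> (\<lambda>x :: real \<times> real. F (fst x))"
abbreviation "d\<^sub>2 \<equiv> (\<lambda>x :: real \<times> real. G (snd x))"

text \<open>Ties are excluded after the transformation, since \<open>F\<close> and \<open>G\<close>
  may have flat pieces. This excludes ties in the raw data too and makes both orderings agree, so
  that raw and transformed ranks coincide.\<close>

definition no_ties :: "nat \<Rightarrow> (nat \<Rightarrow> real \<times> real) \<Rightarrow> bool" where
  "no_ties n z \<longleftrightarrow> (\<forall>i<n. \<forall>j<n. d\<^sub>1 (z i) = d\<^sub>1 (z j) \<longrightarrow> i = j) \<and> (\<forall>i<n. \<forall>j<n. d\<^sub>2 (z i) = d\<^sub>2 (z j) \<longrightarrow> i = j)"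

lemma AE_no_ties: "AE z in sample_law n. no_ties n z"
  using c1.AE_no_ties[of n] c2.AE_no_ties[of n] unfolding no_ties_def by eventually_elim blast

lemma own_ecdf_transform:
  assumes "no_ties n z" "i < n"
  shows "own_ecdf n fst z i = own_ecdf n d\<^sub>1 z i" "own_ecdf n snd z i = own_ecdf n d\<^sub>2 z i"
proof -
  have "fst (z j) \<le> fst (z i) \<longleftrightarrow> F (fst (z j)) \<le> F (fst (z i))" if "j < n" for j
  proof
    assume le: "F (fst (z j)) \<le> F (fst (z i))"
    show "fst (z j) \<le> fst (z i)"
    proof (rule ccontr)
      assume n: "\<not> fst (z j) \<le> fst (z i)"
      then have "F (fst (z i)) \<le> F (fst (z j))" by (intro monoD[OF mono_F]) simp
      then have "i = j" using le assms that unfolding no_ties_def by auto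
      then show False using n by simp
    qed
  qed (rule monoD[OF mono_F])
  then show "own_ecdf n fst z i = own_ecdf n d\<^sub>1 z i"
    unfolding own_ecdf_def ecdf_def by (intro arg_cong2[where f="(/)"] sum.cong refl) auto
  have "snd (z j) \<le> snd (z i) \<longleftrightarrow> G (snd (z j)) \<le> G (snd (z i))" if "j < n" for j
  proof
    assume le: "G (snd (z j)) \<le> G (snd (z i))"
    show "snd (z j) \<le> snd (z i)"
    proof (rule ccontr)
      assume n: "\<not> snd (z j) \<le> snd (z i)"
      then have "G (snd (z i)) \<le> G (snd (z j))" by (intro monoD[OF mono_G]) simp
      then have "i = j" using le assms that unfolding no_ties_def by auto
      then show False using n by simp
    qed
  qed (rule monoD[OF mono_G])
  then show "own_ecdf n snd z i = own_ecdf n d\<^sub>2 z i"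
    unfolding own_ecdf_def ecdf_def by (intro arg_cong2[where f="(/)"] sum.cong refl) auto
qed

lemma rank_stat_transform: "no_ties n z \<Longrightarrow> rank_stat p m n fst snd z = rank_stat p m n d\<^sub>1 d\<^sub>2 z"
  unfolding rank_stat_def using own_ecdf_transform by (intro arg_cong2[where f="(/)"] sum.cong refl) auto

lemma no_ties_fst_snd:
  assumes "no_ties n z" "i < n" "j < n"
  shows "fst (z i) = fst (z j) \<Longrightarrow> i = j" "snd (z i) = snd (z j) \<Longrightarrow> i = j"
  using assms unfolding no_ties_def by metis+

lemma boot_pair: "0 < n \<Longrightarrow> no_ties n z \<Longrightarrow> uniform_pair (boot_base n z) cl\<^sub>1 cl\<^sub>2 p"
  using uniform_coord_boot_base[of n z] no_ties_fst_snd
  by (intro uniform_pair.intro uniform_pair_axioms.intro p prob_boot_base) blast+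

definition plug_in :: "(real \<Rightarrow> real \<Rightarrow> real) \<Rightarrow> nat \<Rightarrow> (nat \<Rightarrow> real \<times> real) \<Rightarrow> real" where
  "plug_in f n z = (\<Sum>i<n. f (own_ecdf n d\<^sub>1 z i) (own_ecdf n d\<^sub>2 z i)) / real n"

lemma plug_in_measurable:
  assumes f: "lipschitz_square L f"
  shows "plug_in f n \<in> borel_measurable (sample_law n)"
proof -
  have "(\<lambda>z. f (own_ecdf n d\<^sub>1 z i) (own_ecdf n d\<^sub>2 z i)) \<in> borel_measurable (sample_law n)" if "i < n" for i
    by (rule lipschitz_square_compose[OF f sample_meas(3,4)[OF that]])
  then show ?thesis unfolding plug_in_def by (intro borel_measurable_divide borel_measurable_sum borel_measurable_const) auto
qed

text \<open>Two errors of the same order: ranks replace the standardised coordinates, and a sample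
  mean replaces an expectation. Each costs \<open>2 * L / sqrt n\<close>.\<close>

lemma plug_in_close:
  assumes f: "lipschitz_square L f" and n: "0 < n"
  shows "integrable (sample_law n) (\<lambda>z. \<bar>plug_in f n z - mean_of f\<bar>)"
    and "(\<integral>z. \<bar>plug_in f n z - mean_of f\<bar> \<partial>sample_law n) \<le> 4 * L / sqrt (real n)"
proof -
  interpret P: prob_space "sample_law n" by (rule prob_space_sample_law)
  note D = lipschitz_squareD[OF f]
  define r where "r = sqrt (real n)"
  have r: "0 < r" "r * r = real n" using n by (auto simp: r_def)
  define g where "g x = f (d\<^sub>1 x) (d\<^sub>2 x) - mean_of f" for x
  have gi: "integrable Q (\<lambda>x. f (d\<^sub>1 x) (d\<^sub>2 x))" by (rule mean_of_integrable[OF f])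
  have gm: "g \<in> borel_measurable Q" unfolding g_def using gi by auto
  have fb: "\<bar>f (d\<^sub>1 x) (d\<^sub>2 x)\<bar> \<le> L" for x using D(4) coords_range by blast
  have mb: "\<bar>mean_of f\<bar> \<le> L"
  proof -
    have "\<bar>mean_of f\<bar> \<le> (\<integral>x. L \<partial>Q)" unfolding mean_of_def
      using gi fb by (intro order_trans[OF integral_abs_bound] integral_mono) auto
    then show ?thesis by (simp add: prob_space)
  qed
  have gb: "\<bar>g x\<bar> \<le> 2 * L" for x unfolding g_def using fb[of x] mb by linarith
  have g0: "(\<integral>x. g x \<partial>Q) = 0" unfolding g_def using gi by (simp add: prob_space mean_of_def)
  have g2: "(\<integral>x. (g x)\<^sup>2 \<partial>Q) \<le> (2 * L)\<^sup>2"
  proof -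
    have b: "(g x)\<^sup>2 \<le> (2 * L)\<^sup>2" for x using power_mono[OF gb[of x] abs_ge_zero, of 2] by simp
    have "integrable Q (\<lambda>x. (g x)\<^sup>2)" using gm b by (intro integrable_const_bound[of _ "(2 * L)\<^sup>2"]) auto
    then have "(\<integral>x. (g x)\<^sup>2 \<partial>Q) \<le> (\<integral>x. (2 * L)\<^sup>2 \<partial>Q)" using b by (intro integral_mono integrable_const)
    then show ?thesis by (simp add: prob_space)
  qed
  define S where "S z = (\<Sum>i<n. g (z i)) / real n" for z :: "nat \<Rightarrow> real \<times> real"
  have Sm: "S \<in> borel_measurable (sample_law n)"
    unfolding S_def by (intro borel_measurable_divide borel_measurable_sum measurable_compose[OF sample_component_measurable gm]) auto
  have Sb: "\<bar>S z\<bar> \<le> 2 * L" for z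
  proof -
    have "\<bar>\<Sum>i<n. g (z i)\<bar> \<le> (\<Sum>i<n. 2 * L)" using gb by (intro order_trans[OF sum_abs] sum_mono)
    then show ?thesis unfolding S_def abs_divide using n by (simp add: field_simps)
  qed
  have S1: "(\<integral>z. \<bar>S z\<bar> \<partial>sample_law n) \<le> 2 * L / r"
  proof (rule P.expectation_abs_le_of_square)
    show "integrable (sample_law n) S" using Sm Sb by (intro integrable_sample_bounded)
    have "\<bar>(S z)\<^sup>2\<bar> \<le> (2 * L)\<^sup>2" for z using power_mono[OF Sb[of z] abs_ge_zero, of 2] by simp
    then show "integrable (sample_law n) (\<lambda>z. (S z)\<^sup>2)"
      using Sm by (intro integrable_sample_bounded[of _ _ "(2 * L)\<^sup>2"]) auto
    have "(\<integral>z. (S z)\<^sup>2 \<partial>sample_law n) = real n * (\<integral>x. (g x)\<^sup>2 \<partial>Q) / (real n)\<^sup>2"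
      unfolding S_def power_divide using integral_sample_sum_square[OF gm gb g0, of n] by simp
    also have "\<dots> = (\<integral>x. (g x)\<^sup>2 \<partial>Q) / (r * r)" using n unfolding r(2) by (simp add: power2_eq_square)
    also have "\<dots> \<le> (2 * L)\<^sup>2 / (r * r)" using g2 r by (intro divide_right_mono) auto
    finally show "(\<integral>z. (S z)\<^sup>2 \<partial>sample_law n) \<le> (2 * L / r)\<^sup>2" by (simp add: power_divide power2_eq_square)
  qed (use D(1) r in simp)
  define E where "E i z = \<bar>own_ecdf n d\<^sub>1 z i - d\<^sub>1 (z i)\<bar> + \<bar>own_ecdf n d\<^sub>2 z i - d\<^sub>2 (z i)\<bar>" for i z
  have Ei: "integrable (sample_law n) (E i)" "(\<integral>z. E i z \<partial>sample_law n) \<le> 2 / r" if i: "i < n" for i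
  proof -
    have b: "\<bar>own_ecdf n d\<^sub>1 z i - d\<^sub>1 (z i)\<bar> \<le> 1" "\<bar>own_ecdf n d\<^sub>2 z i - d\<^sub>2 (z i)\<bar> \<le> 1" for z
      using c1.own_ecdf_bounds[of n z i] c2.own_ecdf_bounds[of n z i] coords_range[of "z i"] by (auto simp: abs_le_iff)
    have m: "(\<lambda>z. own_ecdf n d\<^sub>1 z i - d\<^sub>1 (z i)) \<in> borel_measurable (sample_law n)" "(\<lambda>z. own_ecdf n d\<^sub>2 z i - d\<^sub>2 (z i)) \<in> borel_measurable (sample_law n)"
      by (intro borel_measurable_diff sample_meas i)+
    have i1: "integrable (sample_law n) (\<lambda>z. own_ecdf n d\<^sub>1 z i - d\<^sub>1 (z i))" "integrable (sample_law n) (\<lambda>z. own_ecdf n d\<^sub>2 z i - d\<^sub>2 (z i))"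
      using m b by (auto intro!: integrable_sample_bounded[of _ _ 1])
    have i2: "integrable (sample_law n) (\<lambda>z. (own_ecdf n d\<^sub>1 z i - d\<^sub>1 (z i))\<^sup>2)" "integrable (sample_law n) (\<lambda>z. (own_ecdf n d\<^sub>2 z i - d\<^sub>2 (z i))\<^sup>2)"
      using m b by (auto intro!: integrable_sample_bounded[of _ _ 1] simp: abs_square_le_1)
    show "integrable (sample_law n) (E i)" unfolding E_def using i1 by auto
    have rr: "1 / real n = (1 / r)\<^sup>2" using r by (simp add: power2_eq_square)
    have "(\<integral>z. \<bar>own_ecdf n d\<^sub>1 z i - d\<^sub>1 (z i)\<bar> \<partial>sample_law n) \<le> 1 / r"
      using i1(1) i2(1) c1.own_ecdf_error[OF i] r unfolding rr by (intro P.expectation_abs_le_of_square) auto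
    moreover have "(\<integral>z. \<bar>own_ecdf n d\<^sub>2 z i - d\<^sub>2 (z i)\<bar> \<partial>sample_law n) \<le> 1 / r"
      using i1(2) i2(2) c2.own_ecdf_error[OF i] r unfolding rr by (intro P.expectation_abs_le_of_square) auto
    moreover have "(\<integral>z. E i z \<partial>sample_law n) = (\<integral>z. \<bar>own_ecdf n d\<^sub>1 z i - d\<^sub>1 (z i)\<bar> \<partial>sample_law n) + (\<integral>z. \<bar>own_ecdf n d\<^sub>2 z i - d\<^sub>2 (z i)\<bar> \<partial>sample_law n)"
      unfolding E_def using i1 by simp
    ultimately show "(\<integral>z. E i z \<partial>sample_law n) \<le> 2 / r" by simp
  qed
  have bound: "\<bar>plug_in f n z - mean_of f\<bar> \<le> L * ((\<Sum>i<n. E i z) / real n) + \<bar>S z\<bar>" for z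
  proof -
    have "plug_in f n z - mean_of f = (\<Sum>i<n. f (own_ecdf n d\<^sub>1 z i) (own_ecdf n d\<^sub>2 z i) - f (d\<^sub>1 (z i)) (d\<^sub>2 (z i))) / real n + S z"
      unfolding plug_in_def S_def g_def using n by (simp add: sum_subtractf diff_divide_distrib)
    moreover have "\<bar>(\<Sum>i<n. f (own_ecdf n d\<^sub>1 z i) (own_ecdf n d\<^sub>2 z i) - f (d\<^sub>1 (z i)) (d\<^sub>2 (z i))) / real n\<bar> \<le> (\<Sum>i<n. L * E i z) / real n"
    proof -
      have "\<bar>\<Sum>i<n. f (own_ecdf n d\<^sub>1 z i) (own_ecdf n d\<^sub>2 z i) - f (d\<^sub>1 (z i)) (d\<^sub>2 (z i))\<bar> \<le> (\<Sum>i<n. L * E i z)"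
        unfolding E_def using c1.own_ecdf_bounds c2.own_ecdf_bounds coords_range
        by (intro order_trans[OF sum_abs] sum_mono D(3)) auto
      then have "\<bar>\<Sum>i<n. f (own_ecdf n d\<^sub>1 z i) (own_ecdf n d\<^sub>2 z i) - f (d\<^sub>1 (z i)) (d\<^sub>2 (z i))\<bar> / real n \<le> (\<Sum>i<n. L * E i z) / real n"
        by (rule divide_right_mono) simp
      then show ?thesis by (simp add: abs_divide)
    qed
    moreover have "(\<Sum>i<n. L * E i z) / real n = L * ((\<Sum>i<n. E i z) / real n)" by (simp add: sum_distrib_left)
    ultimately show ?thesis by linarith
  qed
  have Si: "integrable (sample_law n) S" using Sm Sb by (intro integrable_sample_bounded)
  have ri: "integrable (sample_law n) (\<lambda>z. L * ((\<Sum>i<n. E i z) / real n) + \<bar>S z\<bar>)"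
    using Ei(1) Si by (intro Bochner_Integration.integrable_add integrable_mult_right integrable_divide_zero Bochner_Integration.integrable_sum integrable_abs) auto
  show i: "integrable (sample_law n) (\<lambda>z. \<bar>plug_in f n z - mean_of f\<bar>)"
    using bound plug_in_measurable[OF f, of n]
    by (intro Bochner_Integration.integrable_bound[OF ri]) (auto intro!: AE_I2 order_trans[OF _ abs_ge_self])
  have "(\<integral>z. \<bar>plug_in f n z - mean_of f\<bar> \<partial>sample_law n) \<le> (\<integral>z. L * ((\<Sum>i<n. E i z) / real n) + \<bar>S z\<bar> \<partial>sample_law n)"
    by (rule integral_mono[OF i ri bound])
  also have "\<dots> = L * ((\<Sum>i<n. (\<integral>z. E i z \<partial>sample_law n)) / real n) + (\<integral>z. \<bar>S z\<bar> \<partial>sample_law n)"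
  proof -
    have i1: "integrable (sample_law n) (\<lambda>z. (\<Sum>i<n. E i z) / real n)"
      using Ei(1) by (intro integrable_divide_zero Bochner_Integration.integrable_sum) auto
    have i2: "(\<integral>z. (\<Sum>i<n. E i z) \<partial>sample_law n) = (\<Sum>i<n. (\<integral>z. E i z \<partial>sample_law n))"
      using Ei(1) by (intro Bochner_Integration.integral_sum) auto
    have "(\<integral>z. L * ((\<Sum>i<n. E i z) / real n) + \<bar>S z\<bar> \<partial>sample_law n)
      = (\<integral>z. L * ((\<Sum>i<n. E i z) / real n) \<partial>sample_law n) + (\<integral>z. \<bar>S z\<bar> \<partial>sample_law n)"
      using i1 Si by (intro Bochner_Integration.integral_add integrable_mult_right integrable_abs)
    then show ?thesis using i2 by simp
  qed
  also have "\<dots> \<le> L * ((\<Sum>i<n. 2 / r) / real n) + 2 * L / r"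
    using Ei(2) S1 D(1) by (intro add_mono mult_left_mono divide_right_mono sum_mono) auto
  also have "\<dots> = 4 * L / r" using n by (simp add: add_divide_distrib[symmetric])
  finally show "(\<integral>z. \<bar>plug_in f n z - mean_of f\<bar> \<partial>sample_law n) \<le> 4 * L / sqrt (real n)" unfolding r_def .
qed

text \<open>The good event is phrased by finitely many measurable averages over ranks; on it the
  bootstrap variance is controlled pointwise, so that its measurability in the data does not come
  up.\<close>

lemma boot_variance_consistent:
  assumes \<epsilon>: "0 < \<epsilon>"
  shows "\<exists>G. (\<forall>n. G n \<in> sets (sample_law n)) \<and> (\<lambda>n. measure (sample_law n) (G n)) \<longlonglongrightarrow> 1 \<and>
    (\<forall>\<^sub>F n in sequentially. \<forall>z\<in>G n. no_ties n z \<longrightarrow> \<bar>uniform_pair.asymp_var (boot_base n z) cl\<^sub>1 cl\<^sub>2 p - asymp_var\<bar> \<le> \<epsilon>)"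
proof -
  obtain k :: nat where k: "24 * 4 / \<epsilon> < real k" using reals_Archimedean2 by blast
  have k0: "0 < k" using k \<epsilon> by (cases k) (auto simp: divide_less_0_iff)
  \<comment> \<open>The terms \<open>19 * \<eta>\<close>, \<open>96 * d\<close> and
    \<open>24 / k\<close> become at most \<open>\<epsilon> / 2\<close>,
    \<open>\<epsilon> / 4\<close> and \<open>\<epsilon> / 4\<close>.\<close>
  define d where "d = \<epsilon> / 384"
  define \<eta> where "\<eta> = \<epsilon> / 40"
  have d: "0 < d" and \<eta>: "0 < \<eta>" using \<epsilon> by (auto simp: d_def \<eta>_def)
  have small: "19 * \<eta> + 96 * d + 24 / real k \<le> \<epsilon>"
  proof -
    have "24 / real k \<le> \<epsilon> / 4" using k \<epsilon> k0 by (simp add: field_simps)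
    then show ?thesis unfolding \<eta>_def d_def using \<epsilon> by simp
  qed
  define T where "T = test_functions d k"
  define L where "L = 2 / d + 12"
  have L: "0 < L" unfolding L_def using d by (simp add: add_pos_pos)
  have TL: "lipschitz_square L f" if "f \<in> T" for f using test_functions_lipschitz[OF d] that unfolding T_def L_def .
  have fin: "finite T" unfolding T_def by (rule finite_test_functions)
  \<comment> \<open>The other half of \<open>\<eta>\<close> is reserved for the step from rank
    averages to bootstrap expectations.\<close>
  define G where "G n = {z \<in> space (sample_law n). \<forall>f\<in>T. \<bar>plug_in f n z - mean_of f\<bar> < \<eta> / 2}" for n
  have Gm: "G n \<in> sets (sample_law n)" for n
    unfolding G_def using fin plug_in_measurable[OF TL]
    by (intro sets.sets_Collect_finite_All borel_measurable_less borel_measurable_abs borel_measurable_diff borel_measurable_const) auto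
  have GP: "1 - real (card T) * (8 * L / (\<eta> * sqrt (real n))) \<le> measure (sample_law n) (G n)" if n: "0 < n" for n
  proof -
    interpret P: prob_space "sample_law n" by (rule prob_space_sample_law)
    define Bd where "Bd f = {z \<in> space (sample_law n). \<eta> / 2 \<le> \<bar>plug_in f n z - mean_of f\<bar>}" for f
    have Bm: "Bd f \<in> sets (sample_law n)" if "f \<in> T" for f
      unfolding Bd_def using plug_in_measurable[OF TL[OF that], of n]
      by (intro borel_measurable_le borel_measurable_abs borel_measurable_diff borel_measurable_const)
    have Bp: "P.prob (Bd f) \<le> 8 * L / (\<eta> * sqrt (real n))" if f: "f \<in> T" for f
    proof -
      have "P.prob (Bd f) \<le> (\<integral>z. \<bar>plug_in f n z - mean_of f\<bar> \<partial>sample_law n) / (\<eta> / 2)"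
        unfolding Bd_def by (rule integral_Markov_inequality_measure[OF plug_in_close(1)[OF TL[OF f] n] sets.top]) (use \<eta> in auto)
      also have "\<dots> \<le> (4 * L / sqrt (real n)) / (\<eta> / 2)"
        using \<eta> by (intro divide_right_mono plug_in_close(2)[OF TL[OF f] n]) auto
      also have "\<dots> = 8 * L / (\<eta> * sqrt (real n))" by simp
      finally show ?thesis .
    qed
    have "space (sample_law n) - G n = (\<Union>f\<in>T. Bd f)" unfolding G_def Bd_def by (auto simp: not_less)
    then have "P.prob (space (sample_law n) - G n) \<le> (\<Sum>f\<in>T. P.prob (Bd f))"
      using fin Bm by (simp only:) (intro P.finite_measure_subadditive_finite, auto)
    also have "\<dots> \<le> (\<Sum>f\<in>T. 8 * L / (\<eta> * sqrt (real n)))" by (intro sum_mono Bp)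
    also have "\<dots> = real (card T) * (8 * L / (\<eta> * sqrt (real n)))" by simp
    finally show ?thesis using P.prob_compl[OF Gm] by linarith
  qed
  have sq: "filterlim (\<lambda>n. sqrt (real n)) at_top sequentially"
    by (intro filterlim_compose[OF sqrt_at_top] filterlim_real_sequentially)
  have lim: "(\<lambda>n. c / sqrt (real n)) \<longlonglongrightarrow> 0" for c
    by (intro tendsto_divide_0[OF tendsto_const] filterlim_at_top_imp_at_infinity sq)
  have "(\<lambda>n. 1 - real (card T) * (8 * L / \<eta> / sqrt (real n))) \<longlonglongrightarrow> 1 - real (card T) * 0"
    by (intro tendsto_intros lim)
  then have lo: "(\<lambda>n. 1 - real (card T) * (8 * L / (\<eta> * sqrt (real n)))) \<longlonglongrightarrow> 1" by simp
  have "(\<lambda>n. measure (sample_law n) (G n)) \<longlonglongrightarrow> 1"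
  proof (rule tendsto_sandwich[OF _ _ lo tendsto_const])
    show "\<forall>\<^sub>F n in sequentially. 1 - real (card T) * (8 * L / (\<eta> * sqrt (real n))) \<le> measure (sample_law n) (G n)"
      using eventually_gt_at_top[of 0] by eventually_elim (rule GP)
    show "\<forall>\<^sub>F n in sequentially. measure (sample_law n) (G n) \<le> 1"
      using prob_space.prob_le_1[OF prob_space_sample_law] by (intro always_eventually) blast
  qed
  moreover have "\<forall>\<^sub>F n in sequentially. \<forall>z\<in>G n. no_ties n z \<longrightarrow> \<bar>uniform_pair.asymp_var (boot_base n z) cl\<^sub>1 cl\<^sub>2 p - asymp_var\<bar> \<le> \<epsilon>"
  proof -
    have "\<forall>\<^sub>F n in sequentially. 4 * L / sqrt (real n) < \<eta> / 2" using lim \<eta> by (intro order_tendstoD(2)) auto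
    then show ?thesis using eventually_gt_at_top[of 0]
    proof eventually_elim
      case (elim n)
      show ?case
      proof (intro ballI impI)
        fix z assume z: "z \<in> G n" and nt: "no_ties n z"
        interpret B: uniform_pair "boot_base n z" cl\<^sub>1 cl\<^sub>2 p by (rule boot_pair[OF elim(2) nt])
        have "\<bar>B.asymp_var - asymp_var\<bar> \<le> 19 * \<eta> + 96 * d + 24 / real k"
        proof (rule asymp_var_close[OF uniform_pair_axioms B.uniform_pair_axioms d k0])
          fix f assume f: "f \<in> test_functions d k"
          have "\<bar>B.mean_of f - (\<Sum>i<n. f (own_ecdf n fst z i) (own_ecdf n snd z i)) / real n\<bar> \<le> 4 * L / sqrt (real n)"
            unfolding B.mean_of_def by (rule boot_base_lipschitz[OF elim(2) TL]) (use f T_def in simp)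
          moreover have "(\<Sum>i<n. f (own_ecdf n fst z i) (own_ecdf n snd z i)) / real n = plug_in f n z"
            unfolding plug_in_def using own_ecdf_transform[OF nt] by (intro arg_cong2[where f="(/)"] sum.cong refl) auto
          moreover have "\<bar>plug_in f n z - mean_of f\<bar> < \<eta> / 2" using z f unfolding G_def T_def by blast
          ultimately show "\<bar>B.mean_of f - mean_of f\<bar> \<le> \<eta>" using elim(1) by linarith
        qed
        then show "\<bar>B.asymp_var - asymp_var\<bar> \<le> \<epsilon>" using small by linarith
      qed
    qed
  qed
  ultimately show ?thesis using Gm by blast
qed

end

section \<open>The variance of the limit\<close>

definition unit_square :: "(real \<times> real) set" where "unit_square = {0..1} \<times> {0..1}"

text \<open>The square is taken open: its boundary, where the partial derivatives may be arbitrary,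
  is left out.\<close>

definition corner :: "real \<Rightarrow> (real \<times> real) measure" where
  "corner p = restrict_space lborel ({0<..<p} \<times> {0<..<p})"

lemma open_corner: "open ({0<..<p} \<times> {0<..<p} :: (real \<times> real) set)"
  by (intro open_Times) auto

lemma corner_set[measurable, simp]: "({0<..<p} \<times> {0<..<p} :: (real \<times> real) set) \<in> sets borel"
  using open_corner by (rule borel_open)

lemma space_corner[simp]: "space (corner p) = {0<..<p} \<times> {0<..<p}"
  unfolding corner_def by (simp add: space_restrict_space)

lemma finite_measure_corner: "finite_measure (corner p)"
proof
  have "bounded ({0<..<p} \<times> {0<..<p} :: (real \<times> real) set)" by (intro bounded_Times) auto
  then have "emeasure lborel ({0<..<p} \<times> {0<..<p} :: (real \<times> real) set) < \<infinity>" by (rule emeasure_bounded_finite)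
  then show "emeasure (corner p) (space (corner p)) \<noteq> \<infinity>"
    unfolding corner_def by (simp add: emeasure_restrict_space space_restrict_space)
qed

lemma measurable_corner: "f \<in> borel_measurable borel \<Longrightarrow> f \<in> borel_measurable (corner p)"
  unfolding corner_def by (intro measurable_restrict_space1) simp

lemma integral_corner: "(\<integral>t. f t \<partial>corner p) = (\<integral>t. indicator ({0<..<p} \<times> {0<..<p}) t * (f t :: real) \<partial>lborel)"
  unfolding corner_def by (subst integral_restrict_space) auto

text \<open>Maps the bridge to the limit process.\<close>

definition lim_op :: "(real \<times> real \<Rightarrow> real) \<Rightarrow> (real \<times> real \<Rightarrow> real) \<Rightarrow> (real \<times> real \<Rightarrow> real) \<Rightarrow> real \<times> real \<Rightarrow> real" where
  "lim_op b\<^sub>1 b\<^sub>2 A t = A t - b\<^sub>1 t * A (fst t, 1) - b\<^sub>2 t * A (1, snd t)"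

text \<open>Stated for an arbitrary field \<open>A\<close> because it serves twice, for centred
  indicators under the law of the data and for the bridge on its own space. After two exchanges of
  integrals the second moment is a function of the covariance alone.\<close>

lemma linear_functional_moments:
  fixes A :: "real \<times> real \<Rightarrow> 'b \<Rightarrow> real"
  assumes N: "prob_space N" and p: "p \<le> 1"
    and Am: "(\<lambda>(\<omega>, t). A t \<omega>) \<in> borel_measurable (N \<Otimes>\<^sub>M borel)"
    and sq: "\<And>t. t \<in> unit_square \<Longrightarrow> integrable N (\<lambda>\<omega>. (A t \<omega>)\<^sup>2)"
    and mean: "\<And>t. t \<in> unit_square \<Longrightarrow> (\<integral>\<omega>. A t \<omega> \<partial>N) = 0"
    and cov: "\<And>s t. s \<in> unit_square \<Longrightarrow> t \<in> unit_square \<Longrightarrow> (\<integral>\<omega>. A s \<omega> * A t \<omega> \<partial>N) = \<Gamma> s t"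
    and \<Gamma>: "\<And>t. t \<in> unit_square \<Longrightarrow> \<Gamma> t t \<le> 1"
    and b1: "b\<^sub>1 \<in> borel_measurable borel" "\<And>t. \<bar>b\<^sub>1 t\<bar> \<le> 1" and b2: "b\<^sub>2 \<in> borel_measurable borel" "\<And>t. \<bar>b\<^sub>2 t\<bar> \<le> 1"
  defines "Z \<equiv> \<lambda>\<omega>. \<integral>t. lim_op b\<^sub>1 b\<^sub>2 (\<lambda>t. A t \<omega>) t \<partial>corner p"
  shows "integrable N Z" "(\<integral>\<omega>. Z \<omega> \<partial>N) = 0"
    "(\<integral>\<omega>. (Z \<omega>)\<^sup>2 \<partial>N) = (\<integral>(s, t). lim_op b\<^sub>1 b\<^sub>2 (\<lambda>s. lim_op b\<^sub>1 b\<^sub>2 (\<Gamma> s) t) s \<partial>(corner p \<Otimes>\<^sub>M corner p))"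
proof -
  let ?CC = "corner p \<Otimes>\<^sub>M corner p"
  interpret N: prob_space N by (rule N)
  interpret C: finite_measure "corner p" by (rule finite_measure_corner)
  interpret CN: pair_sigma_finite "corner p" N by standard
  interpret CC: pair_sigma_finite "corner p" "corner p" by standard
  interpret CCf: finite_measure "?CC" by (intro finite_measure_pair_measure finite_measure_corner)
  interpret CCN: pair_sigma_finite "?CC" N by standard
  define G where "G t \<omega> = lim_op b\<^sub>1 b\<^sub>2 (\<lambda>t. A t \<omega>) t" for t \<omega>
  have pts: "t \<in> unit_square" "(fst t, 1) \<in> unit_square" "(1, snd t) \<in> unit_square" if "t \<in> space (corner p)" for t
    using that p unfolding unit_square_def by auto
  have Amc: "(\<lambda>x. A (f x) (g x)) \<in> borel_measurable K" if "f \<in> borel_measurable K" "g \<in> measurable K N" for f g and K :: "'c measure"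
    using measurable_compose[OF measurable_Pair[OF that(2,1)] Am] by simp
  have fstm: "(\<lambda>x. (fst (f x), 1) :: real \<times> real) \<in> borel_measurable K" "(\<lambda>x. (1, snd (f x)) :: real \<times> real) \<in> borel_measurable K"
    if "f \<in> borel_measurable K" for f :: "'c \<Rightarrow> real \<times> real" and K
    using that by (auto intro!: borel_measurable_continuous_on[OF _ that] continuous_intros)
  have Gm: "(\<lambda>x. G (f x) (g x)) \<in> borel_measurable K" if f: "f \<in> borel_measurable K" and g: "g \<in> measurable K N" for f g and K :: "'c measure"
    unfolding G_def lim_op_def
    by (intro borel_measurable_diff borel_measurable_times Amc f g fstm measurable_compose[OF f b1(1)] measurable_compose[OF f b2(1)])
  have am: "A t \<in> borel_measurable N" for t using Amc[of "\<lambda>_. t" N "\<lambda>\<omega>. \<omega>"] by simp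
  have idc: "(\<lambda>t. t) \<in> borel_measurable (corner p)" by (rule measurable_corner) simp
  have prod_le: "\<bar>x * y\<bar> \<le> x\<^sup>2 + y\<^sup>2" for x y :: real
  proof -
    have "0 \<le> (\<bar>x\<bar> - \<bar>y\<bar>)\<^sup>2" "0 \<le> x\<^sup>2" "0 \<le> y\<^sup>2" by auto
    then have "2 * (\<bar>x\<bar> * \<bar>y\<bar>) \<le> x\<^sup>2 + y\<^sup>2" by (simp add: power2_eq_square algebra_simps)
    moreover have "0 \<le> \<bar>x\<bar> * \<bar>y\<bar>" by simp
    ultimately show ?thesis unfolding abs_mult by linarith
  qed
  have Api: "integrable N (\<lambda>\<omega>. A s \<omega> * A t \<omega>)" if "s \<in> unit_square" "t \<in> unit_square" for s t
    by (rule Bochner_Integration.integrable_bound[OF Bochner_Integration.integrable_add[OF sq[OF that(1)] sq[OF that(2)]]])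
      (use am prod_le in \<open>auto intro!: AE_I2 borel_measurable_times\<close>)
  have Ai: "integrable N (A t)" if "t \<in> unit_square" for t
    by (rule N.square_integrable_imp_integrable[OF am sq[OF that]])
  have Gi: "integrable N (G t)" "(\<integral>\<omega>. G t \<omega> \<partial>N) = 0" if "t \<in> space (corner p)" for t
    unfolding G_def lim_op_def using Ai[OF pts(1)[OF that]] Ai[OF pts(2)[OF that]] Ai[OF pts(3)[OF that]]
      mean[OF pts(1)[OF that]] mean[OF pts(2)[OF that]] mean[OF pts(3)[OF that]] by auto
  have GG: "integrable N (\<lambda>\<omega>. G s \<omega> * G t \<omega>)"
      "(\<integral>\<omega>. G s \<omega> * G t \<omega> \<partial>N) = lim_op b\<^sub>1 b\<^sub>2 (\<lambda>s. lim_op b\<^sub>1 b\<^sub>2 (\<Gamma> s) t) s"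
    if s: "s \<in> space (corner p)" and t: "t \<in> space (corner p)" for s t
  proof -
    let ?a = "\<lambda>s t. (\<lambda>\<omega>. A s \<omega> * A t \<omega>)"
    let ?s1 = "(fst s, 1)" and ?s2 = "(1, snd s)" and ?t1 = "(fst t, 1)" and ?t2 = "(1, snd t)"
    \<comment> \<open>The nine products are kept apart so that integrability and the covariance can
      be applied to each.\<close>
    have eq: "(\<lambda>\<omega>. G s \<omega> * G t \<omega>) = (\<lambda>\<omega>. (?a s t \<omega> - b\<^sub>1 t * ?a s ?t1 \<omega> - b\<^sub>2 t * ?a s ?t2 \<omega>)
       - b\<^sub>1 s * (?a ?s1 t \<omega> - b\<^sub>1 t * ?a ?s1 ?t1 \<omega> - b\<^sub>2 t * ?a ?s1 ?t2 \<omega>)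
       - b\<^sub>2 s * (?a ?s2 t \<omega> - b\<^sub>1 t * ?a ?s2 ?t1 \<omega> - b\<^sub>2 t * ?a ?s2 ?t2 \<omega>))"
      unfolding G_def lim_op_def by (auto simp: algebra_simps)
    note I = Api[OF pts(1)[OF s] pts(1)[OF t]] Api[OF pts(1)[OF s] pts(2)[OF t]] Api[OF pts(1)[OF s] pts(3)[OF t]]
      Api[OF pts(2)[OF s] pts(1)[OF t]] Api[OF pts(2)[OF s] pts(2)[OF t]] Api[OF pts(2)[OF s] pts(3)[OF t]]
      Api[OF pts(3)[OF s] pts(1)[OF t]] Api[OF pts(3)[OF s] pts(2)[OF t]] Api[OF pts(3)[OF s] pts(3)[OF t]]
    note c = cov[OF pts(1)[OF s] pts(1)[OF t]] cov[OF pts(1)[OF s] pts(2)[OF t]] cov[OF pts(1)[OF s] pts(3)[OF t]]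
      cov[OF pts(2)[OF s] pts(1)[OF t]] cov[OF pts(2)[OF s] pts(2)[OF t]] cov[OF pts(2)[OF s] pts(3)[OF t]]
      cov[OF pts(3)[OF s] pts(1)[OF t]] cov[OF pts(3)[OF s] pts(2)[OF t]] cov[OF pts(3)[OF s] pts(3)[OF t]]
    show "integrable N (\<lambda>\<omega>. G s \<omega> * G t \<omega>)" unfolding eq
      by (intro Bochner_Integration.integrable_diff integrable_mult_right I)
    show "(\<integral>\<omega>. G s \<omega> * G t \<omega> \<partial>N) = lim_op b\<^sub>1 b\<^sub>2 (\<lambda>s. lim_op b\<^sub>1 b\<^sub>2 (\<Gamma> s) t) s"
      unfolding eq lim_op_def using I
      by (simp add: Bochner_Integration.integral_diff Bochner_Integration.integrable_diff integrable_mult_right c)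
  qed
  \<comment> \<open>Three terms with slopes and variances at most 1 give \<open>3 * 3\<close>; this
    uniform bound justifies both exchanges of integrals.\<close>
  have G2: "(\<integral>\<omega>. (G t \<omega>)\<^sup>2 \<partial>N) \<le> 9" "integrable N (\<lambda>\<omega>. (G t \<omega>)\<^sup>2)" if t: "t \<in> space (corner p)" for t
  proof -
    show i: "integrable N (\<lambda>\<omega>. (G t \<omega>)\<^sup>2)" using GG(1)[OF t t] by (simp add: power2_eq_square)
    let ?t1 = "(fst t, 1)" and ?t2 = "(1, snd t)"
    have pw: "(G t \<omega>)\<^sup>2 \<le> 3 * ((A t \<omega>)\<^sup>2 + (A ?t1 \<omega>)\<^sup>2 + (A ?t2 \<omega>)\<^sup>2)" for \<omega>
    proof -
      define x y z where "x = A t \<omega>" and "y = b\<^sub>1 t * A ?t1 \<omega>" and "z = b\<^sub>2 t * A ?t2 \<omega>"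
      have "0 \<le> (x + y)\<^sup>2" "0 \<le> (x + z)\<^sup>2" "0 \<le> (y - z)\<^sup>2" by auto
      then have "(x - y - z)\<^sup>2 \<le> 3 * (x\<^sup>2 + y\<^sup>2 + z\<^sup>2)" by (simp add: power2_eq_square algebra_simps)
      moreover have "y\<^sup>2 \<le> 1 * (A ?t1 \<omega>)\<^sup>2" "z\<^sup>2 \<le> 1 * (A ?t2 \<omega>)\<^sup>2"
      proof -
        have "(b\<^sub>1 t)\<^sup>2 \<le> 1" "(b\<^sub>2 t)\<^sup>2 \<le> 1" using b1(2)[of t] b2(2)[of t] by (simp_all add: abs_square_le_1)
        then show "y\<^sup>2 \<le> 1 * (A ?t1 \<omega>)\<^sup>2" "z\<^sup>2 \<le> 1 * (A ?t2 \<omega>)\<^sup>2"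
          unfolding y_def z_def power_mult_distrib by (intro mult_right_mono; simp)+
      qed
      ultimately show ?thesis unfolding G_def lim_op_def x_def y_def z_def by simp
    qed
    have "(\<integral>\<omega>. (G t \<omega>)\<^sup>2 \<partial>N) \<le> (\<integral>\<omega>. 3 * ((A t \<omega>)\<^sup>2 + (A ?t1 \<omega>)\<^sup>2 + (A ?t2 \<omega>)\<^sup>2) \<partial>N)"
      using i pw sq[OF pts(1)[OF t]] sq[OF pts(2)[OF t]] sq[OF pts(3)[OF t]] by (intro integral_mono) auto
    also have "\<dots> = 3 * (\<Gamma> t t + \<Gamma> ?t1 ?t1 + \<Gamma> ?t2 ?t2)"
      using sq[OF pts(1)[OF t]] sq[OF pts(2)[OF t]] sq[OF pts(3)[OF t]]
        cov[OF pts(1)[OF t] pts(1)[OF t]] cov[OF pts(2)[OF t] pts(2)[OF t]] cov[OF pts(3)[OF t] pts(3)[OF t]]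
      by (simp add: power2_eq_square)
    also have "\<dots> \<le> 9" using \<Gamma>[OF pts(1)[OF t]] \<Gamma>[OF pts(2)[OF t]] \<Gamma>[OF pts(3)[OF t]] by simp
    finally show "(\<integral>\<omega>. (G t \<omega>)\<^sup>2 \<partial>N) \<le> 9" .
  qed
  have Fm: "(\<lambda>(t, \<omega>). G t \<omega>) \<in> borel_measurable (corner p \<Otimes>\<^sub>M N)"
    unfolding case_prod_unfold
    by (intro Gm measurable_compose[OF measurable_fst idc] measurable_snd)
  have F1: "integrable (corner p \<Otimes>\<^sub>M N) (\<lambda>(t, \<omega>). G t \<omega>)"
  proof (rule CN.Fubini_integrable[OF Fm])
    show "AE t in corner p. integrable N (\<lambda>\<omega>. case (t, \<omega>) of (t, \<omega>) \<Rightarrow> G t \<omega>)"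
      using Gi(1) by (auto intro!: AE_I2)
    have m: "(\<lambda>t. \<integral>\<omega>. \<bar>G t \<omega>\<bar> \<partial>N) \<in> borel_measurable (corner p)"
      by (intro N.borel_measurable_lebesgue_integral) (use Fm in \<open>auto simp: case_prod_unfold intro: borel_measurable_abs\<close>)
    have b: "(\<integral>\<omega>. \<bar>G t \<omega>\<bar> \<partial>N) \<le> 10" if t: "t \<in> space (corner p)" for t
    proof -
      have "(\<integral>\<omega>. \<bar>G t \<omega>\<bar> \<partial>N) \<le> (\<integral>\<omega>. (G t \<omega>)\<^sup>2 + 1\<^sup>2 \<partial>N)"
        using Gi(1)[OF t] G2(2)[OF t] prod_le[of _ 1] by (intro integral_mono) auto
      also have "\<dots> \<le> 10" using G2[OF t] by (simp add: N.prob_space)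
      finally show ?thesis .
    qed
    have "integrable (corner p) (\<lambda>t. \<integral>\<omega>. \<bar>G t \<omega>\<bar> \<partial>N)"
      using m b by (intro C.integrable_const_bound[of _ 10]) (auto intro!: AE_I2)
    then show "integrable (corner p) (\<lambda>t. \<integral>\<omega>. norm (case (t, \<omega>) of (t, \<omega>) \<Rightarrow> G t \<omega>) \<partial>N)" by simp
  qed
  have Zeq: "Z \<omega> = (\<integral>t. G t \<omega> \<partial>corner p)" for \<omega> unfolding Z_def G_def ..
  show "integrable N Z" unfolding Zeq[abs_def] using CN.integrable_snd[OF F1] by simp
  have "(\<integral>\<omega>. Z \<omega> \<partial>N) = (\<integral>t. (\<integral>\<omega>. G t \<omega> \<partial>N) \<partial>corner p)"
    unfolding Zeq using CN.Fubini_integral[OF F1] by simp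
  also have "\<dots> = (\<integral>t. 0 \<partial>corner p)" using Gi(2) by (intro Bochner_Integration.integral_cong) auto
  finally show "(\<integral>\<omega>. Z \<omega> \<partial>N) = 0" by simp
  have FFm: "(\<lambda>(st, \<omega>). G (fst st) \<omega> * G (snd st) \<omega>) \<in> borel_measurable (?CC \<Otimes>\<^sub>M N)"
    unfolding case_prod_unfold
    by (intro borel_measurable_times Gm measurable_compose[OF _ idc] measurable_snd measurable_compose[OF measurable_fst measurable_fst]
      measurable_compose[OF measurable_fst measurable_snd])
  have F2: "integrable (?CC \<Otimes>\<^sub>M N) (\<lambda>(st, \<omega>). G (fst st) \<omega> * G (snd st) \<omega>)"
  proof (rule CCN.Fubini_integrable[OF FFm])
    have sp: "fst st \<in> space (corner p)" "snd st \<in> space (corner p)" if "st \<in> space ?CC" for st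
      using that by (auto simp: space_pair_measure)
    show "AE st in ?CC. integrable N (\<lambda>\<omega>. case (st, \<omega>) of (st, \<omega>) \<Rightarrow> G (fst st) \<omega> * G (snd st) \<omega>)"
      using GG(1) sp by (auto intro!: AE_I2)
    have m: "(\<lambda>st. \<integral>\<omega>. \<bar>G (fst st) \<omega> * G (snd st) \<omega>\<bar> \<partial>N) \<in> borel_measurable ?CC"
      by (intro N.borel_measurable_lebesgue_integral) (use FFm in \<open>auto simp: case_prod_unfold intro: borel_measurable_abs\<close>)
    have b: "(\<integral>\<omega>. \<bar>G (fst st) \<omega> * G (snd st) \<omega>\<bar> \<partial>N) \<le> 18" if st: "st \<in> space ?CC" for st
    proof -
      have "(\<integral>\<omega>. \<bar>G (fst st) \<omega> * G (snd st) \<omega>\<bar> \<partial>N) \<le> (\<integral>\<omega>. (G (fst st) \<omega>)\<^sup>2 + (G (snd st) \<omega>)\<^sup>2 \<partial>N)"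
        using GG(1)[OF sp[OF st]] G2(2)[OF sp(1)[OF st]] G2(2)[OF sp(2)[OF st]] prod_le by (intro integral_mono) auto
      also have "\<dots> \<le> 18" using G2[OF sp(1)[OF st]] G2[OF sp(2)[OF st]] by simp
      finally show ?thesis .
    qed
    have "integrable ?CC (\<lambda>st. \<integral>\<omega>. \<bar>G (fst st) \<omega> * G (snd st) \<omega>\<bar> \<partial>N)"
      using m b by (intro CCf.integrable_const_bound[of _ 18]) (auto intro!: AE_I2)
    then show "integrable ?CC (\<lambda>st. \<integral>\<omega>. norm (case (st, \<omega>) of (st, \<omega>) \<Rightarrow> G (fst st) \<omega> * G (snd st) \<omega>) \<partial>N)" by simp
  qed
  \<comment> \<open>The square of an integral is an integral over the product; the integrability
    that this needs holds for almost every \<open>\<omega>\<close>.\<close>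
  have "(\<integral>\<omega>. (Z \<omega>)\<^sup>2 \<partial>N) = (\<integral>\<omega>. (\<integral>st. G (fst st) \<omega> * G (snd st) \<omega> \<partial>?CC) \<partial>N)"
  proof (rule integral_cong_AE)
    have "AE \<omega> in N. integrable ?CC (\<lambda>st. G (fst st) \<omega> * G (snd st) \<omega>)"
      using CCN.AE_integrable_snd[OF F2] by simp
    then show "AE \<omega> in N. (Z \<omega>)\<^sup>2 = (\<integral>st. G (fst st) \<omega> * G (snd st) \<omega> \<partial>?CC)"
    proof eventually_elim
      case (elim \<omega>)
      have "(\<integral>st. G (fst st) \<omega> * G (snd st) \<omega> \<partial>?CC) = (\<integral>s. (\<integral>t. G s \<omega> * G t \<omega> \<partial>corner p) \<partial>corner p)"
        using CC.integral_fst'[OF elim] by simp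
      also have "\<dots> = (Z \<omega>)\<^sup>2" unfolding Zeq by (simp add: power2_eq_square)
      finally show ?case by simp
    qed
    show "(\<lambda>\<omega>. (Z \<omega>)\<^sup>2) \<in> borel_measurable N" using \<open>integrable N Z\<close> by auto
    show "(\<lambda>\<omega>. \<integral>st. G (fst st) \<omega> * G (snd st) \<omega> \<partial>?CC) \<in> borel_measurable N"
      using CCN.integrable_snd[OF F2] by auto
  qed
  also have "\<dots> = (\<integral>st. (\<integral>\<omega>. G (fst st) \<omega> * G (snd st) \<omega> \<partial>N) \<partial>?CC)"
    using CCN.Fubini_integral[OF F2] by simp
  also have "\<dots> = (\<integral>(s, t). lim_op b\<^sub>1 b\<^sub>2 (\<lambda>s. lim_op b\<^sub>1 b\<^sub>2 (\<Gamma> s) t) s \<partial>?CC)"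
    using GG(2) by (intro Bochner_Integration.integral_cong) (auto simp: space_pair_measure)
  finally show "(\<integral>\<omega>. (Z \<omega>)\<^sup>2 \<partial>N) = (\<integral>(s, t). lim_op b\<^sub>1 b\<^sub>2 (\<lambda>s. lim_op b\<^sub>1 b\<^sub>2 (\<Gamma> s) t) s \<partial>?CC)" .
qed

text \<open>The continuous argument is discretised.\<close>

lemma caratheodory_measurable:
  fixes W :: "real \<times> real \<Rightarrow> 'b \<Rightarrow> real"
  assumes m: "\<And>t. W t \<in> borel_measurable N" and c: "\<And>\<omega>. \<omega> \<in> space N \<Longrightarrow> continuous_on UNIV (\<lambda>t. W t \<omega>)"
  shows "(\<lambda>(\<omega>, t). W t \<omega>) \<in> borel_measurable (N \<Otimes>\<^sub>M borel)"
proof -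
  define g where "g k t = (\<lfloor>real (Suc k) * fst t\<rfloor>, \<lfloor>real (Suc k) * snd t\<rfloor>)" for k and t :: "real \<times> real"
  define e where "e k ij = (real_of_int (fst ij) / real (Suc k), real_of_int (snd ij) / real (Suc k))" for k and ij :: "int \<times> int"
  have gm: "(\<lambda>x. g k (snd x)) \<in> measurable (N \<Otimes>\<^sub>M borel) (count_space UNIV)" for k
  proof -
    have f1: "(\<lambda>x. fst (snd x)) \<in> borel_measurable (N \<Otimes>\<^sub>M (borel :: (real \<times> real) measure))"
      "(\<lambda>x. snd (snd x)) \<in> borel_measurable (N \<Otimes>\<^sub>M (borel :: (real \<times> real) measure))"
      by (auto intro!: measurable_compose[OF measurable_snd] borel_measurable_continuous_onI continuous_intros)
    have "(\<lambda>x. \<lfloor>real (Suc k) * fst (snd x)\<rfloor>) \<in> measurable (N \<Otimes>\<^sub>M (borel :: (real \<times> real) measure)) (count_space UNIV)"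
      "(\<lambda>x. \<lfloor>real (Suc k) * snd (snd x)\<rfloor>) \<in> measurable (N \<Otimes>\<^sub>M (borel :: (real \<times> real) measure)) (count_space UNIV)"
      by (auto intro!: measurable_compose[OF _ measurable_real_floor] borel_measurable_times f1)
    then have "(\<lambda>x. g k (snd x)) \<in> measurable (N \<Otimes>\<^sub>M borel) (count_space UNIV \<Otimes>\<^sub>M count_space UNIV)"
      unfolding g_def by (rule measurable_Pair)
    then show ?thesis by (simp add: pair_measure_countable)
  qed
  \<comment> \<open>The rounded argument takes countably many values, so the composition is
    measurable; continuity in \<open>t\<close> passes this on to the limit.\<close>
  have fk: "(\<lambda>x. W (e k (g k (snd x))) (fst x)) \<in> borel_measurable (N \<Otimes>\<^sub>M borel)" for k
    by (rule measurable_compose_countable[OF _ gm, where f="\<lambda>ij x. W (e k ij) (fst x)"])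
      (rule measurable_compose[OF measurable_fst m])
  have lim: "(\<lambda>k. W (e k (g k (snd x))) (fst x)) \<longlonglongrightarrow> W (snd x) (fst x)" if x: "x \<in> space (N \<Otimes>\<^sub>M borel)" for x
  proof -
    have fl: "(\<lambda>k. real_of_int \<lfloor>real (Suc k) * y\<rfloor> / real (Suc k)) \<longlonglongrightarrow> y" for y :: real
    proof (rule LIM_zero_cancel, rule Lim_null_comparison)
      show "\<forall>\<^sub>F k in sequentially. norm (real_of_int \<lfloor>real (Suc k) * y\<rfloor> / real (Suc k) - y) \<le> 1 / real (Suc k)"
      proof (intro always_eventually allI)
        fix k
        have "real_of_int \<lfloor>real (Suc k) * y\<rfloor> / real (Suc k) - y = (real_of_int \<lfloor>real (Suc k) * y\<rfloor> - real (Suc k) * y) / real (Suc k)"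
          by (simp add: diff_divide_distrib)
        moreover have "\<bar>real_of_int \<lfloor>real (Suc k) * y\<rfloor> - real (Suc k) * y\<bar> \<le> 1" by linarith
        ultimately show "norm (real_of_int \<lfloor>real (Suc k) * y\<rfloor> / real (Suc k) - y) \<le> 1 / real (Suc k)"
          by (simp only: real_norm_def abs_divide abs_of_nat) (rule divide_right_mono, auto)
      qed
      show "(\<lambda>k. 1 / real (Suc k)) \<longlonglongrightarrow> 0" using LIMSEQ_inverse_real_of_nat by (simp add: inverse_eq_divide)
    qed
    have "(\<lambda>k. e k (g k (snd x))) \<longlonglongrightarrow> (fst (snd x), snd (snd x))"
      unfolding e_def g_def fst_conv snd_conv by (intro tendsto_Pair fl)
    then have e: "(\<lambda>k. e k (g k (snd x))) \<longlonglongrightarrow> snd x" by simp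
    have "isCont (\<lambda>t. W t (fst x)) (snd x)"
    proof -
      have "fst x \<in> space N" using x by (simp add: space_pair_measure mem_Times_iff)
      from c[OF this] show ?thesis unfolding continuous_on_eq_continuous_at[OF open_UNIV] by blast
    qed
    then show ?thesis using e by (rule isCont_tendsto_compose)
  qed
  have "(\<lambda>x. W (snd x) (fst x)) \<in> borel_measurable (N \<Otimes>\<^sub>M borel)"
    by (rule borel_measurable_LIMSEQ_real[OF lim fk])
  then show ?thesis by (simp add: case_prod_unfold)
qed


section \<open>Projections as integrals of the partial derivatives\<close>

lemma integral_threshold:
  assumes "0 \<le> c"
  shows "(\<integral>u. indicator {0<..<p} u * (of_bool (c \<le> u) :: real) \<partial>lborel) = hinge p c"
proof -
  have "(\<integral>u. indicator {0<..<p} u * (of_bool (c \<le> u) :: real) \<partial>lborel) = (\<integral>u. indicator {c..p} u \<partial>lborel)"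
  proof (rule integral_cong_AE)
    show "AE u in lborel. indicator {0<..<p} u * (of_bool (c \<le> u) :: real) = indicator {c..p} u"
      using AE_lborel_singleton[of 0] AE_lborel_singleton[of p]
      by eventually_elim (use assms in \<open>auto simp: indicator_def\<close>)
  qed auto
  also have "\<dots> = measure lborel {c..p}" by simp
  also have "\<dots> = hinge p c" unfolding hinge_def by (cases "c \<le> p") auto
  finally show ?thesis .
qed

lemma integral_corner_product:
  fixes f g :: "real \<Rightarrow> real"
  assumes [measurable]: "f \<in> borel_measurable borel" "g \<in> borel_measurable borel"
    and b: "\<And>u. \<bar>f u\<bar> \<le> 1" "\<And>v. \<bar>g v\<bar> \<le> 1"
  shows "(\<integral>t. f (fst t) * g (snd t) \<partial>corner p) = (\<integral>u. indicator {0<..<p} u * f u \<partial>lborel) * (\<integral>v. indicator {0<..<p} v * g v \<partial>lborel)"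
proof -
  have "(fst :: real \<times> real \<Rightarrow> real) \<in> borel_measurable borel" "(snd :: real \<times> real \<Rightarrow> real) \<in> borel_measurable borel"
    by (auto intro!: borel_measurable_continuous_onI continuous_intros)
  then have m: "(\<lambda>t. f (fst t) * g (snd t)) \<in> borel_measurable borel"
    by (intro borel_measurable_times measurable_compose[OF _ assms(1)] measurable_compose[OF _ assms(2)])
  interpret C: finite_measure "corner p" by (rule finite_measure_corner)
  have "integrable (corner p) (\<lambda>t. f (fst t) * g (snd t))"
    using b by (intro C.integrable_const_bound[of _ 1] measurable_corner[OF m]) (auto simp: abs_mult mult_le_one)
  then have i: "integrable (lborel \<Otimes>\<^sub>M lborel) (\<lambda>t. indicator ({0<..<p} \<times> {0<..<p}) t * (f (fst t) * g (snd t)))"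
    unfolding corner_def by (subst (asm) integrable_restrict_space) (auto simp: lborel_prod)
  have "(\<integral>t. f (fst t) * g (snd t) \<partial>corner p) = (\<integral>t. indicator ({0<..<p} \<times> {0<..<p}) t * (f (fst t) * g (snd t)) \<partial>(lborel \<Otimes>\<^sub>M lborel))"
    unfolding integral_corner lborel_prod ..
  also have "\<dots> = (\<integral>u. (\<integral>v. indicator ({0<..<p} \<times> {0<..<p}) (u, v) * (f u * g v) \<partial>lborel) \<partial>lborel)"
    using lborel_pair.integral_fst'[OF i] by simp
  also have "\<dots> = (\<integral>u. (indicator {0<..<p} u * f u) * (\<integral>v. indicator {0<..<p} v * g v \<partial>lborel) \<partial>lborel)"
    by (intro Bochner_Integration.integral_cong refl) (simp add: indicator_times mult_ac flip: integral_mult_right_zero)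
  finally show ?thesis by simp
qed

text \<open>Extension by zero off the set where the derivative is given. It makes the slope Borel
  measurable and bounded on the whole plane, as the moment computation requires.\<close>

definition slope :: "(real \<Rightarrow> real \<Rightarrow> real) \<Rightarrow> real \<times> real \<Rightarrow> real" where
  "slope D t = indicator ({0<..<1} \<times> {0..1}) t * D (fst t) (snd t)"

context uniform_pair
begin

definition joint :: "real \<times> real \<Rightarrow> real" where
  "joint t = prob {x \<in> space M. c\<^sub>1 x \<le> fst t \<and> c\<^sub>2 x \<le> snd t}"

lemma joint_bounds: "0 \<le> joint t" "joint t \<le> 1"
  unfolding joint_def by auto

lemma joint_eq_integral: "joint t = (\<integral>x. of_bool (c\<^sub>1 x \<le> fst t \<and> c\<^sub>2 x \<le> snd t) \<partial>M)"
proof -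
  have "(\<integral>x. of_bool (c\<^sub>1 x \<le> fst t \<and> c\<^sub>2 x \<le> snd t) \<partial>M) = (\<integral>x. indicator {x \<in> space M. c\<^sub>1 x \<le> fst t \<and> c\<^sub>2 x \<le> snd t} x \<partial>M :: real)"
    by (intro Bochner_Integration.integral_cong) (auto simp: indicator_def)
  then show ?thesis unfolding joint_def by simp
qed

lemma joint_margins: "0 \<le> u \<Longrightarrow> u \<le> 1 \<Longrightarrow> joint (u, 1) = u" "0 \<le> u \<Longrightarrow> u \<le> 1 \<Longrightarrow> joint (1, u) = u"
  unfolding joint_def using c1.c_uniform[of u] c2.c_uniform[of u] c1.c_range c2.c_range by auto

definition centered :: "real \<times> real \<Rightarrow> 'a \<Rightarrow> real" where
  "centered t x = of_bool (c\<^sub>1 x \<le> fst t \<and> c\<^sub>2 x \<le> snd t) - joint t"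

lemma below_measurable:
  assumes f: "f \<in> borel_measurable K" and g: "g \<in> measurable K M"
  shows "(\<lambda>z. of_bool (c\<^sub>1 (g z) \<le> fst (f z) \<and> c\<^sub>2 (g z) \<le> snd (f z)) :: real) \<in> borel_measurable K"
proof -
  have fs: "(\<lambda>z. fst (f z)) \<in> borel_measurable K" "(\<lambda>z. snd (f z)) \<in> borel_measurable K"
    using f by (auto intro!: borel_measurable_continuous_on[OF _ f] continuous_intros)
  have "(\<lambda>z. (of_bool (c\<^sub>1 (g z) \<le> fst (f z)) :: real) * of_bool (c\<^sub>2 (g z) \<le> snd (f z))) \<in> borel_measurable K"
    by (intro borel_measurable_times measurable_of_bool_cmp fs c1.c_compose_measurable c2.c_compose_measurable g)
  then show ?thesis by (simp add: of_bool_conj)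
qed

lemma joint_measurable: "joint \<in> borel_measurable borel"
proof -
  have "(\<lambda>t. \<integral>x. of_bool (c\<^sub>1 x \<le> fst t \<and> c\<^sub>2 x \<le> snd t) \<partial>M :: real) \<in> borel_measurable borel"
    by (intro borel_measurable_lebesgue_integral)
      (simp add: case_prod_unfold, intro below_measurable, auto)
  then show ?thesis unfolding joint_eq_integral[abs_def] .
qed

lemma centered_measurable: "(\<lambda>(x, t). centered t x) \<in> borel_measurable (M \<Otimes>\<^sub>M borel)"
  unfolding centered_def case_prod_unfold
  by (intro borel_measurable_diff below_measurable measurable_snd measurable_fst measurable_compose[OF measurable_snd joint_measurable])

lemma below_integrable: "integrable M (\<lambda>x. of_bool (c\<^sub>1 x \<le> fst t \<and> c\<^sub>2 x \<le> snd t) :: real)"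
  by (intro integrable_const_bound[of _ 1] below_measurable) auto

lemma centered_moments:
  shows "integrable M (\<lambda>x. (centered t x)\<^sup>2)" "(\<integral>x. centered t x \<partial>M) = 0"
    "(\<integral>x. centered s x * centered t x \<partial>M) = joint (min (fst s) (fst t), min (snd s) (snd t)) - joint s * joint t"
proof -
  have m: "centered t \<in> borel_measurable M" unfolding centered_def by (intro borel_measurable_diff below_measurable) auto
  have "\<bar>centered t x\<bar> \<le> 1" for x unfolding centered_def using joint_bounds[of t] by auto
  then show "integrable M (\<lambda>x. (centered t x)\<^sup>2)"
    using m by (intro integrable_const_bound[of _ 1]) (auto simp: abs_square_le_1)
  show "(\<integral>x. centered t x \<partial>M) = 0"
    unfolding centered_def using below_integrable[of t] by (simp add: joint_eq_integral prob_space)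
  have eq: "(\<lambda>x. centered s x * centered t x) = (\<lambda>x. of_bool (c\<^sub>1 x \<le> fst (min (fst s) (fst t), min (snd s) (snd t)) \<and> c\<^sub>2 x \<le> snd (min (fst s) (fst t), min (snd s) (snd t)))
     - joint t * of_bool (c\<^sub>1 x \<le> fst s \<and> c\<^sub>2 x \<le> snd s) - joint s * of_bool (c\<^sub>1 x \<le> fst t \<and> c\<^sub>2 x \<le> snd t) + joint s * joint t)"
    unfolding centered_def by (auto simp: of_bool_def algebra_simps)
  have "(\<integral>x. centered s x * centered t x \<partial>M) = joint (min (fst s) (fst t), min (snd s) (snd t)) - joint t * joint s - joint s * joint t + joint s * joint t"
    unfolding eq joint_eq_integral[of "(min (fst s) (fst t), min (snd s) (snd t))"] joint_eq_integral[of s, symmetric]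
    using below_integrable[of "(min (fst s) (fst t), min (snd s) (snd t))"] below_integrable[of s] below_integrable[of t]
    by (simp add: prob_space joint_eq_integral[symmetric] joint_eq_integral[of s, symmetric] joint_eq_integral[of t, symmetric])
  then show "(\<integral>x. centered s x * centered t x \<partial>M) = joint (min (fst s) (fst t), min (snd s) (snd t)) - joint s * joint t" by simp
qed

lemma joint_increment:
  assumes "0 \<le> u" "u \<le> u'" "u' \<le> 1"
  shows "joint (u, v) \<le> joint (u', v)" "joint (u', v) - joint (u, v) \<le> u' - u"
proof -
  have m[measurable]: "{x \<in> space M. c\<^sub>1 x \<le> a \<and> c\<^sub>2 x \<le> v} \<in> events" "{x \<in> space M. c\<^sub>1 x \<le> a} \<in> events" for a by measurable
  show "joint (u, v) \<le> joint (u', v)"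
    unfolding joint_def using assms m by (intro finite_measure_mono) auto
  have "joint (u', v) - joint (u, v) = prob ({x \<in> space M. c\<^sub>1 x \<le> u' \<and> c\<^sub>2 x \<le> v} - {x \<in> space M. c\<^sub>1 x \<le> u \<and> c\<^sub>2 x \<le> v})"
    unfolding joint_def fst_conv snd_conv using assms m by (intro finite_measure_Diff[symmetric]) auto
  also have "\<dots> \<le> prob ({x \<in> space M. c\<^sub>1 x \<le> u'} - {x \<in> space M. c\<^sub>1 x \<le> u})"
    using m by (intro finite_measure_mono sets.Diff) auto
  also have "\<dots> = prob {x \<in> space M. c\<^sub>1 x \<le> u'} - prob {x \<in> space M. c\<^sub>1 x \<le> u}"
    using assms m by (intro finite_measure_Diff) auto
  also have "\<dots> = u' - u" using c1.c_uniform assms by simp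
  finally show "joint (u', v) - joint (u, v) \<le> u' - u" .
qed

context
  fixes K1 :: "real \<Rightarrow> real \<Rightarrow> real"
  assumes dK: "\<And>u v. u \<in> {0<..<1} \<Longrightarrow> v \<in> {0..1} \<Longrightarrow> ((\<lambda>u'. joint (u', v)) has_real_derivative K1 u v) (at u)"
    and cK: "continuous_on ({0<..<1} \<times> {0..1}) (\<lambda>(u, v). K1 u v)"
begin

text \<open>Both \<open>joint\<close> and the identity minus \<open>joint\<close> are nondecreasing
  in \<open>u\<close>, the latter because the first margin is uniform.\<close>

lemma partial_bounds:
  assumes u: "u \<in> {0<..<1}" and v: "v \<in> {0..1}"
  shows "0 \<le> K1 u v" "K1 u v \<le> 1"
proof -
  have int: "u \<in> interior {0..1}" using u by simp
  have "mono_on {0..1} (\<lambda>u. joint (u, v))" using joint_increment(1) by (intro mono_onI) auto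
  then show "0 \<le> K1 u v" using dK[OF u v] int by (rule mono_on_imp_deriv_nonneg)
  have "mono_on {0..1} (\<lambda>u. u - joint (u, v))"
  proof (rule mono_onI)
    fix r s :: real assume "r \<in> {0..1}" "s \<in> {0..1}" "r \<le> s"
    then show "r - joint (r, v) \<le> s - joint (s, v)" using joint_increment(2)[of r s v] by simp
  qed
  moreover have "((\<lambda>u. u - joint (u, v)) has_real_derivative 1 - K1 u v) (at u)"
    by (intro DERIV_diff DERIV_ident dK u v)
  ultimately have "0 \<le> 1 - K1 u v" using int by (rule mono_on_imp_deriv_nonneg)
  then show "K1 u v \<le> 1" by simp
qed

lemma partial_measurable: "slope K1 \<in> borel_measurable borel"
proof -
  have "({0<..<1} \<times> {0..1} :: (real \<times> real) set) \<in> sets borel"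
    unfolding borel_prod[symmetric] by (intro pair_measureI) auto
  then have "(\<lambda>t. indicator ({0<..<1} \<times> {0..1}) t *\<^sub>R (case t of (u, v) \<Rightarrow> K1 u v)) \<in> borel_measurable borel"
    using cK by (rule borel_measurable_continuous_on_indicator)
  then show ?thesis unfolding slope_def[abs_def] by (simp add: case_prod_unfold)
qed

lemma partial_range: "0 \<le> slope K1 t" "\<bar>slope K1 t\<bar> \<le> 1"
  unfolding slope_def using partial_bounds[of "fst t" "snd t"] by (auto simp: indicator_def mem_Times_iff)

lemma partial_slice_measurable[measurable]: "(\<lambda>u. slope K1 (u, v)) \<in> borel_measurable borel"
  by (rule measurable_compose[OF _ partial_measurable]) (auto intro!: borel_measurable_continuous_onI continuous_intros)

text \<open>The derivative is known inside the interval only. Sections of \<open>joint\<close> are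
  1-Lipschitz, and continuity up to the end points is all that the fundamental theorem asks for
  there.\<close>

lemma nn_integral_partial:
  assumes v: "v \<in> {0..1}" and x: "0 < x" "x \<le> 1"
  shows "(\<integral>\<^sup>+u. ennreal (slope K1 (u, v)) * indicator {..x} u \<partial>lborel) = ennreal (joint (x, v))"
proof -
  have cont: "continuous_on {0..x} (\<lambda>u. joint (u, v))"
  proof (rule continuous_on_subset[of "{0..1}"], rule lipschitz_on_continuous_on[of 1], rule lipschitz_onI)
    fix a b :: real assume ab: "a \<in> {0..1}" "b \<in> {0..1}"
    show "dist (joint (a, v)) (joint (b, v)) \<le> 1 * dist a b"
      using joint_increment[of a b v] joint_increment[of b a v] ab by (cases "a \<le> b") (auto simp: dist_real_def)
  qed (use x in auto)
  have j0: "joint (0, v) = 0"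
  proof -
    have "joint (0, v) \<le> prob {z \<in> space M. c\<^sub>1 z \<le> 0}" unfolding joint_def by (intro finite_measure_mono) auto
    then show ?thesis using c1.c_uniform[of 0] joint_bounds(1)[of "(0, v)"] by simp
  qed
  have "((\<lambda>u. K1 u v) has_integral (joint (x, v) - joint (0, v))) {0..x}"
  proof (rule fundamental_theorem_of_calculus_interior[OF _ cont])
    show "((\<lambda>u. joint (u, v)) has_vector_derivative K1 u v) (at u)" if "u \<in> {0<..<x}" for u
      using dK[of u v] that v x by (simp add: has_real_derivative_iff_has_vector_derivative)
  qed (use x in simp)
  \<comment> \<open>\<open>slope\<close> is zero at 0 and 1, where \<open>K1\<close> may take other
    values; two points do not affect the integral.\<close>
  then have "((\<lambda>u. slope K1 (u, v)) has_integral joint (x, v)) {0..x}"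
    unfolding j0 diff_zero
    by (rule has_integral_spike_finite[of "{0, 1}", rotated 2]) (use v x in \<open>auto simp: slope_def indicator_def\<close>)
  then have "((\<lambda>u. slope K1 (u, v) * indicator {0..x} u) has_integral joint (x, v)) UNIV"
  proof -
    assume *: "((\<lambda>u. slope K1 (u, v)) has_integral joint (x, v)) {0..x}"
    have eq: "(\<lambda>u. if u \<in> {0..x} then slope K1 (u, v) else 0) = (\<lambda>u. slope K1 (u, v) * indicator {0..x} u)"
      by (rule ext) (auto simp: indicator_def)
    show ?thesis using has_integral_restrict_UNIV[of "{0..x}" "\<lambda>u. slope K1 (u, v)"] * unfolding eq by blast
  qed
  then have "(\<integral>\<^sup>+u. ennreal (slope K1 (u, v) * indicator {0..x} u) \<partial>lborel) = ennreal (joint (x, v))"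
    using partial_range(1) by (intro nn_integral_has_integral_lborel) auto
  moreover have "ennreal (slope K1 (u, v)) * indicator {..x} u = ennreal (slope K1 (u, v) * indicator {0..x} u)" for u
    by (auto simp: slope_def indicator_def)
  ultimately show ?thesis by simp
qed

text \<open>On the event \<open>c\<^sub>2 x \<le> v\<close> the law of the first coordinate has
  density \<open>slope K1 (u, v)\<close>: both measures have the same distribution function and
  hence coincide.\<close>

lemma integral_partial:
  assumes v: "v \<in> {0..1}" and r[measurable]: "r \<in> borel_measurable borel"
  shows "(\<integral>x. r (c\<^sub>1 x) * of_bool (c\<^sub>2 x \<le> v) \<partial>M) = (\<integral>u. r u * slope K1 (u, v) \<partial>lborel)"
proof -
  define S where "S = {x \<in> space M. c\<^sub>2 x \<le> v}"
  have S[measurable]: "S \<in> events" unfolding S_def by measurable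
  define M1 where "M1 = distr (density M (\<lambda>x. ennreal (indicator S x))) borel c\<^sub>1"
  define M2 where "M2 = density lborel (\<lambda>u. ennreal (slope K1 (u, v)))"
  have em1: "emeasure M1 A = emeasure M {x \<in> space M. c\<^sub>1 x \<in> A \<and> c\<^sub>2 x \<le> v}" if [measurable]: "A \<in> sets borel" for A
  proof -
    have "emeasure M1 A = emeasure (density M (\<lambda>x. ennreal (indicator S x))) (c\<^sub>1 -` A \<inter> space M)"
      unfolding M1_def by (subst emeasure_distr) auto
    also have "\<dots> = (\<integral>\<^sup>+x. indicator {x \<in> space M. c\<^sub>1 x \<in> A \<and> c\<^sub>2 x \<le> v} x \<partial>M)"
    proof (subst emeasure_density)
      show "(\<integral>\<^sup>+x. ennreal (indicator S x) * indicator (c\<^sub>1 -` A \<inter> space M) x \<partial>M)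
          = (\<integral>\<^sup>+x. indicator {x \<in> space M. c\<^sub>1 x \<in> A \<and> c\<^sub>2 x \<le> v} x \<partial>M)"
        by (rule nn_integral_cong) (auto simp: S_def indicator_def)
    qed auto
    also have "\<dots> = emeasure M {x \<in> space M. c\<^sub>1 x \<in> A \<and> c\<^sub>2 x \<le> v}" by (rule nn_integral_indicator) measurable
    finally show ?thesis .
  qed
  have le1: "emeasure M1 {..x} = ennreal (joint (x, v))" for x
    unfolding joint_def by (simp add: em1 emeasure_eq_measure)
  have joint_hi: "joint (x, v) = joint (1, v)" if "1 \<le> x" for x
    unfolding joint_def using c1.c_range that by (auto intro!: arg_cong[where f=prob] intro: order_trans)
  have le2: "emeasure M2 {..x} = ennreal (joint (x, v))" for x
  proof -
    have e: "emeasure M2 {..x} = (\<integral>\<^sup>+u. ennreal (slope K1 (u, v)) * indicator {..x} u \<partial>lborel)"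
      unfolding M2_def by (rule emeasure_density) auto
    consider "x \<le> 0" | "0 < x" "x \<le> 1" | "1 < x" by linarith
    then show ?thesis
    proof cases
      case 1
      have "joint (x, v) \<le> prob {z \<in> space M. c\<^sub>1 z \<le> 0}" unfolding joint_def using 1 by (intro finite_measure_mono) auto
      then have "joint (x, v) = 0" using c1.c_uniform[of 0] joint_bounds(1)[of "(x, v)"] by simp
      moreover have "(\<integral>\<^sup>+u. ennreal (slope K1 (u, v)) * indicator {..x} u \<partial>lborel) = (\<integral>\<^sup>+(u::real). 0 \<partial>lborel)"
        using 1 by (intro nn_integral_cong) (auto simp: slope_def indicator_def)
      ultimately show ?thesis unfolding e by simp
    next
      case 2
      then show ?thesis unfolding e by (rule nn_integral_partial[OF v])
    next
      case 3
      have "(\<integral>\<^sup>+u. ennreal (slope K1 (u, v)) * indicator {..x} u \<partial>lborel) = (\<integral>\<^sup>+u. ennreal (slope K1 (u, v)) * indicator {..1} u \<partial>lborel)"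
        using 3 by (intro nn_integral_cong) (auto simp: slope_def indicator_def)
      then show ?thesis unfolding e using nn_integral_partial[OF v, of 1] joint_hi[of x] 3 by simp
    qed
  qed
  have tot1: "emeasure M1 UNIV = ennreal (joint (1, v))"
    using em1[of UNIV] c1.c_range by (simp add: emeasure_eq_measure joint_def)
  have tot2: "emeasure M2 UNIV = ennreal (joint (1, v))"
  proof -
    have "emeasure M2 UNIV = (\<integral>\<^sup>+u. ennreal (slope K1 (u, v)) * indicator UNIV u \<partial>lborel)"
      unfolding M2_def by (rule emeasure_density) auto
    also have "\<dots> = (\<integral>\<^sup>+u. ennreal (slope K1 (u, v)) * indicator {..1} u \<partial>lborel)"
      by (intro nn_integral_cong) (auto simp: slope_def indicator_def)
    finally show ?thesis using nn_integral_partial[OF v, of 1] by simp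
  qed
  have "M1 = M2"
  proof (rule cdf_unique')
    have s1: "sets M1 = sets borel" "space M1 = UNIV" and s2: "sets M2 = sets borel" "space M2 = UNIV"
      unfolding M1_def M2_def by auto
    show "finite_borel_measure M1"
      by (intro finite_borel_measure.intro finite_measureI finite_borel_measure_axioms.intro) (simp_all add: s1 tot1)
    show "finite_borel_measure M2"
      by (intro finite_borel_measure.intro finite_measureI finite_borel_measure_axioms.intro) (simp_all add: s2 tot2)
    show "cdf M1 = cdf M2" unfolding cdf_def measure_def le1 le2 ..
  qed
  have "(\<integral>x. r (c\<^sub>1 x) * of_bool (c\<^sub>2 x \<le> v) \<partial>M) = (\<integral>x. indicator S x * r (c\<^sub>1 x) \<partial>M)"
    by (intro Bochner_Integration.integral_cong) (auto simp: S_def indicator_def)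
  also have "\<dots> = (\<integral>x. r (c\<^sub>1 x) \<partial>density M (\<lambda>x. ennreal (indicator S x)))"
    by (subst integral_density) auto
  also have "\<dots> = (\<integral>u. r u \<partial>M1)" unfolding M1_def by (subst integral_distr) auto
  also have "\<dots> = (\<integral>u. slope K1 (u, v) * r u \<partial>lborel)"
    unfolding \<open>M1 = M2\<close> M2_def using partial_range by (subst integral_density) auto
  finally show ?thesis by (simp add: mult.commute)
qed

text \<open>\<open>hinge\<close> is unfolded as an integral of indicators over the second threshold,
  the integrals are exchanged, and the law restricted to each event is replaced by its density. Here
  the partial derivative of the copula enters the influence function.\<close>

lemma proj_partial:
  shows "c1.proj wt\<^sub>1 s = (\<integral>t. slope K1 t * (of_bool (s \<le> fst t) - fst t) \<partial>corner p)"
proof -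
  \<comment> \<open>The factor \<open>of_bool (0 < u)\<close> matches the open square; the point
    that it excludes has probability zero.\<close>
  define r where "r u = of_bool (0 < u) * (of_bool (u < p) * (of_bool (s \<le> u) - u))" for u :: real
  have r[measurable]: "r \<in> borel_measurable borel" unfolding r_def by measurable
  have rb: "\<bar>r u\<bar> \<le> 1" for u using p by (auto simp: r_def of_bool_def)
  interpret Lebb: pair_sigma_finite M lborel by standard
  interpret C: finite_measure "corner p" by (rule finite_measure_corner)
  have AE0: "AE x in M. c\<^sub>1 x \<noteq> 0"
  proof -
    have "prob {x \<in> space M. c\<^sub>1 x = 0} \<le> prob {x \<in> space M. c\<^sub>1 x \<le> 0}" by (intro finite_measure_mono) auto
    then have "prob {x \<in> space M. c\<^sub>1 x = 0} = 0" using c1.c_uniform[of 0] measure_nonneg[of M "{x \<in> space M. c\<^sub>1 x = 0}"] by simp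
    then show ?thesis by (subst (asm) prob_Collect_eq_0) auto
  qed
  have mm: "(\<lambda>(x, v). r (c\<^sub>1 x) * (indicator {0<..<p} v * of_bool (c\<^sub>2 x \<le> v))) \<in> borel_measurable (M \<Otimes>\<^sub>M lborel)"
    by measurable
  have "c1.proj wt\<^sub>1 s = (\<integral>x. r (c\<^sub>1 x) * hinge p (c\<^sub>2 x) \<partial>M)"
    unfolding c1.proj_def wt\<^sub>1_def r_def
  proof (rule integral_cong_AE)
    show "AE x in M. of_bool (c\<^sub>1 x < p) * hinge p (c\<^sub>2 x) * (of_bool (s \<le> c\<^sub>1 x) - c\<^sub>1 x) =
      of_bool (0 < c\<^sub>1 x) * (of_bool (c\<^sub>1 x < p) * (of_bool (s \<le> c\<^sub>1 x) - c\<^sub>1 x)) * hinge p (c\<^sub>2 x)"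
      using AE0
    proof eventually_elim
      case (elim x)
      then have "0 < c\<^sub>1 x" using c1.c_range[of x] by linarith
      then show ?case by (simp add: mult_ac)
    qed
  qed measurable
  also have "\<dots> = (\<integral>x. (\<integral>v. r (c\<^sub>1 x) * (indicator {0<..<p} v * of_bool (c\<^sub>2 x \<le> v)) \<partial>lborel) \<partial>M)"
    using integral_threshold c2.c_range by simp
  also have "\<dots> = (\<integral>v. (\<integral>x. r (c\<^sub>1 x) * (indicator {0<..<p} v * of_bool (c\<^sub>2 x \<le> v)) \<partial>M) \<partial>lborel)"
  proof (rule Lebb.Fubini_integral[symmetric])
    show "integrable (M \<Otimes>\<^sub>M lborel) (\<lambda>(x, v). r (c\<^sub>1 x) * (indicator {0<..<p} v * of_bool (c\<^sub>2 x \<le> v)))"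
    proof (rule Lebb.Fubini_integrable[OF mm])
      have i: "integrable lborel (\<lambda>v. indicator {0<..<p} v * of_bool (c \<le> v) :: real)" for c
        by (rule Bochner_Integration.integrable_bound[of _ "indicator {0<..<p} :: real \<Rightarrow> real"]) (auto simp: p)
      show "AE x in M. integrable lborel (\<lambda>v. case (x, v) of (x, v) \<Rightarrow> r (c\<^sub>1 x) * (indicator {0<..<p} v * of_bool (c\<^sub>2 x \<le> v)))"
        using i by (intro AE_I2) simp
      have "(\<integral>v. norm (r (c\<^sub>1 x) * (indicator {0<..<p} v * of_bool (c\<^sub>2 x \<le> v))) \<partial>lborel) = \<bar>r (c\<^sub>1 x)\<bar> * hinge p (c\<^sub>2 x)" for x
        using integral_threshold[of "c\<^sub>2 x" p] c2.c_range[of x] by (simp add: abs_mult)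
      moreover have "integrable M (\<lambda>x. \<bar>r (c\<^sub>1 x)\<bar> * hinge p (c\<^sub>2 x))"
        using rb hinge_c by (intro integrable_const_bound[of _ 1]) (auto simp: abs_mult intro!: mult_le_one)
      ultimately show "integrable M (\<lambda>x. \<integral>v. norm (case (x, v) of (x, v) \<Rightarrow> r (c\<^sub>1 x) * (indicator {0<..<p} v * of_bool (c\<^sub>2 x \<le> v))) \<partial>lborel)"
        by simp
    qed
  qed
  also have "\<dots> = (\<integral>v. indicator {0<..<p} v * (\<integral>u. r u * slope K1 (u, v) \<partial>lborel) \<partial>lborel)"
  proof (intro Bochner_Integration.integral_cong refl)
    fix v :: real
    show "(\<integral>x. r (c\<^sub>1 x) * (indicator {0<..<p} v * of_bool (c\<^sub>2 x \<le> v)) \<partial>M) = indicator {0<..<p} v * (\<integral>u. r u * slope K1 (u, v) \<partial>lborel)"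
      using integral_partial[of v r] p by (auto simp: indicator_def)
  qed
  also have "\<dots> = (\<integral>v. (\<integral>u. indicator ({0<..<p} \<times> {0<..<p}) (u, v) * (slope K1 (u, v) * (of_bool (s \<le> u) - u)) \<partial>lborel) \<partial>lborel)"
    unfolding integral_mult_right_zero[symmetric]
    by (intro Bochner_Integration.integral_cong refl) (auto simp: r_def indicator_def)
  also have "\<dots> = (\<integral>t. indicator ({0<..<p} \<times> {0<..<p}) t * (slope K1 t * (of_bool (s \<le> fst t) - fst t)) \<partial>(lborel \<Otimes>\<^sub>M lborel))"
  proof -
    have m: "(\<lambda>t. slope K1 t * (of_bool (s \<le> fst t) - fst t)) \<in> borel_measurable borel"
    proof -
      have f: "(fst :: real \<times> real \<Rightarrow> real) \<in> borel_measurable borel" by (auto intro!: borel_measurable_continuous_onI continuous_intros)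
      show ?thesis by (intro borel_measurable_times partial_measurable borel_measurable_diff measurable_of_bool_cmp f) simp
    qed
    have "integrable (corner p) (\<lambda>t. slope K1 t * (of_bool (s \<le> fst t) - fst t))"
    proof (intro C.integrable_const_bound[of _ 1] measurable_corner[OF m] AE_I2)
      fix t assume "t \<in> space (corner p)"
      then have "\<bar>of_bool (s \<le> fst t) - fst t\<bar> \<le> 1" using p by (auto simp: of_bool_def)
      then show "norm (slope K1 t * (of_bool (s \<le> fst t) - fst t)) \<le> 1"
        using partial_range(2)[of t] unfolding real_norm_def abs_mult by (intro mult_le_one) auto
    qed
    then have "integrable (lborel \<Otimes>\<^sub>M lborel) (\<lambda>t. indicator ({0<..<p} \<times> {0<..<p}) t * (slope K1 t * (of_bool (s \<le> fst t) - fst t)))"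
      unfolding corner_def by (subst (asm) integrable_restrict_space) (auto simp: lborel_prod)
    then show ?thesis using lborel_pair.integral_snd[of "\<lambda>u v. indicator ({0<..<p} \<times> {0<..<p}) (u, v) * (slope K1 (u, v) * (of_bool (s \<le> u) - u))"]
      by (simp add: case_prod_unfold)
  qed
  also have "\<dots> = (\<integral>t. slope K1 t * (of_bool (s \<le> fst t) - fst t) \<partial>corner p)"
    unfolding integral_corner lborel_prod ..
  finally show ?thesis .
qed

end

lemma swap: "uniform_pair M c\<^sub>2 c\<^sub>1 p"
  by (intro uniform_pair.intro uniform_pair_axioms.intro prob_space_axioms c1.uniform_coord_axioms c2.uniform_coord_axioms p)

lemma joint_swap: "uniform_pair.joint M c\<^sub>2 c\<^sub>1 (v, u) = joint (u, v)"
  unfolding joint_def uniform_pair.joint_def[OF swap] by (intro arg_cong[where f=prob]) auto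

end

lemma integral_corner_swap:
  assumes [measurable]: "f \<in> borel_measurable borel"
  shows "(\<integral>t. f (snd t, fst t) \<partial>corner p) = (\<integral>t. (f t :: real) \<partial>corner p)"
proof -
  have m: "(\<lambda>t. indicator ({0<..<p} \<times> {0<..<p}) t * f t) \<in> borel_measurable (lborel \<Otimes>\<^sub>M lborel)"
    by (simp add: lborel_prod)
  have "(\<integral>t. f t \<partial>corner p) = (\<integral>t. indicator ({0<..<p} \<times> {0<..<p}) t * f t \<partial>(lborel \<Otimes>\<^sub>M lborel))"
    unfolding integral_corner lborel_prod ..
  also have "\<dots> = (\<integral>(u, v). indicator ({0<..<p} \<times> {0<..<p}) (v, u) * f (v, u) \<partial>(lborel \<Otimes>\<^sub>M lborel))"
    using lborel_pair.integral_product_swap[OF m] by (simp add: case_prod_unfold)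
  also have "\<dots> = (\<integral>t. f (snd t, fst t) \<partial>corner p)"
    unfolding integral_corner lborel_prod
    by (intro Bochner_Integration.integral_cong refl) (auto simp: indicator_def)
  finally show ?thesis by simp
qed

locale smooth_pair = uniform_pair +
  fixes K1 K2 :: "real \<Rightarrow> real \<Rightarrow> real"
  assumes dK1: "\<And>u v. u \<in> {0<..<1} \<Longrightarrow> v \<in> {0..1} \<Longrightarrow> ((\<lambda>u'. joint (u', v)) has_real_derivative K1 u v) (at u)"
    and cK1: "continuous_on ({0<..<1} \<times> {0..1}) (\<lambda>(u, v). K1 u v)"
    and dK2: "\<And>u v. u \<in> {0..1} \<Longrightarrow> v \<in> {0<..<1} \<Longrightarrow> ((\<lambda>v'. joint (u, v')) has_real_derivative K2 u v) (at v)"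
    and cK2: "continuous_on ({0..1} \<times> {0<..<1}) (\<lambda>(u, v). K2 u v)"
begin

definition slope1 :: "real \<times> real \<Rightarrow> real" where "slope1 = slope K1"
text \<open>Written with the coordinates exchanged, so that the facts about the first partial
  derivative transfer.\<close>

definition slope2 :: "real \<times> real \<Rightarrow> real" where "slope2 t = slope (\<lambda>v u. K2 u v) (snd t, fst t)"
definition bridge_cov :: "real \<times> real \<Rightarrow> real \<times> real \<Rightarrow> real" where
  "bridge_cov s t = joint (min (fst s) (fst t), min (snd s) (snd t)) - joint s * joint t"

interpretation S: uniform_pair M c\<^sub>2 c\<^sub>1 p by (rule swap)

lemma swapped_partials:
  "\<And>u v. u \<in> {0<..<1} \<Longrightarrow> v \<in> {0..1} \<Longrightarrow> ((\<lambda>u'. S.joint (u', v)) has_real_derivative K2 v u) (at u)"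
  "continuous_on ({0<..<1} \<times> {0..1}) (\<lambda>(v, u). K2 u v)"
proof -
  show "((\<lambda>u'. S.joint (u', v)) has_real_derivative K2 v u) (at u)" if "u \<in> {0<..<1}" "v \<in> {0..1}" for u v
    using dK2[OF that(2,1)] unfolding joint_swap .
  have "continuous_on ({0<..<1} \<times> {0..1}) (\<lambda>t. (\<lambda>(u, v). K2 u v) (snd t, fst t))"
    by (rule continuous_on_compose2[OF cK2]) (auto intro!: continuous_intros)
  then show "continuous_on ({0<..<1} \<times> {0..1}) (\<lambda>(v, u). K2 u v)" by (simp add: case_prod_unfold)
qed

lemma slope_measurable: "slope1 \<in> borel_measurable borel" "slope2 \<in> borel_measurable borel"
proof -
  show "slope1 \<in> borel_measurable borel" unfolding slope1_def by (rule partial_measurable[OF dK1 cK1])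
  have "slope (\<lambda>v u. K2 u v) \<in> borel_measurable borel"
    by (rule S.partial_measurable[OF swapped_partials(1) swapped_partials(2)])
  moreover have "(\<lambda>t :: real \<times> real. (snd t, fst t)) \<in> borel_measurable borel"
    by (auto intro!: borel_measurable_continuous_onI continuous_intros)
  ultimately show "slope2 \<in> borel_measurable borel"
    unfolding slope2_def[abs_def] by (rule measurable_compose[rotated])
qed

lemma slope_range: "\<bar>slope1 t\<bar> \<le> 1" "\<bar>slope2 t\<bar> \<le> 1"
  unfolding slope1_def slope2_def
  by (rule partial_range(2)[OF dK1 cK1], assumption, assumption)
    (rule S.partial_range(2)[OF swapped_partials(1) swapped_partials(2)], assumption, assumption)

lemma proj1_slope: "c1.proj wt\<^sub>1 s = (\<integral>t. slope1 t * (of_bool (s \<le> fst t) - fst t) \<partial>corner p)"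
  unfolding slope1_def by (rule proj_partial[OF dK1 cK1])

lemma proj2_slope: "c2.proj wt\<^sub>2 s = (\<integral>t. slope2 t * (of_bool (s \<le> snd t) - snd t) \<partial>corner p)"
proof -
  have m: "(\<lambda>t. slope (\<lambda>v u. K2 u v) t * (of_bool (s \<le> fst t) - fst t)) \<in> borel_measurable borel"
  proof -
    have f: "(fst :: real \<times> real \<Rightarrow> real) \<in> borel_measurable borel" by (auto intro!: borel_measurable_continuous_onI continuous_intros)
    have g: "slope (\<lambda>v u. K2 u v) \<in> borel_measurable borel"
      by (rule S.partial_measurable[OF swapped_partials(1) swapped_partials(2)])
    show ?thesis by (intro borel_measurable_times g borel_measurable_diff measurable_of_bool_cmp f) simp
  qed
  have "c2.proj wt\<^sub>2 s = c2.proj S.wt\<^sub>1 s" unfolding S.wt\<^sub>1_def[abs_def] wt\<^sub>2_def[abs_def] ..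
  also have "\<dots> = (\<integral>t. slope (\<lambda>v u. K2 u v) t * (of_bool (s \<le> fst t) - fst t) \<partial>corner p)"
    by (rule S.proj_partial[OF swapped_partials(1) swapped_partials(2)])
  also have "\<dots> = (\<integral>t. slope (\<lambda>v u. K2 u v) (snd t, fst t) * (of_bool (s \<le> fst (snd t, fst t)) - fst (snd t, fst t)) \<partial>corner p)"
    by (rule integral_corner_swap[OF m, symmetric])
  finally show ?thesis unfolding slope2_def by simp
qed

text \<open>The integral splits term by term: the indicator gives the product of hinges, the two
  marginal terms give the projections. The leftover constant is removed afterwards by comparing
  means.\<close>

lemma infl_eq: "(\<integral>t. lim_op slope1 slope2 (\<lambda>t. centered t x) t \<partial>corner p) = infl x + (kernel_mean - (\<integral>t. joint t \<partial>corner p))"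
proof -
  interpret C: finite_measure "corner p" by (rule finite_measure_corner)
  have fs: "(fst :: real \<times> real \<Rightarrow> real) \<in> borel_measurable borel" "(snd :: real \<times> real \<Rightarrow> real) \<in> borel_measurable borel"
    by (auto intro!: borel_measurable_continuous_onI continuous_intros)
  let ?B = "\<lambda>t. of_bool (c\<^sub>1 x \<le> fst t) * of_bool (c\<^sub>2 x \<le> snd t) :: real"
  let ?P = "\<lambda>t. slope1 t * (of_bool (c\<^sub>1 x \<le> fst t) - fst t)"
  let ?R = "\<lambda>t. slope2 t * (of_bool (c\<^sub>2 x \<le> snd t) - snd t)"
  have m: "?B \<in> borel_measurable borel" "?P \<in> borel_measurable borel" "?R \<in> borel_measurable borel"
    by (intro borel_measurable_times slope_measurable borel_measurable_diff measurable_of_bool_cmp fs; simp)+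
  have i1: "integrable (corner p) ?B"
    by (intro C.integrable_const_bound[of _ 1] measurable_corner m) auto
  have i2: "integrable (corner p) ?P"
  proof (intro C.integrable_const_bound[of _ 1] measurable_corner m AE_I2)
    fix t assume "t \<in> space (corner p)"
    then have "\<bar>of_bool (c\<^sub>1 x \<le> fst t) - fst t\<bar> \<le> 1" using p by (auto simp: of_bool_def)
    then show "norm (?P t) \<le> 1" using slope_range(1)[of t] unfolding real_norm_def abs_mult by (intro mult_le_one) auto
  qed
  have i3: "integrable (corner p) ?R"
  proof (intro C.integrable_const_bound[of _ 1] measurable_corner m AE_I2)
    fix t assume "t \<in> space (corner p)"
    then have "\<bar>of_bool (c\<^sub>2 x \<le> snd t) - snd t\<bar> \<le> 1" using p by (auto simp: of_bool_def)
    then show "norm (?R t) \<le> 1" using slope_range(2)[of t] unfolding real_norm_def abs_mult by (intro mult_le_one) auto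
  qed
  have i4: "integrable (corner p) joint"
    using joint_bounds by (intro C.integrable_const_bound[of _ 1] measurable_corner joint_measurable) auto
  have "(\<integral>t. lim_op slope1 slope2 (\<lambda>t. centered t x) t \<partial>corner p) = (\<integral>t. ?B t - joint t - ?P t - ?R t \<partial>corner p)"
  proof (intro Bochner_Integration.integral_cong refl)
    fix t assume "t \<in> space (corner p)"
    then have "0 \<le> fst t" "fst t \<le> 1" "0 \<le> snd t" "snd t \<le> 1" using p by auto
    then show "lim_op slope1 slope2 (\<lambda>t. centered t x) t = ?B t - joint t - ?P t - ?R t"
      unfolding lim_op_def centered_def fst_conv snd_conv using c1.c_range[of x] c2.c_range[of x]
      by (simp only: joint_margins of_bool_conj) simp
  qed
  also have "\<dots> = (\<integral>t. ?B t \<partial>corner p) - (\<integral>t. joint t \<partial>corner p) - (\<integral>t. ?P t \<partial>corner p) - (\<integral>t. ?R t \<partial>corner p)"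
    using i1 i2 i3 i4 by (simp add: Bochner_Integration.integral_diff Bochner_Integration.integrable_diff)
  also have "(\<integral>t. ?B t \<partial>corner p) = hinge p (c\<^sub>1 x) * hinge p (c\<^sub>2 x)"
  proof -
    have "(\<integral>t. ?B t \<partial>corner p) = (\<integral>u. indicator {0<..<p} u * of_bool (c\<^sub>1 x \<le> u) \<partial>lborel) * (\<integral>u. indicator {0<..<p} u * of_bool (c\<^sub>2 x \<le> u) \<partial>lborel)"
      by (rule integral_corner_product) (auto intro!: measurable_of_bool_cmp)
    then show ?thesis using integral_threshold c1.c_range c2.c_range by simp
  qed
  finally show ?thesis unfolding proj1_slope[symmetric] proj2_slope[symmetric] infl_def by simp
qed

lemma asymp_var_eq:
  "asymp_var = (\<integral>(s, t). lim_op slope1 slope2 (\<lambda>s. lim_op slope1 slope2 (bridge_cov s) t) s \<partial>(corner p \<Otimes>\<^sub>M corner p))"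
proof -
  define k where "k = kernel_mean - (\<integral>t. joint t \<partial>corner p)"
  have \<Gamma>1: "bridge_cov t t \<le> 1" for t
    unfolding bridge_cov_def using joint_bounds[of t] mult_nonneg_nonneg[OF joint_bounds(1) joint_bounds(1), of t t]
    by (unfold min.idem prod.collapse) linarith
  note L = linear_functional_moments[where \<Gamma>=bridge_cov, OF prob_space_axioms p(2) centered_measurable centered_moments(1,2)
      centered_moments(3)[folded bridge_cov_def] \<Gamma>1 slope_measurable(1) slope_range(1) slope_measurable(2) slope_range(2)]
  have "integrable M infl" using infl_bound by (intro integrable_const_bound[of _ 3]) auto
  \<comment> \<open>Both sides have mean zero, which forces the constant to vanish: the integral of
    the copula equals the mean of the product of hinges.\<close>
  then have "k = 0" using L(2) unfolding infl_eq k_def[symmetric] by (simp add: infl_mean prob_space)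
  then show ?thesis using L(3) unfolding infl_eq k_def[symmetric] asymp_var_def by simp
qed

text \<open>The bridge is specified through Bochner expectations, which default to zero for
  functions that are not integrable. Square integrability therefore has to come from
  normality.\<close>

lemma normal_rv_square_integrable:
  assumes "prob_space N" "normal_rv N Z"
  shows "integrable N (\<lambda>\<omega>. (Z \<omega>)\<^sup>2)"
proof -
  interpret N: prob_space N by fact
  have Zm[measurable]: "Z \<in> borel_measurable N" using assms(2) unfolding normal_rv_def by blast
  from assms(2) consider (n) \<mu> \<sigma> where "0 < \<sigma>" "distributed N lborel Z (normal_density \<mu> \<sigma>)" | (c) \<mu> where "AE \<omega> in N. Z \<omega> = \<mu>"
    unfolding normal_rv_def by blast
  then show ?thesis
  proof cases
    case n
    have "integrable lborel (\<lambda>x. normal_density \<mu> \<sigma> x * (x - \<mu>)\<^sup>2 + 2 * \<mu> * (normal_density \<mu> \<sigma> x * (x - \<mu>) ^ 1) + \<mu>\<^sup>2 * (normal_density \<mu> \<sigma> x * (x - \<mu>) ^ 0))"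
      using n(1) by (intro Bochner_Integration.integrable_add integrable_mult_right integrable_normal_moment)
    then have "integrable lborel (\<lambda>x. normal_density \<mu> \<sigma> x * x\<^sup>2)"
      by (simp add: power2_eq_square algebra_simps)
    then show ?thesis
      using distributed_integrable[OF n(2), of "\<lambda>x. x\<^sup>2"] by simp
  next
    case c
    have "integrable N (\<lambda>\<omega>. \<mu>\<^sup>2)" by simp
    moreover have "AE \<omega> in N. \<mu>\<^sup>2 = (Z \<omega>)\<^sup>2" using c by eventually_elim simp
    ultimately show ?thesis by (subst integrable_cong_AE[symmetric]) auto
  qed
qed

text \<open>On the unit square the bridge and the centred indicators share the covariance
  \<open>bridge_cov\<close>, so the second moment is the double integral already found for
  \<open>asymp_var\<close>, divided by the squared denominator.\<close>

lemma rho_limit_variance: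
  assumes N: "prob_space N" and bridge: "copula_bridge C N W"
    and C: "\<And>u v. u \<in> {0..1} \<Longrightarrow> v \<in> {0..1} \<Longrightarrow> C u v = joint (u, v)"
  shows "prob_space.variance N (rho_limit K1 K2 W p) = asymp_var / (rho_denom p)\<^sup>2"
proof -
  interpret N: prob_space N by (rule N)
  \<comment> \<open>Clamping the arguments extends the bridge continuously to the plane, which makes
    it jointly measurable.\<close>
  define W' where "W' t = W (clamp01 (fst t), clamp01 (snd t))" for t
  have cl: "(clamp01 (fst t), clamp01 (snd t)) \<in> {0..1} \<times> {0..1}" for t using clamp01_range(3) by auto
  have W'_id: "W' t = W t" if "t \<in> unit_square" for t using that unfolding W'_def unit_square_def by (auto simp: clamp01_id)
  have nrv: "normal_rv N (W t)" if "t \<in> {0..1} \<times> {0..1}" for t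
  proof -
    have "gaussian_process N ({0..1} \<times> {0..1}) W" using bridge unfolding copula_bridge_def by blast
    then have "normal_rv N (\<lambda>\<omega>. \<Sum>s\<in>{t}. 1 * W s \<omega>)"
      using that unfolding gaussian_process_def by (elim allE[of _ "{t}"] allE[of _ "\<lambda>_. 1"]) simp
    then show ?thesis by simp
  qed
  have Wm: "W' t \<in> borel_measurable N" for t
    using nrv[OF cl] unfolding W'_def normal_rv_def by blast
  have Wc: "continuous_on UNIV (\<lambda>t. W' t \<omega>)" if "\<omega> \<in> space N" for \<omega>
  proof -
    have "continuous_on ({0..1} \<times> {0..1}) (\<lambda>t. W t \<omega>)" using bridge that unfolding copula_bridge_def by blast
    then show ?thesis unfolding W'_def
    proof (rule continuous_on_compose2[where f="\<lambda>t. (clamp01 (fst t), clamp01 (snd t))"])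
      show "continuous_on UNIV (\<lambda>t :: real \<times> real. (clamp01 (fst t), clamp01 (snd t)))"
        unfolding clamp01_def by (intro continuous_intros continuous_on_Pair)
      show "range (\<lambda>t :: real \<times> real. (clamp01 (fst t), clamp01 (snd t))) \<subseteq> {0..1} \<times> {0..1}" using cl by blast
    qed
  qed
  have sq: "integrable N (\<lambda>\<omega>. (W' t \<omega>)\<^sup>2)" for t
    unfolding W'_def by (rule normal_rv_square_integrable[OF N nrv[OF cl]])
  have mean: "(\<integral>\<omega>. W' t \<omega> \<partial>N) = 0" for t
    unfolding W'_def using bridge cl[of t] unfolding copula_bridge_def by blast
  have cov: "(\<integral>\<omega>. W' s \<omega> * W' t \<omega> \<partial>N) = bridge_cov s t" if "s \<in> unit_square" "t \<in> unit_square" for s t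
  proof -
    obtain u v where s: "s = (u, v)" "u \<in> {0..1}" "v \<in> {0..1}" using \<open>s \<in> unit_square\<close> unfolding unit_square_def by auto
    obtain u' v' where t: "t = (u', v')" "u' \<in> {0..1}" "v' \<in> {0..1}" using \<open>t \<in> unit_square\<close> unfolding unit_square_def by auto
    have "(\<integral>\<omega>. W (u, v) \<omega> * W (u', v') \<omega> \<partial>N) = C (min u u') (min v v') - C u v * C u' v'"
      using bridge s t unfolding copula_bridge_def by blast
    moreover have "min u u' \<in> {0..1}" "min v v' \<in> {0..1}" using s t by auto
    ultimately show ?thesis unfolding W'_id[OF that(1)] W'_id[OF that(2)] bridge_cov_def using s t C by simp
  qed
  have \<Gamma>1: "bridge_cov t t \<le> 1" for t
    unfolding bridge_cov_def using joint_bounds[of t] mult_nonneg_nonneg[OF joint_bounds(1) joint_bounds(1), of t t]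
    by (unfold min.idem prod.collapse) linarith
  define Z where "Z \<omega> = (\<integral>t. lim_op slope1 slope2 (\<lambda>t. W' t \<omega>) t \<partial>corner p)" for \<omega>
  have joint_m: "(\<lambda>(\<omega>, t). W' t \<omega>) \<in> borel_measurable (N \<Otimes>\<^sub>M borel)"
    by (rule caratheodory_measurable[OF Wm Wc])
  note L = linear_functional_moments[where \<Gamma>=bridge_cov and A=W', OF N p(2) joint_m sq mean
      cov \<Gamma>1 slope_measurable(1) slope_range(1) slope_measurable(2) slope_range(2), folded Z_def]
  have eq: "rho_limit K1 K2 W p \<omega> = Z \<omega> / rho_denom p" if \<omega>: "\<omega> \<in> space N" for \<omega>
  proof -
    let ?T = "{0<..<p} \<times> {0<..<p} :: (real \<times> real) set"
    let ?h = "\<lambda>(u, v). copula_limit K1 K2 W \<omega> u v"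
    let ?g = "lim_op slope1 slope2 (\<lambda>t. W' t \<omega>)"
    interpret Cn: finite_measure "corner p" by (rule finite_measure_corner)
    have bx: "?T = box (0, 0) (p, p)" by (auto simp: box_def Basis_prod_def)
    have cb: "{0..p} \<times> {0..p} = cbox (0, 0) (p, p)" by (simp add: cbox_Pair_eq)
    have hg: "?h t = ?g t" if t: "t \<in> ?T" for t
    proof -
      obtain u v where uv: "t = (u, v)" "u \<in> {0<..<1}" "v \<in> {0<..<1}" using t p by auto
      then show ?thesis
        by (simp add: copula_limit_def lim_op_def slope1_def slope2_def slope_def W'_def clamp01_id)
    qed
    obtain B where B: "\<And>t. \<bar>W' t \<omega>\<bar> \<le> B"
    proof -
      have "continuous_on ({0..1} \<times> {0..1}) (\<lambda>t. W t \<omega>)" using bridge \<omega> unfolding copula_bridge_def by blast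
      moreover have "compact ({0..1} \<times> {0..1} :: (real \<times> real) set)" by (intro compact_Times) auto
      ultimately have "compact ((\<lambda>t. W t \<omega>) ` ({0..1} \<times> {0..1}))" by (rule compact_continuous_image)
      then have "bounded ((\<lambda>t. W t \<omega>) ` ({0..1} \<times> {0..1}))" by (rule compact_imp_bounded)
      then obtain B where "\<forall>x\<in>(\<lambda>t. W t \<omega>) ` ({0..1} \<times> {0..1}). norm x \<le> B" unfolding bounded_iff by blast
      then have "\<bar>W' t \<omega>\<bar> \<le> B" for t unfolding W'_def using cl[of t] by (metis image_eqI real_norm_def)
      then show ?thesis by (rule that)
    qed
    have wm: "(\<lambda>t. W' t \<omega>) \<in> borel_measurable borel" by (rule borel_measurable_continuous_onI[OF Wc[OF \<omega>]])
    have fsm: "(\<lambda>t. (fst t, 1) :: real \<times> real) \<in> borel_measurable borel" "(\<lambda>t. (1, snd t) :: real \<times> real) \<in> borel_measurable borel"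
      by (auto intro!: borel_measurable_continuous_onI continuous_intros)
    have gm: "?g \<in> borel_measurable borel"
      unfolding lim_op_def[abs_def]
      by (intro borel_measurable_diff borel_measurable_times slope_measurable wm measurable_compose[OF fsm(1) wm] measurable_compose[OF fsm(2) wm])
    have gb: "\<bar>?g t\<bar> \<le> B + B + B" for t
    proof -
      have "\<bar>slope1 t * W' (fst t, 1) \<omega>\<bar> \<le> 1 * B" "\<bar>slope2 t * W' (1, snd t) \<omega>\<bar> \<le> 1 * B"
        unfolding abs_mult by (intro mult_mono slope_range B; simp)+
      then show ?thesis unfolding lim_op_def using B[of t] by linarith
    qed
    have "integrable (corner p) ?g"
      using gb by (intro Cn.integrable_const_bound[of _ "B + B + B"] measurable_corner gm) auto
    then have si: "set_integrable lborel ?T ?g"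
      unfolding corner_def set_integrable_def by (subst (asm) integrable_restrict_space) auto
    \<comment> \<open>The gauge integral ignores the boundary, where the limit process may have
      arbitrary values; inside, it is the Lebesgue integral of a bounded measurable
      function.\<close>
    have "square_integral p (copula_limit K1 K2 W \<omega>) = integral ?T ?h"
      unfolding square_integral_def cb bx by (simp only: integral_open_interval)
    also have "\<dots> = integral ?T ?g" using hg by (rule integral_cong)
    also have "\<dots> = (LINT t:?T|lborel. ?g t)" by (rule set_borel_integral_eq_integral(2)[OF si, symmetric])
    also have "\<dots> = Z \<omega>" unfolding Z_def integral_corner set_lebesgue_integral_def by simp
    finally show ?thesis unfolding rho_limit_def by simp
  qed
  have "N.expectation (rho_limit K1 K2 W p) = (\<integral>\<omega>. Z \<omega> / rho_denom p \<partial>N)"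
    using eq by (intro Bochner_Integration.integral_cong) auto
  then have E0: "N.expectation (rho_limit K1 K2 W p) = 0" using L(2) by simp
  have "N.variance (rho_limit K1 K2 W p) = (\<integral>\<omega>. (Z \<omega>)\<^sup>2 / (rho_denom p)\<^sup>2 \<partial>N)"
    unfolding E0 using eq by (intro Bochner_Integration.integral_cong) (auto simp: power_divide)
  also have "\<dots> = asymp_var / (rho_denom p)\<^sup>2" using L(3) unfolding asymp_var_eq by simp
  finally show ?thesis .
qed

end

section \<open>The estimator as a rank statistic\<close>

lemma continuous_bernstein_op: "continuous_on S (\<lambda>(u, v). bernstein_op m h u v)"
  unfolding bernstein_op_def Bernstein_def split_def by (intro continuous_intros)

lemma integral_double_sum:
  fixes f :: "nat \<Rightarrow> nat \<Rightarrow> real \<Rightarrow> real"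
  assumes "\<And>k l. f k l integrable_on S"
  shows "integral S (\<lambda>x. \<Sum>k\<le>m. \<Sum>l\<le>m. f k l x) = (\<Sum>k\<le>m. \<Sum>l\<le>m. integral S (f k l))"
  using assms by (simp add: integral_sum integrable_sum)

lemma square_integral_bernstein_op:
  "square_integral p (bernstein_op m h) = (\<Sum>k\<le>m. \<Sum>l\<le>m. h (real k / real m) (real l / real m) * bw p m k * bw p m l)"
proof -
  have int: "(Bernstein m k) integrable_on {0..p}" for k
    using integrable_continuous[of 0 p "Bernstein m k"] continuous_Bernstein by simp
  have "square_integral p (bernstein_op m h) = integral {0..p} (\<lambda>u. integral {0..p} (\<lambda>v. bernstein_op m h u v))"
    using integral_prod_continuous[OF continuous_bernstein_op, of 0 0 p p m h]
    by (simp add: square_integral_def cbox_Pair_eq)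
  also have "\<dots> = integral {0..p} (\<lambda>u. \<Sum>k\<le>m. \<Sum>l\<le>m. h (real k / real m) (real l / real m) * bw p m l * Bernstein m k u)"
  proof (rule integral_cong)
    fix u
    have "integral {0..p} (\<lambda>v. bernstein_op m h u v)
        = (\<Sum>k\<le>m. \<Sum>l\<le>m. integral {0..p} (\<lambda>v. h (real k / real m) (real l / real m) * Bernstein m k u * Bernstein m l v))"
      unfolding bernstein_op_def
      by (rule integral_double_sum) (intro integrable_on_mult_right int)
    also have "\<dots> = (\<Sum>k\<le>m. \<Sum>l\<le>m. h (real k / real m) (real l / real m) * bw p m l * Bernstein m k u)"
      unfolding bw_def by (intro sum.cong refl) (simp add: mult_ac)
    finally show "integral {0..p} (\<lambda>v. bernstein_op m h u v)
        = (\<Sum>k\<le>m. \<Sum>l\<le>m. h (real k / real m) (real l / real m) * bw p m l * Bernstein m k u)" .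
  qed
  also have "\<dots> = (\<Sum>k\<le>m. \<Sum>l\<le>m. integral {0..p} (\<lambda>u. h (real k / real m) (real l / real m) * bw p m l * Bernstein m k u))"
    by (rule integral_double_sum) (intro integrable_on_mult_right int)
  also have "\<dots> = (\<Sum>k\<le>m. \<Sum>l\<le>m. h (real k / real m) (real l / real m) * bw p m k * bw p m l)"
    unfolding bw_def by (intro sum.cong refl) (simp add: mult_ac)
  finally show ?thesis .
qed

lemma bphi_product: "bphi p m a * bphi p m b
    = (\<Sum>k\<le>m. \<Sum>l\<le>m. of_bool (a \<le> real k / real m \<and> b \<le> real l / real m) * bw p m k * bw p m l)"
  unfolding bphi_def sum_product by (intro sum.cong refl) (simp add: of_bool_conj)

text \<open>For one observation the indicator factorises, so its weighted sum over the grid is a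
  product of two values of \<open>bphi\<close>; the rest exchanges finite sums.\<close>

lemma square_integral_emp_copula:
  "square_integral p (bernstein_op m (emp_copula n z)) = rank_stat p m n fst snd z"
proof -
  have "(\<Sum>k\<le>m. \<Sum>l\<le>m. (\<Sum>i<n. of_bool (a i \<le> real k / real m \<and> b i \<le> real l / real m)) / real n * bw p m k * bw p m l)
      = (\<Sum>i<n. bphi p m (a i) * bphi p m (b i)) / real n" for a b :: "nat \<Rightarrow> real"
  proof -
    have "(\<Sum>i<n. bphi p m (a i) * bphi p m (b i))
        = (\<Sum>k\<le>m. \<Sum>l\<le>m. \<Sum>i<n. of_bool (a i \<le> real k / real m \<and> b i \<le> real l / real m) * bw p m k * bw p m l)"
      unfolding bphi_product by (rule trans[OF sum.swap sum.cong[OF refl sum.swap]])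
    then show ?thesis
      by (simp only: sum_divide_distrib sum_distrib_right) (intro sum.cong refl, simp)
  qed
  then show ?thesis unfolding square_integral_bernstein_op emp_copula_def rank_stat_def own_ecdf_def .
qed

lemma rho_hat_rank_stat: "rho_hat m n z p = (rank_stat p m n fst snd z - p ^ 4 / 4) / rho_denom p"
  unfolding rho_hat_def spearman_curve_def square_integral_emp_copula ..

lemma rho_denom_pos: "0 < p \<Longrightarrow> p \<le> 1 \<Longrightarrow> 0 < rho_denom p"
proof -
  assume p: "0 < p" "p \<le> 1"
  have "rho_denom p = p ^ 3 * (1 / 3 - p / 4)" unfolding rho_denom_def by (simp add: field_simps power_numeral_reduce)
  then show ?thesis using p by simp
qed

context uniform_pair
begin

text \<open>The expectation passes through the finite grid sum, so that smoothing the population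
  copula is expressed by the same \<open>bphi\<close> as smoothing the empirical one.\<close>

lemma smooth_mean_square_integral: "smooth_mean m = square_integral p (bernstein_op m (\<lambda>u v. joint (u, v)))"
proof -
  have int: "integrable M (\<lambda>x. of_bool (c\<^sub>1 x \<le> a \<and> c\<^sub>2 x \<le> b) * w * w' :: real)" for a b w w'
    using below_integrable[of "(a, b)"] by simp
  have "smooth_mean m = (\<Sum>k\<le>m. \<Sum>l\<le>m. \<integral>x. of_bool (c\<^sub>1 x \<le> real k / real m \<and> c\<^sub>2 x \<le> real l / real m) * bw p m k * bw p m l \<partial>M)"
    unfolding smooth_mean_def bphi_product
    by (subst Bochner_Integration.integral_sum, intro Bochner_Integration.integrable_sum int)
      (intro sum.cong refl Bochner_Integration.integral_sum int)
  then show ?thesis unfolding square_integral_bernstein_op joint_eq_integral by simp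
qed

end

section \<open>Rank patterns\<close>

text \<open>Estimator and bootstrap law depend on a sample only through its ranks, which take finitely many
  values, so that no measurability of \<open>boot_law\<close> or of quantiles in the data has to be shown analytically.\<close>

definition pattern :: "nat \<Rightarrow> (nat \<Rightarrow> real \<times> real) \<Rightarrow> (nat \<times> nat) list" where
  "pattern n z = map (\<lambda>i. (sample_rank n (\<lambda>j. fst (z j)) i, sample_rank n (\<lambda>j. snd (z j)) i)) [0..<n]"

lemma pattern_eqD:
  assumes "pattern n z = pattern n z'" "i < n"
  shows "sample_rank n (\<lambda>j. fst (z j)) i = sample_rank n (\<lambda>j. fst (z' j)) i"
    and "sample_rank n (\<lambda>j. snd (z j)) i = sample_rank n (\<lambda>j. snd (z' j)) i"
  using assms unfolding pattern_def by (auto simp: map_eq_conv)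

lemma pattern_restrict: "pattern n (restrict z {..<n}) = pattern n z"
proof -
  have *: "{j. j < n \<and> f (restrict z {..<n} j) \<le> f (restrict z {..<n} i)} = {j. j < n \<and> f (z j) \<le> f (z i)}"
    if "i < n" for i and f :: "real \<times> real \<Rightarrow> real"
    using that by auto
  show ?thesis unfolding pattern_def sample_rank_def 
  proof (rule map_cong[OF refl])
    fix i assume "i \<in> set [0..<n]"
    then have i: "i < n" by simp
    show "(card {j. j < n \<and> fst (restrict z {..<n} j) \<le> fst (restrict z {..<n} i)}, card {j. j < n \<and> snd (restrict z {..<n} j) \<le> snd (restrict z {..<n} i)})
        = (card {j. j < n \<and> fst (z j) \<le> fst (z i)}, card {j. j < n \<and> snd (z j) \<le> snd (z i)})"
      by (simp only: *[OF i])
  qed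
qed

lemma pattern_finite: "finite (range (pattern n))"
proof (rule finite_subset)
  show "range (pattern n) \<subseteq> {xs. set xs \<subseteq> {..n} \<times> {..n} \<and> length xs = n}"
    unfolding pattern_def using sample_rank_bounds(1) by auto
  show "finite {xs. set xs \<subseteq> {..n} \<times> {..n} \<and> length xs = n}" by (rule finite_lists_length_eq) auto
qed

lemma pattern_measurable:
  assumes sets: "sets N = sets (Pi\<^sub>M {..<n} (\<lambda>_. borel :: (real \<times> real) measure))"
  shows "pattern n \<in> measurable N (count_space UNIV)"
proof -
  let ?P = "Pi\<^sub>M {..<n} (\<lambda>_. borel :: (real \<times> real) measure)"
  have rk: "{z \<in> space ?P. sample_rank n (\<lambda>j. f (z j)) i = k} \<in> sets ?P"
    if i: "i < n" and f[measurable]: "f \<in> borel_measurable borel" for f :: "real \<times> real \<Rightarrow> real" and i k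
  proof -
    have comp: "(\<lambda>z. f (z j)) \<in> borel_measurable ?P" if "j < n" for j
      by (rule measurable_compose[OF _ f]) (use that in \<open>auto intro: measurable_component_singleton\<close>)
    have "(\<lambda>z. \<Sum>j<n. of_bool (f (z j) \<le> f (z i)) :: real) \<in> borel_measurable ?P"
      using i by (intro borel_measurable_sum measurable_of_bool_cmp comp) auto
    from measurable_sets[OF this, of "{real k}"]
    have "{z \<in> space ?P. (\<Sum>j<n. of_bool (f (z j) \<le> f (z i)) :: real) = real k} \<in> sets ?P"
      by (simp only: vimage_def Int_def singleton_iff mem_Collect_eq conj_commute) simp
    moreover have "(\<Sum>j<n. of_bool (f (z j) \<le> f (z i)) :: real) = real (sample_rank n (\<lambda>j. f (z j)) i)" for z
      unfolding sample_rank_def by (simp add: of_bool_def sum.If_cases Int_def)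
    ultimately show ?thesis by simp
  qed
  have "pattern n -` {v} \<inter> space ?P \<in> sets ?P" for v
  proof -
    have "pattern n z = v \<longleftrightarrow> length v = n \<and>
        (\<forall>i\<in>{..<n}. sample_rank n (\<lambda>j. fst (z j)) i = fst (v ! i) \<and> sample_rank n (\<lambda>j. snd (z j)) i = snd (v ! i))" for z
      unfolding pattern_def list_eq_iff_nth_eq by (auto simp: prod_eq_iff)
    then have "pattern n -` {v} \<inter> space ?P = {z \<in> space ?P. length v = n \<and>
        (\<forall>i\<in>{..<n}. sample_rank n (\<lambda>j. fst (z j)) i = fst (v ! i) \<and> sample_rank n (\<lambda>j. snd (z j)) i = snd (v ! i))}"
      by (simp only: vimage_def Int_def singleton_iff mem_Collect_eq conj_commute)
    also have "\<dots> \<in> sets ?P"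
      by (intro sets.sets_Collect_conj sets.sets_Collect_finite_All sets.sets_Collect_const rk)
        (auto intro!: borel_measurable_continuous_onI continuous_intros)
    finally show ?thesis .
  qed
  then have "pattern n \<in> measurable ?P (count_space UNIV)" by (subst measurable_count_space_eq_countable) auto
  then show ?thesis using measurable_cong_sets[OF sets refl] by blast
qed

lemma rank_stat_pattern:
  assumes "pattern n z = pattern n z'"
  shows "rank_stat p m n fst snd z = rank_stat p m n fst snd z'"
  unfolding rank_stat_def own_ecdf_rank
  by (intro arg_cong2[where f="(/)"] sum.cong refl) (simp only: lessThan_iff pattern_eqD[OF assms])

lemma rho_hat_pattern: "pattern n z = pattern n z' \<Longrightarrow> rho_hat m n z p = rho_hat m n z' p"
  unfolding rho_hat_rank_stat using rank_stat_pattern by metis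

lemma boot_law_pattern:
  assumes n: "0 < n" and eq: "pattern n z = pattern n z'"
  shows "boot_law n z = boot_law n z'"
proof -
  have "boot_base n z = boot_base n z'"
  proof (rule measure_eqI)
    fix A assume "A \<in> sets (boot_base n z)"
    then have A: "A \<in> sets borel" by simp
    show "emeasure (boot_base n z) A = emeasure (boot_base n z') A"
      unfolding emeasure_boot_base[OF A]
    proof (rule nn_integral_cong_AE, rule AE_pmfI)
      fix i assume "i \<in> set_pmf (pmf_of_set {..<n})"
      then have "i < n" using n by (subst (asm) set_pmf_of_set) auto
      then show "emeasure (beta_kernel n z i) A = emeasure (beta_kernel n z' i) A"
        unfolding beta_kernel_def using pattern_eqD[OF eq] by simp
    qed
  qed simp
  then show ?thesis unfolding boot_law_eq[OF n] by simp
qed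

text \<open>The bootstrap distribution function before division by \<open>rho_denom\<close>, which
  merely rescales the argument. On this scale the pivot is a pure rank statistic.\<close>

definition boot_rank_cdf :: "real \<Rightarrow> nat \<Rightarrow> nat \<Rightarrow> (nat \<Rightarrow> real \<times> real) \<Rightarrow> real \<Rightarrow> real" where
  "boot_rank_cdf p m n z t = measure (boot_law n z) {s \<in> space (boot_law n z).
     \<bar>sqrt (real n) * (rank_stat p m n fst snd s - rank_stat p m n fst snd z)\<bar> \<le> t}"

lemma boot_rank_cdf_pattern: "0 < n \<Longrightarrow> pattern n z = pattern n z' \<Longrightarrow> boot_rank_cdf p m n z t = boot_rank_cdf p m n z' t"
  unfolding boot_rank_cdf_def by (simp only: boot_law_pattern[of n z z'] rank_stat_pattern[of n z z'])

text \<open>Choosing a representative of each pattern factors the map through a discrete space, so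
  measurability holds even for the discrete \<sigma>-algebra on the target.\<close>

lemma pattern_function_measurable:
  assumes "sets N = sets (Pi\<^sub>M {..<n} (\<lambda>_. borel :: (real \<times> real) measure))"
    and cong: "\<And>z z'. pattern n z = pattern n z' \<Longrightarrow> f z = f z'"
  shows "f \<in> measurable N (count_space UNIV)"
proof -
  have "f z = f (SOME z'. pattern n z' = pattern n z)" for z
    by (rule cong, rule sym, rule someI[where x=z]) (rule refl)
  then have "f = (\<lambda>v. f (SOME z'. pattern n z' = v)) \<circ> pattern n" by (auto simp: fun_eq_iff)
  moreover have "(\<lambda>v. f (SOME z'. pattern n z' = v)) \<circ> pattern n \<in> measurable N (count_space UNIV)"
    by (rule measurable_comp[OF pattern_measurable[OF assms(1)]]) simp
  ultimately show ?thesis by simp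
qed

section \<open>Limit law of the pivots\<close>

text \<open>Linearisation and central limit theorem combined, with the quantifiers over laws,
  transformations, degrees and centrings inside the thresholds. The same \<open>\<delta>\<close>,
  \<open>e\<close> and \<open>n0\<close> thus serve the data and every resampling law.\<close>

lemma pivot_clt:
  assumes \<sigma>: "0 < \<sigma>" and \<epsilon>: "0 < \<epsilon>"
  shows "\<exists>\<delta>>0. \<exists>e>0. e \<le> 1 \<and> (\<exists>n0. \<forall>n\<ge>n0. \<forall>m Q F G \<theta>. data_law Q F G p \<longrightarrow> bw_accurate e p m \<longrightarrow> 1 \<le> m \<longrightarrow> 1 \<le> n \<longrightarrow>
      12 / (e * sqrt (real n)) + 64 * sqrt (real n) / real m \<le> \<delta> \<longrightarrow>
      sqrt (real n) * \<bar>uniform_pair.smooth_mean Q (\<lambda>x. F (fst x)) (\<lambda>x. G (snd x)) p m - \<theta>\<bar> \<le> \<delta> \<longrightarrow>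
      \<bar>uniform_pair.asymp_var Q (\<lambda>x. F (fst x)) (\<lambda>x. G (snd x)) p - \<sigma>\<^sup>2\<bar> \<le> \<delta> \<longrightarrow>
      \<bar>measure (Pi\<^sub>M {..<n} (\<lambda>_. Q)) {z \<in> space (Pi\<^sub>M {..<n} (\<lambda>_. Q)). \<bar>sqrt (real n) * (rank_stat p m n fst snd z - \<theta>)\<bar> \<le> t}
        - normal_abs_cdf \<sigma> t\<bar> \<le> \<epsilon>)"
proof -
  obtain d n0 where d: "0 < d" and clt: "\<And>n (Q :: (real \<times> real) measure) f Z. n \<ge> n0 \<Longrightarrow> prob_space Q \<Longrightarrow> f \<in> borel_measurable Q \<Longrightarrow> (\<forall>x. \<bar>f x\<bar> \<le> 3) \<Longrightarrow>
      (\<integral>x. f x \<partial>Q) = 0 \<Longrightarrow> \<bar>(\<integral>x. (f x)\<^sup>2 \<partial>Q) - \<sigma>\<^sup>2\<bar> \<le> d \<Longrightarrow>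
      Z \<in> borel_measurable (Pi\<^sub>M {..<n} (\<lambda>_. Q)) \<Longrightarrow>
      integrable (Pi\<^sub>M {..<n} (\<lambda>_. Q)) (\<lambda>\<omega>. \<bar>Z \<omega> - (\<Sum>i<n. f (\<omega> i)) / sqrt (real n)\<bar>) \<Longrightarrow>
      (\<integral>\<omega>. \<bar>Z \<omega> - (\<Sum>i<n. f (\<omega> i)) / sqrt (real n)\<bar> \<partial>Pi\<^sub>M {..<n} (\<lambda>_. Q)) \<le> d \<Longrightarrow>
      \<bar>measure (Pi\<^sub>M {..<n} (\<lambda>_. Q)) {\<omega> \<in> space (Pi\<^sub>M {..<n} (\<lambda>_. Q)). \<bar>Z \<omega>\<bar> \<le> t} - normal_abs_cdf \<sigma> t\<bar> \<le> \<epsilon>"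
    using uniform_clt[OF \<sigma> \<epsilon>, where 'a="real \<times> real", of 3 t] by meson
  \<comment> \<open>\<open>50 * sqrt e\<close> is the error that does not vanish as \<open>n\<close>
    grows; this choice keeps it below a quarter of the budget \<open>d\<close>.\<close>
  define e where "e = min 1 ((d / 200)\<^sup>2)"
  have e: "0 < e" "e \<le> 1" "50 * sqrt e \<le> d / 4"
  proof -
    show "0 < e" "e \<le> 1" using d unfolding e_def by auto
    have "sqrt e \<le> sqrt ((d / 200)\<^sup>2)" unfolding e_def by (rule real_sqrt_le_mono) (rule min.cobounded2)
    also have "\<dots> = d / 200" using d by simp
    finally show "50 * sqrt e \<le> d / 4" by simp
  qed
  have "\<bar>measure (Pi\<^sub>M {..<n} (\<lambda>_. Q)) {z \<in> space (Pi\<^sub>M {..<n} (\<lambda>_. Q)). \<bar>sqrt (real n) * (rank_stat p m n fst snd z - \<theta>)\<bar> \<le> t}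
        - normal_abs_cdf \<sigma> t\<bar> \<le> \<epsilon>"
    if n: "n \<ge> n0" "1 \<le> n" and dl: "data_law Q F G p" and acc: "bw_accurate e p m" and m: "1 \<le> m"
      and small: "12 / (e * sqrt (real n)) + 64 * sqrt (real n) / real m \<le> d / 4"
      and bias: "sqrt (real n) * \<bar>uniform_pair.smooth_mean Q (\<lambda>x. F (fst x)) (\<lambda>x. G (snd x)) p m - \<theta>\<bar> \<le> d / 4"
      and var: "\<bar>uniform_pair.asymp_var Q (\<lambda>x. F (fst x)) (\<lambda>x. G (snd x)) p - \<sigma>\<^sup>2\<bar> \<le> d / 4" for n m Q F G \<theta>
  proof -
    interpret D: data_law Q F G p by (rule dl)
    let ?S = "D.sample_law n"
    interpret S: prob_space ?S by (rule D.prob_space_sample_law)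
    define L where "L \<omega> = (\<Sum>i<n. D.infl (\<omega> i)) / sqrt (real n)" for \<omega>
    define Z where "Z \<omega> = sqrt (real n) * (rank_stat p m n D.d\<^sub>1 D.d\<^sub>2 \<omega> - \<theta>)" for \<omega>
    define Z0 where "Z0 \<omega> = sqrt (real n) * (rank_stat p m n D.d\<^sub>1 D.d\<^sub>2 \<omega> - D.smooth_mean m)" for \<omega>
    define b where "b = sqrt (real n) * (D.smooth_mean m - \<theta>)"
    have rm: "rank_stat p m n D.d\<^sub>1 D.d\<^sub>2 \<in> borel_measurable ?S" by (rule D.rank_stat_measurable)
    have Zm: "Z \<in> borel_measurable ?S" "Z0 \<in> borel_measurable ?S" unfolding Z_def Z0_def using rm by measurable
    have Lm: "L \<in> borel_measurable ?S" unfolding L_def using D.sample_meas(5) by (intro borel_measurable_divide borel_measurable_sum) auto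
    have Lb: "\<bar>L \<omega>\<bar> \<le> (\<Sum>i<n. 3) / sqrt (real n)" for \<omega>
      unfolding L_def abs_divide
      by (auto intro!: divide_right_mono order_trans[OF sum_abs] sum_mono D.infl_bound simp del: sum_constant)
    have rb: "\<bar>rank_stat p m n D.d\<^sub>1 D.d\<^sub>2 \<omega>\<bar> \<le> 1" for \<omega>
      using rank_stat_bounds[OF D.p, of m n D.d\<^sub>1 D.d\<^sub>2 \<omega>] by simp
    have Lint: "integrable ?S L" by (rule D.integrable_sample_bounded[OF Lm Lb])
    have rint: "integrable ?S (rank_stat p m n D.d\<^sub>1 D.d\<^sub>2)" by (rule D.integrable_sample_bounded[OF rm rb])
    have Zint: "integrable ?S Z" "integrable ?S Z0"
      unfolding Z_def Z0_def using rint by (auto intro!: integrable_mult_right Bochner_Integration.integrable_diff)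
    have "(\<integral>\<omega>. \<bar>Z \<omega> - L \<omega>\<bar> \<partial>?S) \<le> (\<integral>\<omega>. \<bar>Z0 \<omega> - L \<omega>\<bar> + \<bar>b\<bar> \<partial>?S)"
    proof (rule integral_mono)
      have "Z \<omega> - L \<omega> = (Z0 \<omega> - L \<omega>) + b" for \<omega> unfolding Z_def Z0_def b_def by (simp add: algebra_simps)
      then show "\<bar>Z \<omega> - L \<omega>\<bar> \<le> \<bar>Z0 \<omega> - L \<omega>\<bar> + \<bar>b\<bar>" for \<omega> by (metis abs_triangle_ineq)
    qed (use Zint Lint in auto)
    also have "\<dots> = (\<integral>\<omega>. \<bar>Z0 \<omega> - L \<omega>\<bar> \<partial>?S) + \<bar>b\<bar>"
      using Zint Lint by (subst Bochner_Integration.integral_add) (auto simp: S.prob_space)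
    also have "\<dots> \<le> (50 * sqrt e + 12 / (e * sqrt (real n)) + 64 * sqrt (real n) / real m) + \<bar>b\<bar>"
      unfolding Z0_def L_def using D.asymptotic_linearity[OF acc m e(1,2) n(2)] by simp
    also have "\<dots> \<le> d"
    proof -
      have "\<bar>b\<bar> \<le> d / 4" using bias unfolding b_def by (simp add: abs_mult)
      then show ?thesis using small e(3) d by linarith
    qed
    finally have close: "(\<integral>\<omega>. \<bar>Z \<omega> - L \<omega>\<bar> \<partial>?S) \<le> d" .
    have "\<bar>(\<integral>x. (D.infl x)\<^sup>2 \<partial>Q) - \<sigma>\<^sup>2\<bar> \<le> d" using var d unfolding D.asymp_var_def by linarith
    then have main: "\<bar>measure ?S {\<omega> \<in> space ?S. \<bar>Z \<omega>\<bar> \<le> t} - normal_abs_cdf \<sigma> t\<bar> \<le> \<epsilon>"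
      using close Zint Lint Zm unfolding L_def
      by (intro clt[OF n(1) D.prob_space_axioms D.infl_measurable]) (auto simp: D.infl_bound D.infl_mean)
    \<comment> \<open>Raw and standardised ranks agree off the null set of ties.\<close>
    have "measure ?S {z \<in> space ?S. \<bar>sqrt (real n) * (rank_stat p m n fst snd z - \<theta>)\<bar> \<le> t} = measure ?S {\<omega> \<in> space ?S. \<bar>Z \<omega>\<bar> \<le> t}"
    proof (rule measure_eq_AE)
      show "AE x in ?S. (x \<in> {z \<in> space ?S. \<bar>sqrt (real n) * (rank_stat p m n fst snd z - \<theta>)\<bar> \<le> t}) = (x \<in> {\<omega> \<in> space ?S. \<bar>Z \<omega>\<bar> \<le> t})"
        using D.AE_no_ties[of n] by eventually_elim (simp add: Z_def D.rank_stat_transform)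
      have ss: "sets ?S = sets (Pi\<^sub>M {..<n} (\<lambda>_. borel))" by (rule sets_PiM_cong) auto
      have "rank_stat p m n fst snd \<in> measurable ?S (count_space UNIV)"
        by (rule pattern_function_measurable[OF ss rank_stat_pattern])
      from measurable_sets[OF this, of "{x. \<bar>sqrt (real n) * (x - \<theta>)\<bar> \<le> t}"]
      show "{z \<in> space ?S. \<bar>sqrt (real n) * (rank_stat p m n fst snd z - \<theta>)\<bar> \<le> t} \<in> sets ?S"
        by (simp add: vimage_def Int_def conj_commute)
      show "{\<omega> \<in> space ?S. \<bar>Z \<omega>\<bar> \<le> t} \<in> sets ?S" using Zm by measurable
    qed
    then show ?thesis using main by simp
  qed
  then show ?thesis using d e by (intro exI[of _ "d / 4"] conjI exI[of _ e] exI[of _ n0]) auto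
qed

context data_law
begin

text \<open>Here the sampled law is fixed, so the variance condition holds with equality, and the
  bias is the only centring error.\<close>

lemma data_pivot_limit:
  assumes var: "0 < asymp_var" and m1: "\<And>n. 1 \<le> n \<Longrightarrow> 1 \<le> m n" and mlim: "filterlim m at_top sequentially"
    and sm: "(\<lambda>n. sqrt (real n) / real (m n)) \<longlonglongrightarrow> 0"
    and bias: "(\<lambda>n. sqrt (real n) * \<bar>smooth_mean (m n) - \<theta>\<bar>) \<longlonglongrightarrow> 0"
  shows "(\<lambda>n. measure (sample_law n) {z \<in> space (sample_law n). \<bar>sqrt (real n) * (rank_stat p (m n) n fst snd z - \<theta>)\<bar> \<le> t})
    \<longlonglongrightarrow> normal_abs_cdf (sqrt asymp_var) t"
proof (rule tendstoI)
  fix r :: real assume r: "0 < r"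
  have \<sigma>: "0 < sqrt asymp_var" using var by simp
  have r2: "0 < r / 2" using r by simp
  obtain \<delta> e n0 where d: "0 < \<delta>" "0 < e" "e \<le> 1" and
    P0: "\<And>n m Q F G \<theta>. n \<ge> n0 \<Longrightarrow> data_law Q F G p \<Longrightarrow> bw_accurate e p m \<Longrightarrow> 1 \<le> m \<Longrightarrow> 1 \<le> n \<Longrightarrow>
      12 / (e * sqrt (real n)) + 64 * sqrt (real n) / real m \<le> \<delta> \<Longrightarrow>
      sqrt (real n) * \<bar>uniform_pair.smooth_mean Q (\<lambda>x. F (fst x)) (\<lambda>x. G (snd x)) p m - \<theta>\<bar> \<le> \<delta> \<Longrightarrow>
      \<bar>uniform_pair.asymp_var Q (\<lambda>x. F (fst x)) (\<lambda>x. G (snd x)) p - (sqrt asymp_var)\<^sup>2\<bar> \<le> \<delta> \<Longrightarrow>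
      \<bar>measure (Pi\<^sub>M {..<n} (\<lambda>_. Q)) {z \<in> space (Pi\<^sub>M {..<n} (\<lambda>_. Q)). \<bar>sqrt (real n) * (rank_stat p m n fst snd z - \<theta>)\<bar> \<le> t}
        - normal_abs_cdf (sqrt asymp_var) t\<bar> \<le> r / 2"
    using pivot_clt[OF \<sigma> r2, of p t] by meson
  have P: "\<And>n m. n \<ge> n0 \<Longrightarrow> bw_accurate e p m \<Longrightarrow> 1 \<le> m \<Longrightarrow> 1 \<le> n \<Longrightarrow>
      12 / (e * sqrt (real n)) + 64 * sqrt (real n) / real m \<le> \<delta> \<Longrightarrow>
      sqrt (real n) * \<bar>smooth_mean m - \<theta>\<bar> \<le> \<delta> \<Longrightarrow> \<bar>asymp_var - (sqrt asymp_var)\<^sup>2\<bar> \<le> \<delta> \<Longrightarrow>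
      \<bar>measure (sample_law n) {z \<in> space (sample_law n). \<bar>sqrt (real n) * (rank_stat p m n fst snd z - \<theta>)\<bar> \<le> t}
        - normal_abs_cdf (sqrt asymp_var) t\<bar> \<le> r / 2"
    by (rule P0[OF _ data_law_axioms])
  have l0: "(\<lambda>n. 12 / (e * sqrt (real n)) + 64 * (sqrt (real n) / real (m n))) \<longlonglongrightarrow> 0 + 64 * 0"
    using d by (intro tendsto_add tendsto_mult tendsto_const sm) real_asymp
  have ev: "eventually (\<lambda>n. 12 / (e * sqrt (real n)) + 64 * (sqrt (real n) / real (m n)) < \<delta>) sequentially"
    using order_tendstoD(2)[OF l0] d by simp
  have ev2: "eventually (\<lambda>n. sqrt (real n) * \<bar>smooth_mean (m n) - \<theta>\<bar> < \<delta>) sequentially"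
    using order_tendstoD(2)[OF bias] d by simp
  have ev3: "eventually (\<lambda>n. bw_accurate e p (m n)) sequentially"
    using eventually_compose_filterlim[OF eventually_bw_accurate[OF p d(2)] mlim] .
  show "\<forall>\<^sub>F n in sequentially. dist (measure (sample_law n) {z \<in> space (sample_law n). \<bar>sqrt (real n) * (rank_stat p (m n) n fst snd z - \<theta>)\<bar> \<le> t})
      (normal_abs_cdf (sqrt asymp_var) t) < r"
    using ev ev2 ev3 eventually_ge_at_top[of n0] eventually_ge_at_top[of 1]
  proof eventually_elim
    case (elim n)
    have "\<bar>measure (sample_law n) {z \<in> space (sample_law n). \<bar>sqrt (real n) * (rank_stat p (m n) n fst snd z - \<theta>)\<bar> \<le> t}
        - normal_abs_cdf (sqrt asymp_var) t\<bar> \<le> r / 2"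
      using elim var d(1) by (intro P m1) auto
    then show ?case using r by (simp add: dist_real_def)
  qed
qed

text \<open>On the good event the resampling law has nearly the right variance and a small centring
  error, so the uniform limit theorem applies with it as the sampled law.\<close>

lemma boot_pivot_limit:
  assumes var: "0 < asymp_var" and m1: "\<And>n. 1 \<le> n \<Longrightarrow> 1 \<le> m n" and mlim: "filterlim m at_top sequentially"
    and sm: "(\<lambda>n. sqrt (real n) / real (m n)) \<longlonglongrightarrow> 0" and \<epsilon>: "0 < \<epsilon>"
  shows "\<exists>Gd. (\<forall>n. Gd n \<in> sets (sample_law n)) \<and> (\<lambda>n. measure (sample_law n) (Gd n)) \<longlonglongrightarrow> 1 \<and>
    (\<forall>\<^sub>F n in sequentially. \<forall>z\<in>Gd n. \<bar>boot_rank_cdf p (m n) n z t - normal_abs_cdf (sqrt asymp_var) t\<bar> \<le> \<epsilon>)"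
proof -
  have \<sigma>: "0 < sqrt asymp_var" using var by simp
  obtain \<delta> e n0 where d: "0 < \<delta>" "0 < e" "e \<le> 1" and
    P: "\<And>n m Q F G \<theta>. n \<ge> n0 \<Longrightarrow> data_law Q F G p \<Longrightarrow> bw_accurate e p m \<Longrightarrow> 1 \<le> m \<Longrightarrow> 1 \<le> n \<Longrightarrow>
      12 / (e * sqrt (real n)) + 64 * sqrt (real n) / real m \<le> \<delta> \<Longrightarrow>
      sqrt (real n) * \<bar>uniform_pair.smooth_mean Q (\<lambda>x. F (fst x)) (\<lambda>x. G (snd x)) p m - \<theta>\<bar> \<le> \<delta> \<Longrightarrow>
      \<bar>uniform_pair.asymp_var Q (\<lambda>x. F (fst x)) (\<lambda>x. G (snd x)) p - (sqrt asymp_var)\<^sup>2\<bar> \<le> \<delta> \<Longrightarrow>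
      \<bar>measure (Pi\<^sub>M {..<n} (\<lambda>_. Q)) {z \<in> space (Pi\<^sub>M {..<n} (\<lambda>_. Q)). \<bar>sqrt (real n) * (rank_stat p m n fst snd z - \<theta>)\<bar> \<le> t}
        - normal_abs_cdf (sqrt asymp_var) t\<bar> \<le> \<epsilon>"
    using pivot_clt[OF \<sigma> \<epsilon>, of p t] by meson
  obtain Gd where Gd: "\<forall>n. Gd n \<in> sets (sample_law n)" "(\<lambda>n. measure (sample_law n) (Gd n)) \<longlonglongrightarrow> 1"
    and evG: "\<forall>\<^sub>F n in sequentially. \<forall>z\<in>Gd n. no_ties n z \<longrightarrow> \<bar>uniform_pair.asymp_var (boot_base n z) cl\<^sub>1 cl\<^sub>2 p - asymp_var\<bar> \<le> \<delta>"
    using boot_variance_consistent[OF d(1)] by blast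
  \<comment> \<open>A second tolerance for the centring error, whose part \<open>20 * e'\<close>
    must stay below \<open>\<delta> / 3\<close>.\<close>
  define e' where "e' = min e (\<delta> / 60)"
  have e': "0 < e'" "e' \<le> 1" "20 * e' \<le> \<delta> / 3" using d unfolding e'_def by auto
  have l0: "(\<lambda>n. 12 / (e * sqrt (real n)) + 64 * (sqrt (real n) / real (m n))) \<longlonglongrightarrow> 0 + 64 * 0"
    using d by (intro tendsto_add tendsto_mult tendsto_const sm) real_asymp
  have ev: "eventually (\<lambda>n. 12 / (e * sqrt (real n)) + 64 * (sqrt (real n) / real (m n)) < \<delta>) sequentially"
    using order_tendstoD(2)[OF l0] d by simp
  have l1: "(\<lambda>n. 12 / (e' * sqrt (real n)) + 8 * (sqrt (real n) / real (m n))) \<longlonglongrightarrow> 0 + 8 * 0"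
    using e' by (intro tendsto_add tendsto_mult tendsto_const sm) real_asymp
  have ev1: "eventually (\<lambda>n. 12 / (e' * sqrt (real n)) + 8 * (sqrt (real n) / real (m n)) < \<delta> / 3) sequentially"
    using order_tendstoD(2)[OF l1, of "\<delta> / 3"] d by simp
  have ev3: "eventually (\<lambda>n. bw_accurate e p (m n)) sequentially" "eventually (\<lambda>n. bw_accurate e' p (m n)) sequentially"
    using eventually_compose_filterlim[OF eventually_bw_accurate[OF p d(2)] mlim]
      eventually_compose_filterlim[OF eventually_bw_accurate[OF p e'(1)] mlim] .
  have evC: "\<forall>\<^sub>F n in sequentially. \<forall>z\<in>Gd n. no_ties n z \<longrightarrow> \<bar>boot_rank_cdf p (m n) n z t - normal_abs_cdf (sqrt asymp_var) t\<bar> \<le> \<epsilon>"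
    using ev ev1 ev3 evG eventually_ge_at_top[of n0] eventually_ge_at_top[of 1]
  proof eventually_elim
    case (elim n)
    show ?case
    proof (intro ballI impI)
      fix z assume z: "z \<in> Gd n" "no_ties n z"
      have n: "0 < n" using elim by simp
      interpret B: uniform_pair "boot_base n z" cl\<^sub>1 cl\<^sub>2 p by (rule boot_pair[OF n z(2)])
      \<comment> \<open>The resampling law is itself an instance of \<open>data_law\<close>, with
        clamping in the role of both marginal distribution functions.\<close>
      have mono: "mono clamp01" by (auto simp: mono_def clamp01_def)
      have dl: "data_law (boot_base n z) clamp01 clamp01 p"
        by (intro data_law.intro data_law_axioms.intro B.uniform_pair_axioms mono) simp
      have "sqrt (real n) * \<bar>B.smooth_mean (m n) - rank_stat p (m n) n fst snd z\<bar>
          \<le> 20 * e' + 12 / (e' * sqrt (real n)) + 8 * sqrt (real n) / real (m n)"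
        unfolding B.smooth_mean_def
        by (rule boot_base_centering[OF p elim(4) m1 e'(1,2) n]) (use elim no_ties_fst_snd[OF z(2)] in auto)
      then have "sqrt (real n) * \<bar>B.smooth_mean (m n) - rank_stat p (m n) n fst snd z\<bar> \<le> \<delta>"
        using elim(2) e'(3) d(1) by simp
      then show "\<bar>boot_rank_cdf p (m n) n z t - normal_abs_cdf (sqrt asymp_var) t\<bar> \<le> \<epsilon>"
        unfolding boot_rank_cdf_def boot_law_eq[OF n]
        using elim z var by (intro P[OF _ dl] m1) auto
    qed
  qed
  \<comment> \<open>Almost sure absence of ties is turned into a null set to be removed, so that the
    bound holds for every sample in the event.\<close>
  have "\<exists>N0. N0 \<in> null_sets (sample_law n) \<and> (\<forall>z\<in>space (sample_law n) - N0. no_ties n z)" for n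
    by (rule AE_E3[OF AE_no_ties[of n]]) blast
  then obtain N0 where N0: "\<And>n. N0 n \<in> null_sets (sample_law n)" "\<And>n z. z \<in> space (sample_law n) - N0 n \<Longrightarrow> no_ties n z"
    by metis
  have "measure (sample_law n) (Gd n - N0 n) = measure (sample_law n) (Gd n)" for n
    by (rule measure_Diff_null_set[OF Gd(1)[rule_format] N0(1)])
  moreover have "Gd n - N0 n \<in> sets (sample_law n)" for n using Gd(1) N0(1)[of n] by auto
  moreover have nt: "no_ties n z" if "z \<in> Gd n - N0 n" for n z
    using that sets.sets_into_space[OF Gd(1)[rule_format, of n]] by (intro N0(2)) blast
  moreover have "\<forall>\<^sub>F n in sequentially. \<forall>z\<in>Gd n - N0 n. \<bar>boot_rank_cdf p (m n) n z t - normal_abs_cdf (sqrt asymp_var) t\<bar> \<le> \<epsilon>"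
    using evC by (rule eventually_mono) (use nt in blast)
  ultimately show ?thesis using Gd(2) by (intro exI[of _ "\<lambda>n. Gd n - N0 n"]) simp
qed

end

section \<open>Coverage\<close>

text \<open>Monotonicity locates the generalised inverse, so this covers bootstrap and empirical
  distribution functions alike.\<close>

lemma quantile_bounds:
  assumes "mono K" "K a < q" "q \<le> K b"
  shows "a \<le> quantile K q" "quantile K q \<le> b"
proof -
  have lower: "a \<le> t" if "q \<le> K t" for t
  proof (rule ccontr)
    assume "\<not> a \<le> t"
    then have "K t \<le> K a" by (intro monoD[OF assms(1)]) simp
    then show False using that assms(2) by simp
  qed
  then show "a \<le> quantile K q" unfolding quantile_def using assms(3) by (intro cInf_greatest) auto
  show "quantile K q \<le> b" unfolding quantile_def using assms(3) lower by (intro cInf_lower bdd_belowI[of _ a]) auto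
qed

text \<open>The random quantile may depend on the statistic. Two fixed thresholds with limiting
  probabilities \<open>q - e\<close> and \<open>q + e\<close> enclose it on events of probability
  near one, and the coverage is squeezed between probabilities at fixed thresholds.\<close>

lemma (in prob_space) quantile_coverage:
  fixes A :: "nat \<Rightarrow> 'a \<Rightarrow> real" and K :: "nat \<Rightarrow> 'a \<Rightarrow> real \<Rightarrow> real"
  assumes \<sigma>: "0 < \<sigma>" and q: "0 < q" "q < 1"
    and A: "\<And>n. 1 \<le> n \<Longrightarrow> A n \<in> borel_measurable M"
    and cov: "\<And>n. 1 \<le> n \<Longrightarrow> {\<omega> \<in> space M. A n \<omega> \<le> quantile (K n \<omega>) q} \<in> events"
    and limA: "\<And>t. (\<lambda>n. prob {\<omega> \<in> space M. A n \<omega> \<le> t}) \<longlonglongrightarrow> normal_abs_cdf \<sigma> t"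
    and mono: "\<And>n \<omega>. 1 \<le> n \<Longrightarrow> \<omega> \<in> space M \<Longrightarrow> mono (K n \<omega>)"
    and limK: "\<And>t \<epsilon>. 0 < \<epsilon> \<Longrightarrow> \<exists>E. (\<forall>n\<ge>1. E n \<in> events) \<and> (\<lambda>n. prob (E n)) \<longlonglongrightarrow> 1 \<and>
        (\<forall>\<^sub>F n in sequentially. \<forall>\<omega>\<in>E n. \<bar>K n \<omega> t - normal_abs_cdf \<sigma> t\<bar> \<le> \<epsilon>)"
  shows "(\<lambda>n. prob {\<omega> \<in> space M. A n \<omega> \<le> quantile (K n \<omega>) q}) \<longlonglongrightarrow> q"
proof (rule tendstoI)
  fix r :: real assume r: "0 < r"
  \<comment> \<open>This keeps \<open>q - e\<close> and \<open>q + e\<close> strictly inside the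
    unit interval and the total error \<open>3 * e\<close> below \<open>r\<close>.\<close>
  define e where "e = min (r / 4) (min q (1 - q) / 2)"
  have e: "0 < e" "e \<le> r / 4" "0 < q - e" "q - e < 1" "0 < q + e" "q + e < 1" using r q unfolding e_def by (auto simp: min_def field_simps)
  obtain a where a: "normal_abs_cdf \<sigma> a = q - e" using normal_abs_cdf_quantile[OF \<sigma> e(3,4)] by blast
  obtain b where b: "normal_abs_cdf \<sigma> b = q + e" using normal_abs_cdf_quantile[OF \<sigma> e(5,6)] by blast
  obtain E where E: "\<And>n. 1 \<le> n \<Longrightarrow> E n \<in> events" "(\<lambda>n. prob (E n)) \<longlonglongrightarrow> 1"
      "\<forall>\<^sub>F n in sequentially. \<forall>\<omega>\<in>E n. \<bar>K n \<omega> a - normal_abs_cdf \<sigma> a\<bar> \<le> e / 2"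
    using limK[of "e / 2" a] e by auto
  obtain E' where E': "\<And>n. 1 \<le> n \<Longrightarrow> E' n \<in> events" "(\<lambda>n. prob (E' n)) \<longlonglongrightarrow> 1"
      "\<forall>\<^sub>F n in sequentially. \<forall>\<omega>\<in>E' n. \<bar>K n \<omega> b - normal_abs_cdf \<sigma> b\<bar> \<le> e / 2"
    using limK[of "e / 2" b] e by auto
  have ev1: "\<forall>\<^sub>F n in sequentially. prob (E n) > 1 - e / 2" "\<forall>\<^sub>F n in sequentially. prob (E' n) > 1 - e / 2"
    using order_tendstoD(1)[OF E(2)] order_tendstoD(1)[OF E'(2)] e by simp_all
  have ev2: "\<forall>\<^sub>F n in sequentially. prob {\<omega> \<in> space M. A n \<omega> \<le> a} > q - 2 * e"
      "\<forall>\<^sub>F n in sequentially. prob {\<omega> \<in> space M. A n \<omega> \<le> b} < q + 2 * e"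
    using order_tendstoD(1)[OF limA[of a]] order_tendstoD(2)[OF limA[of b]] a b e(1) by simp_all
  show "\<forall>\<^sub>F n in sequentially. dist (prob {\<omega> \<in> space M. A n \<omega> \<le> quantile (K n \<omega>) q}) q < r"
    using ev1 ev2 E(3) E'(3) eventually_ge_at_top[of 1]
  proof eventually_elim
    case (elim n)
    note [measurable] = A[OF elim(7)] cov[OF elim(7)] E(1)[OF elim(7)] E'(1)[OF elim(7)]
    let ?Q = "{\<omega> \<in> space M. A n \<omega> \<le> quantile (K n \<omega>) q}"
    have sub: "E n \<subseteq> space M" "E' n \<subseteq> space M" using E(1) E'(1) elim(7) sets.sets_into_space by blast+
    have bd: "a \<le> quantile (K n \<omega>) q" "quantile (K n \<omega>) q \<le> b" if "\<omega> \<in> E n" "\<omega> \<in> E' n" for \<omega>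
    proof -
      have "\<bar>K n \<omega> a - (q - e)\<bar> \<le> e / 2" "\<bar>K n \<omega> b - (q + e)\<bar> \<le> e / 2" using elim(5,6) that a b by auto
      then have "K n \<omega> a < q" "q \<le> K n \<omega> b" using e(1) by linarith+
      then show "a \<le> quantile (K n \<omega>) q" "quantile (K n \<omega>) q \<le> b"
        using quantile_bounds[OF mono] elim(7) that(1) sub by blast+
    qed
    have bad: "prob (space M - E n) \<le> e / 2" "prob (space M - E' n) \<le> e / 2"
      using elim(1,2) by (simp_all add: prob_compl)
    have "prob {\<omega> \<in> space M. A n \<omega> \<le> a} \<le> prob (?Q \<union> ((space M - E n) \<union> (space M - E' n)))"
      by (rule finite_measure_mono) (use bd in force, measurable)
    also have "\<dots> \<le> prob ?Q + (prob (space M - E n) + prob (space M - E' n))"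
      by (rule order_trans[OF measure_Un_le]) (auto intro!: add_left_mono measure_Un_le)
    finally have lo: "q - 3 * e < prob ?Q" using bad elim(3) by linarith
    have "prob ?Q \<le> prob ({\<omega> \<in> space M. A n \<omega> \<le> b} \<union> ((space M - E n) \<union> (space M - E' n)))"
      by (rule finite_measure_mono) (use bd in force, measurable)
    also have "\<dots> \<le> prob {\<omega> \<in> space M. A n \<omega> \<le> b} + (prob (space M - E n) + prob (space M - E' n))"
      by (rule order_trans[OF measure_Un_le]) (auto intro!: add_left_mono measure_Un_le)
    finally have "prob ?Q < q + 3 * e" using bad elim(4) by linarith
    then show ?case using lo e(1,2) by (simp add: dist_real_def abs_less_iff)
  qed
qed

section \<open>Bootstrap samples given the data\<close>

text \<open>For a measurable map into a discrete space the preimage of every set is an event;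
  measurability is thus reduced to dependence on ranks.\<close>

lemma determined_event:
  assumes g: "g \<in> measurable M (count_space UNIV)"
    and det: "\<And>x y. x \<in> space M \<Longrightarrow> y \<in> space M \<Longrightarrow> g x = g y \<Longrightarrow> \<Phi> x = \<Phi> y"
  shows "{x \<in> space M. \<Phi> x} \<in> sets M"
proof -
  have "{x \<in> space M. \<Phi> x} = g -` (g ` {x \<in> space M. \<Phi> x}) \<inter> space M" using det by blast
  also have "\<dots> \<in> sets M" by (rule measurable_sets[OF g]) simp
  finally show ?thesis .
qed

text \<open>Chebyshev's inequality for a mean of centred indicators, whose second moment is at most
  1.\<close>

lemma (in prob_space) ecdf_deviation:
  assumes h[measurable]: "h \<in> borel_measurable M" and \<epsilon>: "0 < \<epsilon>" and N: "0 < N"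
  shows "measure (sample_law N) {s \<in> space (sample_law N). \<epsilon> < \<bar>ecdf N (\<lambda>b. h (s b)) t - prob {x \<in> space M. h x \<le> t}\<bar>}
    \<le> 1 / (real N * \<epsilon>\<^sup>2)"
proof -
  interpret P: prob_space "sample_law N" by (rule prob_space_sample_law)
  define \<pi> where "\<pi> = prob {x \<in> space M. h x \<le> t}"
  define f where "f x = of_bool (h x \<le> t) - \<pi>" for x
  have \<pi>: "0 \<le> \<pi>" "\<pi> \<le> 1" unfolding \<pi>_def by auto
  have fm: "f \<in> borel_measurable M" unfolding f_def by (intro borel_measurable_diff measurable_of_bool_cmp) auto
  have fb: "\<bar>f x\<bar> \<le> 1" for x unfolding f_def using \<pi> by auto
  have "(\<integral>x. of_bool (h x \<le> t) \<partial>M) = (\<integral>x. indicator {x \<in> space M. h x \<le> t} x \<partial>M)"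
    by (intro Bochner_Integration.integral_cong refl) (simp add: indicator_def)
  also have "\<dots> = prob ({x \<in> space M. h x \<le> t} \<inter> space M)" by (rule Bochner_Integration.integral_indicator)
  also have "\<dots> = \<pi>" unfolding \<pi>_def by (intro arg_cong[where f=prob]) blast
  finally have i1: "(\<integral>x. of_bool (h x \<le> t) \<partial>M) = \<pi>" .
  have int: "integrable M (\<lambda>x. of_bool (h x \<le> t) :: real)"
    by (rule integrable_const_bound[of _ 1]) (auto intro!: measurable_of_bool_cmp)
  have mean: "(\<integral>x. f x \<partial>M) = 0"
    unfolding f_def using i1 int by (subst Bochner_Integration.integral_diff) (auto simp: prob_space)
  define u where "u s = (\<Sum>i<N. f (s i))\<^sup>2" for s
  have fs: "(\<lambda>s. f (s i)) \<in> borel_measurable (sample_law N)" if "i < N" for i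
    by (rule measurable_compose[OF sample_component_measurable[OF that] fm])
  have um[measurable]: "u \<in> borel_measurable (sample_law N)"
    unfolding u_def by (intro borel_measurable_power borel_measurable_sum fs) simp
  have ub: "\<bar>u s\<bar> \<le> (real N)\<^sup>2" for s
  proof -
    have "\<bar>\<Sum>i<N. f (s i)\<bar> \<le> (\<Sum>i<N. 1)" by (rule order_trans[OF sum_abs]) (intro sum_mono fb)
    then have "\<bar>\<Sum>i<N. f (s i)\<bar> \<le> real N" by simp
    from power_mono[OF this abs_ge_zero, of 2] show ?thesis unfolding u_def by simp
  qed
  have ui: "integrable (sample_law N) u" by (rule integrable_sample_bounded[OF um ub])
  have "(\<integral>x. (f x)\<^sup>2 \<partial>M) \<le> (\<integral>x. 1 \<partial>M)"
  proof (rule integral_mono)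
    show "(f x)\<^sup>2 \<le> 1" for x using fb[of x] abs_le_square_iff[of "f x" 1] by simp
    then show "integrable M (\<lambda>x. (f x)\<^sup>2)" using fm by (intro integrable_const_bound[of _ 1]) auto
  qed simp
  then have Eu: "(\<integral>s. u s \<partial>sample_law N) \<le> real N"
    unfolding u_def integral_sample_sum_square[OF fm fb mean] using N by (simp add: prob_space)
  have c: "0 < (real N * \<epsilon>)\<^sup>2" using N \<epsilon> by simp
  have "\<epsilon> < \<bar>ecdf N (\<lambda>b. h (s b)) t - \<pi>\<bar> \<Longrightarrow> (real N * \<epsilon>)\<^sup>2 \<le> u s" for s
  proof -
    assume *: "\<epsilon> < \<bar>ecdf N (\<lambda>b. h (s b)) t - \<pi>\<bar>"
    have "ecdf N (\<lambda>b. h (s b)) t - \<pi> = (\<Sum>i<N. f (s i)) / real N"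
      unfolding ecdf_def f_def sum_subtractf using N by (simp add: field_simps)
    then have "\<epsilon> < \<bar>\<Sum>i<N. f (s i)\<bar> / real N" using * by simp
    then have "real N * \<epsilon> \<le> \<bar>\<Sum>i<N. f (s i)\<bar>" using N by (simp add: field_simps)
    then have "\<bar>real N * \<epsilon>\<bar> \<le> \<bar>\<Sum>i<N. f (s i)\<bar>" using \<epsilon> by simp
    then show ?thesis unfolding u_def by (simp only: abs_le_square_iff)
  qed
  then have "measure (sample_law N) {s \<in> space (sample_law N). \<epsilon> < \<bar>ecdf N (\<lambda>b. h (s b)) t - \<pi>\<bar>}
      \<le> measure (sample_law N) {s \<in> space (sample_law N). u s \<ge> (real N * \<epsilon>)\<^sup>2}"
    by (intro P.finite_measure_mono) (auto, measurable)
  also have "\<dots> \<le> (\<integral>s. u s \<partial>sample_law N) / (real N * \<epsilon>)\<^sup>2"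
    by (rule integral_Markov_inequality_measure[OF ui _ _ c, of "space (sample_law N)"]) (auto simp: u_def)
  also have "\<dots> \<le> real N / (real N * \<epsilon>)\<^sup>2" using Eu c by (intro divide_right_mono) auto
  also have "\<dots> = 1 / (real N * \<epsilon>\<^sup>2)" using N \<epsilon> by (simp add: power2_eq_square field_simps)
  finally show ?thesis unfolding \<pi>_def .
qed

lemma sets_boot_law: "0 < n \<Longrightarrow> sets (boot_law n z) = sets (Pi\<^sub>M {..<n} (\<lambda>_. borel))"
  unfolding boot_law_eq by (rule sets_PiM_cong) auto

lemma prob_boot_law: "0 < n \<Longrightarrow> prob_space (boot_law n z)"
  unfolding boot_law_eq by (intro prob_space_PiM prob_boot_base)

lemma boot_samples_measurable:
  assumes "boot_samples M n N Z S"
  shows "(\<lambda>\<omega>. \<lambda>i\<in>{..<n}. Z i \<omega>) \<in> measurable M (Pi\<^sub>M {..<n} (\<lambda>_. borel))"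
    and "b < N \<Longrightarrow> (\<lambda>\<omega>. \<lambda>i\<in>{..<n}. S b i \<omega>) \<in> measurable M (Pi\<^sub>M {..<n} (\<lambda>_. borel))"
proof -
  show "(\<lambda>\<omega>. \<lambda>i\<in>{..<n}. Z i \<omega>) \<in> measurable M (Pi\<^sub>M {..<n} (\<lambda>_. borel))"
    using assms unfolding boot_samples_def has_conditional_law_def by blast
  have T: "(\<lambda>\<omega>. \<lambda>b\<in>{..<N}. \<lambda>i\<in>{..<n}. S b i \<omega>) \<in> measurable M (Pi\<^sub>M {..<N} (\<lambda>_. Pi\<^sub>M {..<n} (\<lambda>_. borel)))"
    using assms unfolding boot_samples_def has_conditional_law_def by blast
  assume b: "b < N"
  then have "(\<lambda>s. s b) \<in> measurable (Pi\<^sub>M {..<N} (\<lambda>_. Pi\<^sub>M {..<n} (\<lambda>_. borel :: (real \<times> real) measure))) (Pi\<^sub>M {..<n} (\<lambda>_. borel))"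
    by (intro measurable_component_singleton) simp
  from measurable_compose[OF T this] show "(\<lambda>\<omega>. \<lambda>i\<in>{..<n}. S b i \<omega>) \<in> measurable M (Pi\<^sub>M {..<n} (\<lambda>_. borel))"
    using b by simp
qed

lemma pattern_rv_measurable:
  assumes "(\<lambda>\<omega>. \<lambda>i\<in>{..<n}. Z i \<omega>) \<in> measurable M (Pi\<^sub>M {..<n} (\<lambda>_. borel))"
  shows "(\<lambda>\<omega>. pattern n (\<lambda>i. Z i \<omega>)) \<in> measurable M (count_space UNIV)"
  using measurable_compose[OF assms pattern_measurable[OF refl]] by (simp add: pattern_restrict)

lemma boot_patterns_measurable:
  assumes "boot_samples M n N Z S"
  shows "(\<lambda>\<omega>. (pattern n (\<lambda>i. Z i \<omega>), map (\<lambda>b. pattern n (\<lambda>i. S b i \<omega>)) [0..<N])) \<in> measurable M (count_space UNIV)"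
proof -
  have Zm: "(\<lambda>\<omega>. pattern n (\<lambda>i. Z i \<omega>)) \<in> measurable M (count_space UNIV)"
    by (rule pattern_rv_measurable[OF boot_samples_measurable(1)[OF assms]])
  have Sm: "(\<lambda>\<omega>. pattern n (\<lambda>i. S b i \<omega>)) \<in> measurable M (count_space UNIV)" if "b < N" for b
    by (rule pattern_rv_measurable[OF boot_samples_measurable(2)[OF assms that]])
  have "(\<lambda>\<omega>. (pattern n (\<lambda>i. Z i \<omega>), map (\<lambda>b. pattern n (\<lambda>i. S b i \<omega>)) [0..<N])) -` {w} \<inter> space M \<in> sets M" for w
  proof -
    have "(pattern n (\<lambda>i. Z i \<omega>), map (\<lambda>b. pattern n (\<lambda>i. S b i \<omega>)) [0..<N]) = w \<longleftrightarrow>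
        pattern n (\<lambda>i. Z i \<omega>) = fst w \<and> length (snd w) = N \<and> (\<forall>b\<in>{..<N}. pattern n (\<lambda>i. S b i \<omega>) = snd w ! b)" for \<omega>
      unfolding prod_eq_iff fst_conv snd_conv list_eq_iff_nth_eq by auto
    then have "(\<lambda>\<omega>. (pattern n (\<lambda>i. Z i \<omega>), map (\<lambda>b. pattern n (\<lambda>i. S b i \<omega>)) [0..<N])) -` {w} \<inter> space M
        = {\<omega> \<in> space M. pattern n (\<lambda>i. Z i \<omega>) = fst w \<and> length (snd w) = N \<and> (\<forall>b\<in>{..<N}. pattern n (\<lambda>i. S b i \<omega>) = snd w ! b)}"
      by (simp only: vimage_def Int_def singleton_iff mem_Collect_eq conj_commute)
    also have "\<dots> \<in> sets M"
    proof (intro sets.sets_Collect_conj sets.sets_Collect_finite_All sets.sets_Collect_const)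
      show "{\<omega> \<in> space M. pattern n (\<lambda>i. Z i \<omega>) = fst w} \<in> sets M" by (rule determined_event[OF Zm]) simp
      show "{\<omega> \<in> space M. pattern n (\<lambda>i. S b i \<omega>) = snd w ! b} \<in> sets M" if "b \<in> {..<N}" for b
        using that by (intro determined_event[OF Sm[of b]]) auto
    qed simp
    finally show ?thesis .
  qed
  then show ?thesis by (subst measurable_count_space_eq_countable) auto
qed

text \<open>Given one rank pattern the conditional law is a fixed product measure, so Chebyshev's
  bound holds there with a constant independent of the pattern. The finitely many pattern events are
  disjoint, so summing over them loses nothing.\<close>

lemma (in prob_space) boot_ecdf_deviation:
  fixes g :: "(nat \<Rightarrow> real \<times> real) \<Rightarrow> (nat \<Rightarrow> real \<times> real) \<Rightarrow> real" and t :: real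
  assumes bs: "boot_samples M n N Z S" and n: "0 < n" and \<epsilon>: "0 < \<epsilon>"
    and g: "\<And>z z' s s'. pattern n z = pattern n z' \<Longrightarrow> pattern n s = pattern n s' \<Longrightarrow> g z s = g z' s'"
  defines "bad \<equiv> {\<omega> \<in> space M. \<epsilon> < \<bar>ecdf N (\<lambda>b. g (\<lambda>i. Z i \<omega>) (\<lambda>i. S b i \<omega>)) t
      - measure (boot_law n (\<lambda>i. Z i \<omega>)) {s \<in> space (boot_law n (\<lambda>i. Z i \<omega>)). g (\<lambda>i. Z i \<omega>) s \<le> t}\<bar>}"
  shows "bad \<in> events" and "0 < N \<Longrightarrow> prob bad \<le> 1 / (real N * \<epsilon>\<^sup>2)"
proof -
  have ecdf_cong: "ecdf N x t = ecdf N y t" if "\<And>b. b < N \<Longrightarrow> x b = y b" for x y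
    unfolding ecdf_def using that by simp
  show bad: "bad \<in> events" unfolding bad_def
  proof (rule determined_event[OF boot_patterns_measurable[OF bs]])
    fix \<omega> \<omega>'
    assume "(pattern n (\<lambda>i. Z i \<omega>), map (\<lambda>b. pattern n (\<lambda>i. S b i \<omega>)) [0..<N])
        = (pattern n (\<lambda>i. Z i \<omega>'), map (\<lambda>b. pattern n (\<lambda>i. S b i \<omega>')) [0..<N])"
    then have pz: "pattern n (\<lambda>i. Z i \<omega>) = pattern n (\<lambda>i. Z i \<omega>')"
      and ps: "\<And>b. b < N \<Longrightarrow> pattern n (\<lambda>i. S b i \<omega>) = pattern n (\<lambda>i. S b i \<omega>')"
      by (auto simp: map_eq_conv)
    have "ecdf N (\<lambda>b. g (\<lambda>i. Z i \<omega>) (\<lambda>i. S b i \<omega>)) t = ecdf N (\<lambda>b. g (\<lambda>i. Z i \<omega>') (\<lambda>i. S b i \<omega>')) t"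
      by (intro ecdf_cong g pz ps)
    then show "(\<epsilon> < \<bar>ecdf N (\<lambda>b. g (\<lambda>i. Z i \<omega>) (\<lambda>i. S b i \<omega>)) t
          - measure (boot_law n (\<lambda>i. Z i \<omega>)) {s \<in> space (boot_law n (\<lambda>i. Z i \<omega>)). g (\<lambda>i. Z i \<omega>) s \<le> t}\<bar>)
        = (\<epsilon> < \<bar>ecdf N (\<lambda>b. g (\<lambda>i. Z i \<omega>') (\<lambda>i. S b i \<omega>')) t
          - measure (boot_law n (\<lambda>i. Z i \<omega>')) {s \<in> space (boot_law n (\<lambda>i. Z i \<omega>')). g (\<lambda>i. Z i \<omega>') s \<le> t}\<bar>)"
      using boot_law_pattern[OF n pz] g[OF pz refl] by simp
  qed
  assume N: "0 < N"
  let ?P = "Pi\<^sub>M {..<n} (\<lambda>_. borel :: (real \<times> real) measure)"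
  let ?Q = "Pi\<^sub>M {..<N} (\<lambda>_. ?P)"
  let ?F = "vimage_algebra (space M) (\<lambda>\<omega>. \<lambda>i\<in>{..<n}. Z i \<omega>) ?P"
  define D where "D \<omega> = (\<lambda>i\<in>{..<n}. Z i \<omega>)" for \<omega>
  define T where "T \<omega> = (\<lambda>b\<in>{..<N}. \<lambda>i\<in>{..<n}. S b i \<omega>)" for \<omega>
  \<comment> \<open>A representative sample for each pattern turns data-dependent objects into
    functions of the pattern.\<close>
  define rep where "rep v = (SOME z. pattern n z = v)" for v
  define L where "L v = boot_law n (rep v)" for v
  define E where "E v = {s \<in> space ?Q. \<epsilon> < \<bar>ecdf N (\<lambda>b. g (rep v) (s b)) t - measure (L v) {s \<in> space (L v). g (rep v) s \<le> t}\<bar>}" for v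
  define A where "A v = {\<omega> \<in> space M. pattern n (D \<omega>) = v}" for v
  have rep: "pattern n (rep (pattern n z)) = pattern n z" for z
    unfolding rep_def by (rule someI[where x=z]) (rule refl)
  have Dm: "D \<in> measurable M ?P" and Tm: "T \<in> measurable M ?Q"
    and cond: "\<And>E. E \<in> sets ?Q \<Longrightarrow> AE \<omega> in M. real_cond_exp M ?F (\<lambda>\<omega>. indicator E (T \<omega>)) \<omega> = measure (Pi\<^sub>M {..<N} (\<lambda>_. boot_law n (D \<omega>))) E"
    using bs unfolding boot_samples_def has_conditional_law_def D_def T_def by blast+
  have Dpat: "pattern n (D \<omega>) = pattern n (\<lambda>i. Z i \<omega>)" for \<omega>
    unfolding D_def using pattern_restrict[of n "\<lambda>i. Z i \<omega>"] by simp
  have sub: "subalgebra M ?F"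
    unfolding subalgebra_def using sets_image_in_sets[OF refl Dm] unfolding D_def by simp
  interpret F: finite_measure_subalgebra M ?F by unfold_locales (rule sub)
  have setsL: "sets (L v) = sets ?P" for v unfolding L_def by (rule sets_boot_law[OF n])
  have gN: "g (rep v) \<in> borel_measurable K" if "sets K = sets ?P" for v K
  proof -
    have "g (rep v) \<in> measurable K (count_space UNIV)" by (rule pattern_function_measurable[OF that g[OF refl]])
    moreover have "(\<lambda>x :: real. x) \<in> measurable (count_space UNIV) borel" by simp
    ultimately show ?thesis by (rule measurable_compose)
  qed
  have gm: "g (rep v) \<in> borel_measurable ?P" "g (rep v) \<in> borel_measurable (L v)" for v
    by (rule gN[OF refl], rule gN[OF setsL])
  have Em: "E v \<in> sets ?Q" for v
  proof -
    have "(\<lambda>s. g (rep v) (s b)) \<in> borel_measurable ?Q" if "b < N" for b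
      by (rule measurable_compose[OF _ gm(1)]) (use that in \<open>auto intro: measurable_component_singleton\<close>)
    then have "(\<lambda>s. ecdf N (\<lambda>b. g (rep v) (s b)) t) \<in> borel_measurable ?Q"
      unfolding ecdf_def by (intro borel_measurable_divide borel_measurable_sum measurable_of_bool_cmp) auto
    then show ?thesis unfolding E_def by measurable
  qed
  have Am: "A v \<in> sets ?F" for v
  proof -
    have "pattern n -` {v} \<inter> space ?P \<in> sets ?P" by (rule measurable_sets[OF pattern_measurable[OF refl]]) simp
    from in_vimage_algebra[OF this, of "\<lambda>\<omega>. \<lambda>i\<in>{..<n}. Z i \<omega>" "space M"]
    have "D -` (pattern n -` {v} \<inter> space ?P) \<inter> space M \<in> sets ?F" unfolding D_def .
    moreover have "D -` (pattern n -` {v} \<inter> space ?P) \<inter> space M = A v"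
      unfolding A_def using measurable_space[OF Dm] by auto
    ultimately show ?thesis by simp
  qed
  then have AM: "A v \<in> events" for v using sub unfolding subalgebra_def by blast
  have TE: "T -` E v \<inter> space M \<in> events" for v by (rule measurable_sets[OF Tm Em])
  have dev: "measure (Pi\<^sub>M {..<N} (\<lambda>_. L v)) (E v) \<le> 1 / (real N * \<epsilon>\<^sup>2)" for v
  proof -
    interpret L: prob_space "L v" unfolding L_def by (rule prob_boot_law[OF n])
    have "sets (L.sample_law N) = sets ?Q" by (rule sets_PiM_cong) (simp_all add: setsL)
    then have "space (L.sample_law N) = space ?Q" by (rule sets_eq_imp_space_eq)
    then show ?thesis using L.ecdf_deviation[OF gm(2) \<epsilon> N, of t] unfolding E_def by simp
  qed
  have part: "prob (A v \<inter> (T -` E v \<inter> space M)) \<le> prob (A v) * (1 / (real N * \<epsilon>\<^sup>2))" for v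
  proof -
    have int: "integrable M (\<lambda>\<omega>. indicator (E v) (T \<omega>) :: real)"
      by (rule integrable_const_bound[of _ 1]) (use measurable_compose[OF Tm borel_measurable_indicator[OF Em]] in auto)
    have "prob (A v \<inter> (T -` E v \<inter> space M)) = (\<integral>\<omega>\<in>A v. indicator (E v) (T \<omega>) \<partial>M)"
    proof -
      have "(\<integral>\<omega>\<in>A v. indicator (E v) (T \<omega>) \<partial>M) = (\<integral>\<omega>. indicator (A v \<inter> (T -` E v \<inter> space M)) \<omega> \<partial>M)"
        unfolding set_lebesgue_integral_def by (intro Bochner_Integration.integral_cong refl) (simp add: indicator_def)
      also have "\<dots> = prob (A v \<inter> (T -` E v \<inter> space M) \<inter> space M)" by (rule Bochner_Integration.integral_indicator)
      also have "\<dots> = prob (A v \<inter> (T -` E v \<inter> space M))" by (intro arg_cong[where f=prob]) blast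
      finally show ?thesis by (rule sym)
    qed
    \<comment> \<open>The pattern event lies in the \<sigma>-algebra of the data, so the conditional
      expectation has the same integral over it.\<close>
    also have "\<dots> = (\<integral>\<omega>\<in>A v. real_cond_exp M ?F (\<lambda>\<omega>. indicator (E v) (T \<omega>)) \<omega> \<partial>M)"
      by (rule F.real_cond_exp_intA[OF int Am])
    also have "\<dots> = (\<integral>\<omega>\<in>A v. measure (Pi\<^sub>M {..<N} (\<lambda>_. L v)) (E v) \<partial>M)"
      unfolding set_lebesgue_integral_def
    proof (rule integral_cong_AE)
      show "(\<lambda>\<omega>. indicator (A v) \<omega> *\<^sub>R real_cond_exp M ?F (\<lambda>\<omega>. indicator (E v) (T \<omega>)) \<omega>) \<in> borel_measurable M"
        using AM[of v] by (intro borel_measurable_scaleR borel_measurable_indicator borel_measurable_cond_exp2) auto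
      show "(\<lambda>\<omega>. indicator (A v) \<omega> *\<^sub>R measure (Pi\<^sub>M {..<N} (\<lambda>_. L v)) (E v)) \<in> borel_measurable M"
        using AM[of v] by simp
      show "AE \<omega> in M. indicator (A v) \<omega> *\<^sub>R real_cond_exp M ?F (\<lambda>\<omega>. indicator (E v) (T \<omega>)) \<omega>
          = indicator (A v) \<omega> *\<^sub>R measure (Pi\<^sub>M {..<N} (\<lambda>_. L v)) (E v)"
        using cond[OF Em[of v]]
      proof eventually_elim
        case (elim \<omega>)
        have "boot_law n (D \<omega>) = L v" if "\<omega> \<in> A v"
          unfolding L_def using that rep[of "D \<omega>"] by (intro boot_law_pattern[OF n]) (simp add: A_def)
        then show ?case using elim by (auto simp: indicator_def)
      qed
    qed
    also have "\<dots> = prob (A v) * measure (Pi\<^sub>M {..<N} (\<lambda>_. L v)) (E v)"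
      unfolding set_lebesgue_integral_def using AM[of v] by simp
    also have "\<dots> \<le> prob (A v) * (1 / (real N * \<epsilon>\<^sup>2))" by (intro mult_left_mono dev) simp
    finally show ?thesis .
  qed
  have AT: "A v \<inter> (T -` E v \<inter> space M) \<in> events" for v by (intro sets.Int AM TE)
  define V where "V = range (pattern n)"
  have finV: "finite V" unfolding V_def by (rule pattern_finite)
  have "bad \<subseteq> (\<Union>v\<in>V. A v \<inter> (T -` E v \<inter> space M))"
  proof
    fix \<omega> assume \<omega>: "\<omega> \<in> bad"
    define v where "v = pattern n (D \<omega>)"
    have pz: "pattern n (\<lambda>i. Z i \<omega>) = pattern n (rep v)" unfolding v_def rep by (rule Dpat[symmetric])
    have sp: "\<omega> \<in> space M" using \<omega> unfolding bad_def by simp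
    have pS: "pattern n (\<lambda>i. S b i \<omega>) = pattern n (T \<omega> b)" if "b < N" for b
      unfolding T_def using that pattern_restrict[of n "\<lambda>i. S b i \<omega>"] by simp
    have "ecdf N (\<lambda>b. g (\<lambda>i. Z i \<omega>) (\<lambda>i. S b i \<omega>)) t = ecdf N (\<lambda>b. g (rep v) (T \<omega> b)) t"
      by (intro ecdf_cong g pz pS)
    then have "T \<omega> \<in> E v"
      using \<omega> measurable_space[OF Tm sp] boot_law_pattern[OF n pz] g[OF pz refl] unfolding bad_def E_def L_def by simp
    then show "\<omega> \<in> (\<Union>v\<in>V. A v \<inter> (T -` E v \<inter> space M))" using sp unfolding A_def V_def v_def by auto
  qed
  then have "prob bad \<le> prob (\<Union>v\<in>V. A v \<inter> (T -` E v \<inter> space M))"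
    by (rule finite_measure_mono) (intro sets.finite_UN finV sets.Int AM TE)
  also have "\<dots> \<le> (\<Sum>v\<in>V. prob (A v \<inter> (T -` E v \<inter> space M)))"
    by (rule finite_measure_subadditive_finite[OF finV]) (use AT in blast)
  also have "\<dots> \<le> (\<Sum>v\<in>V. prob (A v) * (1 / (real N * \<epsilon>\<^sup>2)))" by (intro sum_mono part)
  also have "\<dots> = prob (\<Union>v\<in>V. A v) * (1 / (real N * \<epsilon>\<^sup>2))"
    unfolding sum_distrib_right[symmetric] using AM finV
    by (subst finite_measure_finite_Union) (auto simp: disjoint_family_on_def A_def)
  also have "\<dots> \<le> 1 / (real N * \<epsilon>\<^sup>2)" using mult_right_mono[OF prob_le_1, of "1 / (real N * \<epsilon>\<^sup>2)"] by simp
  finally show "prob bad \<le> 1 / (real N * \<epsilon>\<^sup>2)" .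
qed

section \<open>The probability integral transform\<close>

text \<open>\<open>F\<close> may be flat, so the sublevel set is described by its largest point,
  which exists because the set is closed and, as \<open>u < 1\<close>, bounded above; by continuity
  \<open>F\<close> takes the value \<open>u\<close> there. An empty sublevel set is possible for
  \<open>u = 0\<close> only.\<close>

lemma continuous_cdf_level:
  fixes F :: "real \<Rightarrow> real"
  assumes cont: "continuous_on UNIV F" and mono: "mono F" and top: "(F \<longlongrightarrow> 1) at_top" and bot: "(F \<longlongrightarrow> 0) at_bot"
    and u: "0 \<le> u" "u < 1"
  obtains "u = 0" "\<And>y. \<not> F y \<le> u" | x where "F x = u" "\<And>y. F y \<le> u \<longleftrightarrow> y \<le> x"
proof (cases "\<exists>y. F y \<le> u")
  case False
  have "u = 0"
  proof (rule ccontr)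
    assume "u \<noteq> 0"
    then have "0 < u" using u by simp
    then have "eventually (\<lambda>y. F y < u) at_bot" using order_tendstoD(2)[OF bot] by blast
    then obtain y where "F y < u" unfolding eventually_at_bot_linorder by blast
    then show False using False by (metis less_imp_le)
  qed
  then show ?thesis using False that(1) by blast
next
  case True
  then obtain y0 where y0: "F y0 \<le> u" by blast
  have "eventually (\<lambda>y. u < F y) at_top" using order_tendstoD(1)[OF top] u by blast
  then obtain b where b: "u < F b" unfolding eventually_at_top_linorder by blast
  define S where "S = {y. F y \<le> u}"
  have up: "y \<le> b" if "y \<in> S" for y
  proof (rule ccontr)
    assume "\<not> y \<le> b"
    then have "F b \<le> F y" by (intro monoD[OF mono]) simp
    then show False using b that unfolding S_def by simp
  qed
  have bdd: "bdd_above S" using up by (rule bdd_aboveI)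
  have "closed S" unfolding S_def by (intro closed_Collect_le cont continuous_on_const)
  then have "Sup S \<in> S" using y0 bdd by (intro closed_contains_Sup) (auto simp: S_def)
  then have S: "F (Sup S) \<le> u" unfolding S_def by simp
  have iff: "F y \<le> u \<longleftrightarrow> y \<le> Sup S" for y
    using cSup_upper[OF _ bdd, of y] monoD[OF mono, of y "Sup S"] S unfolding S_def by auto
  have "y0 \<le> b" using up y0 unfolding S_def by simp
  then obtain x where x: "F x = u"
    using IVT'[of F y0 u b] y0 b continuous_on_subset[OF cont] by auto
  then have "F (Sup S) = u" using S iff[of x] monoD[OF mono, of x "Sup S"] by simp
  then show ?thesis using that(2) iff by blast
qed

text \<open>The probability integral transform: \<open>F (\<phi> z) \<le> u\<close> is a half-line
  event for \<open>\<phi>\<close>, and the end of the half-line has level exactly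
  \<open>u\<close>.\<close>

lemma margin_cdf_facts:
  fixes Q :: "(real \<times> real) measure" and \<phi> :: "real \<times> real \<Rightarrow> real"
  assumes Q: "prob_space Q" and meas: "\<phi> \<in> borel_measurable Q"
    and F: "\<And>x. F x = measure Q {z \<in> space Q. \<phi> z \<le> x}" and cont: "continuous_on UNIV F"
  shows "mono F" "(F \<longlongrightarrow> 1) at_top" "(F \<longlongrightarrow> 0) at_bot" "uniform_coord Q (\<lambda>z. F (\<phi> z))"
proof -
  interpret Q: prob_space Q by (rule Q)
  interpret D: real_distribution "distr Q borel \<phi>" by (rule Q.real_distribution_distr[OF meas])
  have eq: "F = Distribution_Functions.cdf (distr Q borel \<phi>)"
    unfolding fun_eq_iff cdf_def F using meas by (simp add: measure_distr vimage_def Int_def conj_commute)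
  show mono: "mono F" unfolding eq by (intro monoI D.cdf_nondecreasing)
  show top: "(F \<longlongrightarrow> 1) at_top" unfolding eq by (rule D.cdf_lim_at_top_prob)
  show bot: "(F \<longlongrightarrow> 0) at_bot" unfolding eq by (rule D.cdf_lim_at_bot)
  have rng: "0 \<le> F x" "F x \<le> 1" for x unfolding F by auto
  have Fm: "F \<in> borel_measurable borel" by (rule borel_measurable_continuous_onI[OF cont])
  have "measure Q {z \<in> space Q. F (\<phi> z) \<le> u} = u" if u: "0 \<le> u" "u \<le> 1" for u
  proof (cases "u = 1")
    case True
    then show ?thesis using rng Q.prob_space by simp
  next
    case False
    then have "u < 1" using u by simp
    from continuous_cdf_level[OF cont mono top bot u(1) this] show ?thesis
    proof cases
      case 1
      then show ?thesis by simp
    next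
      case (2 x)
      then show ?thesis using F[of x] by simp
    qed
  qed
  then show "uniform_coord Q (\<lambda>z. F (\<phi> z))"
    using rng measurable_compose[OF meas Fm]
    by (intro uniform_coord.intro Q uniform_coord_axioms.intro) auto
qed

text \<open>Sublevel sets of \<open>F\<close> and \<open>G\<close> are half-lines ending at the
  levels \<open>u\<close> and \<open>v\<close>, so the standardised pair has \<open>C\<close> as its
  distribution function. Empty sublevel sets and arguments equal to 1 are settled by the boundary
  values of a copula.\<close>

lemma copula_data_law:
  fixes Q :: "(real \<times> real) measure"
  assumes Q: "prob_space Q" and sets: "sets Q = sets borel"
    and F: "\<And>x. F x = measure Q {z \<in> space Q. fst z \<le> x}" and G: "\<And>y. G y = measure Q {z \<in> space Q. snd z \<le> y}"
    and contF: "continuous_on UNIV F" and contG: "continuous_on UNIV G"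
    and C: "copula C" and H: "\<And>x y. measure Q {z \<in> space Q. fst z \<le> x \<and> snd z \<le> y} = C (F x) (G y)"
    and p: "0 \<le> p" "p \<le> 1"
  shows "data_law Q F G p"
    and "u \<in> {0..1} \<Longrightarrow> v \<in> {0..1} \<Longrightarrow> uniform_pair.joint Q (\<lambda>z. F (fst z)) (\<lambda>z. G (snd z)) (u, v) = C u v"
proof -
  have fs: "fst \<in> borel_measurable Q" "snd \<in> borel_measurable Q"
    unfolding measurable_cong_sets[OF sets refl] by (auto intro!: borel_measurable_continuous_onI continuous_intros)
  note F' = margin_cdf_facts[OF Q fs(1) F contF]
  note G' = margin_cdf_facts[OF Q fs(2) G contG]
  interpret uniform_pair Q "\<lambda>z. F (fst z)" "\<lambda>z. G (snd z)" p
    using p by (intro uniform_pair.intro uniform_pair_axioms.intro Q F'(4) G'(4))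
  show "data_law Q F G p"
    by (intro data_law.intro data_law_axioms.intro uniform_pair_axioms sets F'(1) G'(1))
  assume uv: "u \<in> {0..1}" "v \<in> {0..1}"
  have C01: "C w 0 = 0" "C 0 w = 0" "C w 1 = w" "C 1 w = w" if "w \<in> {0..1}" for w
    using C that unfolding copula_def by blast+
  show "joint (u, v) = C u v"
  proof (cases "u = 1 \<or> v = 1")
    case True
    then show ?thesis using joint_margins uv C01 by auto
  next
    case False
    then have "0 \<le> u" "u < 1" "0 \<le> v" "v < 1" using uv by auto
    from continuous_cdf_level[OF contF F'(1-3) this(1,2)] show ?thesis
    proof cases
      case 1
      then show ?thesis using C01(2)[OF uv(2)] unfolding joint_def by simp
    next
      case x: (2 x)
      from continuous_cdf_level[OF contG G'(1-3) \<open>0 \<le> v\<close> \<open>v < 1\<close>] show ?thesis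
      proof cases
        case 1
        then show ?thesis using C01(1)[OF uv(1)] unfolding joint_def by simp
      next
        case y: (2 y)
        then show ?thesis using x H[of x y] unfolding joint_def by simp
      qed
    qed
  qed
qed

section \<open>Bias\<close>

lemma (in uniform_pair) square_integral_joint:
  assumes C: "\<And>u v. u \<in> {0..1} \<Longrightarrow> v \<in> {0..1} \<Longrightarrow> C u v = joint (u, v)"
  shows "(\<lambda>(u, v). C u v) integrable_on ({0..p} \<times> {0..p})" and "0 \<le> square_integral p C" "square_integral p C \<le> 1"
proof -
  let ?S = "{0..p} \<times> {0..p} :: (real \<times> real) set"
  have cb: "?S = cbox (0, 0) (p, p)" by (simp add: cbox_Pair_eq)
  have "set_integrable lborel ?S joint"
    unfolding set_integrable_def cb
  proof (rule integrableI_bounded_set_indicator[of _ _ _ 1])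
    show "joint \<in> borel_measurable lborel" using joint_measurable by simp
    show "AE x\<in>cbox (0, 0) (p, p) in lborel. norm (joint x) \<le> 1" using joint_bounds by simp
    show "emeasure lborel (cbox (0, 0) (p, p)) < \<infinity>" by (rule emeasure_lborel_cbox_finite)
  qed simp
  then have ji: "joint integrable_on ?S" by (rule set_borel_integral_eq_integral(1))
  have eq: "joint t = (case t of (u, v) \<Rightarrow> C u v)" if "t \<in> ?S" for t
    using that C[of "fst t" "snd t"] p by (auto simp: split_beta)
  show int: "(\<lambda>(u, v). C u v) integrable_on ?S" by (rule integrable_eq[OF ji eq])
  have rng: "(case t of (u, v) \<Rightarrow> C u v) \<in> {0..1}" if "t \<in> ?S" for t
    using eq[OF that] joint_bounds[of t] by simp
  then show "0 \<le> square_integral p C" unfolding square_integral_def using rng by (intro integral_nonneg int) simp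
  have "square_integral p C \<le> integral ?S (\<lambda>_. 1)"
    unfolding square_integral_def
  proof (rule integral_le[OF int])
    show "(\<lambda>_. 1 :: real) integrable_on ?S" unfolding cb by (rule Henstock_Kurzweil_Integration.integrable_const)
  qed (use rng in simp)
  also have "\<dots> = p * p" using p by (simp add: cb content_Pair)
  also have "\<dots> \<le> 1" using p by (simp add: mult_le_one)
  finally show "square_integral p C \<le> 1" .
qed

text \<open>The integrated bias is the gap between smoothed mean and unsmoothed integral. The crude
  bound 1 gives hypothesis (ii) its meaning at a single \<open>p\<close>: a real \<open>SUP\<close>
  bounds its members when the family is bounded.\<close>

lemma (in uniform_pair) bias_square_integral:
  assumes C: "\<And>u v. u \<in> {0..1} \<Longrightarrow> v \<in> {0..1} \<Longrightarrow> C u v = joint (u, v)"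
  shows "square_integral p (\<lambda>u v. bernstein_op r C u v - C u v) = smooth_mean r - square_integral p C"
    and "\<bar>square_integral p (\<lambda>u v. bernstein_op r C u v - C u v)\<bar> \<le> 1"
proof -
  have "real k / real r \<in> {0..1}" if "k \<le> r" for k using that by (auto simp: divide_le_eq_1)
  then have "bernstein_op r C = bernstein_op r (\<lambda>u v. joint (u, v))"
    unfolding bernstein_op_def fun_eq_iff by (auto simp: C intro!: sum.cong)
  then have "square_integral p (bernstein_op r C) = smooth_mean r" using smooth_mean_square_integral by simp
  moreover have "square_integral p (\<lambda>u v. bernstein_op r C u v - C u v) = square_integral p (bernstein_op r C) - square_integral p C"
  proof -
    have "(\<lambda>(u, v). bernstein_op r C u v) integrable_on ({0..p} \<times> {0..p})"
    proof -
      have "(\<lambda>(u, v). bernstein_op r C u v) integrable_on cbox (0, 0) (p, p)"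
        by (rule integrable_continuous[OF continuous_bernstein_op])
      then show ?thesis by (simp add: cbox_Pair_eq)
    qed
    from Henstock_Kurzweil_Integration.integral_diff[OF this square_integral_joint(1)[OF C]]
    show ?thesis unfolding square_integral_def by (simp add: split_def)
  qed
  ultimately show eq: "square_integral p (\<lambda>u v. bernstein_op r C u v - C u v) = smooth_mean r - square_integral p C" by simp
  have b: "0 \<le> bphi p r (c\<^sub>1 x) * bphi p r (c\<^sub>2 x)" "bphi p r (c\<^sub>1 x) * bphi p r (c\<^sub>2 x) \<le> 1" for x
    using bphi_bounds[OF p] by (auto intro!: mult_le_one)
  have "integrable M (\<lambda>x. bphi p r (c\<^sub>1 x) * bphi p r (c\<^sub>2 x))"
    using b by (intro integrable_const_bound[of _ 1] borel_measurable_times measurable_compose[OF c1.c_measurable bphi_measurable]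
        measurable_compose[OF c2.c_measurable bphi_measurable]) auto
  from integral_mono[OF this, of "\<lambda>_. 1"] have "smooth_mean r \<le> (\<integral>x. 1 \<partial>M)" unfolding smooth_mean_def using b by simp
  moreover have "0 \<le> smooth_mean r" unfolding smooth_mean_def using b by (intro Bochner_Integration.integral_nonneg)
  ultimately have "0 \<le> smooth_mean r" "smooth_mean r \<le> 1" by (simp_all add: prob_space)
  then show "\<bar>square_integral p (\<lambda>u v. bernstein_op r C u v - C u v)\<bar> \<le> 1"
    unfolding eq using square_integral_joint(2,3)[OF C] by linarith
qed

lemma bigo_scaled_limit:
  fixes f a :: "nat \<Rightarrow> real" and m :: "nat \<Rightarrow> nat"
  assumes f: "f \<in> O(\<lambda>r. 1 / real r)" and m: "filterlim m at_top sequentially"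
    and sm: "(\<lambda>n. sqrt (real n) / real (m n)) \<longlonglongrightarrow> 0" and a: "\<And>r. \<bar>a r\<bar> \<le> f r"
  shows "(\<lambda>n. sqrt (real n) * \<bar>a (m n)\<bar>) \<longlonglongrightarrow> 0"
proof -
  obtain c where c: "0 < c" "eventually (\<lambda>r. norm (f r) \<le> c * norm (1 / real r)) at_top"
    using f by (rule landau_o.bigE)
  have ev: "eventually (\<lambda>n. norm (f (m n)) \<le> c * norm (1 / real (m n))) sequentially"
    using eventually_compose_filterlim[OF c(2) m] .
  have lim: "(\<lambda>n. c * (sqrt (real n) / real (m n))) \<longlonglongrightarrow> 0" using tendsto_mult_right_zero[OF sm] .
  show ?thesis
  proof (rule tendsto_sandwich[OF _ _ tendsto_const lim])
    show "\<forall>\<^sub>F n in sequentially. sqrt (real n) * \<bar>a (m n)\<bar> \<le> c * (sqrt (real n) / real (m n))"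
      using ev
    proof eventually_elim
      case (elim n)
      have "\<bar>a (m n)\<bar> \<le> c * (1 / real (m n))" using a[of "m n"] elim by simp
      from mult_left_mono[OF this, of "sqrt (real n)"] show ?case by (simp add: mult_ac)
    qed
  qed simp
qed

section \<open>Coverage of the bootstrap intervals\<close>

lemma scaled_abs_le:
  fixes a b c d s t :: real
  assumes "0 < d"
  shows "\<bar>s * ((a - c) / d - (b - c) / d)\<bar> \<le> t \<longleftrightarrow> \<bar>s * (a - b)\<bar> \<le> d * t"
proof -
  have "s * ((a - c) / d - (b - c) / d) = s * (a - b) / d" by (simp add: diff_divide_distrib right_diff_distrib)
  then have "\<bar>s * ((a - c) / d - (b - c) / d)\<bar> = \<bar>s * (a - b)\<bar> / d" using assms by simp
  then show ?thesis using assms by (simp add: field_simps)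
qed

lemma mem_interval_iff:
  fixes \<rho> \<rho>' c r :: real
  assumes "0 < r"
  shows "\<rho> \<in> {\<rho>' - c / r .. \<rho>' + c / r} \<longleftrightarrow> \<bar>r * (\<rho>' - \<rho>)\<bar> \<le> c"
proof -
  have "\<rho> \<in> {\<rho>' - c / r .. \<rho>' + c / r} \<longleftrightarrow> \<bar>\<rho>' - \<rho>\<bar> \<le> c / r" by (auto simp: abs_le_iff)
  also have "\<dots> \<longleftrightarrow> \<bar>r * (\<rho>' - \<rho>)\<bar> \<le> c" using assms by (simp add: abs_mult pos_le_divide_eq mult.commute)
  finally show ?thesis .
qed

lemma boot_pivot_pattern:
  "pattern n z = pattern n z' \<Longrightarrow> pattern n s = pattern n s' \<Longrightarrow> boot_pivot m n z p s = boot_pivot m n z' p s'"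
  unfolding boot_pivot_def using rho_hat_pattern[of n z z'] rho_hat_pattern[of n s s'] by simp

lemma boot_pivot_measurable: "0 < n \<Longrightarrow> boot_pivot m n z p \<in> borel_measurable (boot_law n z')"
proof -
  assume n: "0 < n"
  have "boot_pivot m n z p \<in> measurable (boot_law n z') (count_space UNIV)"
    by (rule pattern_function_measurable[OF sets_boot_law[OF n] boot_pivot_pattern[OF refl]])
  moreover have "(\<lambda>x :: real. x) \<in> measurable (count_space UNIV) borel" by simp
  ultimately show ?thesis by (rule measurable_compose)
qed

lemma boot_pivot_prob:
  assumes "0 < rho_denom p"
  shows "measure (boot_law n z) {s \<in> space (boot_law n z). \<bar>boot_pivot m n z p s\<bar> \<le> t} = boot_rank_cdf p m n z (rho_denom p * t)"
  unfolding boot_rank_cdf_def boot_pivot_def rho_hat_rank_stat scaled_abs_le[OF assms] ..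

lemma boot_cdf:
  assumes n: "0 < n"
  shows "0 < rho_denom p \<Longrightarrow> cdf (distr (boot_law n z) borel (\<lambda>s. \<bar>boot_pivot m n z p s\<bar>)) t = boot_rank_cdf p m n z (rho_denom p * t)"
    and "mono (cdf (distr (boot_law n z) borel (\<lambda>s. \<bar>boot_pivot m n z p s\<bar>)))"
proof -
  interpret L: prob_space "boot_law n z" by (rule prob_boot_law[OF n])
  have m: "(\<lambda>s. \<bar>boot_pivot m n z p s\<bar>) \<in> borel_measurable (boot_law n z)"
    by (rule borel_measurable_abs[OF boot_pivot_measurable[OF n]])
  interpret R: real_distribution "distr (boot_law n z) borel (\<lambda>s. \<bar>boot_pivot m n z p s\<bar>)"
    by (rule L.real_distribution_distr[OF m])
  show "mono (cdf (distr (boot_law n z) borel (\<lambda>s. \<bar>boot_pivot m n z p s\<bar>)))" by (intro monoI R.cdf_nondecreasing)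
  show "cdf (distr (boot_law n z) borel (\<lambda>s. \<bar>boot_pivot m n z p s\<bar>)) t = boot_rank_cdf p m n z (rho_denom p * t)" if "0 < rho_denom p"
    unfolding cdf_def boot_pivot_prob[OF that, symmetric] by (subst measure_distr[OF m]) (auto intro!: arg_cong[where f="measure (boot_law n z)"])
qed

lemma mono_ecdf: "mono (ecdf n x)"
  unfolding ecdf_def by (intro monoI divide_right_mono sum_mono) auto

theorem corollary3p2:
  fixes M :: "'a measure" and X Y :: "nat \<Rightarrow> 'a \<Rightarrow> real"
    and H :: "real \<Rightarrow> real \<Rightarrow> real" and F G :: "real \<Rightarrow> real"
    and C C\<^sub>1 C\<^sub>2 :: "real \<Rightarrow> real \<Rightarrow> real"
    and N :: "'b measure" and W :: "real \<times> real \<Rightarrow> 'b \<Rightarrow> real"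
    and m :: "nat \<Rightarrow> nat" and p\<^sub>0 p\<^sub>j \<alpha> :: real
  assumes "prob_space M"
    and "prob_space.indep_vars M (\<lambda>_. borel) (\<lambda>i \<omega>. (X i \<omega>, Y i \<omega>)) UNIV"
    and "\<And>i. distr M borel (\<lambda>\<omega>. (X i \<omega>, Y i \<omega>)) = distr M borel (\<lambda>\<omega>. (X 0 \<omega>, Y 0 \<omega>))"
    and "\<And>x y. H x y = measure M {\<omega> \<in> space M. X 0 \<omega> \<le> x \<and> Y 0 \<omega> \<le> y}"
    and "\<And>x. F x = measure M {\<omega> \<in> space M. X 0 \<omega> \<le> x}"
    and "\<And>y. G y = measure M {\<omega> \<in> space M. Y 0 \<omega> \<le> y}"
    and "continuous_on UNIV F" and "continuous_on UNIV G"
    and "copula C" and "\<And>x y. H x y = C (F x) (G y)"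
    and "p\<^sub>0 \<in> {0<..<1}"
    and "\<And>u v. u \<in> {0<..<1} \<Longrightarrow> v \<in> {0..1} \<Longrightarrow> ((\<lambda>u'. C u' v) has_real_derivative C\<^sub>1 u v) (at u)"
    and "continuous_on ({0<..<1} \<times> {0..1}) (\<lambda>(u, v). C\<^sub>1 u v)"
    and "\<And>u v. u \<in> {0..1} \<Longrightarrow> v \<in> {0<..<1} \<Longrightarrow> ((\<lambda>v'. C u v') has_real_derivative C\<^sub>2 u v) (at v)"
    and "continuous_on ({0..1} \<times> {0<..<1}) (\<lambda>(u, v). C\<^sub>2 u v)"
    and "(\<lambda>r. SUP p\<in>{p\<^sub>0..1}. \<bar>square_integral p (\<lambda>u v. bernstein_op r C u v - C u v)\<bar>)
           \<in> O(\<lambda>r. 1 / real r)"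
    and "\<And>n. n \<ge> 1 \<Longrightarrow> m n \<ge> 1"
    and "filterlim m at_top sequentially"
    and "(\<lambda>n. sqrt (real n) / real (m n)) \<longlonglongrightarrow> 0"
    and "p\<^sub>j \<in> {p\<^sub>0..1}" and "\<alpha> \<in> {0<..<1}"
    and "prob_space N" and "copula_bridge C N W"
    and "prob_space.variance N (rho_limit C\<^sub>1 C\<^sub>2 W p\<^sub>j) > 0"
  shows
    "(\<lambda>n. measure M {\<omega> \<in> space M.
        let z = (\<lambda>i. (X i \<omega>, Y i \<omega>));
            \<rho>' = rho_hat (m n) n z p\<^sub>j;
            c = boot_quantile (m n) n z p\<^sub>j (1 - \<alpha>)
        in spearman_curve C p\<^sub>j \<in> {\<rho>' - c / sqrt (real n) .. \<rho>' + c / sqrt (real n)}})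
       \<longlonglongrightarrow> 1 - \<alpha> \<and>
     (\<forall>(B :: nat \<Rightarrow> nat) (S :: nat \<Rightarrow> nat \<Rightarrow> nat \<Rightarrow> 'a \<Rightarrow> real \<times> real).
        filterlim B at_top sequentially \<longrightarrow>
        (\<forall>n\<ge>1. boot_samples M n (B n) (\<lambda>i \<omega>. (X i \<omega>, Y i \<omega>)) (S n)) \<longrightarrow>
        (\<lambda>n. measure M {\<omega> \<in> space M.
            let z = (\<lambda>i. (X i \<omega>, Y i \<omega>));
                \<rho>' = rho_hat (m n) n z p\<^sub>j;
                c = emp_boot_quantile (m n) n z p\<^sub>j (B n) (\<lambda>b i. S n b i \<omega>) (1 - \<alpha>)
            in spearman_curve C p\<^sub>j \<in> {\<rho>' - c / sqrt (real n) .. \<rho>' + c / sqrt (real n)}})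
          \<longlonglongrightarrow> 1 - \<alpha>)"
proof -
  interpret prob_space M by (rule assms(1))
  define Z where "Z i \<omega> = (X i \<omega>, Y i \<omega>)" for i \<omega>
  define Q where "Q = distr M borel (Z 0)"
  let ?p = "p\<^sub>j"
  have p: "0 < ?p" "0 \<le> ?p" "?p \<le> 1" using assms(11,20) by auto
  have Zm: "Z i \<in> borel_measurable M" for i
    using assms(2) unfolding indep_vars_def2 Z_def by blast
  have Q: "prob_space Q" unfolding Q_def by (rule prob_space_distr[OF Zm])
  have setsQ: "sets Q = sets borel" unfolding Q_def by simp
  have Q_measure: "measure Q {z \<in> space Q. \<Phi> z} = prob {\<omega> \<in> space M. \<Phi> (Z 0 \<omega>)}" if "{z. \<Phi> z} \<in> sets borel" for \<Phi>
    unfolding Q_def using that by (subst measure_distr[OF Zm]) (auto intro!: arg_cong[where f=prob])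
  have closed: "{z :: real \<times> real. fst z \<le> x} \<in> sets borel" "{z :: real \<times> real. snd z \<le> x} \<in> sets borel" for x
    by (auto intro!: borel_closed closed_Collect_le continuous_intros)
  have F: "F x = measure Q {z \<in> space Q. fst z \<le> x}" and G: "G x = measure Q {z \<in> space Q. snd z \<le> x}" for x
    unfolding assms(5,6) by (subst Q_measure[OF closed(1)], simp add: Z_def) (subst Q_measure[OF closed(2)], simp add: Z_def)
  have H: "measure Q {z \<in> space Q. fst z \<le> x \<and> snd z \<le> y} = C (F x) (G y)" for x y
  proof -
    have "{z :: real \<times> real. fst z \<le> x \<and> snd z \<le> y} \<in> sets borel"
      using sets.Int[OF closed(1)[of x] closed(2)[of y]] by (simp add: Int_def)
    from Q_measure[OF this] show ?thesis using assms(4,10) by (simp add: Z_def)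
  qed
  note cop = copula_data_law[OF Q setsQ F G assms(7,8,9) H]
  interpret D: data_law Q F G ?p by (rule cop(1)[OF p(2,3)])
  have joint: "D.joint (u, v) = C u v" if "u \<in> {0..1}" "v \<in> {0..1}" for u v
    by (rule cop(2)[OF p(2,3) that])
  interpret SP: smooth_pair Q "\<lambda>z. F (fst z)" "\<lambda>z. G (snd z)" ?p C\<^sub>1 C\<^sub>2
  proof
    fix u v :: real
    \<comment> \<open>\<open>joint\<close> agrees with \<open>C\<close> on the unit square only, so
      the derivative is transferred within the open interval.\<close>
    show "((\<lambda>u'. D.joint (u', v)) has_real_derivative C\<^sub>1 u v) (at u)" if "u \<in> {0<..<1}" "v \<in> {0..1}"
      by (rule has_field_derivative_transform_within_open[OF assms(12)[OF that] open_greaterThanLessThan[of 0 1]])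
        (use that in \<open>auto simp: joint\<close>)
    show "((\<lambda>v'. D.joint (u, v')) has_real_derivative C\<^sub>2 u v) (at v)" if "u \<in> {0..1}" "v \<in> {0<..<1}"
      by (rule has_field_derivative_transform_within_open[OF assms(14)[OF that] open_greaterThanLessThan[of 0 1]])
        (use that in \<open>auto simp: joint\<close>)
  qed (rule assms(13), rule assms(15))
  define d where "d = rho_denom ?p"
  have d: "0 < d" unfolding d_def by (rule rho_denom_pos[OF p(1,3)])
  have "0 < D.asymp_var / d\<^sup>2"
    using SP.rho_limit_variance[OF assms(22,23) joint[symmetric]] assms(24) unfolding d_def by simp
  then have av: "0 < D.asymp_var" using d by (simp add: zero_less_divide_iff)
  define \<theta> where "\<theta> = square_integral ?p C"
  have bias: "(\<lambda>n. sqrt (real n) * \<bar>D.smooth_mean (m n) - \<theta>\<bar>) \<longlonglongrightarrow> 0"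
  proof (rule bigo_scaled_limit[OF assms(16,18,19), where a="\<lambda>r. D.smooth_mean r - \<theta>"])
    fix r
    have "\<bar>square_integral q (\<lambda>u v. bernstein_op r C u v - C u v)\<bar> \<le> 1" if "q \<in> {p\<^sub>0..1}" for q
    proof -
      have q: "0 \<le> q" "q \<le> 1" using that assms(11) by auto
      interpret Dq: data_law Q F G q by (rule cop(1)[OF q])
      show ?thesis by (rule Dq.bias_square_integral(2)) (rule cop(2)[OF q, symmetric])
    qed
    then have "bdd_above ((\<lambda>q. \<bar>square_integral q (\<lambda>u v. bernstein_op r C u v - C u v)\<bar>) ` {p\<^sub>0..1})"
      by (intro bdd_aboveI2)
    note sup = cSUP_upper[OF assms(20) this]
    have eq: "square_integral ?p (\<lambda>u v. bernstein_op r C u v - C u v) = D.smooth_mean r - \<theta>"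
      unfolding \<theta>_def by (rule D.bias_square_integral(1)[OF joint[symmetric]])
    show "\<bar>D.smooth_mean r - \<theta>\<bar> \<le> (SUP p\<in>{p\<^sub>0..1}. \<bar>square_integral p (\<lambda>u v. bernstein_op r C u v - C u v)\<bar>)"
      using sup unfolding eq .
  qed
  \<comment> \<open>\<open>asymp_var\<close> belongs to the rank statistic; the estimator divides by
    \<open>rho_denom\<close>.\<close>
  define \<sigma> where "\<sigma> = sqrt D.asymp_var / d"
  have \<sigma>: "0 < \<sigma>" unfolding \<sigma>_def using av d by simp
  have scale: "normal_abs_cdf (sqrt D.asymp_var) (d * t) = normal_abs_cdf \<sigma> t" for t
    unfolding normal_abs_cdf_def \<sigma>_def using d by (simp add: mult.commute)
  let ?z = "\<lambda>\<omega> i. Z i \<omega>"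
  have law: "distr M (Pi\<^sub>M {..<n} (\<lambda>_. borel)) (\<lambda>\<omega>. \<lambda>i\<in>{..<n}. Z i \<omega>) = D.sample_law n" if "1 \<le> n" for n
  proof -
    have "indep_vars (\<lambda>_. borel) Z {..<n}"
      using indep_vars_subset[OF assms(2), of "{..<n}"] unfolding Z_def by simp
    then have "distr M (Pi\<^sub>M {..<n} (\<lambda>_. borel)) (\<lambda>\<omega>. \<lambda>i\<in>{..<n}. Z i \<omega>) = (\<Pi>\<^sub>M i\<in>{..<n}. distr M borel (Z i))"
      using that Zm by (subst (asm) indep_vars_iff_distr_eq_PiM') (auto simp: lessThan_empty_iff)
    also have "\<dots> = D.sample_law n"
      using assms(3) unfolding Q_def Z_def by (intro PiM_cong) auto
    finally show ?thesis .
  qed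
  have Znm: "(\<lambda>\<omega>. \<lambda>i\<in>{..<n}. Z i \<omega>) \<in> measurable M (Pi\<^sub>M {..<n} (\<lambda>_. borel))" for n
    using Zm by (intro measurable_restrict) auto
  have ss: "sets (D.sample_law n) = sets (Pi\<^sub>M {..<n} (\<lambda>_. borel))" for n by (rule sets_PiM_cong) (auto simp: setsQ)
  \<comment> \<open>Events about the first \<open>n\<close> observations are moved to the product
    law, under which the limit theorems are stated.\<close>
  have pull: "{\<omega> \<in> space M. restrict (?z \<omega>) {..<n} \<in> E} \<in> events"
      "1 \<le> n \<Longrightarrow> prob {\<omega> \<in> space M. restrict (?z \<omega>) {..<n} \<in> E} = measure (D.sample_law n) E"
    if E: "E \<in> sets (D.sample_law n)" for n E
  proof -
    have E': "E \<in> sets (Pi\<^sub>M {..<n} (\<lambda>_. borel))" using E ss by simp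
    have eq: "{\<omega> \<in> space M. restrict (?z \<omega>) {..<n} \<in> E} = (\<lambda>\<omega>. \<lambda>i\<in>{..<n}. Z i \<omega>) -` E \<inter> space M" by auto
    show "{\<omega> \<in> space M. restrict (?z \<omega>) {..<n} \<in> E} \<in> events" unfolding eq by (rule measurable_sets[OF Znm E'])
    show "prob {\<omega> \<in> space M. restrict (?z \<omega>) {..<n} \<in> E} = measure (D.sample_law n) E" if "1 \<le> n"
      unfolding law[OF that, symmetric] eq by (rule measure_distr[OF Znm E', symmetric])
  qed
  have pat: "(\<lambda>\<omega>. pattern n (?z \<omega>)) \<in> measurable M (count_space UNIV)" for n
    by (rule pattern_rv_measurable[OF Znm])
  define A where "A n \<omega> = \<bar>sqrt (real n) * (rho_hat (m n) n (?z \<omega>) ?p - spearman_curve C ?p)\<bar>" for n \<omega>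
  have A_le: "A n \<omega> \<le> t \<longleftrightarrow> \<bar>sqrt (real n) * (rank_stat ?p (m n) n fst snd (?z \<omega>) - \<theta>)\<bar> \<le> d * t" for n \<omega> t
    unfolding A_def rho_hat_rank_stat spearman_curve_def \<theta>_def[symmetric] d_def[symmetric] by (rule scaled_abs_le[OF d])
  have A_cong: "A n \<omega> = A n \<omega>'" if "pattern n (?z \<omega>) = pattern n (?z \<omega>')" for n \<omega> \<omega>'
    unfolding A_def rho_hat_pattern[OF that] ..
  have Am: "A n \<in> borel_measurable M" for n
    unfolding borel_measurable_iff_le
  proof (intro allI determined_event[OF pat[of n]])
    fix a \<omega> \<omega>' assume "pattern n (?z \<omega>) = pattern n (?z \<omega>')"
    from A_cong[OF this] show "(A n \<omega> \<le> a) = (A n \<omega>' \<le> a)" by simp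
  qed
  have limA: "(\<lambda>n. prob {\<omega> \<in> space M. A n \<omega> \<le> t}) \<longlonglongrightarrow> normal_abs_cdf \<sigma> t" for t
  proof (rule Lim_transform_eventually)
    show "(\<lambda>n. measure (D.sample_law n) {z \<in> space (D.sample_law n). \<bar>sqrt (real n) * (rank_stat ?p (m n) n fst snd z - \<theta>)\<bar> \<le> d * t})
        \<longlonglongrightarrow> normal_abs_cdf \<sigma> t"
      unfolding scale[symmetric] by (rule D.data_pivot_limit[OF av assms(17,18,19) bias])
    show "\<forall>\<^sub>F n in sequentially. measure (D.sample_law n) {z \<in> space (D.sample_law n). \<bar>sqrt (real n) * (rank_stat ?p (m n) n fst snd z - \<theta>)\<bar> \<le> d * t}
        = prob {\<omega> \<in> space M. A n \<omega> \<le> t}"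
      using eventually_ge_at_top[of 1]
    proof eventually_elim
      case (elim n)
      let ?E = "{z \<in> space (D.sample_law n). \<bar>sqrt (real n) * (rank_stat ?p (m n) n fst snd z - \<theta>)\<bar> \<le> d * t}"
      have E: "?E \<in> sets (D.sample_law n)"
      proof (rule determined_event[OF pattern_measurable[OF ss]])
        fix z z' assume eq: "pattern n z = pattern n z'"
        show "(\<bar>sqrt (real n) * (rank_stat ?p (m n) n fst snd z - \<theta>)\<bar> \<le> d * t) = (\<bar>sqrt (real n) * (rank_stat ?p (m n) n fst snd z' - \<theta>)\<bar> \<le> d * t)"
          unfolding rank_stat_pattern[OF eq] ..
      qed
      have "restrict (?z \<omega>) {..<n} \<in> space (D.sample_law n)" if "\<omega> \<in> space M" for \<omega>
        using measurable_space[OF Znm that, of n] sets_eq_imp_space_eq[OF ss] by simp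
      then have "{\<omega> \<in> space M. A n \<omega> \<le> t} = {\<omega> \<in> space M. restrict (?z \<omega>) {..<n} \<in> ?E}"
        unfolding A_le using rank_stat_pattern[OF pattern_restrict] by auto
      then show ?case using pull(2)[OF E elim] by simp
    qed
  qed
  \<comment> \<open>Closeness at the single point \<open>t\<close> suffices, since the coverage
    argument evaluates the distribution function at two thresholds only.\<close>
  have good: "\<exists>E. (\<forall>n\<ge>1. E n \<in> events) \<and> (\<lambda>n. prob (E n)) \<longlonglongrightarrow> 1 \<and>
      (\<forall>\<^sub>F n in sequentially. \<forall>\<omega>\<in>E n. \<bar>boot_rank_cdf ?p (m n) n (?z \<omega>) (d * t) - normal_abs_cdf \<sigma> t\<bar> \<le> \<epsilon>)"
    if \<epsilon>: "0 < \<epsilon>" for t \<epsilon>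
  proof -
    obtain E where E: "\<And>n. E n \<in> sets (D.sample_law n)" "(\<lambda>n. measure (D.sample_law n) (E n)) \<longlonglongrightarrow> 1"
      and ev: "\<forall>\<^sub>F n in sequentially. \<forall>z\<in>E n. \<bar>boot_rank_cdf ?p (m n) n z (d * t) - normal_abs_cdf (sqrt D.asymp_var) (d * t)\<bar> \<le> \<epsilon>"
      using D.boot_pivot_limit[OF av assms(17,18,19) \<epsilon>, of "d * t"] by blast
    define E' where "E' n = {\<omega> \<in> space M. restrict (?z \<omega>) {..<n} \<in> E n}" for n
    have "(\<lambda>n. prob (E' n)) \<longlonglongrightarrow> 1"
      by (rule Lim_transform_eventually[OF E(2)], rule eventually_mono[OF eventually_ge_at_top[of 1]])
        (simp add: E'_def pull(2)[OF E(1)])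
    moreover have "\<forall>\<^sub>F n in sequentially. \<forall>\<omega>\<in>E' n. \<bar>boot_rank_cdf ?p (m n) n (?z \<omega>) (d * t) - normal_abs_cdf \<sigma> t\<bar> \<le> \<epsilon>"
      using ev eventually_ge_at_top[of 1]
    proof eventually_elim
      case (elim n)
      then have "0 < n" by simp
      from elim(1)[unfolded scale] boot_rank_cdf_pattern[OF this pattern_restrict] show ?case unfolding E'_def by auto
    qed
    moreover have "E' n \<in> events" for n unfolding E'_def by (rule pull(1)[OF E(1)])
    ultimately show ?thesis by blast
  qed
  have \<alpha>: "0 < 1 - \<alpha>" "1 - \<alpha> < 1" using assms(21) by auto
  have interval: "spearman_curve C ?p \<in> {rho_hat (m n) n (?z \<omega>) ?p - c / sqrt (real n) .. rho_hat (m n) n (?z \<omega>) ?p + c / sqrt (real n)}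
      \<longleftrightarrow> A n \<omega> \<le> c" if "1 \<le> n" for n \<omega> c
    unfolding A_def using that by (intro mem_interval_iff) simp
  let ?K = "\<lambda>n \<omega>. cdf (distr (boot_law n (?z \<omega>)) borel (\<lambda>s. \<bar>boot_pivot (m n) n (?z \<omega>) ?p s\<bar>))"
  have "(\<lambda>n. prob {\<omega> \<in> space M. A n \<omega> \<le> boot_quantile (m n) n (?z \<omega>) ?p (1 - \<alpha>)}) \<longlonglongrightarrow> 1 - \<alpha>"
    unfolding boot_quantile_def
  proof (rule quantile_coverage[OF \<sigma> \<alpha>])
    show "(\<lambda>n. prob {\<omega> \<in> space M. A n \<omega> \<le> t}) \<longlonglongrightarrow> normal_abs_cdf \<sigma> t" for t by (rule limA)
    show "A n \<in> borel_measurable M" for n by (rule Am)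
    fix n :: nat assume "1 \<le> n"
    then have n: "0 < n" by simp
    show "{\<omega> \<in> space M. A n \<omega> \<le> quantile (?K n \<omega>) (1 - \<alpha>)} \<in> events"
    proof (rule determined_event[OF pat[of n]])
      fix \<omega> \<omega>' assume eq: "pattern n (?z \<omega>) = pattern n (?z \<omega>')"
      show "(A n \<omega> \<le> quantile (?K n \<omega>) (1 - \<alpha>))
          = (A n \<omega>' \<le> quantile (?K n \<omega>') (1 - \<alpha>))"
        unfolding A_cong[OF eq] boot_law_pattern[OF n eq] boot_pivot_pattern[OF eq refl] ..
    qed
    show "mono (?K n \<omega>)" for \<omega>
      by (rule boot_cdf(2)[OF n])
  next
    fix t \<epsilon> :: real assume "0 < \<epsilon>"
    from good[OF this, of t] obtain E where E: "\<forall>n\<ge>1. E n \<in> events" "(\<lambda>n. prob (E n)) \<longlonglongrightarrow> 1"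
      and ev: "\<forall>\<^sub>F n in sequentially. \<forall>\<omega>\<in>E n.
        \<bar>boot_rank_cdf ?p (m n) n (?z \<omega>) (d * t) - normal_abs_cdf \<sigma> t\<bar> \<le> \<epsilon>" by blast
    have "\<forall>\<^sub>F n in sequentially. \<forall>\<omega>\<in>E n.
        \<bar>?K n \<omega> t - normal_abs_cdf \<sigma> t\<bar> \<le> \<epsilon>"
      using ev eventually_ge_at_top[of 1] by eventually_elim (simp add: boot_cdf(1)[OF _ d[unfolded d_def]] d_def)
    with E show "\<exists>E. (\<forall>n\<ge>1. E n \<in> events) \<and> (\<lambda>n. prob (E n)) \<longlonglongrightarrow> 1 \<and>
        (\<forall>\<^sub>F n in sequentially. \<forall>\<omega>\<in>E n.
          \<bar>?K n \<omega> t - normal_abs_cdf \<sigma> t\<bar> \<le> \<epsilon>)" by blast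
  qed
  then have part1: "(\<lambda>n. measure M {\<omega> \<in> space M.
        let z = ?z \<omega>; \<rho>' = rho_hat (m n) n z ?p; c = boot_quantile (m n) n z ?p (1 - \<alpha>)
        in spearman_curve C ?p \<in> {\<rho>' - c / sqrt (real n) .. \<rho>' + c / sqrt (real n)}}) \<longlonglongrightarrow> 1 - \<alpha>"
    by (rule Lim_transform_eventually, intro eventually_mono[OF eventually_ge_at_top[of 1]]) (simp only: Let_def interval)
  have part2: "(\<lambda>n. measure M {\<omega> \<in> space M.
        let z = ?z \<omega>; \<rho>' = rho_hat (m n) n z ?p; c = emp_boot_quantile (m n) n z ?p (B n) (\<lambda>b i. S n b i \<omega>) (1 - \<alpha>)
        in spearman_curve C ?p \<in> {\<rho>' - c / sqrt (real n) .. \<rho>' + c / sqrt (real n)}}) \<longlonglongrightarrow> 1 - \<alpha>"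
    if B: "filterlim B at_top sequentially" and S: "\<forall>n\<ge>1. boot_samples M n (B n) Z (S n)"
    for B :: "nat \<Rightarrow> nat" and S :: "nat \<Rightarrow> nat \<Rightarrow> nat \<Rightarrow> 'a \<Rightarrow> real \<times> real"
  proof -
    let ?K = "\<lambda>n \<omega>. ecdf (B n) (\<lambda>b. \<bar>boot_pivot (m n) n (?z \<omega>) ?p (\<lambda>i. S n b i \<omega>)\<bar>)"
    have "(\<lambda>n. prob {\<omega> \<in> space M. A n \<omega> \<le> emp_boot_quantile (m n) n (?z \<omega>) ?p (B n) (\<lambda>b i. S n b i \<omega>) (1 - \<alpha>)}) \<longlonglongrightarrow> 1 - \<alpha>"
      unfolding emp_boot_quantile_def
    proof (rule quantile_coverage[OF \<sigma> \<alpha>])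
      show "(\<lambda>n. prob {\<omega> \<in> space M. A n \<omega> \<le> t}) \<longlonglongrightarrow> normal_abs_cdf \<sigma> t" for t by (rule limA)
      show "A n \<in> borel_measurable M" for n by (rule Am)
      show "mono (?K n \<omega>)" for n \<omega> by (rule mono_ecdf)
      fix n :: nat assume n: "1 \<le> n"
      show "{\<omega> \<in> space M. A n \<omega> \<le> quantile (?K n \<omega>) (1 - \<alpha>)} \<in> events"
      proof (rule determined_event[OF boot_patterns_measurable[OF S[rule_format, OF n]]])
        fix \<omega> \<omega>'
        assume "(pattern n (?z \<omega>), map (\<lambda>b. pattern n (\<lambda>i. S n b i \<omega>)) [0..<B n])
            = (pattern n (?z \<omega>'), map (\<lambda>b. pattern n (\<lambda>i. S n b i \<omega>')) [0..<B n])"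
        then have pz: "pattern n (?z \<omega>) = pattern n (?z \<omega>')"
          and ps: "\<And>b. b < B n \<Longrightarrow> pattern n (\<lambda>i. S n b i \<omega>) = pattern n (\<lambda>i. S n b i \<omega>')"
          by (auto simp: map_eq_conv)
        have "?K n \<omega> = ?K n \<omega>'"
          unfolding ecdf_def fun_eq_iff
          by (intro allI arg_cong2[where f="(/)"] sum.cong refl arg_cong[where f=of_bool])
            (simp add: boot_pivot_pattern[OF pz ps])
        then show "(A n \<omega> \<le> quantile (?K n \<omega>) (1 - \<alpha>)) = (A n \<omega>' \<le> quantile (?K n \<omega>') (1 - \<alpha>))"
          unfolding A_cong[OF pz] by simp
      qed
    next
      fix t \<epsilon> :: real assume \<epsilon>: "0 < \<epsilon>"
      then have e2: "0 < \<epsilon> / 2" by simp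
      from good[OF e2, of t] obtain E where E: "\<And>n. 1 \<le> n \<Longrightarrow> E n \<in> events" "(\<lambda>n. prob (E n)) \<longlonglongrightarrow> 1"
        and ev: "\<forall>\<^sub>F n in sequentially. \<forall>\<omega>\<in>E n.
          \<bar>boot_rank_cdf ?p (m n) n (?z \<omega>) (d * t) - normal_abs_cdf \<sigma> t\<bar> \<le> \<epsilon> / 2"
        by blast
      \<comment> \<open>The tolerance is halved between the Monte Carlo error and the distance of
        the bootstrap distribution from its limit.\<close>
      define bad where "bad n = {\<omega> \<in> space M. \<epsilon> / 2 < \<bar>?K n \<omega> t
          - boot_rank_cdf ?p (m n) n (?z \<omega>) (d * t)\<bar>}" for n
      have bad: "bad n \<in> events" "0 < B n \<Longrightarrow> prob (bad n) \<le> 1 / (real (B n) * (\<epsilon> / 2)\<^sup>2)" if n: "1 \<le> n" for n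
      proof -
        have n0: "0 < n" using n by simp
        note dev = boot_ecdf_deviation[OF S[rule_format, OF n] n0 e2, where g="\<lambda>z s. \<bar>boot_pivot (m n) n z ?p s\<bar>" and t=t,
            unfolded boot_pivot_prob[OF d[unfolded d_def]], folded d_def]
        show "bad n \<in> events" unfolding bad_def by (rule dev(1)) (intro arg_cong[where f=abs] boot_pivot_pattern)
        show "prob (bad n) \<le> 1 / (real (B n) * (\<epsilon> / 2)\<^sup>2)" if "0 < B n"
          unfolding bad_def by (rule dev(2)[OF _ that]) (intro arg_cong[where f=abs] boot_pivot_pattern)
      qed
      \<comment> \<open>The Chebyshev bound does not involve the data and vanishes as the number of
        bootstrap samples grows, at whatever rate.\<close>
      have lim0: "(\<lambda>n. prob (E n) - 1 / (real (B n) * (\<epsilon> / 2)\<^sup>2)) \<longlonglongrightarrow> 1 - 0"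
      proof (rule tendsto_diff[OF E(2)])
        have "(\<lambda>k. 1 / (real k * (\<epsilon> / 2)\<^sup>2)) \<longlonglongrightarrow> 0" using \<epsilon> by real_asymp
        from filterlim_compose[OF this B] show "(\<lambda>n. 1 / (real (B n) * (\<epsilon> / 2)\<^sup>2)) \<longlonglongrightarrow> 0" .
      qed
      have "(\<lambda>n. prob (E n - bad n)) \<longlonglongrightarrow> 1"
      proof (rule tendsto_sandwich[OF _ _ lim0[simplified] tendsto_const])
        have "eventually (\<lambda>n. 1 \<le> B n) sequentially" using B unfolding filterlim_at_top by blast
        then show "\<forall>\<^sub>F n in sequentially. prob (E n) - 1 / (real (B n) * (\<epsilon> / 2)\<^sup>2) \<le> prob (E n - bad n)"
          using eventually_ge_at_top[of 1]
        proof eventually_elim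
          case (elim n)
          have "prob (E n) \<le> prob ((E n - bad n) \<union> bad n)"
            using E(1) bad(1) elim(2) by (intro finite_measure_mono) auto
          also have "\<dots> \<le> prob (E n - bad n) + prob (bad n)" using E(1) bad(1) elim(2) by (intro measure_Un_le) auto
          finally show ?case using bad(2)[OF elim(2)] elim(1) by simp
        qed
      qed simp
      moreover have "\<forall>\<^sub>F n in sequentially. \<forall>\<omega>\<in>E n - bad n. \<bar>?K n \<omega> t - normal_abs_cdf \<sigma> t\<bar> \<le> \<epsilon>"
        using ev eventually_ge_at_top[of 1]
      proof eventually_elim
        case (elim n)
        show ?case
        proof
          fix \<omega> assume \<omega>: "\<omega> \<in> E n - bad n"
          then have "\<omega> \<in> space M" using E(1)[OF elim(2)] sets.sets_into_space by blast
          then have "\<bar>?K n \<omega> t - boot_rank_cdf ?p (m n) n (?z \<omega>) (d * t)\<bar> \<le> \<epsilon> / 2"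
            using \<omega> unfolding bad_def by auto
          moreover have "\<bar>boot_rank_cdf ?p (m n) n (?z \<omega>) (d * t) - normal_abs_cdf \<sigma> t\<bar> \<le> \<epsilon> / 2"
            using elim(1) \<omega> by blast
          ultimately show "\<bar>?K n \<omega> t - normal_abs_cdf \<sigma> t\<bar> \<le> \<epsilon>" by linarith
        qed
      qed
      moreover have "\<forall>n\<ge>1. E n - bad n \<in> events" using E(1) bad(1) by auto
      ultimately show "\<exists>E. (\<forall>n\<ge>1. E n \<in> events) \<and> (\<lambda>n. prob (E n)) \<longlonglongrightarrow> 1 \<and>
          (\<forall>\<^sub>F n in sequentially. \<forall>\<omega>\<in>E n. \<bar>?K n \<omega> t - normal_abs_cdf \<sigma> t\<bar> \<le> \<epsilon>)"
        by (intro exI[of _ "\<lambda>n. E n - bad n"] conjI)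
    qed
    then show ?thesis
      by (rule Lim_transform_eventually, intro eventually_mono[OF eventually_ge_at_top[of 1]]) (simp only: Let_def interval)
  qed
  show ?thesis using part1 part2 unfolding Z_def by blast
qed

end
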